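(* Let $(C_1,C_2)$ be a double-chain with $n=|C_1|+|C_2|$ points such that $|C_i|\ge \frac15(|C_1|+|C_2|)$ for $i=1,2$. Then $(C_1,C_2)$ is $2$-color universal for the path $P_n$; that is, for every $2$-coloring (black/white) of the points of $C_1\cup C_2$ in which the sizes of the two color classes differ by at most $1$, there is a non-crossing Hamiltonian alternating path on $C_1\cup C_2$. Moreover, such a path can be found in time linear in $n$.
   Context: A convex (resp. concave) chain is a finite set of points in the plane lying on the graph of a strictly convex (resp. strictly concave) function. A double-chain $(C_1,C_2)$ consists of a convex chain $C_1$ and a concave chain $C_2$ such that every point of $C_2$ lies strictly below every line determined by two points of $C_1$, and every point of $C_1$ lies strictly above every line determined by two points of $C_2$. A point set $S$ of $n$ points is $2$-color universal for a bipartite graph $G$ on $n$ vertices if for every proper $2$-coloring of $G$ and every $2$-coloring of $S$ with the same number of black points as $G$ has black vertices, there is a color-preserving bijection $V(G)\to S$ such that the straight-line segments representing the edges are pairwise non-crossing. A non-crossing Hamiltonian alternating path (NHAP) on a $2$-colored point set is a path visiting every point exactly once, drawn with straight-line segments, no two of which cross, and whose consecutive vertices have different colors. ($P_n$ has a proper $2$-coloring compatible with a given point coloring exactly when the color class sizes differ by at most $1$.)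
   Formalization: For the linear-time claim, the points of each chain are given as input sorted from left to right; with points in arbitrary order a comparison-based real RAM needs order n log n steps. *)

theory Defs
  imports "HOL-Analysis.Analysis" "HOL-Library.Landau_Symbols"
begin

type_synonym point = "real \<times> real"


section \<open>Double-chains\<close>

definition strictly_convex_on :: "real set \<Rightarrow> (real \<Rightarrow> real) \<Rightarrow> bool" where
  "strictly_convex_on I f \<longleftrightarrow> convex I \<and>
     (\<forall>x\<in>I. \<forall>y\<in>I. \<forall>u>0. \<forall>v>0. u + v = 1 \<longrightarrow> x \<noteq> y \<longrightarrow>
        f (u * x + v * y) < u * f x + v * f y)"

definition strictly_concave_on :: "real set \<Rightarrow> (real \<Rightarrow> real) \<Rightarrow> bool" where
  "strictly_concave_on I f \<longleftrightarrow> strictly_convex_on I (\<lambda>x. - f x)"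

definition convex_chain :: "point set \<Rightarrow> bool" where
  "convex_chain C \<longleftrightarrow> finite C \<and> (\<exists>f. strictly_convex_on UNIV f \<and> (\<forall>p\<in>C. snd p = f (fst p)))"

definition concave_chain :: "point set \<Rightarrow> bool" where
  "concave_chain C \<longleftrightarrow> finite C \<and> (\<exists>f. strictly_concave_on UNIV f \<and> (\<forall>p\<in>C. snd p = f (fst p)))"

definition strictly_below :: "point \<Rightarrow> point set \<Rightarrow> bool" where
  "strictly_below p L \<longleftrightarrow> (\<exists>y. (fst p, y) \<in> L \<and> snd p < y)"

definition strictly_above :: "point \<Rightarrow> point set \<Rightarrow> bool" where
  "strictly_above p L \<longleftrightarrow> (\<exists>y. (fst p, y) \<in> L \<and> y < snd p)"

text \<open>Disjointness follows from the other conditions unless both chains have at most one point.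
  The line determined by \<open>a\<close> and \<open>b\<close> is \<open>affine hull {a, b}\<close>.\<close>

definition double_chain :: "point set \<Rightarrow> point set \<Rightarrow> bool" where
  "double_chain C1 C2 \<longleftrightarrow> convex_chain C1 \<and> concave_chain C2 \<and> C1 \<inter> C2 = {} \<and>
     (\<forall>p\<in>C2. \<forall>a\<in>C1. \<forall>b\<in>C1. a \<noteq> b \<longrightarrow> strictly_below p (affine hull {a, b})) \<and>
     (\<forall>p\<in>C1. \<forall>a\<in>C2. \<forall>b\<in>C2. a \<noteq> b \<longrightarrow> strictly_above p (affine hull {a, b}))"


section \<open>Straight-line drawings and universality\<close>

text \<open>Two distinct edges may meet only in a common endpoint. Colorings are predicates;
  \<open>True\<close> stands for black.\<close>

definition noncrossing :: "point \<Rightarrow> point \<Rightarrow> point \<Rightarrow> point \<Rightarrow> bool" where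
  "noncrossing a b c d \<longleftrightarrow> closed_segment a b \<inter> closed_segment c d \<subseteq> {a, b} \<inter> {c, d}"

definition simple_graph :: "'v set \<Rightarrow> 'v set set \<Rightarrow> bool" where
  "simple_graph V E \<longleftrightarrow> finite V \<and> (\<forall>e\<in>E. e \<subseteq> V \<and> card e = 2)"

definition proper_2_coloring :: "'v set set \<Rightarrow> ('v \<Rightarrow> bool) \<Rightarrow> bool" where
  "proper_2_coloring E c \<longleftrightarrow> (\<forall>u v. {u, v} \<in> E \<longrightarrow> c u \<noteq> c v)"

definition two_color_universal :: "point set \<Rightarrow> 'v set \<Rightarrow> 'v set set \<Rightarrow> bool" where
  "two_color_universal S V E \<longleftrightarrow>
     simple_graph V E \<and> (\<exists>c. proper_2_coloring E c) \<and> finite S \<and> card S = card V \<and>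
     (\<forall>c col. proper_2_coloring E c \<longrightarrow> card {p \<in> S. col p} = card {v \<in> V. c v} \<longrightarrow>
        (\<exists>\<phi>. bij_betw \<phi> V S \<and> (\<forall>v\<in>V. col (\<phi> v) = c v) \<and>
          (\<forall>u v x y. {u, v} \<in> E \<longrightarrow> {x, y} \<in> E \<longrightarrow> {u, v} \<noteq> {x, y} \<longrightarrow>
             noncrossing (\<phi> u) (\<phi> v) (\<phi> x) (\<phi> y))))"

definition path_vertices :: "nat \<Rightarrow> nat set" where
  "path_vertices n = {..<n}"

definition path_edges :: "nat \<Rightarrow> nat set set" where
  "path_edges n = {{i, Suc i} | i. Suc i < n}"

definition equitable :: "point set \<Rightarrow> (point \<Rightarrow> bool) \<Rightarrow> bool" where
  "equitable S col \<longleftrightarrow> \<bar>int (card {p \<in> S. col p}) - int (card {p \<in> S. \<not> col p})\<bar> \<le> 1"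

definition nhap :: "point set \<Rightarrow> (point \<Rightarrow> bool) \<Rightarrow> point list \<Rightarrow> bool" where
  "nhap S col xs \<longleftrightarrow> distinct xs \<and> set xs = S \<and>
     (\<forall>i. Suc i < length xs \<longrightarrow> col (xs ! i) \<noteq> col (xs ! Suc i)) \<and>
     (\<forall>i j. i < j \<longrightarrow> Suc j < length xs \<longrightarrow>
        noncrossing (xs ! i) (xs ! Suc i) (xs ! j) (xs ! Suc j))"


section \<open>A real RAM\<close>

text \<open>A structured form of the real RAM with uniform cost. There are integer and real memories,
  each organized into named arrays; a scalar variable is an array used only at index 0.
  Integers support addition, subtraction and comparison, reals the field operations and
  comparison, and there is no conversion from reals to integers. Only integer cells can be used
  as addresses. An assignment or test counts as one step, whatever its expressions: a fixed
  program contains finitely many expressions, so this changes the running time by a constant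
  factor only.\<close>

record store =
  ints :: "string \<Rightarrow> int \<Rightarrow> int"
  reals :: "string \<Rightarrow> int \<Rightarrow> real"

datatype iexp =
    IConst int
  | ICell string iexp
  | IAdd iexp iexp
  | ISub iexp iexp

datatype rexp =
    RConst int
  | RCell string iexp
  | RAdd rexp rexp
  | RSub rexp rexp
  | RMul rexp rexp
  | RDiv rexp rexp

datatype bexp =
    ILess iexp iexp
  | RLess rexp rexp
  | BNot bexp
  | BAnd bexp bexp

datatype com =
    Skip
  | IAssign string iexp iexp
  | RAssign string iexp rexp
  | Sequ com com
  | Cond bexp com com
  | While bexp com

fun ieval :: "iexp \<Rightarrow> store \<Rightarrow> int" where
  "ieval (IConst k) s = k"
| "ieval (ICell a e) s = ints s a (ieval e s)"
| "ieval (IAdd e f) s = ieval e s + ieval f s"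
| "ieval (ISub e f) s = ieval e s - ieval f s"

fun reval :: "rexp \<Rightarrow> store \<Rightarrow> real" where
  "reval (RConst k) s = of_int k"
| "reval (RCell a e) s = reals s a (ieval e s)"
| "reval (RAdd e f) s = reval e s + reval f s"
| "reval (RSub e f) s = reval e s - reval f s"
| "reval (RMul e f) s = reval e s * reval f s"
| "reval (RDiv e f) s = reval e s / reval f s"

fun beval :: "bexp \<Rightarrow> store \<Rightarrow> bool" where
  "beval (ILess e f) s \<longleftrightarrow> ieval e s < ieval f s"
| "beval (RLess e f) s \<longleftrightarrow> reval e s < reval f s"
| "beval (BNot b) s \<longleftrightarrow> \<not> beval b s"
| "beval (BAnd b c) s \<longleftrightarrow> beval b s \<and> beval c s"

definition write_int :: "string \<Rightarrow> int \<Rightarrow> int \<Rightarrow> store \<Rightarrow> store" where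
  "write_int a i x s = s\<lparr>ints := (ints s)(a := (ints s a)(i := x))\<rparr>"

definition write_real :: "string \<Rightarrow> int \<Rightarrow> real \<Rightarrow> store \<Rightarrow> store" where
  "write_real a i x s = s\<lparr>reals := (reals s)(a := (reals s a)(i := x))\<rparr>"

text \<open>\<open>exec c s t s'\<close>: started in store \<open>s\<close>, program \<open>c\<close> halts after exactly \<open>t\<close> steps in store \<open>s'\<close>.\<close>

inductive exec :: "com \<Rightarrow> store \<Rightarrow> nat \<Rightarrow> store \<Rightarrow> bool" where
  Skip: "exec Skip s 1 s"
| IAssign: "exec (IAssign a e f) s 1 (write_int a (ieval e s) (ieval f s) s)"
| RAssign: "exec (RAssign a e f) s 1 (write_real a (ieval e s) (reval f s) s)"
| Sequ: "exec c s t s' \<Longrightarrow> exec d s' t' s'' \<Longrightarrow> exec (Sequ c d) s (t + t') s''"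
| Cond_True: "beval b s \<Longrightarrow> exec c s t s' \<Longrightarrow> exec (Cond b c d) s (Suc t) s'"
| Cond_False: "\<not> beval b s \<Longrightarrow> exec d s t s' \<Longrightarrow> exec (Cond b c d) s (Suc t) s'"
| While_False: "\<not> beval b s \<Longrightarrow> exec (While b c) s 1 s"
| While_True: "beval b s \<Longrightarrow> exec c s t s' \<Longrightarrow> exec (While b c) s' t' s'' \<Longrightarrow>
    exec (While b c) s (Suc (t + t')) s''"

text \<open>The points are stored chain by chain, each chain from left to right. (For points in
  arbitrary order no linear-time algorithm exists in this model: a point set has only
  exponentially many non-crossing Hamiltonian paths, so a path determines the order of the input
  up to \<open>2\<^sup>O\<^sup>(\<^sup>n\<^sup>)\<close> possibilities.)\<close>

definition input_store :: "point list \<Rightarrow> point list \<Rightarrow> (point \<Rightarrow> bool) \<Rightarrow> store" where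
  "input_store ps qs col = (let zs = ps @ qs in
     \<lparr>ints = (\<lambda>a i.
        if a = ''n1'' \<and> i = 0 then int (length ps)
        else if a = ''n2'' \<and> i = 0 then int (length qs)
        else if a = ''black'' \<and> 0 \<le> i \<and> i < int (length zs) then of_bool (col (zs ! nat i))
        else 0),
      reals = (\<lambda>a i.
        if a = ''x'' \<and> 0 \<le> i \<and> i < int (length zs) then fst (zs ! nat i)
        else if a = ''y'' \<and> 0 \<le> i \<and> i < int (length zs) then snd (zs ! nat i)
        else 0)\<rparr>)"

text \<open>The output is read from the first \<open>length zs\<close> cells of the array \<open>''path''\<close>, which must
  contain positions in the list \<open>zs\<close> of input points.\<close>

definition outputs_path :: "store \<Rightarrow> point list \<Rightarrow> point list \<Rightarrow> bool" where
  "outputs_path s zs xs \<longleftrightarrow> length xs = length zs \<and>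
     (\<forall>i < length zs. \<exists>k < length zs. ints s ''path'' (int i) = int k \<and> xs ! i = zs ! k)"

definition left_to_right :: "point list \<Rightarrow> bool" where
  "left_to_right ps \<longleftrightarrow> sorted_wrt (\<lambda>p q. fst p < fst q) ps"

end

theory Submission
  imports Defs
begin

text \<open>Call one color the major color of the first chain and the other one the major color of the second chain,
  such that majors are not outnumbered by minors in either chain; the two excesses then differ by at most one.
  A chain is cut into bodies, runs of consecutive points. Inside of a body, two adjacent majors are
  connected through a minor outside of all bodies (their spine); gaps and spines are matched like
  parentheses, so that the edges within a chain do not cross. The path visits the bodies of the two chains
  alternately from left to right, hence the edges between the chains do not cross either. Its colors
  alternate if the right end of each body and the left end of the next body on the other chain are
  both majors or both minors of their chains. To achieve this, the inner chain is decomposed greedily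
  into a suitable number of bodies, and the outer chain imitates the sequence of ends by attaching minors
  to its bodies. The number of bodies of a chain may be anything between its width (the number of
  its runs of at least two minors between majors) plus one and its length; the width of a chain is at most a quarter of its length, and this is where the
  factor 5 enters. Additional majors to the left or to the right of a chain adjust
  the excesses; they become the ends of the path and are dropped. All steps are single loops over the chains, so the time is linear.\<close>

section \<open>Crossings in a double-chain\<close>

text \<open>A body with its gaps filled by spines alternates, so the majors minus the minors of a
  body and its spines is 1 minus the number of its minor ends. Summed up, gaps and spines are
  equally many exactly if the excess is the number of bodies minus the number of minor ends; this
  equation governs all choices of numbers below. The outer chain is the rigid one: it follows an
  arbitrary sequence of ends only with its least number of bodies, its width plus one; with more
  bodies, only a sequence of majors throughout is under control. The inner chain must therefore
  admit as many bodies as the outer width, which its length has to allow, and more than its own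
  width. If this fails with either chain outside, monotonicity of the width under padding leaves one
  case: the relevant widths coincide and bound both excesses. There both chains get the same number
  of bodies, and the greedy sequence is explicit enough to be copied. Coordinates enter only through
  the left-to-right order of each chain, so the program reads lengths and colors alone.\<close>

lemma noncrossing_sym: "noncrossing a b c d \<longleftrightarrow> noncrossing c d a b"
  by (auto simp: noncrossing_def)

lemma noncrossing_swap: "noncrossing a b c d \<longleftrightarrow> noncrossing b a c d"
  "noncrossing a b c d \<longleftrightarrow> noncrossing a b d c"
  by (auto simp: noncrossing_def closed_segment_commute insert_commute)

text \<open>The signed vertical distance of \<open>z\<close> from the line of slope \<open>k\<close>
  and intercept \<open>l\<close>. It is affine in \<open>z\<close>, so its values along a segment
  are combinations of those at the endpoints.\<close>

definition lin :: "real \<Rightarrow> real \<Rightarrow> point \<Rightarrow> real" where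
  "lin k l z = snd z - k * fst z - l"

lemma segment_lin:
  assumes "z \<in> closed_segment a b"
  obtains u where "0 \<le> u" "u \<le> 1" "z = (1 - u) *\<^sub>R a + u *\<^sub>R b"
    "\<And>k l. lin k l z = (1 - u) * lin k l a + u * lin k l b" "fst z = (1 - u) * fst a + u * fst b"
proof -
  obtain u where u: "0 \<le> u" "u \<le> 1" "z = (1 - u) *\<^sub>R a + u *\<^sub>R b"
    using assms by (auto simp: in_segment)
  show ?thesis
    by (rule that[OF u]) (auto simp: u(3) lin_def algebra_simps)
qed

lemma convex_comb_zero:
  fixes u r s :: real
  assumes "0 \<le> u" "u \<le> 1" "(1 - u) * r + u * s = 0" "r \<le> 0" "s < 0"
  shows "u = 0"
proof (rule ccontr)
  assume "u \<noteq> 0"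
  then have "u * s < 0" using assms by (simp add: mult_pos_neg)
  moreover have "(1 - u) * r \<le> 0" using assms by (simp add: mult_nonneg_nonpos)
  ultimately show False using assms(3) by linarith
qed

text \<open>Edges often share an endpoint with the line used to separate them, so the separation is
  weak. Strictness at \<open>d\<close> alone leaves \<open>c\<close> as the only candidate for a
  common point, and the last premise makes it a common endpoint.\<close>

lemma noncrossing_by_line:
  assumes "lin k l a \<ge> 0" "lin k l b \<ge> 0" "lin k l c \<le> 0" "lin k l d < 0"
    and "c \<in> closed_segment a b \<Longrightarrow> c = a \<or> c = b"
  shows "noncrossing a b c d"
  unfolding noncrossing_def
proof
  fix z assume z: "z \<in> closed_segment a b \<inter> closed_segment c d"
  obtain u where u: "0 \<le> u" "u \<le> 1" "lin k l z = (1 - u) * lin k l a + u * lin k l b"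
    using z by (blast elim: segment_lin)
  obtain v where v: "0 \<le> v" "v \<le> 1" "lin k l z = (1 - v) * lin k l c + v * lin k l d"
    "z = (1 - v) *\<^sub>R c + v *\<^sub>R d"
    using z by (blast elim: segment_lin)
  have "lin k l z \<ge> 0" using u assms by simp
  moreover have "lin k l z \<le> 0" unfolding v(3)
    using v(1,2) assms(3,4) by (meson add_nonpos_nonpos diff_ge_0_iff_ge less_imp_le mult_nonneg_nonpos)
  ultimately have "(1 - v) * lin k l c + v * lin k l d = 0" using v(3) by linarith
  then have "v = 0" using convex_comb_zero v assms by blast
  then have "z = c" using v by simp
  then show "z \<in> {a, b} \<inter> {c, d}" using z assms(5) by auto
qed

definition slope :: "point \<Rightarrow> point \<Rightarrow> real" where
  "slope a b = (snd b - snd a) / (fst b - fst a)"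

text \<open>Signed vertical height over the line through \<open>a\<close> and \<open>b\<close>. For
  a vertical line the slope is the default value 0 of the division, hence the hypotheses that the
  abscissas differ.\<close>

definition above :: "point \<Rightarrow> point \<Rightarrow> point \<Rightarrow> real" where
  "above a b = lin (slope a b) (snd a - slope a b * fst a)"

lemma above_self [simp]: "above a b a = 0" "fst a \<noteq> fst b \<Longrightarrow> above a b b = 0"
  by (auto simp: above_def lin_def slope_def field_simps)

lemma strictly_below_iff:
  assumes "fst a \<noteq> fst b"
  shows "strictly_below p (affine hull {a, b}) \<longleftrightarrow> above a b p < 0"
    and "strictly_above p (affine hull {a, b}) \<longleftrightarrow> above a b p > 0"
proof -
  have *: "(fst p, y) \<in> affine hull {a, b} \<longleftrightarrow> above a b (fst p, y) = 0" for y
  proof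
    assume "(fst p, y) \<in> affine hull {a, b}"
    then obtain u v where "(fst p, y) = u *\<^sub>R a + v *\<^sub>R b" "u + v = 1"
      by (auto simp: affine_hull_2)
    then have "(fst p, y) = (1 - v) *\<^sub>R a + v *\<^sub>R b" by (simp add: eq_diff_eq)
    then have p: "fst p = fst a + v * (fst b - fst a)" and y: "y = snd a + v * (snd b - snd a)"
      by (auto simp: prod_eq_iff algebra_simps)
    have "slope a b * (fst b - fst a) = snd b - snd a"
      using assms by (simp add: slope_def)
    then have "slope a b * (v * (fst b - fst a)) = v * (snd b - snd a)"
      by (metis mult.left_commute)
    then show "above a b (fst p, y) = 0"
      unfolding above_def lin_def p y by (simp only: fst_conv snd_conv) (simp only: algebra_simps)
  next
    assume h: "above a b (fst p, y) = 0"
    define v where "v = (fst p - fst a) / (fst b - fst a)"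
    have "(fst p, y) = (1 - v) *\<^sub>R a + v *\<^sub>R b"
      using h assms unfolding above_def lin_def slope_def v_def
      by (auto simp: prod_eq_iff divide_simps) (auto simp: algebra_simps)
    then show "(fst p, y) \<in> affine hull {a, b}"
      unfolding affine_hull_2 by (smt (verit) mem_Collect_eq)
  qed
  have y: "above a b (fst p, y) = 0 \<longleftrightarrow> y = snd p - above a b p" for y
    by (auto simp: above_def lin_def)
  show "strictly_below p (affine hull {a, b}) \<longleftrightarrow> above a b p < 0"
    unfolding strictly_below_def * y by auto
  show "strictly_above p (affine hull {a, b}) \<longleftrightarrow> above a b p > 0"
    unfolding strictly_above_def * y by auto
qed

text \<open>All three signs express one inequality, that \<open>b\<close> lies below the chord from
  \<open>a\<close> to \<open>c\<close>, cleared of denominators. Each form is recorded because the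
  line of any two of the three points may serve as a separator.\<close>

lemma strictly_convex_above:
  assumes "strictly_convex_on UNIV f" "snd a = f (fst a)" "snd b = f (fst b)" "snd c = f (fst c)"
    "fst a < fst b" "fst b < fst c"
  shows "above a c b < 0" "above a b c > 0" "above b c a > 0"
proof -
  define u where "u = (fst c - fst b) / (fst c - fst a)"
  define v where "v = (fst b - fst a) / (fst c - fst a)"
  have uv: "u > 0" "v > 0" "u + v = 1" "u * fst a + v * fst c = fst b"
    using assms(5,6) unfolding u_def v_def by (auto simp: divide_simps) (auto simp: algebra_simps)
  have "f (u * fst a + v * fst c) < u * f (fst a) + v * f (fst c)"
    using assms(1,5,6) uv(1-3) unfolding strictly_convex_on_def by (metis UNIV_I less_irrefl less_trans)
  then have "snd b < u * snd a + v * snd c" using uv assms by simp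
  then have *: "snd b * (fst c - fst a) < snd a * (fst c - fst b) + snd c * (fst b - fst a)"
    using assms(5,6) unfolding u_def v_def by (simp add: divide_simps split: if_splits) (simp add: algebra_simps)
  show "above a c b < 0" "above a b c > 0" "above b c a > 0"
    using * assms(5,6) unfolding above_def lin_def slope_def
    by (simp_all add: divide_simps) (simp_all add: algebra_simps)
qed


lemma noncrossing_by_above:
  assumes "above e f a \<ge> 0" "above e f b \<ge> 0" "above e f c \<le> 0" "above e f d < 0"
    and "c \<in> closed_segment a b \<Longrightarrow> c = a \<or> c = b"
  shows "noncrossing a b c d"
  using assms(1-4) noncrossing_by_line[where k = "slope e f" and l = "snd e - slope e f * fst e", OF _ _ _ _ assms(5)]
  unfolding above_def by simp

text \<open>What one chain sees of a double-chain: it is convex, and all its lines pass above the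
  other chain. The reflected lower chain satisfies the same condition, so statements about edges
  within a chain are proved only once.\<close>

definition facing :: "point set \<Rightarrow> point set \<Rightarrow> bool" where
  "facing S T \<longleftrightarrow> inj_on fst S \<and>
     (\<forall>a\<in>S. \<forall>b\<in>S. \<forall>c\<in>S. fst a < fst b \<longrightarrow> fst b < fst c \<longrightarrow>
        above a c b < 0 \<and> above a b c > 0 \<and> above b c a > 0) \<and>
     (\<forall>a\<in>S. \<forall>b\<in>S. \<forall>t\<in>T. fst a < fst b \<longrightarrow> above a b t < 0)"

lemma above_segment:
  assumes "z \<in> closed_segment a b" "fst a \<noteq> fst b"
  shows "above a b z = 0"
  using assms by (auto elim!: segment_lin simp: above_def[of a b] above_self[unfolded above_def])

lemma fst_segment:
  fixes a b z :: point
  assumes "z \<in> closed_segment a b" "fst a \<le> fst b"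
  shows "fst a \<le> fst z" "fst z \<le> fst b"
proof -
  obtain u where u: "0 \<le> u" "u \<le> 1" "fst z = (1 - u) * fst a + u * fst b"
    using assms(1) by (blast elim: segment_lin)
  have "fst z = fst a + u * (fst b - fst a)" "fst z = fst b - (1 - u) * (fst b - fst a)"
    using u(3) by (simp_all add: algebra_simps)
  moreover have "0 \<le> u * (fst b - fst a)" "0 \<le> (1 - u) * (fst b - fst a)" using u assms(2) by simp_all
  ultimately show "fst a \<le> fst z" "fst z \<le> fst b" by linarith+
qed

lemma segment_end:
  fixes a b z :: point
  assumes "z \<in> closed_segment a b" "fst a < fst b"
  shows "fst z = fst a \<Longrightarrow> z = a" "fst z = fst b \<Longrightarrow> z = b"
proof -
  obtain u where u: "0 \<le> u" "u \<le> 1" "fst z = (1 - u) * fst a + u * fst b" "z = (1 - u) *\<^sub>R a + u *\<^sub>R b"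
    using assms(1) by (blast elim: segment_lin)
  have *: "fst z = fst a + u * (fst b - fst a)" "fst z = fst b - (1 - u) * (fst b - fst a)"
    using u(3) by (simp_all add: algebra_simps)
  show "fst z = fst a \<Longrightarrow> z = a" using *(1) assms u(4) by auto
  show "fst z = fst b \<Longrightarrow> z = b" using *(2) assms u(4) by auto
qed

lemma facing_segment:
  assumes "facing S T" "a \<in> S" "b \<in> S" "c \<in> S" "fst a < fst b" "c \<in> closed_segment a b"
  shows "c = a \<or> c = b"
proof (rule ccontr)
  assume n: "\<not> (c = a \<or> c = b)"
  have "fst a < fst c" "fst c < fst b"
    using fst_segment[OF assms(6)] segment_end[OF assms(6,5)] n assms(5) by (auto simp: less_le)
  then have "above a b c < 0" using assms unfolding facing_def by blast
  then show False using above_segment[OF assms(6)] assms(5) by simp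
qed

text \<open>Two chords of a convex chain that do not interleave are separated by a vertical line or
  nested. In the nested case the inner chord lies below the line of the outer one, strictly so
  except at a shared endpoint.\<close>

lemma noncrossing_inner:
  assumes S: "facing S T" "a \<in> S" "b \<in> S" "c \<in> S" "d \<in> S"
    and "fst a < fst b" "fst c < fst d" "(a, b) \<noteq> (c, d)"
    and "\<not> (fst a < fst c \<and> fst c < fst b \<and> fst b < fst d)"
    and "\<not> (fst c < fst a \<and> fst a < fst d \<and> fst d < fst b)"
  shows "noncrossing a b c d"
proof -
  have disj: "noncrossing a b c d" if "fst a < fst b" "fst c < fst d" "fst b \<le> fst c"
    for a b c d :: point
    unfolding noncrossing_def
  proof
    fix z assume z: "z \<in> closed_segment a b \<inter> closed_segment c d"
    then have "fst z \<le> fst b" "fst c \<le> fst z"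
      using fst_segment(2)[of z a b] fst_segment(1)[of z c d] that by simp_all
    then have e: "fst z = fst b" "fst z = fst c" using that by linarith+
    have "z = b" using segment_end(2)[OF IntD1[OF z] that(1)] e by blast
    moreover have "z = c" using segment_end(1)[OF IntD2[OF z] that(2)] e by blast
    ultimately show "z \<in> {a, b} \<inter> {c, d}" by blast
  qed
  have nest: "noncrossing a b c d" if in4: "a \<in> S" "b \<in> S" "c \<in> S" "d \<in> S"
    and "fst a < fst b" "fst c < fst d" "fst a \<le> fst c" "fst d \<le> fst b" and nab: "(a, b) \<noteq> (c, d)" for a b c d
  proof -
    have le: "above a b x \<le> 0" "x \<noteq> a \<Longrightarrow> x \<noteq> b \<Longrightarrow> above a b x < 0"
      if "x \<in> S" "fst a \<le> fst x" "fst x \<le> fst b" for x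
    proof -
      show *: "above a b x < 0" if "x \<noteq> a" "x \<noteq> b"
      proof -
        have "fst x \<noteq> fst a" "fst x \<noteq> fst b"
          using \<open>x \<in> S\<close> in4 S(1) that unfolding facing_def inj_on_def by metis+
        then have "fst a < fst x" "fst x < fst b" using \<open>fst a \<le> fst x\<close> \<open>fst x \<le> fst b\<close> by auto
        then show ?thesis using S(1) \<open>x \<in> S\<close> in4 unfolding facing_def by blast
      qed
      show "above a b x \<le> 0" using * above_self[of a b] \<open>fst a < fst b\<close> by fastforce
    qed
    have seg: "x \<in> closed_segment a b \<Longrightarrow> x = a \<or> x = b" if "x \<in> S" for x
      using facing_segment[OF S(1) in4(1,2) that \<open>fst a < fst b\<close>] by blast
    have ab: "above a b a \<ge> 0" "above a b b \<ge> 0" using \<open>fst a < fst b\<close> by auto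
    consider "c \<noteq> a" | "d \<noteq> b" using nab by blast
    then show ?thesis
    proof cases
      case 1
      have "above a b c < 0" using 1 that by (intro le) auto
      moreover have "above a b d \<le> 0" using that by (intro le) auto
      ultimately have "noncrossing a b d c"
        using noncrossing_by_above ab seg[of d] in4 by blast
      then show ?thesis using noncrossing_swap(2) by blast
    next
      case 2
      have "above a b d < 0" using 2 that by (intro le) auto
      moreover have "above a b c \<le> 0" using that by (intro le) auto
      ultimately show ?thesis
        using noncrossing_by_above ab seg[of c] in4 by blast
    qed
  qed
  have ne: "(c, d) \<noteq> (a, b)" using assms(8) by auto
  consider "fst b \<le> fst c" | "fst d \<le> fst a" | "fst a \<le> fst c" "fst d \<le> fst b"
    | "fst c \<le> fst a" "fst b \<le> fst d"
    using assms(9,10) by linarith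
  then show ?thesis
    using disj[OF assms(6,7)] disj[OF assms(7,6)] nest[OF S(2-5) assms(6,7)]
      nest[OF S(4,5,2,3) assms(7,6)] assms(8) ne noncrossing_sym[of a b c d] by cases auto
qed

text \<open>If \<open>c\<close> is not beyond the chord, the line of the chord separates. Otherwise
  it is the line joining \<open>c\<close> to the nearer endpoint of the chord: the farther endpoint
  lies above it and \<open>t\<close> below.\<close>

lemma noncrossing_inner_cross:
  assumes S: "facing S T" "a \<in> S" "b \<in> S" "c \<in> S" "t \<in> T" and ab: "fst a < fst b"
  shows "noncrossing a b c t"
proof -
  have seg: "c \<in> closed_segment a b \<Longrightarrow> c = a \<or> c = b"
    using facing_segment[OF S(1-4) ab] by blast
  have eq: "fst c = fst x \<Longrightarrow> c = x" if "x \<in> S" for x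
    using S(1,4) that unfolding facing_def inj_on_def by blast
  note F = S(1)[unfolded facing_def, THEN conjunct2]
  have t: "above a b t < 0" using F S ab by blast
  consider "fst c < fst a" | "fst b < fst c" | "above a b c \<le> 0"
  proof -
    assume a: thesis if "fst c < fst a"
    assume b: thesis if "fst b < fst c"
    assume c: thesis if "above a b c \<le> 0"
    consider "fst c < fst a" | "fst b < fst c" | "c = a" | "c = b" | "fst a < fst c \<and> fst c < fst b"
      using eq[OF S(2)] eq[OF S(3)] by linarith
    then show thesis
    proof cases
      case 5
      then have "above a b c < 0" using F S by blast
      then show ?thesis using c by simp
    qed (use a b c above_self[of a b] ab in auto)
  qed
  then show ?thesis
  proof cases
    case 1
    have "above c a b > 0" "above c a t < 0" using F S 1 ab by blast+
    moreover have "above c a a = 0" "above c a c = 0" using 1 by auto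
    ultimately show ?thesis
      using noncrossing_by_above[of c a a b c t] seg by simp
  next
    case 2
    have "above b c a > 0" "above b c t < 0" using F S 2 ab by blast+
    moreover have "above b c b = 0" "above b c c = 0" using 2 by auto
    ultimately show ?thesis
      using noncrossing_by_above[of b c a b c t] seg by simp
  next
    case 3
    have "above a b a = 0" "above a b b = 0" using ab by auto
    then show ?thesis
      using noncrossing_by_above[of a b a b c t] seg t 3 by simp
  qed
qed

lemma noncrossing_inner_inner:
  assumes "facing S T" "a \<in> S" "b \<in> S" "c \<in> T" "d \<in> T" "fst a < fst b"
  shows "noncrossing a b c d"
proof -
  have "above a b c < 0" "above a b d < 0" using assms unfolding facing_def by blast+
  moreover have "above a b a = 0" "above a b b = 0" using assms by auto
  moreover have "c \<in> closed_segment a b \<Longrightarrow> c = a \<or> c = b"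
    using above_segment[of c a b] calculation(1) assms(6) by auto
  ultimately show ?thesis
    using noncrossing_by_above[of a b a b c d] by simp
qed

text \<open>Both segments run from \<open>p\<close> to a line missing \<open>p\<close>. The height
  over this line determines the parameter on either segment, so a common point has equal parameters,
  which is only possible at \<open>p\<close>.\<close>

lemma noncrossing_fan:
  assumes "lin k l a = 0" "lin k l b = 0" "lin k l p \<noteq> 0" "a \<noteq> b"
  shows "noncrossing p a p b"
  unfolding noncrossing_def
proof
  fix z assume z: "z \<in> closed_segment p a \<inter> closed_segment p b"
  obtain u where u: "lin k l z = (1 - u) * lin k l p + u * lin k l a" "z = (1 - u) *\<^sub>R p + u *\<^sub>R a"
    using z by (blast elim: segment_lin)
  obtain v where v: "lin k l z = (1 - v) * lin k l p + v * lin k l b" "z = (1 - v) *\<^sub>R p + v *\<^sub>R b"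
    using z by (blast elim: segment_lin)
  have "u = v" using u(1) v(1) assms by auto
  then have "u *\<^sub>R a = u *\<^sub>R b" using u(2) v(2) by auto
  then have "u = 0" using assms(4) by auto
  then show "z \<in> {p, a} \<inter> {p, b}" using u(2) by simp
qed

lemma noncrossing_fan_above:
  assumes "above e f a = 0" "above e f b = 0" "above e f p \<noteq> 0" "a \<noteq> b"
  shows "noncrossing p a p b"
  using assms noncrossing_fan[of "slope e f" "snd e - slope e f * fst e" a b p]
  unfolding above_def by simp

text \<open>Two edges between the chains in the same left-to-right order. With a shared endpoint
  this is a fan. With four distinct points, a common point is measured over the line of the upper
  endpoints and over the line of the lower ones.\<close>

lemma noncrossing_cross:
  assumes p: "p1 \<in> S" "p2 \<in> S" and q: "q1 \<in> T" "q2 \<in> T"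
    and below: "\<And>a b t. a \<in> S \<Longrightarrow> b \<in> S \<Longrightarrow> t \<in> T \<Longrightarrow> fst a < fst b \<Longrightarrow> above a b t < 0"
    and abv: "\<And>a b t. a \<in> T \<Longrightarrow> b \<in> T \<Longrightarrow> t \<in> S \<Longrightarrow> fst a < fst b \<Longrightarrow> above a b t > 0"
    and "p1 = p2 \<or> fst p1 < fst p2" "q1 = q2 \<or> fst q1 < fst q2" "(p1, q1) \<noteq> (p2, q2)"
  shows "noncrossing p1 q1 p2 q2"
proof -
  consider "p1 = p2" "fst q1 < fst q2" | "q1 = q2" "fst p1 < fst p2" | "fst p1 < fst p2" "fst q1 < fst q2"
    using assms(7-9) by auto
  then show ?thesis
  proof cases
    case 1
    have "above q1 q2 q1 = 0" "above q1 q2 q2 = 0" "above q1 q2 p1 > 0" using 1 abv p q by auto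
    then show ?thesis

      using noncrossing_fan_above[of q1 q2 q1 q2 p1] 1 by force
  next
    case 2
    have "above p1 p2 p1 = 0" "above p1 p2 p2 = 0" "above p1 p2 q1 < 0" using 2 below p q by auto
    then have "noncrossing q1 p1 q1 p2"

      using noncrossing_fan_above[of p1 p2 p1 p2 q1] 2 by force
    then show ?thesis using 2 noncrossing_swap by metis
  next
    case 3
    define f g where "f = above p1 p2" and "g = above q1 q2"
    have f: "f p1 = 0" "f p2 = 0" "f q1 < 0" "f q2 < 0" using 3 below p q by (auto simp: f_def)
    have g: "g q1 = 0" "g q2 = 0" "g p1 > 0" "g p2 > 0" using 3 abv p q by (auto simp: g_def)
    define a c where "a = slope p1 p2" and "c = slope q1 q2"
    have df: "f q1 - f q2 = (a - c) * (fst q2 - fst q1)" and dg: "g p1 - g p2 = (a - c) * (fst p1 - fst p2)"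
    proof -
      have "c * (fst q2 - fst q1) = snd q2 - snd q1" "a * (fst p2 - fst p1) = snd p2 - snd p1"
        using 3 by (auto simp: a_def c_def slope_def)
      then show "f q1 - f q2 = (a - c) * (fst q2 - fst q1)" "g p1 - g p2 = (a - c) * (fst p1 - fst p2)"
        unfolding f_def g_def above_def lin_def a_def[symmetric] c_def[symmetric]
        by (auto simp: algebra_simps)
    qed
    have "z \<notin> closed_segment p2 q2" if z1: "z \<in> closed_segment p1 q1" for z
    proof
      assume z2: "z \<in> closed_segment p2 q2"
      obtain s where s: "0 \<le> s" "s \<le> 1" "\<And>k l. lin k l z = (1 - s) * lin k l p1 + s * lin k l q1"
          "fst z = (1 - s) * fst p1 + s * fst q1"
        using z1 by (rule segment_lin) blast
      obtain t where t: "0 \<le> t" "t \<le> 1" "\<And>k l. lin k l z = (1 - t) * lin k l p2 + t * lin k l q2"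
          "fst z = (1 - t) * fst p2 + t * fst q2"
        using z2 by (rule segment_lin) blast
      have fe: "s * f q1 = t * f q2"
        using s(3) t(3) f(1,2) unfolding f_def above_def by (metis add_0 mult_zero_right)
      have ge: "(1 - s) * g p1 = (1 - t) * g p2"
        using s(3) t(3) g(1,2) unfolding g_def above_def by (metis add.right_neutral mult_zero_right)
      \<comment> \<open>Comparing the slopes orders the heights of the lower points under one line
        and those of the upper points over the other. One of the equations \<open>fe\<close> and
        \<open>ge\<close> then excludes \<open>s < t\<close> and the other one
        \<open>s > t\<close>.\<close>
      have "s = t"
      proof (cases "a \<ge> c")
        case True
        have "f q1 \<ge> f q2" using df True 3 by (smt (verit) mult_nonneg_nonneg)
        then have "\<not> s < t" using fe f t s by (smt (verit) mult_less_cancel_right mult_left_mono)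
        moreover have "g p1 \<le> g p2" using dg True 3 by (smt (verit) mult_nonneg_nonpos)
        then have "\<not> s > t" using ge g t s by (smt (verit) mult_less_cancel_right mult_left_mono)
        ultimately show ?thesis by simp
      next
        case False
        have "f q1 \<le> f q2" using df False 3 by (smt (verit) mult_nonpos_nonneg)
        then have "\<not> s > t" using fe f t s by (smt (verit) mult_less_cancel_right mult_left_mono)
        moreover have "g p1 \<ge> g p2" using dg False 3 by (smt (verit) mult_nonpos_nonpos)
        then have "\<not> s < t" using ge g t s by (smt (verit) mult_less_cancel_right mult_left_mono)
        ultimately show ?thesis by simp
      qed
      \<comment> \<open>At equal parameters the second segment is strictly to the right of the first
        one.\<close>
      then have "(1 - s) * (fst p2 - fst p1) + s * (fst q2 - fst q1) = 0"
        using s(4) t(4) by (simp add: algebra_simps)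
      then show False using s(1,2) 3
        by (smt (verit) mult_nonneg_nonneg mult_pos_pos)
    qed
    then show ?thesis unfolding noncrossing_def by blast
  qed
qed

section \<open>Reflection exchanging the roles of the two chains\<close>

definition flip :: "point \<Rightarrow> point" where
  "flip p = (fst p, - snd p)"

lemma flip_simps [simp]: "fst (flip p) = fst p" "flip (flip p) = p" "flip p = flip q \<longleftrightarrow> p = q"
  by (auto simp: flip_def prod_eq_iff)

lemma above_flip [simp]: "above (flip a) (flip b) (flip c) = - above a b c"
  by (simp add: above_def lin_def slope_def flip_def algebra_simps minus_divide_left diff_divide_distrib)

lemma noncrossing_flip: "noncrossing (flip a) (flip b) (flip c) (flip d) \<longleftrightarrow> noncrossing a b c d"
proof -
  have l: "linear flip"
    by (rule linearI) (auto simp: flip_def prod_eq_iff)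
  have i: "inj flip" by (auto simp: inj_def)
  have "closed_segment (flip x) (flip y) = flip ` closed_segment x y" for x y
    using l by (metis closed_segment_linear_image)
  moreover have "{flip x, flip y} = flip ` {x, y}" for x y by auto
  ultimately show ?thesis
    unfolding noncrossing_def by (metis (no_types) i image_Int inj_image_subset_iff)
qed

lemma double_chain_facing:
  assumes "double_chain C1 C2"
  shows "facing C1 C2" "facing (flip ` C2) (flip ` C1)"
proof -
  obtain f where f: "strictly_convex_on UNIV f" "\<forall>p\<in>C1. snd p = f (fst p)"
    using assms unfolding double_chain_def convex_chain_def by blast
  obtain g where g: "strictly_convex_on UNIV (\<lambda>x. - g x)" "\<forall>p\<in>C2. snd p = g (fst p)"
    using assms unfolding double_chain_def concave_chain_def strictly_concave_on_def by blast
  have 1: "\<And>p a b. p \<in> C2 \<Longrightarrow> a \<in> C1 \<Longrightarrow> b \<in> C1 \<Longrightarrow> fst a < fst b \<Longrightarrow> above a b p < 0"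
    using assms strictly_below_iff(1) unfolding double_chain_def by (metis less_irrefl)
  have 2: "\<And>p a b. p \<in> C1 \<Longrightarrow> a \<in> C2 \<Longrightarrow> b \<in> C2 \<Longrightarrow> fst a < fst b \<Longrightarrow> above a b p > 0"
    using assms strictly_below_iff(2) unfolding double_chain_def by (metis less_irrefl)
  have inj: "inj_on fst C1" "inj_on fst (flip ` C2)"
    using f(2) g(2) by (simp_all add: inj_on_def prod_eq_iff flip_def)
  show "facing C1 C2"
    unfolding facing_def using strictly_convex_above[OF f(1)] f(2)
    by (intro conjI inj(1)) (simp_all add: 1)
  have "\<forall>p\<in>flip ` C2. snd p = - g (fst p)" using g(2) by (auto simp: flip_def)
  then have *: "\<forall>a\<in>flip ` C2. \<forall>b\<in>flip ` C2. \<forall>c\<in>flip ` C2. fst a < fst b \<longrightarrow> fst b < fst c \<longrightarrow>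
        above a c b < 0 \<and> above a b c > 0 \<and> above b c a > 0"
    using strictly_convex_above[OF g(1)] by metis
  show "facing (flip ` C2) (flip ` C1)"
    unfolding facing_def by (intro conjI inj(2) *) (auto simp: 2)
qed

section \<open>Programs on the integer memory\<close>

type_synonym ram = "string \<Rightarrow> int \<Rightarrow> int"

fun iev :: "iexp \<Rightarrow> ram \<Rightarrow> int" where
  "iev (IConst k) s = k"
| "iev (ICell a e) s = s a (iev e s)"
| "iev (IAdd e f) s = iev e s + iev f s"
| "iev (ISub e f) s = iev e s - iev f s"

text \<open>\<open>RLess\<close> gets the arbitrary value \<open>False\<close>; agreement with
  \<open>beval\<close> is only claimed under \<open>intb\<close>.\<close>

fun bev :: "bexp \<Rightarrow> ram \<Rightarrow> bool" where
  "bev (ILess e f) s \<longleftrightarrow> iev e s < iev f s"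
| "bev (RLess e f) s \<longleftrightarrow> False"
| "bev (BNot b) s \<longleftrightarrow> \<not> bev b s"
| "bev (BAnd b c) s \<longleftrightarrow> bev b s \<and> bev c s"

fun intb :: "bexp \<Rightarrow> bool" where
  "intb (ILess e f) = True"
| "intb (RLess e f) = False"
| "intb (BNot b) = intb b"
| "intb (BAnd b c) = (intb b \<and> intb c)"

definition upd :: "string \<Rightarrow> int \<Rightarrow> int \<Rightarrow> ram \<Rightarrow> ram" where
  "upd x k v s = s(x := (s x)(k := v))"

lemma upd_apply [simp]: "upd x k v s y = (if y = x then (s x)(k := v) else s y)"
  by (simp add: upd_def)

text \<open>Loop-free integer programs are functions on the memory, computed by \<open>eff\<close>.
  The simplifier can thus execute every loop body symbolically, and only the loops themselves need
  invariants.\<close>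

fun straight :: "com \<Rightarrow> bool" where
  "straight Skip = True"
| "straight (IAssign x e f) = True"
| "straight (RAssign x e f) = False"
| "straight (Sequ c d) = (straight c \<and> straight d)"
| "straight (Cond b c d) = (intb b \<and> straight c \<and> straight d)"
| "straight (While b c) = False"

fun eff :: "com \<Rightarrow> ram \<Rightarrow> ram" where
  "eff (IAssign x e f) s = upd x (iev e s) (iev f s) s"
| "eff (Sequ c d) s = eff d (eff c s)"
| "eff (Cond b c d) s = (if bev b s then eff c s else eff d s)"
| "eff _ s = s"

fun csize :: "com \<Rightarrow> nat" where
  "csize (Sequ c d) = csize c + csize d"
| "csize (Cond b c d) = csize c + csize d + 1"
| "csize _ = 1"

text \<open>Total correctness with a time bound, stated on the integer memory alone: quantifying
  over all stores with this integer part means that nothing about the reals has to be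
  tracked.\<close>

definition wp :: "com \<Rightarrow> nat \<Rightarrow> (ram \<Rightarrow> bool) \<Rightarrow> ram \<Rightarrow> bool" where
  "wp c t Q a \<longleftrightarrow> (\<forall>s :: store. ints s = a \<longrightarrow> (\<exists>t' s'. exec c s t' s' \<and> t' \<le> t \<and> Q (ints s')))"

lemma iev_ints: "ieval e s = iev e (ints s)"
  by (induction e) auto

lemma bev_ints: "intb b \<Longrightarrow> beval b s = bev b (ints s)"
  by (induction b) (auto simp: iev_ints)

lemma wp_straight':
  "straight c \<Longrightarrow> \<exists>t s'. exec c s t s' \<and> t \<le> csize c \<and> ints s' = eff c (ints s)"
proof (induction c arbitrary: s)
  case (IAssign x e f)
  have "exec (IAssign x e f) s 1 (write_int x (ieval e s) (ieval f s) s)" by (rule exec.IAssign)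
  moreover have "ints (write_int x (ieval e s) (ieval f s) s) = eff (IAssign x e f) (ints s)"
    by (simp add: write_int_def upd_def iev_ints)
  ultimately show ?case by fastforce
next
  case (Sequ c d)
  obtain t s' where 1: "exec c s t s'" "t \<le> csize c" "ints s' = eff c (ints s)" using Sequ by fastforce
  obtain t' s'' where 2: "exec d s' t' s''" "t' \<le> csize d" "ints s'' = eff d (ints s')"
    using Sequ by fastforce
  show ?case using exec.Sequ[OF 1(1) 2(1)] 1 2 by (intro exI conjI) auto
next
  case (Cond b c d)
  show ?case
  proof (cases "beval b s")
    case True
    obtain t s' where 1: "exec c s t s'" "t \<le> csize c" "ints s' = eff c (ints s)" using Cond by fastforce
    show ?thesis using exec.Cond_True[OF True 1(1)] 1 True Cond.prems bev_ints[of b s]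
      by (intro exI conjI) auto
  next
    case False
    obtain t s' where 1: "exec d s t s'" "t \<le> csize d" "ints s' = eff d (ints s)" using Cond by fastforce
    show ?thesis using exec.Cond_False[OF False 1(1)] 1 False Cond.prems bev_ints[of b s]
      by (intro exI conjI) auto
  qed
next
  case Skip
  show ?case using exec.Skip[of s] by fastforce
qed auto

lemma wpI:
  assumes "\<And>s :: store. ints s = a \<Longrightarrow> \<exists>t' s'. exec c s t' s' \<and> t' \<le> t \<and> Q (ints s')"
  shows "wp c t Q a"
  using assms by (simp add: wp_def)

lemma wp_straight: "straight c \<Longrightarrow> Q (eff c a) \<Longrightarrow> csize c \<le> t \<Longrightarrow> wp c t Q a"
  by (rule wpI) (metis wp_straight' le_trans)

lemma wpD:
  assumes "wp c t Q (ints s)"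
  obtains t' s' where "exec c s t' s'" "t' \<le> t" "Q (ints s')"
  using assms unfolding wp_def by blast

lemma wp_mono:
  assumes "wp c t Q a" "t \<le> t'" "\<And>b. Q b \<Longrightarrow> Q' b"
  shows "wp c t' Q' a"
proof (rule wpI)
  fix s :: store
  assume "ints s = a"
  then obtain r s' where "exec c s r s'" "r \<le> t" "Q (ints s')" using assms(1) by (metis wpD)
  then show "\<exists>t'' s'. exec c s t'' s' \<and> t'' \<le> t' \<and> Q' (ints s')"
    using assms(2,3) by (meson le_trans)
qed

lemma wp_sequ:
  assumes "wp c t R a" "\<And>b. R b \<Longrightarrow> wp d t' Q b"
  shows "wp (Sequ c d) (t + t') Q a"
proof (rule wpI)
  fix s :: store
  assume "ints s = a"
  then obtain r s' where 1: "exec c s r s'" "r \<le> t" "R (ints s')" using assms(1) by (metis wpD)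
  obtain r' s'' where 2: "exec d s' r' s''" "r' \<le> t'" "Q (ints s'')"
    using assms(2)[OF 1(3)] by (metis wpD)
  show "\<exists>t'' s'. exec (Sequ c d) s t'' s' \<and> t'' \<le> t + t' \<and> Q (ints s')"
    using exec.Sequ[OF 1(1) 2(1)] 1(2) 2(2,3) by (meson add_mono)
qed

lemma wp_cond:
  assumes "intb b" "bev b a \<Longrightarrow> wp c t Q a" "\<not> bev b a \<Longrightarrow> wp d t Q a"
  shows "wp (Cond b c d) (t + 1) Q a"
proof (rule wpI)
  fix s :: store
  assume s: "ints s = a"
  show "\<exists>t' s'. exec (Cond b c d) s t' s' \<and> t' \<le> t + 1 \<and> Q (ints s')"
  proof (cases "bev b a")
    case True
    then obtain r s' where "exec c s r s'" "r \<le> t" "Q (ints s')" using assms(2) s by (metis wpD)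
    then show ?thesis
      using exec.Cond_True[of b s] True s bev_ints[OF assms(1)] by (metis Suc_eq_plus1 Suc_le_mono)
  next
    case False
    then obtain r s' where "exec d s r s'" "r \<le> t" "Q (ints s')" using assms(3) s by (metis wpD)
    then show ?thesis
      using exec.Cond_False[of b s] False s bev_ints[OF assms(1)] by (metis Suc_eq_plus1 Suc_le_mono)
  qed
qed

abbreviation V :: "string \<Rightarrow> iexp" where "V x \<equiv> ICell x (IConst 0)"
abbreviation Asg :: "string \<Rightarrow> iexp \<Rightarrow> com" where "Asg x \<equiv> IAssign x (IConst 0)"

definition For :: "iexp \<Rightarrow> iexp \<Rightarrow> com \<Rightarrow> com" where
  "For e f c = Sequ (Asg ''i'' e) (While (ILess (V ''i'') f) (Sequ c (Asg ''i'' (IAdd (V ''i'') (IConst 1)))))"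

text \<open>The invariant is indexed by the number of completed rounds and decides the guard.
  Termination and running time therefore need no separate variant: there are exactly
  \<open>N - j\<close> rounds to go.\<close>

lemma wp_while:
  assumes "straight c"
    and "\<And>j a. j < N \<Longrightarrow> I j a \<Longrightarrow> I (Suc j) (eff c a)"
    and "\<And>j a. j \<le> N \<Longrightarrow> I j a \<Longrightarrow> bev b a \<longleftrightarrow> j < N"
    and "intb b" "I j a" "j \<le> N"
  shows "wp (While b c) ((N - j) * (csize c + 1) + 1) (I N) a"
  using assms(5,6)
proof (induction "N - j" arbitrary: j a)
  case 0
  then have "j = N" "\<not> bev b a" using assms(3) by auto
  then show ?case
    using 0 exec.While_False[of b _ c] bev_ints[OF assms(4)] by (intro wpI) (metis add_0 le_refl mult_0)
next
  case (Suc k)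
  then have j: "j < N" "k = N - Suc j" "bev b a" using assms(3) by auto
  have IH: "wp (While b c) (k * (csize c + 1) + 1) (I N) (eff c a)"
    using Suc.hyps(1)[OF j(2) assms(2)[OF j(1) Suc.prems(1)]] j by simp
  show ?case
  proof (rule wpI)
    fix s :: store assume s: "ints s = a"
    obtain t s' where 1: "exec c s t s'" "t \<le> csize c" "ints s' = eff c a"
      using wp_straight'[OF assms(1)] s by blast
    obtain t' s'' where 2: "exec (While b c) s' t' s''" "t' \<le> k * (csize c + 1) + 1" "I N (ints s'')"
      using IH[folded 1(3)] by (rule wpD)
    have "exec (While b c) s (Suc (t + t')) s''"
      using exec.While_True[OF _ 1(1) 2(1)] j s bev_ints[OF assms(4)] by simp
    moreover have "Suc (t + t') \<le> (N - j) * (csize c + 1) + 1"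
      using 1 2 Suc.hyps(2)[symmetric] by simp
    ultimately show "\<exists>t' s'. exec (While b c) s t' s' \<and> t' \<le> (N - j) * (csize c + 1) + 1 \<and> I N (ints s')"
      using 2(3) by blast
  qed
qed

text \<open>The loop variable is the cell \<open>''i''\<close>; the bound is re-evaluated in every round, so the
  invariant has to determine its value.\<close>

lemma wp_For:
  fixes lo hi :: int
  assumes "straight c" "iev e a = lo" "lo \<le> hi"
    and "I lo (upd ''i'' 0 lo a)"
    and "\<And>i a. lo \<le> i \<Longrightarrow> i < hi \<Longrightarrow> I i a \<Longrightarrow>
      I (i + 1) (upd ''i'' 0 (eff c a ''i'' 0 + 1) (eff c a))"
    and "\<And>i a. lo \<le> i \<Longrightarrow> i \<le> hi \<Longrightarrow> I i a \<Longrightarrow> a ''i'' 0 = i \<and> iev f a = hi"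
    and "\<And>a. I hi a \<Longrightarrow> Q a"
    and "t \<ge> (nat (hi - lo)) * (csize c + 2) + 2"
  shows "wp (For e f c) t Q a"
proof -
  let ?c = "Sequ c (Asg ''i'' (IAdd (V ''i'') (IConst 1)))"
  define J where "J j = I (lo + int j)" for j
  have a: "J 0 (upd ''i'' 0 lo a)" using assms(4) by (simp add: J_def)
  have b: "J (Suc j) (eff ?c a)" if "j < nat (hi - lo)" "J j a" for j a
  proof -
    have "I (lo + int j + 1) (upd ''i'' 0 (eff c a ''i'' 0 + 1) (eff c a))"
      using that by (intro assms(5)) (auto simp: J_def)
    then show ?thesis by (simp add: J_def add_ac)
  qed
  have c: "bev (ILess (V ''i'') f) a \<longleftrightarrow> j < nat (hi - lo)" if "j \<le> nat (hi - lo)" "J j a" for j a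
    using assms(6)[of "lo + int j" a] that assms(3) by (auto simp: J_def)
  have "wp (While (ILess (V ''i'') f) ?c) ((nat (hi - lo) - 0) * (csize ?c + 1) + 1) (J (nat (hi - lo)))
      (upd ''i'' 0 lo a)"
    using assms(1) by (intro wp_while[where I = J and N = "nat (hi - lo)"] a b c) simp_all
  then have w: "wp (While (ILess (V ''i'') f) ?c) (nat (hi - lo) * (csize c + 2) + 1) (J (nat (hi - lo)))
      (upd ''i'' 0 lo a)" by simp
  have "wp (Asg ''i'' e) 1 (\<lambda>b. b = upd ''i'' 0 lo a) a"
    by (rule wp_straight) (simp_all add: assms(2))
  then have "wp (For e f c) (1 + (nat (hi - lo) * (csize c + 2) + 1)) (J (nat (hi - lo))) a"
    unfolding For_def by (rule wp_sequ) (use w in simp)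
  then show ?thesis
  proof (rule wp_mono)
    show "1 + (nat (hi - lo) * (csize c + 2) + 1) \<le> t" using assms(8) by simp
    show "Q b" if "J (nat (hi - lo)) b" for b
      using that assms(3) by (intro assms(7)) (simp add: J_def)
  qed
qed

section \<open>Alternating between two chains\<close>

definition edges :: "'a list \<Rightarrow> ('a \<times> 'a) set" where
  "edges xs = set (zip xs (tl xs))"

lemma edges_simps [simp]: "edges [] = {}" "edges [x] = {}" "edges (x # y # xs) = insert (x, y) (edges (y # xs))"
  by (auto simp: edges_def)

lemma edges_Cons: "edges (x # xs) = (if xs = [] then {} else insert (x, hd xs) (edges xs))"
  by (cases xs) auto

lemma edges_nth: "Suc i < length xs \<Longrightarrow> (xs ! i, xs ! Suc i) \<in> edges xs"
  unfolding edges_def by (auto simp: in_set_zip nth_tl intro!: exI[of _ i])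

lemma edges_append_subset: "edges ys \<subseteq> edges (xs @ ys @ zs)"
proof
  fix e assume "e \<in> edges ys"
  then obtain i where "i < length ys - 1" "fst e = ys ! i" "snd e = ys ! Suc i"
    unfolding edges_def by (auto simp: in_set_zip nth_tl)
  then have i: "Suc i < length ys" "e = (ys ! i, ys ! Suc i)" by (simp_all add: prod_eq_iff)
  then show "e \<in> edges (xs @ ys @ zs)"
    using edges_nth[of "length xs + i" "xs @ ys @ zs"] by (simp add: nth_append)
qed

text \<open>The right end of a body is to match the left end of the next body on the other chain.
  Listing the ends of both chains in order, with the very first left end of the path dropped, turns
  this into entrywise agreement; the one entry left over is the end of the path.\<close>

definition step1 :: "'a list \<Rightarrow> 'a list \<Rightarrow> bool" where
  "step1 p q \<longleftrightarrow> (\<exists>z. p = q @ [z] \<or> q = p @ [z])"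

lemma step1_Cons: "step1 (a # p) (b # q) \<longleftrightarrow> a = b \<and> step1 p q"
  by (auto simp: step1_def)

lemma step1_Nil: "step1 (a # p) [] \<longleftrightarrow> p = []"
  by (auto simp: step1_def)

lemma step1_sym: "step1 p q \<longleftrightarrow> step1 q p"
  by (auto simp: step1_def)

text \<open>Vertices are pairs of a chain and a position. \<open>w\<close> marks the majors, \<open>en\<close> the right ends of bodies,
  \<open>gp\<close> the majors joined to the next major through the spine given by \<open>mu\<close>.\<close>

context
  fixes w en gp :: "bool \<Rightarrow> int \<Rightarrow> bool" and mu :: "bool \<Rightarrow> int \<Rightarrow> int"
begin

text \<open>\<open>xs\<close> and \<open>ys\<close> are the unvisited body positions of the current
  and of the other chain. Passing the right end of a body exchanges the two lists, so they need not
  be split into bodies beforehand.\<close>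

function emit :: "bool \<Rightarrow> int list \<Rightarrow> int list \<Rightarrow> (bool \<times> int) list" where
  "emit s [] ys = []"
| "emit s (x # xs) ys = (s, x) # (if en s x then emit (\<not> s) ys xs
     else (if gp s x then [(s, mu s x)] else []) @ emit s xs ys)"
  by pat_completeness auto
termination by (relation "Wellfounded.measure (\<lambda>(s, xs, ys). length xs + length ys)") auto

text \<open>The ends of all bodies in order, two per body, with \<open>True\<close> for a minor; a
  body of one element contributes the same entry twice. With \<open>f\<close> false, the left end of
  the first body is omitted, as the path is already inside it.\<close>

fun slots :: "bool \<Rightarrow> bool \<Rightarrow> int list \<Rightarrow> bool list" where
  "slots s f [] = []"
| "slots s f (x # xs) = (if f then [\<not> w s x] else []) @ (if en s x then [\<not> w s x] else []) @ slots s (en s x) xs"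

fun linked :: "bool \<Rightarrow> int list \<Rightarrow> bool" where
  "linked s [] = True"
| "linked s [x] = en s x"
| "linked s (x # y # zs) = (x < y \<and> (en s x \<or> y = x + 1 \<and> (w s x \<or> w s y) \<and> (gp s x \<longleftrightarrow> w s x \<and> w s y)) \<and>
     linked s (y # zs))"

fun outs :: "bool \<Rightarrow> int list \<Rightarrow> (bool \<times> int) list" where
  "outs s [] = []"
| "outs s (x # xs) = (s, x) # (if \<not> en s x \<and> gp s x then [(s, mu s x)] else []) @ outs s xs"

text \<open>A superset of the edges within a chain that does not mention the order of the walk, so
  that their crossings can be excluded without following \<open>emit\<close>.\<close>

definition arcs :: "bool \<Rightarrow> ((bool \<times> int) \<times> (bool \<times> int)) set" where
  "arcs s = {((s, x), (s, x + 1)) | x. w s x \<noteq> w s (x + 1)} \<union>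
     {((s, x), (s, mu s x)) | x. \<not> en s x \<and> gp s x} \<union> {((s, mu s x), (s, x + 1)) | x. \<not> en s x \<and> gp s x}"

text \<open>Edges between the chains, always written with the chain \<open>True\<close> first
  regardless of the direction of travel: only their monotonicity in both coordinates
  matters.\<close>

function bridges :: "bool \<Rightarrow> int list \<Rightarrow> int list \<Rightarrow> (int \<times> int) list" where
  "bridges s [] ys = []"
| "bridges s (x # xs) ys = (if en s x
     then (if ys = [] then [] else [if s then (x, hd ys) else (hd ys, x)]) @ bridges (\<not> s) ys xs
     else bridges s xs ys)"
  by pat_completeness auto
termination by (relation "Wellfounded.measure (\<lambda>(s, xs, ys). length xs + length ys)") auto

text \<open>The endpoints are both majors or both minors. As the major color of one chain is the
  minor color of the other, this means that their colors differ.\<close>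

definition crosses :: "(int \<times> int) set \<Rightarrow> ((bool \<times> int) \<times> (bool \<times> int)) set" where
  "crosses R = {((True, a), (False, b)) | a b. (a, b) \<in> R \<and> w True a = w False b} \<union>
     {((False, b), (True, a)) | a b. (a, b) \<in> R \<and> w True a = w False b}"

lemma linked_Cons: "linked s (x # xs) \<Longrightarrow> linked s xs"
  by (cases xs) auto

lemma linked_less: "linked s (x # xs) \<Longrightarrow> y \<in> set xs \<Longrightarrow> x < y"
proof (induction xs arbitrary: x)
  case (Cons a xs)
  then have "x < a" "linked s (a # xs)" by auto
  then show ?case using Cons.IH[of a] Cons.prems by fastforce
qed simp

lemma hd_emit: "xs \<noteq> [] \<Longrightarrow> hd (emit s xs ys) = (s, hd xs) \<and> emit s xs ys \<noteq> []"
  by (cases xs) auto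

text \<open>The common induction step for the walk: passing a right end consumes one entry of either
  list of ends, and what remains is the same situation with the chains exchanged.\<close>

lemma emit_step:
  assumes "linked s (x # xs)" "linked (\<not> s) ys" "step1 (slots s False (x # xs)) (slots (\<not> s) True ys)"
  shows "\<not> en s x \<Longrightarrow> xs \<noteq> [] \<and> step1 (slots s False xs) (slots (\<not> s) True ys)"
    and "en s x \<Longrightarrow> ys = [] \<Longrightarrow> xs = []"
    and "en s x \<Longrightarrow> ys \<noteq> [] \<Longrightarrow> w s x = w (\<not> s) (hd ys) \<and> step1 (slots (\<not> s) False ys) (slots s True xs)"
proof -
  show "\<not> en s x \<Longrightarrow> xs \<noteq> [] \<and> step1 (slots s False xs) (slots (\<not> s) True ys)"
    using assms by (cases xs) auto
  show "en s x \<Longrightarrow> ys = [] \<Longrightarrow> xs = []"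
    using assms(3) by (cases xs) (auto simp: step1_Nil)
  show "en s x \<Longrightarrow> ys \<noteq> [] \<Longrightarrow> w s x = w (\<not> s) (hd ys) \<and> step1 (slots (\<not> s) False ys) (slots s True xs)"
    using assms(3) by (cases ys) (auto simp: step1_Cons step1_sym)
qed

text \<open>Stated with multisets, so that completeness of the walk and absence of repetitions
  follow from one equation.\<close>

lemma mset_emit:
  assumes "linked s xs" "linked (\<not> s) ys" "xs \<noteq> []" "step1 (slots s False xs) (slots (\<not> s) True ys)"
  shows "mset (emit s xs ys) = mset (outs s xs) + mset (outs (\<not> s) ys)"
  using assms
proof (induction s xs ys rule: emit.induct)
  case (2 s x xs ys)
  note st = emit_step[OF 2(3,4,6)]
  show ?case
  proof (cases "en s x")
    case True
    show ?thesis
    proof (cases "ys = []")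
      case True
      then show ?thesis using st(2) \<open>en s x\<close> by simp
    next
      case False
      then have "mset (emit (\<not> s) ys xs) = mset (outs (\<not> s) ys) + mset (outs s xs)"
        using 2(1)[OF True] 2(4) linked_Cons[OF 2(3)] st(3)[OF True False] by simp
      then show ?thesis using True by simp
    qed
  next
    case False
    then have "mset (emit s xs ys) = mset (outs s xs) + mset (outs (\<not> s) ys)"
      using 2(2)[OF False] 2(4) linked_Cons[OF 2(3)] st(1)[OF False] by simp
    then show ?thesis using False by simp
  qed
qed simp

lemma edges_emit:
  assumes "linked s xs" "linked (\<not> s) ys" "xs \<noteq> []" "step1 (slots s False xs) (slots (\<not> s) True ys)"
  shows "edges (emit s xs ys) \<subseteq> arcs True \<union> arcs False \<union> crosses (set (bridges s xs ys))"
  using assms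
proof (induction s xs ys rule: emit.induct)
  case (2 s x xs ys)
  note st = emit_step[OF 2(3,4,6)]
  show ?case
  proof (cases "en s x")
    case True
    show ?thesis
    proof (cases "ys = []")
      case True
      then show ?thesis using st(2) \<open>en s x\<close> by simp
    next
      case False
      then have IH: "edges (emit (\<not> s) ys xs) \<subseteq> arcs True \<union> arcs False \<union> crosses (set (bridges (\<not> s) ys xs))"
        using 2(1)[OF True] 2(4) linked_Cons[OF 2(3)] st(3)[OF True False] by simp
      have "((s, x), (\<not> s, hd ys)) \<in> crosses {if s then (x, hd ys) else (hd ys, x)}"
        using st(3)[OF True False] by (cases s) (auto simp: crosses_def)
      then show ?thesis using True False IH hd_emit[OF False, of "\<not> s" xs]
        by (auto simp: edges_Cons crosses_def)
    qed
  next
    case False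
    have ne: "xs \<noteq> []" using st(1)[OF False] by simp
    have IH: "edges (emit s xs ys) \<subseteq> arcs True \<union> arcs False \<union> crosses (set (bridges s xs ys))"
      using 2(2)[OF False] 2(4) linked_Cons[OF 2(3)] st(1)[OF False] by simp
    have y: "hd xs = x + 1" "w s x \<or> w s (x + 1)" "gp s x \<longleftrightarrow> w s x \<and> w s (x + 1)"
      using 2(3) False ne by (cases xs; auto)+
    have arcs: "arcs s \<subseteq> arcs True \<union> arcs False" by (cases s) auto
    show ?thesis
    proof (cases "gp s x")
      case True
      have "((s, x), (s, mu s x)) \<in> arcs s" "((s, mu s x), (s, x + 1)) \<in> arcs s"
        using True False by (auto simp: arcs_def)
      then show ?thesis using True False IH hd_emit[OF ne, of s ys] y arcs
        by (auto simp: edges_Cons)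
    next
      case gp: False
      have "((s, x), (s, x + 1)) \<in> arcs s"
        using y gp by (auto simp: arcs_def)
      then show ?thesis using gp False IH hd_emit[OF ne, of s ys] y arcs
        by (auto simp: edges_Cons)
    qed
  qed
qed simp

lemma set_bridges:
  "set (bridges s xs ys) \<subseteq> (if s then set xs \<times> set ys else set ys \<times> set xs)"
proof (induction s xs ys rule: bridges.induct)
  case (2 s x xs ys)
  show ?case
  proof (cases "en s x")
    case True
    show ?thesis using 2(1)[OF True] True hd_in_set[of ys] by (cases s; cases "ys = []") fastforce+
  next
    case False
    show ?thesis using 2(2)[OF False] False by (cases s) auto
  qed
qed simp

lemma sorted_bridges:
  assumes "linked s xs" "linked (\<not> s) ys"
  shows "sorted_wrt (\<lambda>(a, b) (c, d). a \<le> c \<and> b \<le> d) (bridges s xs ys)"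
  using assms
proof (induction s xs ys rule: bridges.induct)
  case (2 s x xs ys)
  show ?case
  proof (cases "en s x")
    case True
    have IH: "sorted_wrt (\<lambda>(a, b) (c, d). a \<le> c \<and> b \<le> d) (bridges (\<not> s) ys xs)"
      using 2(1)[OF True] 2(3,4) linked_Cons by simp
    have y: "hd ys \<le> y" if "y \<in> set ys" for y
      using linked_less[of "\<not> s" "hd ys" "tl ys" y] 2(4) that by (cases ys) auto
    have x: "x \<le> y" if "y \<in> set xs" for y
      using linked_less[OF 2(3) that] by simp
    show ?thesis using True IH set_bridges[of "\<not> s" ys xs] x y
      by (cases s) (fastforce simp: sorted_wrt_append)+
  next
    case False
    then show ?thesis using 2(2)[OF False] 2(3,4) linked_Cons by simp
  qed
qed simp

text \<open>The entry without partner belongs to the chain on which the walk stops. This is needed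
  later to see that a major added at a right border is really the last vertex.\<close>

lemma last_emit_aux:
  assumes "linked s xs" "linked (\<not> s) ys" "xs \<noteq> []"
  shows "(slots s False xs = slots (\<not> s) True ys @ [z] \<longrightarrow> last (emit s xs ys) = (s, last xs)) \<and>
    (slots s False xs @ [z] = slots (\<not> s) True ys \<longrightarrow> last (emit s xs ys) = (\<not> s, last ys))"
  using assms
proof (induction s xs ys rule: emit.induct)
  case (2 s x xs ys)
  have l: "linked s xs" using 2(3) by (rule linked_Cons)
  show ?case
  proof (cases "en s x")
    case True
    show ?thesis
    proof (cases ys)
      case Nil
      then show ?thesis using True by (cases xs) auto
    next
      case (Cons y zs)
      have IH: "(slots (\<not> s) False ys = slots s True xs @ [z] \<longrightarrow> last (emit (\<not> s) ys xs) = (\<not> s, last ys)) \<and>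
        (slots (\<not> s) False ys @ [z] = slots s True xs \<longrightarrow> last (emit (\<not> s) ys xs) = (s, last xs))"
        using 2(1)[OF True] 2(4) l Cons by simp
      have "last (emit s (x # xs) ys) = last (emit (\<not> s) ys xs)"
        using True Cons hd_emit[of ys "\<not> s" xs] by simp
      moreover have "xs \<noteq> []" if "slots (\<not> s) False ys @ [z] = slots s True xs" using that by auto
      ultimately show ?thesis using IH True Cons by auto
    qed
  next
    case False
    then have ne: "xs \<noteq> []" using 2(3) by auto
    have "last (emit s (x # xs) ys) = last (emit s xs ys)"
      using False ne hd_emit[of xs s ys] by simp
    then show ?thesis using 2(2)[OF False] 2(4) l ne False by simp
  qed
qed simp

lemmas last_emit = last_emit_aux[THEN conjunct1, rule_format] last_emit_aux[THEN conjunct2, rule_format]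

end

section \<open>Counting positions in an interval\<close>

definition cnt :: "int \<Rightarrow> int \<Rightarrow> (int \<Rightarrow> bool) \<Rightarrow> int" where
  "cnt lo hi P = (\<Sum>i\<in>{lo..<hi}. of_bool (P i))"

lemma sum_shift_int:
  fixes f :: "int \<Rightarrow> int"
  assumes "lo \<le> hi"
  shows "(\<Sum>i\<in>{lo..<hi}. f (i + 1)) = (\<Sum>i\<in>{lo..<hi}. f i) - f lo + f hi"
proof -
  have s: "(\<Sum>i\<in>{lo..<hi}. f (i + 1)) = (\<Sum>i\<in>{lo+1..<hi+1}. f i)"
    by (rule sum.reindex_bij_witness[of _ "\<lambda>i. i - 1" "\<lambda>i. i + 1"]) auto
  have "(\<Sum>i\<in>{lo..hi}. f i) = f lo + (\<Sum>i\<in>{lo+1..<hi+1}. f i)"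
  proof -
    have "{lo..hi} = insert lo {lo+1..<hi+1}" using assms by auto
    then show ?thesis by simp
  qed
  moreover have "(\<Sum>i\<in>{lo..hi}. f i) = f hi + (\<Sum>i\<in>{lo..<hi}. f i)"
  proof -
    have "{lo..hi} = insert hi {lo..<hi}" using assms by auto
    then show ?thesis by simp
  qed
  ultimately show ?thesis using s by simp
qed

lemma cnt_Suc: "lo \<le> i \<Longrightarrow> cnt lo (i + 1) P = cnt lo i P + of_bool (P i)"
proof -
  assume "lo \<le> i"
  then have "{lo..<i+1} = insert i {lo..<i}" by auto
  then show ?thesis by (simp add: cnt_def)
qed

lemma cnt_empty [simp]: "cnt lo lo P = 0"
  by (simp add: cnt_def)

lemma cnt_nonneg: "0 \<le> cnt lo hi P"
  unfolding cnt_def by (rule sum_nonneg) auto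

lemma cnt_mono: "i \<le> j \<Longrightarrow> cnt lo i P \<le> cnt lo j P"
  unfolding cnt_def by (rule sum_mono2) auto

lemma cnt_zero: "cnt lo hi P = 0 \<Longrightarrow> lo \<le> i \<Longrightarrow> i < hi \<Longrightarrow> \<not> P i"
  unfolding cnt_def by (subst (asm) sum_nonneg_eq_0_iff) auto

lemma cnt_pos: "P i \<Longrightarrow> lo \<le> i \<Longrightarrow> i < hi \<Longrightarrow> 1 \<le> cnt lo hi P"
  using cnt_zero[of lo hi P i] cnt_nonneg[of lo hi P] by linarith

lemma cnt_pos_ex: "1 \<le> cnt lo hi P \<Longrightarrow> \<exists>i. lo \<le> i \<and> i < hi \<and> P i"
proof (rule ccontr)
  assume "1 \<le> cnt lo hi P" and n: "\<nexists>i. lo \<le> i \<and> i < hi \<and> P i"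
  have "cnt lo hi P = 0" unfolding cnt_def by (rule sum.neutral) (use n in auto)
  then show False using \<open>1 \<le> cnt lo hi P\<close> by simp
qed

lemma cnt_cong: "(\<And>i. lo \<le> i \<Longrightarrow> i < hi \<Longrightarrow> P i = Q i) \<Longrightarrow> cnt lo hi P = cnt lo hi Q"
  unfolding cnt_def by (rule sum.cong) auto

lemma cnt_card: "cnt lo hi P = int (card {i. lo \<le> i \<and> i < hi \<and> P i})"
proof -
  have "{i. lo \<le> i \<and> i < hi \<and> P i} = {lo..<hi} \<inter> {i. P i}" by auto
  then show ?thesis by (simp add: cnt_def sum.If_cases of_bool_def)
qed

text \<open>The predicate counted selects the first \<open>m\<close> positions with
  \<open>P\<close>; all greedy selections and the choice of cuts have this form.\<close>

lemma cnt_first: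
  assumes "0 \<le> m"
  shows "cnt lo hi (\<lambda>i. P i \<and> cnt lo i P < m) = min m (cnt lo hi P)"
proof (cases "lo \<le> hi")
  case True
  then show ?thesis
  proof (induction hi rule: int_ge_induct)
    case (step i)
    then show ?case using cnt_nonneg[of lo i P] by (auto simp: cnt_Suc)
  qed (use assms in simp)
qed (use assms in \<open>simp add: cnt_def\<close>)

section \<open>Words of majors and minors\<close>

definition mino :: "(int \<Rightarrow> bool) \<Rightarrow> int \<Rightarrow> int \<Rightarrow> int \<Rightarrow> bool" where
  "mino w lo hi i \<longleftrightarrow> lo \<le> i \<and> i < hi \<and> \<not> w i"
text \<open>A tail can be attached to the run of majors on its left, a head to the run on its right.
  Positions outside the chain are not major, so a border minor next to a major is a tail or a head
  and never belongs to \<open>ones\<close>.\<close>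

definition tails :: "(int \<Rightarrow> bool) \<Rightarrow> int \<Rightarrow> int \<Rightarrow> int \<Rightarrow> bool" where
  "tails w lo hi i \<longleftrightarrow> mino w lo hi i \<and> w (i - 1) \<and> \<not> w (i + 1)"
definition heads :: "(int \<Rightarrow> bool) \<Rightarrow> int \<Rightarrow> int \<Rightarrow> int \<Rightarrow> bool" where
  "heads w lo hi i \<longleftrightarrow> mino w lo hi i \<and> \<not> w (i - 1) \<and> w (i + 1)"
definition mids :: "(int \<Rightarrow> bool) \<Rightarrow> int \<Rightarrow> int \<Rightarrow> int \<Rightarrow> bool" where
  "mids w lo hi i \<longleftrightarrow> mino w lo hi i \<and> \<not> w (i - 1) \<and> \<not> w (i + 1)"
definition ones :: "(int \<Rightarrow> bool) \<Rightarrow> int \<Rightarrow> int \<Rightarrow> int \<Rightarrow> bool" where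
  "ones w lo hi i \<longleftrightarrow> mino w lo hi i \<and> w (i - 1) \<and> w (i + 1)"
definition pairs :: "(int \<Rightarrow> bool) \<Rightarrow> int \<Rightarrow> bool" where
  "pairs w i \<longleftrightarrow> w i \<and> w (i + 1)"

lemmas classes = mino_def tails_def heads_def mids_def ones_def pairs_def

text \<open>The number of minor blocks of length at least two between majors (if there is a major).\<close>

definition wide :: "(int \<Rightarrow> bool) \<Rightarrow> int \<Rightarrow> int \<Rightarrow> int" where
  "wide w lo hi = cnt lo hi w - cnt lo hi (pairs w) - cnt lo hi (ones w lo hi) - 1"

definition excess :: "(int \<Rightarrow> bool) \<Rightarrow> int \<Rightarrow> int \<Rightarrow> int" where
  "excess w lo hi = cnt lo hi w - cnt lo hi (mino w lo hi)"

locale chain =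
  fixes w :: "int \<Rightarrow> bool" and lo hi :: int
  assumes range: "w i \<Longrightarrow> lo \<le> i \<and> i < hi" and ne: "lo < hi"
begin

abbreviation "ct \<equiv> cnt lo hi"
abbreviation "mi \<equiv> mino w lo hi"
abbreviation "ta \<equiv> tails w lo hi"
abbreviation "he \<equiv> heads w lo hi"
abbreviation "md \<equiv> mids w lo hi"
abbreviation "on \<equiv> ones w lo hi"
abbreviation "pr \<equiv> pairs w"

lemma count_minors: "ct mi = ct ta + ct he + ct md + ct on"
  unfolding cnt_def sum.distrib[symmetric] by (rule sum.cong) (auto simp: classes)

lemma count_length: "hi - lo = ct w + ct mi"
proof -
  have "ct w + ct mi = (\<Sum>i\<in>{lo..<hi}. 1)"
    unfolding cnt_def sum.distrib[symmetric] by (rule sum.cong) (auto simp: classes)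
  then show ?thesis using ne by simp
qed

text \<open>The right side is the number of runs of majors that do not reach the right border. Each
  of them is followed by exactly one minor, which is a tail or a single minor between
  majors.\<close>

lemma count_tails: "ct ta + ct on = ct w - ct pr - of_bool (w (hi - 1))"
proof -
  have "ct w - ct pr = (\<Sum>i\<in>{lo..<hi}. of_bool (w (i + 1 - 1) \<and> \<not> w (i + 1)))"
    unfolding cnt_def sum_subtractf[symmetric] by (rule sum.cong) (auto simp: classes)
  also have "\<dots> = (\<Sum>i\<in>{lo..<hi}. of_bool (w (i - 1) \<and> \<not> w i)) + of_bool (w (hi - 1))"
    using range[of "lo - 1"] range[of hi] ne
    by (subst sum_shift_int[where f = "\<lambda>i. of_bool (w (i - 1) \<and> \<not> w i)"]) auto
  also have "(\<Sum>i\<in>{lo..<hi}. of_bool (w (i - 1) \<and> \<not> w i)) = ct ta + ct on"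
    unfolding cnt_def sum.distrib[symmetric] by (rule sum.cong) (auto simp: classes)
  finally show ?thesis by simp
qed

lemma count_heads: "ct he + ct on = ct w - ct pr - of_bool (w lo)"
proof -
  have pr: "ct pr = (\<Sum>i\<in>{lo..<hi}. of_bool (w (i - 1) \<and> w i))"
    using sum_shift_int[of lo hi "\<lambda>i. of_bool (w (i - 1) \<and> w i)"] range[of "lo - 1"] range[of hi] ne
    by (auto simp: cnt_def pairs_def)
  have "ct he + ct on = (\<Sum>i\<in>{lo..<hi}. of_bool (w (i + 1) \<and> \<not> w (i + 1 - 1)))"
    unfolding cnt_def sum.distrib[symmetric] by (rule sum.cong) (auto simp: classes)
  also have "\<dots> = (\<Sum>i\<in>{lo..<hi}. of_bool (w i \<and> \<not> w (i - 1))) - of_bool (w lo)"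
    using range[of "lo - 1"] range[of hi] ne
    by (subst sum_shift_int[where f = "\<lambda>i. of_bool (w i \<and> \<not> w (i - 1))"]) auto
  also have "(\<Sum>i\<in>{lo..<hi}. of_bool (w i \<and> \<not> w (i - 1))) = ct w - ct pr"
    unfolding pr unfolding cnt_def sum_subtractf[symmetric] by (rule sum.cong) (auto simp: classes)
  finally show ?thesis .
qed

lemma tail_or_mid: "\<not> w (hi - 1) \<Longrightarrow> 1 \<le> ct ta + ct md"
proof -
  assume n: "\<not> w (hi - 1)"
  have "ta (hi - 1) \<or> md (hi - 1)" using n range[of hi] ne by (auto simp: classes)
  then show ?thesis
    using cnt_pos[of ta "hi - 1" lo hi] cnt_pos[of md "hi - 1" lo hi] cnt_nonneg[of lo hi ta]
      cnt_nonneg[of lo hi md] ne by auto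
qed

text \<open>The first major to the right of a minor without major neighbours is preceded by at least
  two minors, the second of which is a head.\<close>

lemma head_before:
  assumes "w j" "i < j" "\<not> w i" "\<not> w (i - 1)" "\<not> w (i + 1)" "lo \<le> i"
  shows "\<exists>k. he k"
proof -
  have "\<exists>k. i < k \<and> w k \<and> (\<forall>l. i < l \<and> l < k \<longrightarrow> \<not> w l)"
  proof -
    define n where "n = (LEAST n. w (i + 1 + int n))"
    have ex: "w (i + 1 + int (nat (j - i - 1)))" using assms(1,2) by simp
    have "w (i + 1 + int n)" unfolding n_def by (rule LeastI[of "\<lambda>n. w (i + 1 + int n)", OF ex])
    moreover have "\<not> w l" if "i < l" "l < i + 1 + int n" for l
    proof
      assume "w l"
      then have "w (i + 1 + int (nat (l - i - 1)))" using that by simp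
      then have "n \<le> nat (l - i - 1)" unfolding n_def by (rule Least_le)
      then show False using that by linarith
    qed
    ultimately show ?thesis by (intro exI[of _ "i + 1 + int n"]) auto
  qed
  then obtain k where k: "i < k" "w k" "\<And>l. i < l \<Longrightarrow> l < k \<Longrightarrow> \<not> w l" by blast
  have "k \<noteq> i + 1" using k(2) assms(5) by auto
  then have "i < k - 1" using k(1) by simp
  then have "\<not> w (k - 1)" using k(3) by simp
  moreover have "\<not> w (k - 2)" using k(3)[of "k - 2"] \<open>i < k - 1\<close> assms(3) by (cases "i = k - 2") auto
  ultimately have "he (k - 1)" using k(1,2) range[of k] assms(6) by (auto simp: classes)
  then show ?thesis by blast
qed

lemma tail_after:
  assumes "w j" "j < i" "\<not> w i" "\<not> w (i - 1)" "\<not> w (i + 1)" "i < hi"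
  shows "\<exists>k. ta k"
proof -
  \<comment> \<open>Reflection turns tails into heads; the half-open interval from \<open>lo\<close>
    to \<open>hi\<close> becomes the one from \<open>1 - hi\<close> to
    \<open>1 - lo\<close>.\<close>
  interpret r: chain "\<lambda>k. w (- k)" "1 - hi" "1 - lo"
    using range ne by unfold_locales force+
  obtain k where "heads (\<lambda>k. w (- k)) (1 - hi) (1 - lo) k"
    using r.head_before[of "- j" "- i"] assms by (auto simp: algebra_simps)
  moreover have "- 1 - k = - k - 1" by simp
  ultimately have "ta (- k)" by (auto simp: classes algebra_simps simp del: diff_minus_eq_add)
  then show ?thesis by blast
qed

text \<open>Needed for a parity problem of the greedy choice: middle minors can only take two ends
  at a time, and an odd end left over must find a place on a tail or a head.\<close>

lemma mid_needs_end:
  assumes "1 \<le> ct w" "1 \<le> ct md"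
  shows "1 \<le> ct ta + ct he"
proof -
  obtain i where i: "lo \<le> i" "i < hi" "md i" using cnt_pos_ex[OF assms(2)] by blast
  obtain j where j: "w j" using cnt_pos_ex[OF assms(1)] by blast
  have "i \<noteq> j" using i j by (auto simp: classes)
  then have "(\<exists>k. he k) \<or> (\<exists>k. ta k)"
    using head_before[of j i] tail_after[of j i] i j by (auto simp: mids_def mino_def neq_iff)
  then show ?thesis
  proof (elim disjE exE)
    fix k assume "he k"
    then have "1 \<le> ct he" by (intro cnt_pos[of _ k]) (auto simp: classes)
    then show ?thesis using cnt_nonneg[of lo hi ta] by linarith
  next
    fix k assume "ta k"
    then have "1 \<le> ct ta" by (intro cnt_pos[of _ k]) (auto simp: classes)
    then show ?thesis using cnt_nonneg[of lo hi he] by linarith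
  qed
qed

text \<open>Each wide block has a tail and a head of its own. As minors form at most half of a chain
  of nonnegative excess, its width is at most a quarter of its length.\<close>

lemma wide_bound: "2 * wide w lo hi \<le> ct mi"
  using count_tails count_heads count_minors cnt_nonneg[of lo hi md] cnt_nonneg[of lo hi on]
  unfolding wide_def by (cases "w lo"; cases "w (hi - 1)") auto

text \<open>If a border is a major, the width equals the number of tails or of heads. Otherwise both
  numbers are the width plus one, and they are positive because the last minor is a tail or a middle
  minor.\<close>

lemma wide_nonneg: "1 \<le> ct w \<Longrightarrow> 0 \<le> wide w lo hi"
  using count_tails count_heads tail_or_mid mid_needs_end cnt_nonneg[of lo hi ta] cnt_nonneg[of lo hi he]
  unfolding wide_def by (cases "w lo"; cases "w (hi - 1)"; cases "1 \<le> ct md") auto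

text \<open>A major added at the border may turn a leading block of minors into a block between
  majors, but never merges or shortens a block that is already there.\<close>

lemma wide_left: "wide w lo hi \<le> wide (w(lo - 1 := True)) (lo - 1) hi"
proof -
  let ?w = "w(lo - 1 := True)"
  have set: "{lo - 1..<hi} = insert (lo - 1) {lo..<hi}" using ne by auto
  have l: "\<not> w (lo - 1)" using range[of "lo - 1"] by auto
  define v where "v = ?w"
  have v: "v (lo - 1)" "\<And>i. i \<noteq> lo - 1 \<Longrightarrow> v i = w i" by (auto simp: v_def)
  have "(\<Sum>i\<in>{lo..<hi}. of_bool (v i)) = (\<Sum>i\<in>{lo..<hi}. of_bool (w i) :: int)"
    "(\<Sum>i\<in>{lo..<hi}. of_bool (v i \<and> v (i + 1))) = (\<Sum>i\<in>{lo..<hi}. of_bool (w i \<and> w (i + 1)) :: int)"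
    by (rule sum.cong; use v(2) in force)+
  then have q: "cnt (lo - 1) hi ?w = ct w + 1" and p: "cnt (lo - 1) hi (pairs ?w) = ct pr + of_bool (w lo)"
    unfolding cnt_def set pairs_def v_def[symmetric] using v by (simp_all del: sum_of_bool_eq)
  have o: "cnt (lo - 1) hi (ones ?w (lo - 1) hi) = ct on + of_bool (\<not> w lo \<and> w (lo + 1))"
  proof -
    have "{lo..<hi} = insert lo {lo+1..<hi}" using ne by auto
    moreover have "(\<Sum>i\<in>{lo+1..<hi}. of_bool (ones ?w (lo - 1) hi i)) = (\<Sum>i\<in>{lo+1..<hi}. of_bool (on i) :: int)"
      by (rule sum.cong) (auto simp: classes)
    moreover have "\<not> on lo" using l by (auto simp: classes)
    moreover have "\<not> ones ?w (lo - 1) hi (lo - 1)" by (auto simp: classes)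
    moreover have "ones ?w (lo - 1) hi lo \<longleftrightarrow> \<not> w lo \<and> w (lo + 1)" using ne by (auto simp: classes)
    ultimately show ?thesis unfolding cnt_def set by simp
  qed
  show ?thesis unfolding wide_def q p o by auto
qed

lemma wide_right: "wide w lo hi \<le> wide (w(hi := True)) lo (hi + 1)"
proof -
  let ?w = "w(hi := True)"
  have set: "{lo..<hi+1} = insert hi {lo..<hi}" using ne by auto
  have set2: "{lo..<hi} = insert (hi - 1) {lo..<hi - 1}" using ne by auto
  have l: "\<not> w hi" "\<not> w (hi + 1)" using range[of hi] range[of "hi + 1"] by auto
  define v where "v = ?w"
  have v: "v hi" "\<And>i. i \<noteq> hi \<Longrightarrow> v i = w i" by (auto simp: v_def)
  have "(\<Sum>i\<in>{lo..<hi}. of_bool (v i)) = (\<Sum>i\<in>{lo..<hi}. of_bool (w i) :: int)"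
    by (rule sum.cong; use v(2) in force)
  then have q: "cnt lo (hi + 1) ?w = ct w + 1"
    unfolding cnt_def set v_def[symmetric] using v by (simp del: sum_of_bool_eq)
  have p: "cnt lo (hi + 1) (pairs ?w) = ct pr + of_bool (w (hi - 1))"
  proof -
    have "(\<Sum>i\<in>{lo..<hi - 1}. of_bool (pairs ?w i)) = (\<Sum>i\<in>{lo..<hi - 1}. of_bool (pr i) :: int)"
      by (rule sum.cong) (auto simp: classes)
    moreover have "pairs ?w (hi - 1) \<longleftrightarrow> w (hi - 1)" "\<not> pairs ?w hi" "\<not> pr (hi - 1)"
      using l by (auto simp: pairs_def)
    ultimately show ?thesis unfolding cnt_def set
      by (subst (1 2) set2) (simp del: sum_of_bool_eq fun_upd_apply)
  qed
  have o: "cnt lo (hi + 1) (ones ?w lo (hi + 1)) = ct on + of_bool (\<not> w (hi - 1) \<and> w (hi - 2))"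
  proof -
    have "(\<Sum>i\<in>{lo..<hi - 1}. of_bool (ones ?w lo (hi + 1) i)) = (\<Sum>i\<in>{lo..<hi - 1}. of_bool (on i) :: int)"
      by (rule sum.cong) (auto simp: classes)
    moreover have "\<not> on (hi - 1)" using l by (auto simp: classes)
    moreover have "\<not> ones ?w lo (hi + 1) hi" by (auto simp: classes)
    moreover have "ones ?w lo (hi + 1) (hi - 1) \<longleftrightarrow> \<not> w (hi - 1) \<and> w (hi - 2)" using ne by (auto simp: classes)
    ultimately show ?thesis unfolding cnt_def set by (subst (1 2) set2) simp
  qed
  show ?thesis unfolding wide_def q p o by auto
qed

end

section \<open>Decomposition of a chain into bodies\<close>

text \<open>A status \<open>s i\<close> tells how many ends of bodies the minor \<open>i\<close> forms (a body consisting of \<open>i\<close> alone has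
  two). By \<open>x i\<close>, bodies are separated between the majors \<open>i\<close> and \<open>i + 1\<close>, or at the minor \<open>i\<close> between
  two majors.\<close>

definition body where
  "body w lo hi s x i \<longleftrightarrow> lo \<le> i \<and> i < hi \<and> (w i \<or> (s i :: int) > 0 \<or> (ones w lo hi i \<and> \<not> x i))"
text \<open>The sum in the last clause separates two kinds of minors before a major: a head is
  joined to it with status 1, a single minor between majors only with status 0, since with status 1
  it is the right end of the body on its left. Status 2 never joins.\<close>

definition joined where
  "joined w lo hi s x i \<longleftrightarrow> (pairs w i \<and> \<not> x i) \<or>
     (w i \<and> \<not> w (i + 1) \<and> body w lo hi s x (i + 1) \<and> s (i + 1) \<le> 1) \<or>
     (\<not> w i \<and> w (i + 1) \<and> body w lo hi s x i \<and> s i + of_bool (w (i - 1)) = 1)"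
definition ends where
  "ends w lo hi s x i \<longleftrightarrow> body w lo hi s x i \<and> \<not> joined w lo hi s x i"
definition gaps where
  "gaps w x i \<longleftrightarrow> pairs w i \<and> \<not> x i"
definition spines where
  "spines w lo hi s x i \<longleftrightarrow> mino w lo hi i \<and> \<not> body w lo hi s x i"

text \<open>A middle minor has no adjacent major, so it is a body of its own or no body element at
  all; this excludes status 1. A single minor that is cut becomes a spine, so it must not form any
  ends.\<close>

locale labelled = chain +
  fixes s :: "int \<Rightarrow> int" and x :: "int \<Rightarrow> bool"
  assumes s_major: "\<not> mino w lo hi i \<Longrightarrow> s i = 0"
    and s_range: "s i \<in> {0, 1, 2}"
    and s_mid: "mids w lo hi i \<Longrightarrow> s i \<noteq> 1"
    and x_place: "x i \<Longrightarrow> pairs w i \<or> (ones w lo hi i \<and> s i = 0)"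
begin

abbreviation "bo \<equiv> body w lo hi s x"
abbreviation "jo \<equiv> joined w lo hi s x"
abbreviation "en \<equiv> ends w lo hi s x"
abbreviation "gp \<equiv> gaps w x"
abbreviation "sp \<equiv> spines w lo hi s x"

lemma joined_body: "jo i \<Longrightarrow> bo i \<and> bo (i + 1)"
  using range[of i] range[of "i + 1"] by (auto simp: joined_def body_def pairs_def)

text \<open>Runs of majors are the bodies to begin with. A minor of status 2 adds a body, a single
  minor of status 0 merges two runs, and a cut undoes such a merge or splits a run.\<close>

lemma count_ends:
  "ct en = ct w - ct pr + ct (\<lambda>i. s i = 2) - ct (\<lambda>i. on i \<and> s i = 0) + ct x"
proof -
  \<comment> \<open>\<open>J\<close> and \<open>K\<close> say that a minor is joined to the major on
    its left and on its right, respectively. The join on the left is counted by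
    \<open>joined\<close> at the major; shifting the index moves it to the minor, and the identity
    can then be checked position by position.\<close>
  define J where "J i \<longleftrightarrow> w (i - 1) \<and> \<not> w i \<and> bo i \<and> s i \<le> 1" for i
  define K where "K i \<longleftrightarrow> \<not> w i \<and> w (i + 1) \<and> bo i \<and> s i + of_bool (w (i - 1)) = 1" for i
  have "(\<Sum>i\<in>{lo..<hi}. of_bool (J (i + 1)) :: int) = ct J"
    unfolding cnt_def using ne range[of "lo - 1"]
    by (subst sum_shift_int[where f = "\<lambda>i. of_bool (J i)"]) (auto simp: J_def body_def)
  moreover have "of_bool (en i) = (of_bool (bo i) - of_bool (gp i) - of_bool (J (i + 1)) - of_bool (K i) :: int)" for i
  proof -
    have "bo i" if "w i" using that range[of i] by (simp add: body_def)
    then show ?thesis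
      unfolding ends_def joined_def J_def K_def gaps_def pairs_def
      by (cases "w i"; cases "w (i + 1)"; cases "bo i") simp_all
  qed
  ultimately have "ct en = ct bo - ct gp - ct J - ct K"
    unfolding cnt_def by (simp add: sum_subtractf)
  also have "\<dots> = ct w - ct pr + ct (\<lambda>i. s i = 2) - ct (\<lambda>i. on i \<and> s i = 0) + ct x"
    unfolding cnt_def sum_subtractf[symmetric] sum.distrib[symmetric]
  proof (rule sum.cong)
    fix i assume "i \<in> {lo..<hi}"
    then show "of_bool (bo i) - of_bool (gp i) - of_bool (J i) - of_bool (K i) =
      (of_bool (w i) - of_bool (pr i) + of_bool (s i = 2) - of_bool (on i \<and> s i = 0) + of_bool (x i) :: int)"
      using s_major[of i] s_range[of i] s_mid[of i] x_place[of i]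
      by (cases "w i"; cases "w (i - 1)"; cases "w (i + 1)")
        (auto simp: J_def K_def body_def gaps_def classes)
  qed simp
  finally show ?thesis .
qed

lemma sum_s: "(\<Sum>i\<in>{lo..<hi}. s i) = ct (\<lambda>i. s i = 1 \<and> mi i) + 2 * ct (\<lambda>i. s i = 2)"
  unfolding cnt_def sum_distrib_left sum.distrib[symmetric]
proof (rule sum.cong)
  fix i
  show "s i = of_bool (s i = 1 \<and> mi i) + 2 * of_bool (s i = 2)"
    using s_range[of i] s_major[of i] by (cases "mi i") auto
qed simp

text \<open>A body whose gaps are filled alternates, so its majors minus its minors minus its gaps
  equals 1 minus its number of minor ends. Summing over the bodies and comparing with the excess, in
  which the spines take the place of the gaps, gives the claim.\<close>

lemma balanced:
  assumes "ct en - (\<Sum>i\<in>{lo..<hi}. s i) = excess w lo hi"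
  shows "ct gp = ct sp"
proof -
  have 1: "ct gp = ct pr - ct (\<lambda>i. pr i \<and> x i)"
    unfolding cnt_def sum_subtractf[symmetric] by (rule sum.cong) (auto simp: gaps_def)
  have 2: "ct sp = ct (\<lambda>i. mi i \<and> s i = 0) - ct (\<lambda>i. on i \<and> s i = 0) + ct (\<lambda>i. on i \<and> s i = 0 \<and> x i)"
    unfolding cnt_def sum_subtractf[symmetric] sum.distrib[symmetric]
  proof (rule sum.cong)
    fix i
    show "of_bool (sp i) = (of_bool (mi i \<and> s i = 0) - of_bool (on i \<and> s i = 0) + of_bool (on i \<and> s i = 0 \<and> x i) :: int)"
      using s_range[of i] by (cases "w (i - 1)"; cases "w (i + 1)") (auto simp: spines_def body_def classes)
  qed simp
  have 3: "ct x = ct (\<lambda>i. pr i \<and> x i) + ct (\<lambda>i. on i \<and> s i = 0 \<and> x i)"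
    unfolding cnt_def sum.distrib[symmetric]
  proof (rule sum.cong)
    fix i
    show "of_bool (x i) = (of_bool (pr i \<and> x i) + of_bool (on i \<and> s i = 0 \<and> x i) :: int)"
      using x_place[of i] by (cases "w i") (auto simp: classes)
  qed simp
  have 4: "ct mi = ct (\<lambda>i. mi i \<and> s i = 0) + ct (\<lambda>i. s i = 1 \<and> mi i) + ct (\<lambda>i. s i = 2)"
    unfolding cnt_def sum.distrib[symmetric]
  proof (rule sum.cong)
    fix i
    show "of_bool (mi i) = (of_bool (mi i \<and> s i = 0) + of_bool (s i = 1 \<and> mi i) + of_bool (s i = 2) :: int)"
      using s_range[of i] s_major[of i] by (cases "mi i") auto
  qed simp
  show ?thesis using assms count_ends 1 2 3 4 sum_s unfolding excess_def by linarith
qed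

end

section \<open>Reading off the ends of the bodies from left to right\<close>

lemma slots_snoc:
  "slots W En b f (xs @ [y]) = slots W En b f xs @
     (if (if xs = [] then f else En b (last xs)) then [\<not> W b y] else []) @ (if En b y then [\<not> W b y] else [])"
  by (induction xs arbitrary: f) auto

lemma length_slots:
  "linked W En Gp b xs \<Longrightarrow> length (slots W En b f xs) + (if f \<or> xs = [] then 0 else 1) = 2 * length (filter (En b) xs)"
proof (induction xs arbitrary: f)
  case (Cons a xs)
  then have "length (slots W En b (En b a) xs) + (if En b a \<or> xs = [] then 0 else 1) = 2 * length (filter (En b) xs)"
    using linked_Cons by blast
  moreover have "En b a \<or> xs \<noteq> []" using Cons.prems by (cases xs) auto
  ultimately show ?case by auto
qed simp

lemma upto_Suc: "lo \<le> i \<Longrightarrow> [lo..i] = [lo..i - 1] @ [i]" for lo i :: int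
  by (simp add: upto_rec2)

lemma length_filter_upto: "int (length (filter P [lo..hi - 1])) = cnt lo hi P"
proof -
  have "length (filter P [lo..hi - 1]) = card (set (filter P [lo..hi - 1]))"
    by (rule distinct_card[symmetric]) simp
  also have "set (filter P [lo..hi - 1]) = {i. lo \<le> i \<and> i < hi \<and> P i}" by auto
  finally show ?thesis by (simp add: cnt_card)
qed

context labelled
begin

definition starts :: "int \<Rightarrow> bool" where
  "starts i \<longleftrightarrow> bo i \<and> (\<not> bo (i - 1) \<or> en (i - 1))"

abbreviation "bodies i \<equiv> filter bo [lo..i - 1]"

text \<open>\<open>slots\<close> refers to the last body position seen, \<open>starts\<close> only
  to the position immediately before \<open>i\<close>. This reconciles the two when spines lie in
  between.\<close>

lemma last_bodies:
  assumes "lo \<le> i" "bodies i \<noteq> []"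
  shows "en (last (bodies i)) \<or> (bo (i - 1) \<and> last (bodies i) = i - 1)"
  using assms
proof (induction i rule: int_ge_induct)
  case (step i)
  show ?case
  proof (cases "bo i")
    case True
    then show ?thesis using step(1) by (simp add: upto_Suc)
  next
    case False
    then have e: "bodies (i + 1) = bodies i" using step(1) by (simp add: upto_Suc)
    then have "en (last (bodies i)) \<or> (bo (i - 1) \<and> last (bodies i) = i - 1)" using step by simp
    moreover have "\<not> jo (i - 1)" using joined_body[of "i - 1"] False by auto
    ultimately show ?thesis unfolding e by (auto simp: ends_def)
  qed
qed simp

text \<open>The ends formed at a position depend on it and its neighbours only. This local form is
  what counting arguments use, and also how the program computes the list.\<close>

lemma slots_bodies:
  assumes "lo \<le> i" "W b = w" "En b = en"
  shows "slots W En b True (bodies (i + 1)) = slots W En b True (bodies i) @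
    (if starts i then [\<not> w i] else []) @ (if en i then [\<not> w i] else [])"
proof (cases "bo i")
  case True
  have "starts i \<longleftrightarrow> (if bodies i = [] then True else en (last (bodies i)))"
  proof (cases "bo (i - 1)")
    case b: True
    then have "lo \<le> i - 1" by (simp add: body_def)
    then have "bodies i \<noteq> [] \<and> last (bodies i) = i - 1" using b upto_Suc[of lo "i - 1"] by simp
    then show ?thesis using b True by (simp add: starts_def)
  next
    case False
    then show ?thesis using True last_bodies[OF assms(1)] by (auto simp: starts_def)
  qed
  then show ?thesis using True assms by (simp add: upto_Suc slots_snoc)
next
  case False
  then show ?thesis using assms by (simp add: upto_Suc starts_def ends_def)
qed

lemma linked_bodies:
  assumes "W b = w" "En b = en" "Gp b = gp" "lo \<le> i" "i \<le> hi"
  shows "linked W En Gp b (filter bo [i..hi - 1])"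
  using assms(5,4)
proof (induction i rule: int_le_induct)
  case (step i)
  have IH: "linked W En Gp b (filter bo [i..hi - 1])" using step by simp
  have u: "[i - 1..hi - 1] = (i - 1) # [i..hi - 1]" using step(1) by (simp add: upto_rec1)
  show ?case
  proof (cases "bo (i - 1)")
    case True
    have nxt: "bo i \<and> i < hi" if "\<not> en (i - 1)"
      using that True joined_body[of "i - 1"] by (auto simp: ends_def body_def)
    have j: "(w (i - 1) \<or> w i) \<and> (gp (i - 1) \<longleftrightarrow> w (i - 1) \<and> w i)" if "\<not> en (i - 1)"
      using that True by (auto simp: ends_def joined_def gaps_def pairs_def)
    show ?thesis
    proof (cases "filter bo [i..hi - 1]")
      case Nil
      have "en (i - 1)"
      proof (rule ccontr)
        assume "\<not> en (i - 1)"
        then have "i \<in> set (filter bo [i..hi - 1])" using nxt by auto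
        then show False using Nil by simp
      qed
      then show ?thesis unfolding u using True Nil assms(2) by simp
    next
      case (Cons y ys)
      have "y \<in> set (filter bo [i..hi - 1])" unfolding Cons by simp
      then have "i \<le> y" by simp
      moreover have "y = i" if "\<not> en (i - 1)"
      proof -
        have "[i..hi - 1] = i # [i + 1..hi - 1]" using nxt[OF that] by (simp add: upto_rec1)
        then show ?thesis using Cons nxt[OF that] by simp
      qed
      ultimately show ?thesis unfolding u using True Cons IH j assms(1-3) by auto
    qed
  next
    case False
    then show ?thesis unfolding u using IH by simp
  qed
qed simp

lemma bodies_ends: "length (filter en (bodies hi)) = nat (ct en)"
proof -
  have "filter en (bodies hi) = filter en [lo..hi - 1]"
    by (auto simp: ends_def intro: filter_cong)
  then show ?thesis using length_filter_upto[of en lo hi] by simp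
qed

end

section \<open>Prescribed ends of the bodies\<close>

text \<open>Without extra cuts, the flags of the ends of the bodies are read off the statuses: each tail and
  each head contributes its own flag, whether it is attached or a spine.\<close>

locale prescribed = chain +
  fixes F :: "int \<Rightarrow> bool" and s :: "int \<Rightarrow> int" and pos :: "int \<Rightarrow> int"
  assumes pos: "pos i = of_bool (w lo) + cnt lo i (\<lambda>j. tails w lo hi j \<or> heads w lo hi j)"
    and s: "s i = of_bool ((tails w lo hi i \<or> heads w lo hi i) \<and> F (pos i))"
    and F0: "\<not> F 0" and F1: "\<not> F (2 * wide w lo hi + 1)"
begin

sublocale labelled w lo hi s "\<lambda>_. False"
  by unfold_locales (auto simp: s classes)

lemma pos_Suc: "lo \<le> i \<Longrightarrow> pos (i + 1) = pos i + of_bool (ta i \<or> he i)"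
  by (simp add: pos cnt_Suc)

lemma pos_nonneg: "0 \<le> pos i"
  using cnt_nonneg by (simp add: pos)

lemma pos_hi: "pos hi = 2 * wide w lo hi + 2 - of_bool (w (hi - 1))"
proof -
  have "ct (\<lambda>j. ta j \<or> he j) = ct ta + ct he"
    unfolding cnt_def sum.distrib[symmetric] by (rule sum.cong) (auto simp: classes)
  then show ?thesis using count_tails count_heads unfolding pos wide_def by auto
qed

text \<open>The list of ends read so far has about \<open>pos i\<close> entries, but reading and
  indexing are not synchronous. The flag of an unattached tail is already contributed by the major
  before it, that of an unattached head only by the major after it, and at the borders a major
  stands in for the missing minor; the last three terms are these corrections.\<close>

lemma slots_prescribed_prefix:
  assumes "lo \<le> i" "i \<le> hi" "W b = w" "En b = en"
  shows "slots W En b True (bodies i) = map F [0..pos i - 1 +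
    of_bool (w (i - 1) \<and> (i = hi \<or> (ta i \<and> s i = 0))) - of_bool (i = lo \<and> w lo) - of_bool (he (i - 1) \<and> s (i - 1) = 0)]"
    (is "_ = map F [0..?d i]")
  using assms(1,2)
proof (induction i rule: int_ge_induct)
  case base
  have "\<not> he (lo - 1)" "\<not> w (lo - 1)" using range[of "lo - 1"] by (auto simp: classes)
  then show ?case by (simp add: pos)
next
  case (step i)
  then have i: "lo \<le> i" "i < hi" by auto
  define d where "d = ?d i"
  have IH: "slots W En b True (bodies i) = map F [0..d]" using step d_def by simp
  have ST: "slots W En b True (bodies (i + 1)) = map F [0..d] @
      (if starts i then [\<not> w i] else []) @ (if en i then [\<not> w i] else [])"
    using slots_bodies[where W = W and En = En and b = b, OF i(1) assms(3,4)] IH by simp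
  have p: "pos (i + 1) = pos i + of_bool (ta i \<or> he i)" using pos_Suc i by simp
  have p0: "0 \<le> pos i" by (rule pos_nonneg)
  have wlo: "\<not> w (lo - 1)" using range[of "lo - 1"] by auto
  have hlo: "\<not> he (lo - 1)" by (auto simp: classes)
  have snoc: "map F [0..d] @ [F (d + 1)] = map F [0..d + 1]" if "-1 \<le> d" for d
    using that upto_Suc[of 0 "d + 1"] by simp
  consider "w i" | "ta i" | "he i" | "md i" | "on i" using i by (auto simp: classes)
  then show ?case
  proof cases
    case 1
    have cls: "\<not> ta i" "\<not> he i" "\<not> md i" "\<not> on i" using 1 by (auto simp: classes)
    have st: "starts i \<longleftrightarrow> i = lo \<or> (he (i - 1) \<and> s (i - 1) = 0)"
    proof (cases "i = lo")
      case True
      then show ?thesis using 1 i by (simp add: starts_def body_def)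
    next
      case False
      then have "lo \<le> i - 1" using i by simp
      then consider "w (i - 1)" | "he (i - 1)" "\<not> w (i - 1)" | "on (i - 1)" "\<not> w (i - 1)" "\<not> he (i - 1)"
        using 1 i by (auto simp: classes)
      then show ?thesis
      proof cases
        case a: 1
        then have "\<not> en (i - 1)" "bo (i - 1)" "\<not> he (i - 1)"
          using 1 \<open>lo \<le> i - 1\<close> i by (auto simp: ends_def joined_def pairs_def body_def classes)
        then show ?thesis using False by (simp add: starts_def)
      next
        case b: 2
        then have "\<not> w (i - 2)" "\<not> on (i - 1)" by (auto simp: classes)
        then show ?thesis using 1 b False i s[of "i - 1"]
          by (auto simp: starts_def ends_def joined_def pairs_def body_def)
      next
        case c: 3
        then have "w (i - 2)" "s (i - 1) = 0" by (auto simp: classes s)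
        then have "\<not> en (i - 1)" "bo (i - 1)"
          using 1 c \<open>lo \<le> i - 1\<close> i by (auto simp: ends_def joined_def pairs_def body_def)
        then show ?thesis using False c by (simp add: starts_def)
      qed
    qed
    have e: "en i \<longleftrightarrow> i + 1 = hi \<or> (ta (i + 1) \<and> s (i + 1) = 0)"
    proof (cases "i + 1 = hi")
      case True
      then show ?thesis using 1 i range[of hi] by (auto simp: ends_def joined_def pairs_def body_def)
    next
      case False
      then consider "w (i + 1)" | "ta (i + 1)" "\<not> w (i + 1)" | "on (i + 1)" "\<not> w (i + 1)" "\<not> ta (i + 1)"
        using 1 i by (auto simp: classes)
      then show ?thesis
      proof cases
        case a: 1
        then show ?thesis using 1 False by (auto simp: ends_def joined_def pairs_def classes)
      next
        case b: 2
        then have "\<not> on (i + 1)" by (auto simp: classes)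
        then show ?thesis using 1 b False i s[of "i + 1"]
          by (auto simp: ends_def joined_def pairs_def body_def)
      next
        case c: 3
        then have "s (i + 1) = 0" by (auto simp: classes s)
        then show ?thesis using 1 c False i
          by (auto simp: ends_def joined_def pairs_def body_def)
      qed
    qed
    \<comment> \<open>A left end contributed at a major is \<open>False\<close> as it should be: at
      the left border its index is 0, where \<open>F0\<close> applies, and otherwise it is the index
      of an unattached head, whose flag is \<open>False\<close>.\<close>
    have dd: "(if starts i then [\<not> w i] else []) = (if d = pos i - 1 then [] else [F (pos i - 1)])"
      "d = pos i - 1 - of_bool (starts i)"
    proof -
      have lo: "pos i = 1" if "i = lo" using that 1 by (simp add: pos)
      have he: "\<not> F (pos i - 1)" if "he (i - 1)" "s (i - 1) = 0"
      proof -
        have "lo \<le> i - 1" using that(1) by (auto simp: classes)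
        then have "pos i = pos (i - 1) + 1" using pos_Suc[of "i - 1"] that(1) by simp
        then show ?thesis using that s[of "i - 1"] by auto
      qed
      show "d = pos i - 1 - of_bool (starts i)"
        unfolding d_def using st 1 i cls hlo by auto
      then show "(if starts i then [\<not> w i] else []) = (if d = pos i - 1 then [] else [F (pos i - 1)])"
        using st lo he 1 F0 by auto
    qed
    have a1: "map F [0..d] @ (if starts i then [\<not> w i] else []) = map F [0..pos i - 1]"
    proof (cases "starts i")
      case True
      have "1 \<le> pos i"
      proof (cases "i = lo")
        case True
        then show ?thesis using 1 by (simp add: pos)
      next
        case False
        then have "he (i - 1)" using st True by simp
        then show ?thesis using pos_Suc[of "i - 1"] pos_nonneg[of "i - 1"] i False by simp
      qed
      then show ?thesis using dd True snoc[of "pos i - 2"] by simp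
    next
      case False
      then show ?thesis using dd by simp
    qed
    \<comment> \<open>At the right border this is the last index, where \<open>F1\<close> applies;
      elsewhere it is the index of the unattached tail that follows.\<close>
    have "F (pos i) = False" if "en i"
    proof (cases "i + 1 = hi")
      case True
      then have "pos i = 2 * wide w lo hi + 1" using pos_hi p cls 1 by auto
      then show ?thesis using F1 by simp
    next
      case False
      then have "ta (i + 1)" "s (i + 1) = 0" using e that by auto
      then show ?thesis using s[of "i + 1"] p cls by auto
    qed
    then have a2: "map F [0..pos i - 1] @ (if en i then [\<not> w i] else []) = map F [0..pos i - 1 + of_bool (en i)]"
      using snoc[of "pos i - 1"] p0 1 by auto
    have D: "?d (i + 1) = pos i - 1 + of_bool (en i)"
      using e 1 p cls i by auto
    show ?thesis unfolding D ST append_assoc[symmetric] a1 a2 ..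
  next
    case 2
    have c: "\<not> w i" "w (i - 1)" "\<not> w (i + 1)" "\<not> he i" "\<not> on i" "\<not> he (i - 1)" using 2 by (auto simp: classes)
    have lo: "i \<noteq> lo" using c wlo by auto
    have e: "en i \<longleftrightarrow> s i \<noteq> 0" "\<not> starts i"
    proof -
      have "\<not> pairs w i" using c by (simp add: pairs_def)
      then show "en i \<longleftrightarrow> s i \<noteq> 0" using c i s[of i] by (auto simp: ends_def joined_def body_def)
      have "bo (i - 1)" using c range[of "i - 1"] by (simp add: body_def)
      then show "\<not> starts i" using c i s[of i] lo
        by (auto simp: starts_def ends_def joined_def pairs_def)
    qed
    show ?thesis
    proof (cases "s i = 0")
      case True
      then show ?thesis using ST[unfolded d_def] e c p 2 i lo by simp
    next
      case False
      then have "F (pos i)" using s[of i] by auto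
      then show ?thesis using ST[unfolded d_def] e c p 2 i lo False snoc[of "pos i - 1"] p0 by simp
    qed
  next
    case 3
    have c: "\<not> w i" "\<not> w (i - 1)" "w (i + 1)" "\<not> ta i" "\<not> on i" "\<not> he (i - 1)" using 3 by (auto simp: classes)
    have e: "starts i \<longleftrightarrow> s i \<noteq> 0" "\<not> en i"
    proof -
      have "\<not> jo (i - 1)" using c by (auto simp: joined_def pairs_def)
      then show "starts i \<longleftrightarrow> s i \<noteq> 0" using c i s[of i]
        by (auto simp: starts_def ends_def body_def)
      show "\<not> en i" using c i s[of i] 
        by (auto simp: ends_def joined_def pairs_def body_def)
    qed
    have hi: "i + 1 \<noteq> hi" "\<not> (i = lo \<and> w lo)" using c range[of "i + 1"] by auto
    show ?thesis
    proof (cases "s i = 0")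
      case True
      then show ?thesis using ST[unfolded d_def] e c p 3 i hi by simp
    next
      case False
      then have "F (pos i)" using s[of i] by auto
      then show ?thesis using ST[unfolded d_def] e c p 3 i hi False snoc[of "pos i - 1"] p0 by simp
    qed
  next
    case 4
    have c: "\<not> w i" "\<not> w (i - 1)" "\<not> w (i + 1)" "\<not> ta i" "\<not> he i" "\<not> on i" "\<not> he (i - 1)" "s i = 0"
      using 4 by (auto simp: classes s)
    have "\<not> bo i" "\<not> (i = lo \<and> w lo)" using c by (auto simp: body_def)
    then show ?thesis using ST[unfolded d_def] c p i by (cases "i = lo") (simp_all add: starts_def ends_def)
  next
    case 5
    have c: "\<not> w i" "w (i - 1)" "w (i + 1)" "\<not> ta i" "\<not> he i" "\<not> he (i - 1)" "s i = 0"
      using 5 by (auto simp: classes s)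
    have lo: "i \<noteq> lo" using c wlo by auto
    have "\<not> en i" using c i 5 by (auto simp: ends_def joined_def pairs_def body_def)
    moreover have "\<not> starts i" using c i 5 range[of "i - 1"]
      by (auto simp: starts_def ends_def joined_def pairs_def body_def)
    moreover have "i + 1 \<noteq> hi" using c range[of "i + 1"] by auto
    ultimately show ?thesis using ST[unfolded d_def] c p i lo by simp
  qed
qed

lemma slots_prescribed:
  assumes "W b = w" "En b = en"
  shows "slots W En b True (bodies hi) = map F [0..2 * wide w lo hi + 1]"
proof -
  have "hi \<noteq> lo" "\<not> ta hi" using ne by (auto simp: classes)
  moreover have "\<not> he (hi - 1)" using range[of hi] by (auto simp: classes)
  ultimately show ?thesis
    using slots_prescribed_prefix[where W = W and En = En and b = b and i = hi] assms ne pos_hi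
    by (cases "w (hi - 1)") (auto simp: add.commute)
qed

lemma count_ends_prescribed: "ct en = wide w lo hi + 1"
proof -
  have "s i \<noteq> 2" for i by (simp add: s)
  then have 1: "ct (\<lambda>i. s i = 2) = 0" by (simp add: cnt_def)
  have 2: "ct (\<lambda>i. on i \<and> s i = 0) = ct on"
    by (rule cnt_cong) (auto simp: s classes)
  have 3: "ct (\<lambda>_. False) = 0" by (simp add: cnt_def)
  show ?thesis unfolding wide_def count_ends 1 2 3 by simp
qed

end

section \<open>Assembling two labelled chains into one path\<close>

definition interleaved :: "int \<Rightarrow> int \<Rightarrow> int \<Rightarrow> int \<Rightarrow> bool" where
  "interleaved a b c d \<longleftrightarrow> min a b < min c d \<and> min c d < max a b \<and> max a b < max c d"

text \<open>The combinatorial substitute for \<open>noncrossing\<close>. An edge within a chain and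
  an edge between the chains never cross, so that combination is unrestricted.
  \<open>interleaved\<close> only covers the case in which the first pair starts further left;
  therefore both orders of the two edges are needed to exclude a crossing.\<close>

fun uncrossed :: "(bool \<times> int) \<times> (bool \<times> int) \<Rightarrow> (bool \<times> int) \<times> (bool \<times> int) \<Rightarrow> bool" where
  "uncrossed ((s, a), (t, b)) ((u, c), (v, d)) \<longleftrightarrow>
     (s = t \<and> u = v \<and> s = u \<longrightarrow> \<not> interleaved a b c d) \<and>
     (s \<noteq> t \<and> u \<noteq> v \<longrightarrow> (if s = u then a \<le> c \<and> b \<le> d \<or> c \<le> a \<and> d \<le> b else a \<le> d \<and> b \<le> c \<or> d \<le> a \<and> c \<le> b))"

text \<open>A gap is reached from its spine at \<open>i\<close> and at \<open>i + 1\<close>. No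
  position lies strictly between these two and no spine coincides with either, so moving from one to
  the other cannot create an interleaving that the gaps do not have.\<close>

lemma peaks:
  assumes "\<not> interleaved i m j n" "\<not> interleaved j n i m" "i \<noteq> j" "m \<noteq> n"
    "m \<noteq> i" "m \<noteq> i + 1" "m \<noteq> j" "m \<noteq> j + 1" "n \<noteq> i" "n \<noteq> i + 1" "n \<noteq> j" "n \<noteq> j + 1"
    "a = i \<or> a = i + 1" "c = j \<or> c = j + 1"
  shows "\<not> interleaved a m c n" "\<not> interleaved m a c n" "\<not> interleaved a m n c" "\<not> interleaved m a n c"
  using assms unfolding interleaved_def min_def max_def by (smt (verit))+

lemma sorted_wrt_pair:
  "sorted_wrt Q xs \<Longrightarrow> x \<in> set xs \<Longrightarrow> y \<in> set xs \<Longrightarrow> x = y \<or> Q x y \<or> Q y x"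
  by (induction xs) auto

lemma set_outs: "set (outs en gp mu s xs) = Pair s ` (set xs \<union> mu s ` {x \<in> set xs. \<not> en s x \<and> gp s x})"
  by (induction xs) auto

lemma distinct_outs:
  assumes "distinct xs" "set xs \<subseteq> A" "\<And>x. x \<in> set xs \<Longrightarrow> \<not> en s x \<Longrightarrow> gp s x \<Longrightarrow> mu s x \<notin> A" "inj_on (mu s) {x. gp s x}"
  shows "distinct (outs en gp mu s xs)"
  using assms(1-3)
proof (induction xs)
  case (Cons a xs)
  have "\<not> en s a \<Longrightarrow> gp s a \<Longrightarrow> mu s a \<noteq> a \<and> mu s a \<notin> set xs" using Cons.prems by fastforce
  moreover have "mu s x \<noteq> a" if "x \<in> set xs" "\<not> en s x" "gp s x" for x
    using Cons.prems(2,3) that by (metis list.set_intros subsetD)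
  moreover have "distinct (outs en gp mu s xs)" using Cons by simp
  ultimately show ?case using Cons.prems(1) assms(4) by (auto simp: set_outs inj_on_def)
qed simp

text \<open>The index \<open>True\<close> stands for the outer chain, on which the path starts.
  \<open>M\<close> is only constrained on gaps, where it is a bijection onto the spines without
  interleaved pairs.\<close>

locale matched =
  fixes W :: "bool \<Rightarrow> int \<Rightarrow> bool" and L H :: "bool \<Rightarrow> int" and S :: "bool \<Rightarrow> int \<Rightarrow> int"
    and X :: "bool \<Rightarrow> int \<Rightarrow> bool" and M :: "bool \<Rightarrow> int \<Rightarrow> int"
  assumes lab: "labelled (W b) (L b) (H b) (S b) (X b)"
    and M_spine: "gaps (W b) (X b) i \<Longrightarrow> spines (W b) (L b) (H b) (S b) (X b) (M b i)"
    and M_inj: "inj_on (M b) {i. gaps (W b) (X b) i}"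
    and M_surj: "spines (W b) (L b) (H b) (S b) (X b) j \<Longrightarrow> \<exists>i. gaps (W b) (X b) i \<and> M b i = j"
    and M_nested: "gaps (W b) (X b) i \<Longrightarrow> gaps (W b) (X b) j \<Longrightarrow> i \<noteq> j \<Longrightarrow> \<not> interleaved i (M b i) j (M b j)"
begin

definition "B b i \<longleftrightarrow> body (W b) (L b) (H b) (S b) (X b) i"
definition "EN b i \<longleftrightarrow> ends (W b) (L b) (H b) (S b) (X b) i"
definition "GP b i \<longleftrightarrow> gaps (W b) (X b) i"
definition "bds b = filter (B b) [L b..H b - 1]"
definition "route = emit EN GP M True (bds True) (bds False)"

lemma linked_bds: "linked W EN GP b (bds b)"
proof -
  interpret l: labelled "W b" "L b" "H b" "S b" "X b" by (rule lab)
  have "B b = l.bo" by (auto simp: B_def)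
  moreover have "EN b = l.en" "GP b = l.gp" by (auto simp: EN_def GP_def)
  ultimately show ?thesis unfolding bds_def
    using l.linked_bodies[where W = W and En = EN and Gp = GP and b = b and i = "L b"] l.ne by simp
qed

lemma gap_facts:
  assumes "GP b i"
  shows "\<not> EN b i" "B b i" "B b (i + 1)" "W b i" "W b (i + 1)" "\<not> W b (M b i)" "\<not> B b (M b i)"
    "L b \<le> M b i" "M b i < H b"
proof -
  interpret l: labelled "W b" "L b" "H b" "S b" "X b" by (rule lab)
  have g: "gaps (W b) (X b) i" using assms by (simp add: GP_def)
  show "W b i" "W b (i + 1)" using g by (auto simp: gaps_def pairs_def)
  then show "\<not> EN b i" "B b i" "B b (i + 1)"
    using g l.range[of i] l.range[of "i + 1"]
    by (auto simp: EN_def ends_def joined_def gaps_def B_def body_def)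
  show "\<not> W b (M b i)" "\<not> B b (M b i)" "L b \<le> M b i" "M b i < H b"
    using M_spine[OF g] by (auto simp: spines_def mino_def B_def)
qed

lemma range_cases: "L b \<le> i \<and> i < H b \<longleftrightarrow> i \<in> set (bds b) \<or> (\<exists>j. GP b j \<and> M b j = i)"
proof
  interpret l: labelled "W b" "L b" "H b" "S b" "X b" by (rule lab)
  assume i: "L b \<le> i \<and> i < H b"
  show "i \<in> set (bds b) \<or> (\<exists>j. GP b j \<and> M b j = i)"
  proof (cases "B b i")
    case False
    then have "spines (W b) (L b) (H b) (S b) (X b) i"
      using i by (auto simp: spines_def mino_def B_def body_def)
    then show ?thesis using M_surj by (auto simp: GP_def)
  qed (use i in \<open>auto simp: bds_def\<close>)
next
  assume "i \<in> set (bds b) \<or> (\<exists>j. GP b j \<and> M b j = i)"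
  then show "L b \<le> i \<and> i < H b" using gap_facts by (auto simp: bds_def)
qed

lemma set_outs_bds: "set (outs EN GP M b (bds b)) = {b} \<times> {L b..<H b}"
proof -
  have "{x \<in> set (bds b). \<not> EN b x \<and> GP b x} = {x. GP b x}"
  proof -
    have "x \<in> set (bds b)" if "GP b x" for x
      using gap_facts(2)[OF that] by (auto simp: bds_def B_def body_def)
    then show ?thesis using gap_facts(1) by blast
  qed
  then have "set (outs EN GP M b (bds b)) = Pair b ` (set (bds b) \<union> M b ` {x. GP b x})"
    by (simp add: set_outs)
  also have "set (bds b) \<union> M b ` {x. GP b x} = {L b..<H b}"
    using range_cases by auto
  finally show ?thesis by auto
qed

lemma distinct_outs_bds: "distinct (outs EN GP M b (bds b))"
  using gap_facts(7) M_inj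
  by (intro distinct_outs[where A = "set (bds b)"]) (auto simp: bds_def GP_def)

lemma arcs_uncrossed:
  assumes "e \<in> arcs W EN GP M b" "f \<in> arcs W EN GP M b"
  shows "uncrossed e f"
proof -
  have adj: "\<not> interleaved x (x + 1) c d" "\<not> interleaved c d x (x + 1)" for x c d :: int
    by (auto simp: interleaved_def min_def max_def)
  have pk: "\<not> interleaved a (M b i) c (M b j) \<and> \<not> interleaved (M b i) a c (M b j) \<and>
      \<not> interleaved a (M b i) (M b j) c \<and> \<not> interleaved (M b i) a (M b j) c"
    if g: "GP b i" "GP b j" and a: "a = i \<or> a = i + 1" "c = j \<or> c = j + 1" for i j a c
  proof (cases "i = j")
    case True
    have "M b i \<noteq> i" "M b i \<noteq> i + 1" using gap_facts[OF g(1)] by metis+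
    then show ?thesis using True a by (auto simp: interleaved_def min_def max_def)
  next
    case False
    have n: "M b i \<noteq> M b j" using g False M_inj by (auto simp: inj_on_def GP_def)
    have d: "M b k \<noteq> l" "M b k \<noteq> l + 1" if "GP b k" "GP b l" for k l
      using gap_facts[OF that(1)] gap_facts[OF that(2)] by metis+
    have i1: "\<not> interleaved i (M b i) j (M b j)" and i2: "\<not> interleaved j (M b j) i (M b i)"
      using M_nested[of b i j] M_nested[of b j i] g False by (auto simp: GP_def)
    note P = peaks[OF i1 i2 False n d(1)[OF g(1) g(1)] d(2)[OF g(1) g(1)] d(1)[OF g] d(2)[OF g]
      d(1)[OF g(2,1)] d(2)[OF g(2,1)] d(1)[OF g(2) g(2)] d(2)[OF g(2) g(2)] a]
    show ?thesis using P by blast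
  qed
  have cases: "\<exists>u v. h = ((b, u), (b, v)) \<and> (v = u + 1 \<or>
      (\<exists>i a. GP b i \<and> (a = i \<or> a = i + 1) \<and> (u = a \<and> v = M b i \<or> u = M b i \<and> v = a)))"
    if "h \<in> arcs W EN GP M b" for h
    using that unfolding arcs_def by blast
  obtain u v where e: "e = ((b, u), (b, v))" and uv: "v = u + 1 \<or>
      (\<exists>i a. GP b i \<and> (a = i \<or> a = i + 1) \<and> (u = a \<and> v = M b i \<or> u = M b i \<and> v = a))"
    using cases[OF assms(1)] by blast
  obtain c d where f: "f = ((b, c), (b, d))" and cd: "d = c + 1 \<or>
      (\<exists>i a. GP b i \<and> (a = i \<or> a = i + 1) \<and> (c = a \<and> d = M b i \<or> c = M b i \<and> d = a))"
    using cases[OF assms(2)] by blast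
  have "\<not> interleaved u v c d"
  proof (cases "v = u + 1 \<or> d = c + 1")
    case True
    then show ?thesis using adj by auto
  next
    case False
    then obtain i a where i: "GP b i" "a = i \<or> a = i + 1" "u = a \<and> v = M b i \<or> u = M b i \<and> v = a"
      using uv by blast
    obtain j a' where j: "GP b j" "a' = j \<or> a' = j + 1" "c = a' \<and> d = M b j \<or> c = M b j \<and> d = a'"
      using cd False by blast
    show ?thesis using pk[OF i(1) j(1) i(2) j(2)] i(3) j(3) by (elim disjE conjE) simp_all
  qed
  then show ?thesis using e f by simp
qed

definition color :: "bool \<times> int \<Rightarrow> bool" where
  "color p \<longleftrightarrow> W (fst p) (snd p) = fst p"

lemma arcs_color: "(p, q) \<in> arcs W EN GP M b \<Longrightarrow> color p \<noteq> color q"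
  using gap_facts[of b] by (auto simp: arcs_def color_def)

lemma arcs_side: "e \<in> arcs W EN GP M b \<Longrightarrow> \<exists>x y. e = ((b, x), (b, y))"
  by (auto simp: arcs_def)

end

locale linked_up = matched +
  assumes step: "step1 (slots W EN True False (bds True)) (slots W EN False True (bds False))"
    and O_ne: "bds True \<noteq> []"
begin

lemma route_mset: "mset route = mset (outs EN GP M True (bds True) @ outs EN GP M False (bds False))"
  using mset_emit[of W EN GP True "bds True" "bds False" M] linked_bds[of True] linked_bds[of False] O_ne step
  by (simp add: route_def)

lemma route_distinct: "distinct route"
proof -
  have "distinct (outs EN GP M True (bds True) @ outs EN GP M False (bds False))"
    using distinct_outs_bds set_outs_bds by auto
  then show ?thesis using route_mset mset_eq_imp_distinct_iff by blast
qed

lemma route_set: "set route = {True} \<times> {L True..<H True} \<union> {False} \<times> {L False..<H False}"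
  using mset_eq_setD[OF route_mset] set_outs_bds by simp

lemma route_edges:
  "edges route \<subseteq> arcs W EN GP M True \<union> arcs W EN GP M False \<union> crosses W (set (bridges EN True (bds True) (bds False)))"
  unfolding route_def using linked_bds[of True] linked_bds[of False] O_ne step
  by (intro edges_emit) auto

lemma route_color:
  assumes "(p, q) \<in> edges route"
  shows "color p \<noteq> color q"
proof -
  let ?R = "set (bridges EN True (bds True) (bds False))"
  have "(p, q) \<in> arcs W EN GP M True \<or> (p, q) \<in> arcs W EN GP M False \<or> (p, q) \<in> crosses W ?R"
    using route_edges assms by blast
  moreover have "color p \<noteq> color q" if "(p, q) \<in> crosses W ?R"
    using that unfolding crosses_def by (auto simp: color_def)
  ultimately show ?thesis using arcs_color by blast
qed

lemma route_uncrossed: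
  assumes "e \<in> edges route" "f \<in> edges route"
  shows "uncrossed e f"
proof -
  let ?R = "set (bridges EN True (bds True) (bds False))"
  have sorted: "sorted_wrt (\<lambda>(a, b) (c, d). a \<le> c \<and> b \<le> d) (bridges EN True (bds True) (bds False))"
    using linked_bds[of True] linked_bds[of False] by (intro sorted_bridges) auto
  have mono: "a \<le> c \<and> b \<le> d \<or> c \<le> a \<and> d \<le> b" if "(a, b) \<in> ?R" "(c, d) \<in> ?R" for a b c d
    using sorted_wrt_pair[OF sorted that] by auto
  have cr: "(\<exists>a b. (a, b) \<in> ?R \<and> (h = ((True, a), (False, b)) \<or> h = ((False, b), (True, a)))) \<or>
      (\<exists>s. h \<in> arcs W EN GP M s)" if "h \<in> edges route" for h
    using route_edges that unfolding crosses_def by blast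
  show ?thesis using cr[OF assms(1)] cr[OF assms(2)]
  proof (elim disjE exE)
    fix a b c d
    assume e: "(a, b) \<in> ?R \<and> (e = ((True, a), (False, b)) \<or> e = ((False, b), (True, a)))"
      and f: "(c, d) \<in> ?R \<and> (f = ((True, c), (False, d)) \<or> f = ((False, d), (True, c)))"
    then show ?thesis using mono[of a b c d] by auto
  next
    fix a b s
    assume e: "(a, b) \<in> ?R \<and> (e = ((True, a), (False, b)) \<or> e = ((False, b), (True, a)))"
      and f: "f \<in> arcs W EN GP M s"
    then show ?thesis using arcs_side[OF f] by auto
  next
    fix c d s
    assume f: "(c, d) \<in> ?R \<and> (f = ((True, c), (False, d)) \<or> f = ((False, d), (True, c)))"
      and e: "e \<in> arcs W EN GP M s"
    then show ?thesis using arcs_side[OF e] by auto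
  next
    fix s t
    assume e: "e \<in> arcs W EN GP M s" and f: "f \<in> arcs W EN GP M t"
    show ?thesis
    proof (cases "s = t")
      case True
      then show ?thesis using arcs_uncrossed e f by blast
    next
      case False
      then show ?thesis using arcs_side[OF e] arcs_side[OF f] by auto
    qed
  qed
qed

lemma hd_route: "W True (L True) \<Longrightarrow> hd route = (True, L True)"
proof -
  assume w: "W True (L True)"
  interpret l: labelled "W True" "L True" "H True" "S True" "X True" by (rule lab)
  have "[L True..H True - 1] = L True # [L True + 1..H True - 1]" using l.ne by (simp add: upto_rec1)
  moreover have "B True (L True)" using w l.ne by (simp add: B_def body_def)
  ultimately have "hd (bds True) = L True" by (simp add: bds_def)
  then show ?thesis using O_ne hd_emit by (simp add: route_def)
qed

lemma last_bds: "W b (H b - 1) \<Longrightarrow> last (bds b) = H b - 1"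
proof -
  assume w: "W b (H b - 1)"
  interpret l: labelled "W b" "L b" "H b" "S b" "X b" by (rule lab)
  have "[L b..H b - 1] = [L b..H b - 1 - 1] @ [H b - 1]" using l.ne upto_Suc[of "L b" "H b - 1"] by simp
  moreover have "B b (H b - 1)" using w l.ne by (simp add: B_def body_def)
  ultimately show ?thesis by (simp add: bds_def)
qed

lemma last_route:
  "slots W EN True False (bds True) = slots W EN False True (bds False) @ [z] \<Longrightarrow> last route = (True, last (bds True))"
  "slots W EN True False (bds True) @ [z] = slots W EN False True (bds False) \<Longrightarrow> last route = (False, last (bds False))"
  using last_emit[of W EN GP True "bds True" "bds False" z M] linked_bds[of True] linked_bds[of False] O_ne
  by (auto simp: route_def)

end

text \<open>Vertices are dropped only at the two ends of the path, so no new edge arises and all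
  properties of edges are inherited.\<close>

lemma edges_filter_ends:
  assumes "distinct P" "\<And>p. p \<in> set P \<Longrightarrow> \<not> r p \<Longrightarrow> p = hd P \<or> p = last P"
  shows "edges (filter r P) \<subseteq> edges P"
proof (cases P)
  case (Cons a Q)
  have tail: "\<exists>zs. Q = filter r Q @ zs"
  proof (cases Q rule: rev_cases)
    case (snoc R z)
    have "r p" if "p \<in> set R" for p
    proof (rule ccontr)
      assume "\<not> r p"
      then have "p = a \<or> p = z" using assms(2)[of p] that Cons snoc by auto
      then show False using that assms(1) Cons snoc by auto
    qed
    then have "filter r R = R" by simp
    then show ?thesis using snoc by auto
  qed simp
  then obtain zs where zs: "Q = filter r Q @ zs" by blast
  define V where "V = filter r P"
  show ?thesis
  proof (cases "r a")
    case True
    then have "P = [] @ V @ zs" using Cons zs by (simp add: V_def)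
    then show ?thesis using edges_append_subset[of V "[]" zs] by (simp add: V_def)
  next
    case False
    then have "P = [a] @ V @ zs" using Cons zs by (simp add: V_def)
    then show ?thesis using edges_append_subset[of V "[a]" zs] by (simp add: V_def)
  qed
qed simp

section \<open>Statuses and cuts for a given number of bodies\<close>

definition place :: "(int \<Rightarrow> bool) \<Rightarrow> int \<Rightarrow> int \<Rightarrow> (int \<Rightarrow> int) \<Rightarrow> int \<Rightarrow> bool" where
  "place w lo hi s i \<longleftrightarrow> pairs w i \<or> (ones w lo hi i \<and> s i = 0)"
definition cuts :: "(int \<Rightarrow> bool) \<Rightarrow> int \<Rightarrow> int \<Rightarrow> (int \<Rightarrow> int) \<Rightarrow> int \<Rightarrow> int \<Rightarrow> bool" where
  "cuts w lo hi s k i \<longleftrightarrow> place w lo hi s i \<and> k \<le> cnt lo i (place w lo hi s)"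
definition first :: "int \<Rightarrow> (int \<Rightarrow> bool) \<Rightarrow> int \<Rightarrow> int \<Rightarrow> int" where
  "first lo P m i = of_bool (P i \<and> cnt lo i P < m)"
definition attach :: "(int \<Rightarrow> bool) \<Rightarrow> int \<Rightarrow> int \<Rightarrow> (int \<Rightarrow> bool) \<Rightarrow> int \<Rightarrow> int" where
  "attach w lo hi F i = of_bool ((tails w lo hi i \<or> heads w lo hi i) \<and>
     F (of_bool (w lo) + cnt lo i (\<lambda>j. tails w lo hi j \<or> heads w lo hi j)))"
text \<open>With cuts at all possible places there are as many bodies as majors and minors of status
  2 together. Each place left uncut saves one body, so this many places have to be spared to end up
  with \<open>k\<close> bodies.\<close>

definition skip :: "(int \<Rightarrow> bool) \<Rightarrow> int \<Rightarrow> int \<Rightarrow> (int \<Rightarrow> int) \<Rightarrow> int \<Rightarrow> int" where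
  "skip w lo hi s k = cnt lo hi w + cnt lo hi (\<lambda>i. s i = 2) - k"

locale statuses = chain +
  fixes s :: "int \<Rightarrow> int"
  assumes major0: "\<not> mino w lo hi i \<Longrightarrow> s i = 0"
    and range012: "s i \<in> {0, 1, 2}"
    and mid1: "mids w lo hi i \<Longrightarrow> s i \<noteq> 1"
begin

lemma labelled_cuts: "labelled w lo hi s (cuts w lo hi s k)"
  using major0 range012 mid1 by unfold_locales (auto simp: cuts_def place_def)

lemma count_place: "ct (place w lo hi s) = ct pr + ct (\<lambda>i. on i \<and> s i = 0)"
  unfolding cnt_def sum.distrib[symmetric] by (rule sum.cong) (auto simp: place_def classes)

lemma count_cuts:
  assumes "0 \<le> k" "k \<le> ct (place w lo hi s)"
  shows "ct (cuts w lo hi s k) = ct (place w lo hi s) - k"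
proof -
  have "ct (cuts w lo hi s k) + ct (\<lambda>i. place w lo hi s i \<and> cnt lo i (place w lo hi s) < k) = ct (place w lo hi s)"
    unfolding cnt_def[of lo hi] sum.distrib[symmetric] by (rule sum.cong) (auto simp: cuts_def)
  then show ?thesis using cnt_first[OF assms(1), of lo hi "place w lo hi s"] assms(2) by simp
qed

lemma no_cuts: "cuts w lo hi s (ct (place w lo hi s)) = (\<lambda>_. False)"
proof (rule ext, rule ccontr)
  fix i
  assume "cuts w lo hi s (ct (place w lo hi s)) i \<noteq> False"
  then have c: "place w lo hi s i" "ct (place w lo hi s) \<le> cnt lo i (place w lo hi s)"
    by (auto simp: cuts_def)
  then have "lo \<le> i" "i < hi" using range[of i] by (auto simp: place_def classes)
  then have "cnt lo (i + 1) (place w lo hi s) \<le> ct (place w lo hi s)" by (intro cnt_mono) simp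
  then show False using c cnt_Suc[OF \<open>lo \<le> i\<close>, of "place w lo hi s"] by simp
qed

lemma count_ends_cuts:
  assumes "0 \<le> skip w lo hi s k" "skip w lo hi s k \<le> ct (place w lo hi s)"
  shows "ct (ends w lo hi s (cuts w lo hi s (skip w lo hi s k))) = k"
proof -
  interpret labelled w lo hi s "cuts w lo hi s (skip w lo hi s k)" by (rule labelled_cuts)
  show ?thesis using count_ends count_cuts[OF assms] count_place by (simp add: skip_def)
qed

end

context labelled
begin

lemma flags: "s i = of_bool (\<not> w i \<and> starts i) + of_bool (\<not> w i \<and> en i)"
proof -
  have j: "en (i - 1) \<longleftrightarrow> bo (i - 1) \<and> \<not> jo (i - 1)" by (simp add: ends_def)
  consider "w i" | "\<not> w i" "\<not> mi i" | "ta i" | "he i" | "md i" | "on i" by (auto simp: classes)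
  then show ?thesis
  proof cases
    case 1
    then show ?thesis using s_major[of i] by (simp add: classes)
  next
    case 2
    then show ?thesis using s_major[of i] by (auto simp: classes starts_def ends_def body_def)
  next
    case 3
    have c: "\<not> w i" "w (i - 1)" "\<not> w (i + 1)" "\<not> on i" "\<not> x (i - 1) \<or> True" using 3 by (auto simp: classes)
    have b: "bo (i - 1)" using c range[of "i - 1"] by (simp add: body_def)
    show ?thesis using c b s_range[of i] 3
      by (auto simp: starts_def j joined_def pairs_def ends_def body_def classes)
  next
    case 4
    have c: "\<not> w i" "\<not> w (i - 1)" "w (i + 1)" "\<not> on i" using 4 by (auto simp: classes)
    show ?thesis using c s_range[of i] 4
      by (auto simp: starts_def j joined_def pairs_def ends_def body_def classes)
  next
    case 5
    have c: "\<not> w i" "\<not> w (i - 1)" "\<not> w (i + 1)" "\<not> on i" using 5 by (auto simp: classes)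
    show ?thesis using c s_range[of i] s_mid[of i] 5
      by (auto simp: starts_def j joined_def pairs_def ends_def body_def classes)
  next
    case 6
    have c: "\<not> w i" "w (i - 1)" "w (i + 1)" using 6 by (auto simp: classes)
    have b: "bo (i - 1)" using c range[of "i - 1"] by (simp add: body_def)
    have bi: "bo i \<longleftrightarrow> 0 < s i \<or> \<not> x i" using 6 by (auto simp: body_def classes)
    have "jo (i - 1) \<longleftrightarrow> bo i \<and> s i \<le> 1" "jo i \<longleftrightarrow> bo i \<and> s i = 0"
      using c by (auto simp: joined_def pairs_def)
    then show ?thesis using b bi c s_range[of i]
      by (auto simp: starts_def j ends_def)
  qed
qed

lemma count_flags:
  assumes "W b = w" "En b = en"
  shows "int (count_list (slots W En b True (bodies hi)) True) = (\<Sum>i\<in>{lo..<hi}. s i)"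
proof -
  have "int (count_list (slots W En b True (bodies i)) True) = (\<Sum>j\<in>{lo..<i}. s j)" if "lo \<le> i" for i
    using that
  proof (induction i rule: int_ge_induct)
    case (step i)
    have "{lo..<i + 1} = insert i {lo..<i}" using step by auto
    moreover have "count_list (slots W En b True (bodies (i + 1))) True =
      count_list (slots W En b True (bodies i)) True + of_bool (\<not> w i \<and> starts i) + of_bool (\<not> w i \<and> en i)"
      unfolding slots_bodies[where W = W and En = En and b = b, OF step(1) assms] by auto
    ultimately show ?case using step flags[of i] by simp
  qed simp
  then show ?thesis using ne by simp
qed

lemma length_slots_bodies:
  assumes "W b = w" "En b = en"
  shows "int (length (slots W En b True (bodies hi))) = 2 * ct en"
proof -
  have "linked W En (\<lambda>_. gp) b (bodies hi)"
    using linked_bodies[where W = W and En = En and b = b and Gp = "\<lambda>_. gp" and i = lo] assms ne by simp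
  then have "length (slots W En b True (bodies hi)) = 2 * length (filter en (bodies hi))"
    using length_slots[of W En "\<lambda>_. gp" b "bodies hi" True] assms(2) by simp
  then show ?thesis using bodies_ends cnt_nonneg[of lo hi en] by simp
qed

end

text \<open>The budget \<open>h\<close> is the number of minor ends to be formed. A first end on a
  tail or a head is free, two ends on a middle minor force one additional body, and every further
  end forces a body of its own. Taking the cheap ends first keeps the least possible number of
  bodies small.\<close>

locale greedy = chain +
  fixes h :: int
  assumes h0: "0 \<le> h"
begin

definition "m1 = min h (ct ta)"
definition "m2 = min (h - m1) (ct he)"
definition "m3 = min ((h - m1 - m2) div 2) (ct md)"
definition "m4 = min (h - m1 - m2 - 2 * m3) (ct ta)"
definition "m5 = min (h - m1 - m2 - 2 * m3 - m4) (ct he)"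
definition "m6 = min (h - m1 - m2 - 2 * m3 - m4 - m5) (ct on)"
definition "m7 = min (h - m1 - m2 - 2 * m3 - m4 - m5 - m6) (ct on)"

definition "status i = first lo ta m1 i + first lo he m2 i + 2 * first lo md m3 i + first lo ta m4 i
  + first lo he m5 i + first lo on m6 i + first lo on m7 i"

text \<open>Second ends are only handed out once the corresponding first pass has served its whole
  class. Hence \<open>m4 \<le> m1\<close>, \<open>m5 \<le> m2\<close> and
  \<open>m7 \<le> m6\<close>: a second end always goes to a minor that already has one.\<close>

lemma m_bounds:
  "0 \<le> m1" "0 \<le> m2" "0 \<le> m3" "0 \<le> m4" "0 \<le> m5" "0 \<le> m6" "0 \<le> m7"
  "m1 \<le> ct ta" "m2 \<le> ct he" "m3 \<le> ct md" "m4 \<le> m1" "m5 \<le> m2" "m6 \<le> ct on" "m7 \<le> m6"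
  "m1 + m2 + 2 * m3 + m4 + m5 + m6 + m7 \<le> h"
proof -
  note n = cnt_nonneg[of lo hi ta] cnt_nonneg[of lo hi he] cnt_nonneg[of lo hi md] cnt_nonneg[of lo hi on]
  have r1: "0 \<le> h - m1" "0 \<le> m1" "m1 \<le> ct ta" using h0 n by (auto simp: m1_def)
  have r2: "0 \<le> h - m1 - m2" "0 \<le> m2" "m2 \<le> ct he" using r1 n by (auto simp: m2_def)
  have r3: "0 \<le> h - m1 - m2 - 2 * m3" "0 \<le> m3" "m3 \<le> ct md" using r2 n by (auto simp: m3_def)
  have r4: "0 \<le> h - m1 - m2 - 2 * m3 - m4" "0 \<le> m4" "m4 \<le> ct ta" using r3 n by (auto simp: m4_def)
  have r5: "0 \<le> h - m1 - m2 - 2 * m3 - m4 - m5" "0 \<le> m5" "m5 \<le> ct he" using r4 n by (auto simp: m5_def)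
  have r6: "0 \<le> h - m1 - m2 - 2 * m3 - m4 - m5 - m6" "0 \<le> m6" "m6 \<le> ct on" using r5 n by (auto simp: m6_def)
  have r7: "0 \<le> h - m1 - m2 - 2 * m3 - m4 - m5 - m6 - m7" "0 \<le> m7" "m7 \<le> ct on" using r6 n by (auto simp: m7_def)
  have "m1 < ct ta \<Longrightarrow> m4 = 0"
    using r2 r3 r4 unfolding m1_def m4_def by linarith
  moreover have "m2 < ct he \<Longrightarrow> m5 = 0"
    using r2 r3 r4 r5 unfolding m2_def m5_def by linarith
  moreover have "m6 < ct on \<Longrightarrow> m7 = 0"
    using r6 r7 unfolding m6_def m7_def by linarith
  ultimately show "0 \<le> m1" "0 \<le> m2" "0 \<le> m3" "0 \<le> m4" "0 \<le> m5" "0 \<le> m6" "0 \<le> m7"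
    "m1 \<le> ct ta" "m2 \<le> ct he" "m3 \<le> ct md" "m4 \<le> m1" "m5 \<le> m2" "m6 \<le> ct on" "m7 \<le> m6"
    "m1 + m2 + 2 * m3 + m4 + m5 + m6 + m7 \<le> h"
    using r1 r2 r3 r4 r5 r6 r7 by linarith+
qed

sublocale statuses w lo hi status
  by unfold_locales (auto simp: status_def first_def classes)

lemma count_first: "0 \<le> m \<Longrightarrow> m \<le> ct P \<Longrightarrow> (\<Sum>i\<in>{lo..<hi}. first lo P m i) = m"
  using cnt_first[of m lo hi P] unfolding cnt_def[of lo hi] first_def by simp

lemma sum_status: "(\<Sum>i\<in>{lo..<hi}. status i) = m1 + m2 + 2 * m3 + m4 + m5 + m6 + m7"
  using m_bounds unfolding status_def
  by (simp add: sum.distrib sum_distrib_left[symmetric] count_first)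

lemma exclusive:
  "ta i \<Longrightarrow> \<not> he i \<and> \<not> md i \<and> \<not> on i" "he i \<Longrightarrow> \<not> ta i \<and> \<not> md i \<and> \<not> on i"
  "md i \<Longrightarrow> \<not> ta i \<and> \<not> he i \<and> \<not> on i" "on i \<Longrightarrow> \<not> ta i \<and> \<not> he i \<and> \<not> md i"
  by (auto simp: classes)

lemma count_two: "ct (\<lambda>i. status i = 2) = m3 + m4 + m5 + m7"
proof -
  have "ct (\<lambda>i. status i = 2) =
    (\<Sum>i\<in>{lo..<hi}. first lo md m3 i + first lo ta m4 i + first lo he m5 i + first lo on m7 i)"
    unfolding cnt_def
  proof (rule sum.cong)
    fix i
    show "of_bool (status i = 2) = first lo md m3 i + first lo ta m4 i + first lo he m5 i + first lo on m7 i"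
    proof -
      have z: "\<not> P i \<Longrightarrow> first lo P m i = 0" for P m by (simp add: first_def)
      consider "ta i" | "he i" | "md i" | "on i" | "\<not> ta i \<and> \<not> he i \<and> \<not> md i \<and> \<not> on i" by blast
      then show ?thesis
      proof cases
        case 1
        then show ?thesis using exclusive(1) m_bounds(11) by (simp add: status_def z) (auto simp: first_def)
      next
        case 2
        then show ?thesis using exclusive(2) m_bounds(12) by (simp add: status_def z) (auto simp: first_def)
      next
        case 3
        then show ?thesis using exclusive(3) by (simp add: status_def z) (auto simp: first_def)
      next
        case 4
        then show ?thesis using exclusive(4) m_bounds(14) by (simp add: status_def z) (auto simp: first_def)
      qed (simp add: status_def z)
    qed
  qed simp
  then show ?thesis using m_bounds by (simp add: sum.distrib count_first)
qed

lemma count_one_zero: "ct (\<lambda>i. on i \<and> status i = 0) = ct on - m6"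
proof -
  have "ct (\<lambda>i. on i \<and> status i = 0) = (\<Sum>i\<in>{lo..<hi}. of_bool (on i) - first lo on m6 i)"
    unfolding cnt_def
  proof (rule sum.cong)
    fix i
    show "of_bool (on i \<and> status i = 0) = of_bool (on i) - first lo on m6 i"
    proof (cases "on i")
      case True
      have z: "\<not> P i \<Longrightarrow> first lo P m i = 0" for P m by (simp add: first_def)
      show ?thesis using True exclusive(4) m_bounds(14) by (simp add: status_def z) (auto simp: first_def)
    qed (simp add: first_def)
  qed simp
  then show ?thesis using m_bounds by (simp add: sum_subtractf count_first cnt_def)
qed

end

lemma fill_up:
  fixes a b c r :: int
  assumes "x = min r a" "y = min (r - x) b" "z = min (r - x - y) c" "u = min (r - x - y - z) c"
    "0 \<le> a" "0 \<le> b" "0 \<le> c" "r \<le> a + b + 2 * c"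
  shows "x + y + z + u = r"
  using assms by (auto simp: min_def split: if_splits)

text \<open>A chain can be decomposed into any number \<open>k\<close> of bodies within these bounds.\<close>

locale decomposition = chain +
  fixes k :: int
  assumes q: "1 \<le> ct w" and D: "0 \<le> excess w lo hi" "excess w lo hi \<le> k"
    and k: "wide w lo hi + 1 \<le> k" "k \<le> hi - lo"
begin

sublocale greedy w lo hi "k - excess w lo hi"
  using D by unfold_locales simp

lemma sum_status_eq: "(\<Sum>i\<in>{lo..<hi}. status i) = k - excess w lo hi"
proof -
  let ?h = "k - excess w lo hi"
  \<comment> \<open>Here the upper bound on \<open>k\<close> enters: the length exceeds the excess
    by twice the number of minors, and each minor can take at most two ends.\<close>
  have h: "?h \<le> 2 * ct mi" using k(2) count_length by (simp add: excess_def)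
  note n = cnt_nonneg[of lo hi ta] cnt_nonneg[of lo hi he] cnt_nonneg[of lo hi md] cnt_nonneg[of lo hi on]
  have "m1 + m2 + 2 * m3 + m4 + m5 + m6 + m7 = ?h"
  proof (cases "?h \<le> ct ta + ct he")
    case True
    then have "m1 + m2 = ?h" using h0 n by (auto simp: m1_def m2_def)
    then show ?thesis using m_bounds by linarith
  next
    case False
    then have m12: "m1 = ct ta" "m2 = ct he" using n by (auto simp: m1_def m2_def)
    show ?thesis
    proof (cases "(?h - m1 - m2) div 2 < ct md")
      case True
      then have "m3 = (?h - m1 - m2) div 2" by (simp add: m3_def)
      then have r: "?h - m1 - m2 - 2 * m3 = (?h - m1 - m2) mod 2" by (simp add: minus_mult_div_eq_mod)
      show ?thesis
      proof (cases "?h - m1 - m2 - 2 * m3 = 0")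
        case True
        then show ?thesis using m_bounds by linarith
      next
        case False
        then have 1: "?h - m1 - m2 - 2 * m3 = 1" using r by auto
        \<comment> \<open>One end is left over after serving middle minors in pairs. It becomes the
          second end of a tail or a head, and one of these exists because there is a middle
          minor.\<close>
        have "0 < ct md" using True \<open>\<not> ?h \<le> ct ta + ct he\<close> m12 by linarith
        then have "1 \<le> ct ta + ct he" using mid_needs_end[OF q] by simp
        then have "m4 + m5 = 1" using 1 n unfolding m4_def m5_def by linarith
        then show ?thesis using 1 m_bounds by linarith
      qed
    next
      case False
      then have m3: "m3 = ct md" by (simp add: m3_def)
      have "m4 + m5 + m6 + m7 = ?h - m1 - m2 - 2 * m3"
        by (rule fill_up[where a = "ct ta" and b = "ct he" and c = "ct on"])
          (use m12 m3 h count_minors n in \<open>simp_all add: m4_def m5_def m6_def m7_def\<close>)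
      then show ?thesis by simp
    qed
  qed
  then show ?thesis using sum_status by simp
qed

text \<open>The first bound holds since \<open>m1 + m2 + m3 + m6\<close> counts minors with at least
  one end. The second one amounts to the width plus one being at most the excess plus
  \<open>m1 + m2 + m3\<close>: the free ends, together with the excess, must cover the bodies that
  cannot be avoided.\<close>

lemma skip_bounds:
  "0 \<le> skip w lo hi status k" "skip w lo hi status k \<le> ct (place w lo hi status)"
proof -
  note n = cnt_nonneg[of lo hi ta] cnt_nonneg[of lo hi he] cnt_nonneg[of lo hi md] cnt_nonneg[of lo hi on]
    cnt_nonneg[of lo hi pr] cnt_nonneg[of lo hi w]
  let ?D = "excess w lo hi"
  have e: "?D = ct w - ct mi" by (simp add: excess_def)
  have s: "m1 + m2 + 2 * m3 + m4 + m5 + m6 + m7 = k - ?D" using sum_status_eq sum_status by simp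
  have "skip w lo hi status k = ct mi - (m1 + m2 + m3 + m6)"
    using s e count_two by (simp add: skip_def)
  moreover have "m1 + m2 + m3 + m6 \<le> ct mi" using m_bounds count_minors by linarith
  moreover have "wide w lo hi + 1 \<le> ?D + (m1 + m2 + m3)"
  proof (cases "k - ?D \<le> ct ta + ct he")
    case True
    then have "m1 + m2 = k - ?D" using h0 n by (auto simp: m1_def m2_def)
    then show ?thesis using k(1) m_bounds(3) by linarith
  next
    case False
    then have m12: "m1 = ct ta" "m2 = ct he" using n by (auto simp: m1_def m2_def)
    have R: "ct ta = wide w lo hi + 1 - of_bool (w (hi - 1))" "ct he = wide w lo hi + 1 - of_bool (w lo)"
      using count_tails count_heads by (auto simp: wide_def)
    \<comment> \<open>The only critical case has majors at both borders, no excess and no wide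
      block. Then all minors are single and separate runs of majors, which makes the excess
      positive.\<close>
    have "of_bool (w (hi - 1)) + of_bool (w lo) \<le> ?D + wide w lo hi + 1 + m3"
    proof (rule ccontr)
      assume a: "\<not> ?thesis"
      then have b: "w (hi - 1)" "w lo" "?D = 0" "wide w lo hi = 0" "m3 = 0"
        using D(1) wide_nonneg[OF q] m_bounds(3) by (auto split: if_splits simp: of_bool_def)
      then have "ct ta = 0" "ct he = 0" using R by auto
      then have "ct md = 0" using mid_needs_end[OF q] n by linarith
      then have "ct mi = ct on" using count_minors \<open>ct ta = 0\<close> \<open>ct he = 0\<close> by simp
      then show False using b e n unfolding wide_def by linarith
    qed
    then show ?thesis using R m12 by linarith
  qed
  ultimately show "0 \<le> skip w lo hi status k" "skip w lo hi status k \<le> ct (place w lo hi status)"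
    using e n unfolding count_place count_one_zero wide_def by linarith+
qed

abbreviation "xcut \<equiv> cuts w lo hi status (skip w lo hi status k)"

sublocale labelled w lo hi status xcut
  by (rule labelled_cuts)

lemma count_ends_k: "ct en = k"
  using count_ends_cuts[OF skip_bounds] .

lemma balanced_k: "ct gp = ct sp"
  using balanced count_ends_k sum_status_eq by simp

text \<open>If the budget does not exceed the number of wide blocks, only tails are attached.\<close>

lemma few_prescribed:
  assumes "k = wide w lo hi + 1" "1 \<le> excess w lo hi"
  shows "prescribed w lo hi (\<lambda>j. odd j \<and> j < 2 * (k - excess w lo hi)) status
      (\<lambda>i. of_bool (w lo) + cnt lo i (\<lambda>j. tails w lo hi j \<or> heads w lo hi j))"
    and "xcut = (\<lambda>_. False)"
proof -
  let ?h = "k - excess w lo hi"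
  let ?p = "\<lambda>i. of_bool (w lo) + cnt lo i (\<lambda>j. ta j \<or> he j)"
  have R: "ct ta = wide w lo hi + 1 - of_bool (w (hi - 1))" using count_tails by (auto simp: wide_def)
  have "?h \<le> ct ta" using R assms by auto
  then have m: "m1 = ?h" using h0 by (simp add: m1_def)
  then have m0: "m2 = 0" "m3 = 0" "m4 = 0" "m5 = 0" "m6 = 0" "m7 = 0" using m_bounds by linarith+
  have c0: "first lo P 0 i = 0" for P i using cnt_nonneg[of lo i P] by (simp add: first_def)
  have st: "status i = of_bool (ta i \<and> cnt lo i ta < ?h)" for i
    unfolding status_def m m0 c0 by (simp add: first_def)
  \<comment> \<open>Tails and heads alternate. By this formula a tail preceded by \<open>c\<close>
    tails has index \<open>2 * c + 1\<close>, and a head has an even index; so the first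
    \<open>?h\<close> tails are the odd indices below \<open>2 * ?h\<close>.\<close>
  have par: "?p i = 2 * cnt lo i ta + of_bool (w (i - 1) \<or> w i)" if "lo \<le> i" "i < hi" for i
    using that
  proof (induction i rule: int_ge_induct)
    case base
    then show ?case using range[of "lo - 1"] by auto
  next
    case (step i)
    then have "?p i = 2 * cnt lo i ta + of_bool (w (i - 1) \<or> w i)" by simp
    moreover have "of_bool (w (i - 1) \<or> w i) + of_bool (ta i \<or> he i) = 2 * of_bool (ta i) + (of_bool (w i \<or> w (i + 1)) :: int)"
      using step by (cases "w (i - 1)"; cases "w i"; cases "w (i + 1)") (auto simp: classes)
    ultimately show ?case using step(1) by (simp add: cnt_Suc)
  qed
  show "prescribed w lo hi (\<lambda>j. odd j \<and> j < 2 * ?h) status ?p"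
  proof unfold_locales
    fix i
    show "status i = of_bool ((ta i \<or> he i) \<and> odd (?p i) \<and> ?p i < 2 * ?h)"
    proof (cases "lo \<le> i \<and> i < hi")
      case True
      then show ?thesis unfolding st using par[of i] by (auto simp: classes)
    next
      case False
      then show ?thesis unfolding st by (auto simp: classes)
    qed
  qed (use assms D in auto)
  have "skip w lo hi status k = ct (place w lo hi status)"
    unfolding skip_def count_place count_one_zero count_two using m0 assms(1) by (simp add: wide_def)
  then show "xcut = (\<lambda>_. False)" using no_cuts by simp
qed

end

section \<open>The outer chain imitates the inner one\<close>

lemma slots_cong:
  "W b = W' b' \<Longrightarrow> En b = En' b' \<Longrightarrow> slots W En b f xs = slots W' En' b' f xs"
  by (induction xs arbitrary: f) auto

lemma count_list_replicate: "count_list xs True = 0 \<Longrightarrow> xs = replicate (length xs) False"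
  by (induction xs) (auto split: if_splits)

definition flags :: "(int \<Rightarrow> bool) \<Rightarrow> int \<Rightarrow> int \<Rightarrow> (int \<Rightarrow> int) \<Rightarrow> (int \<Rightarrow> bool) \<Rightarrow> bool list" where
  "flags w lo hi s x = slots (\<lambda>_. w) (\<lambda>_. ends w lo hi s x) True True (filter (body w lo hi s x) [lo..hi - 1])"

text \<open>\<open>K\<close> and \<open>KO\<close> are the numbers of bodies of the inner and of the outer chain. The path starts on the outer
  chain; it ends there if \<open>KO = K + 1\<close> and on the inner chain if \<open>KO = K\<close>.\<close>

locale engine = O: chain wO loO hiO + I: decomposition wI loI hiI K
  for wO loO hiO wI loI hiI K +
  fixes KO :: int
  assumes mode: "(KO = K + 1 \<and> excess wO loO hiO = excess wI loI hiI + 1 \<and>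
      (K = wide wO loO hiO \<or> (wide wO loO hiO \<le> K \<and> K = excess wI loI hiI))) \<or>
    (KO = K \<and> K = wide wI loI hiI + 1 \<and> wide wO loO hiO = wide wI loI hiI \<and>
      excess wO loO hiO = excess wI loI hiI \<and> 1 \<le> excess wI loI hiI)"
begin

definition "SI = flags wI loI hiI I.status I.xcut"
text \<open>The ends wanted on the outer chain are those of the inner chain, delayed by one. The
  default \<open>False\<close> before and after the list is a major, for the entries that have no
  partner.\<close>

definition "FA j \<longleftrightarrow> 1 \<le> j \<and> j \<le> int (length SI) \<and> SI ! nat (j - 1)"
definition "sO = attach wO loO hiO FA"
definition "xO = cuts wO loO hiO sO (skip wO loO hiO sO KO)"

lemma length_SI: "int (length SI) = 2 * K"
  unfolding SI_def flags_def using I.length_slots_bodies[of "\<lambda>_. wI" True "\<lambda>_. I.en"] I.count_ends_k by simp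

lemma count_SI: "int (count_list SI True) = K - excess wI loI hiI"
  unfolding SI_def flags_def using I.count_flags[of "\<lambda>_. wI" True "\<lambda>_. I.en"] I.sum_status_eq by simp

sublocale O: statuses wO loO hiO sO
  by unfold_locales (auto simp: sO_def attach_def classes)

sublocale O: labelled wO loO hiO sO xO
  unfolding xO_def by (rule O.labelled_cuts)

lemma skip_O: "skip wO loO hiO sO KO = O.ct wO - KO"
proof -
  have "sO i \<noteq> 2" for i by (simp add: sO_def attach_def)
  then show ?thesis by (simp add: skip_def cnt_def)
qed

lemma place_O: "O.ct (place wO loO hiO sO) = O.ct wO - wide wO loO hiO - 1"
proof -
  have "O.ct (\<lambda>i. O.on i \<and> sO i = 0) = O.ct O.on"
    by (rule cnt_cong) (auto simp: sO_def attach_def classes)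
  then show ?thesis by (simp add: O.count_place wide_def)
qed

lemma map_FA: "map FA [0..2 * K + 1] = False # SI @ [False]"
proof (rule nth_equalityI)
  have K: "0 \<le> K" using I.D by simp
  show "length (map FA [0..2 * K + 1]) = length (False # SI @ [False])"
    using length_SI K by simp
  fix i assume "i < length (map FA [0..2 * K + 1])"
  then have i: "int i \<le> 2 * K + 1" using K by simp
  have "map FA [0..2 * K + 1] ! i = FA (int i)" using i by simp
  also have "\<dots> = (False # SI @ [False]) ! i"
    using i length_SI by (cases i) (auto simp: FA_def nth_append)
  finally show "map FA [0..2 * K + 1] ! i = (False # SI @ [False]) ! i" .
qed

lemma prescribed_O:
  assumes "KO = wide wO loO hiO + 1" "\<not> FA (2 * wide wO loO hiO + 1)"
  shows "O.ct O.en = KO" "flags wO loO hiO sO xO = map FA [0..2 * wide wO loO hiO + 1]"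
proof -
  have x: "xO = (\<lambda>_. False)"
  proof -
    have "skip wO loO hiO sO KO = O.ct (place wO loO hiO sO)"
      using skip_O place_O assms(1) by linarith
    then show ?thesis unfolding xO_def using O.no_cuts by simp
  qed
  interpret P: prescribed wO loO hiO FA sO
    "\<lambda>i. of_bool (wO loO) + cnt loO i (\<lambda>j. tails wO loO hiO j \<or> heads wO loO hiO j)"
    by unfold_locales (use assms(2) in \<open>auto simp: sO_def attach_def FA_def\<close>)
  show "O.ct O.en = KO" using P.count_ends_prescribed x assms(1) by simp
  show "flags wO loO hiO sO xO = map FA [0..2 * wide wO loO hiO + 1]"
    unfolding flags_def x
    using P.slots_prescribed[of "\<lambda>_. wO" True "\<lambda>_. ends wO loO hiO sO (\<lambda>_. False)"] by simp
qed

text \<open>In case \<open>a\<close> the outer chain has its least number of bodies, so its ends can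
  be prescribed. In case \<open>b\<close> the inner budget is zero: all ends are majors, and the
  list is determined by its length. In case \<open>c\<close> only tails of the inner chain are
  attached, fewer than there are bodies; hence the last two entries of its list are majors, as the
  right border of the outer chain and the end of the path require.\<close>

lemma flags_O:
  "O.ct O.en = KO \<and> (if KO = K + 1 then flags wO loO hiO sO xO = False # SI @ [False]
    else flags wO loO hiO sO xO @ [False] = False # SI)"
proof -
  consider (a) "KO = K + 1" "K = wide wO loO hiO"
    | (b) "KO = K + 1" "excess wO loO hiO = K + 1" "wide wO loO hiO \<le> K" "K = excess wI loI hiI"
    | (c) "KO = K" "K = wide wI loI hiI + 1" "wide wO loO hiO = wide wI loI hiI" "1 \<le> excess wI loI hiI"
    using mode by auto
  then show ?thesis
  proof cases
    case a
    have "\<not> FA (2 * K + 1)" using length_SI unfolding FA_def by linarith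
    then have "\<not> FA (2 * wide wO loO hiO + 1)" using a(2) by simp
    then show ?thesis using prescribed_O a map_FA by simp
  next
    case b
    have "count_list SI True = 0" using count_SI b(4) by simp
    then have SI: "SI = replicate (length SI) False" by (rule count_list_replicate)
    then have FA: "\<not> FA j" for j
    proof -
      have "\<not> SI ! nat (j - 1)" if "nat (j - 1) < length SI"
        using that SI by (metis nth_replicate)
      then show ?thesis unfolding FA_def by auto
    qed
    then have s0: "sO i = 0" for i by (simp add: sO_def attach_def)
    have en: "O.ct O.en = KO" unfolding xO_def
    proof (rule O.count_ends_cuts)
      show "0 \<le> skip wO loO hiO sO KO"
        using b cnt_nonneg[of loO hiO O.mi] unfolding skip_O excess_def by linarith
      have "O.ct wO - KO \<le> O.ct (place wO loO hiO sO)"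
        using b unfolding place_O by linarith
      then show "skip wO loO hiO sO KO \<le> O.ct (place wO loO hiO sO)" unfolding skip_O .
    qed
    let ?f = "flags wO loO hiO sO xO"
    have "count_list ?f True = 0"
      using O.count_flags[of "\<lambda>_. wO" True "\<lambda>_. O.en"] s0 unfolding flags_def by simp
    then have "?f = replicate (length ?f) False" by (rule count_list_replicate)
    moreover have "int (length ?f) = 2 * KO"
      using O.length_slots_bodies[of "\<lambda>_. wO" True "\<lambda>_. O.en"] en unfolding flags_def by simp
    then have "length ?f = Suc (length SI + 1)" using length_SI b by linarith
    ultimately have "?f = False # replicate (length SI) False @ [False]"
      by (simp add: replicate_append_same)
    then show ?thesis using en b SI by simp
  next
    case c
    interpret P: prescribed wI loI hiI "\<lambda>j. odd j \<and> j < 2 * (K - excess wI loI hiI)" I.status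
      "\<lambda>i. of_bool (wI loI) + cnt loI i (\<lambda>j. tails wI loI hiI j \<or> heads wI loI hiI j)"
      using I.few_prescribed c by blast
    have SI: "SI = map (\<lambda>j. odd j \<and> j < 2 * (K - excess wI loI hiI)) [0..2 * wide wI loI hiI + 1]"
      unfolding SI_def flags_def I.few_prescribed(2)[OF c(2,4)]
      using P.slots_prescribed[of "\<lambda>_. wI" True "\<lambda>_. ends wI loI hiI I.status (\<lambda>_. False)"] by simp
    have w0: "0 \<le> wide wI loI hiI" using I.wide_nonneg I.q by simp
    have nth: "SI ! nat j \<longleftrightarrow> odd j \<and> j < 2 * (K - excess wI loI hiI)"
      if "0 \<le> j" "j \<le> 2 * wide wI loI hiI + 1" for j
      unfolding SI using that by simp
    have "\<not> FA (2 * wide wO loO hiO + 1)"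
      unfolding FA_def using nth[of "2 * wide wI loI hiI"] w0 c(3) by auto
    moreover have e: "2 * wide wO loO hiO + 1 = 2 * K - 1" "KO = wide wO loO hiO + 1" using c by linarith+
    ultimately have P: "O.ct O.en = KO" "flags wO loO hiO sO xO = map FA [0..2 * K - 1]"
      using prescribed_O[OF e(2)] unfolding e(1) by blast+
    have "\<not> FA (2 * K)"
    proof -
      have "K - excess wI loI hiI \<le> wide wI loI hiI" using c(2,4) by linarith
      then have "\<not> 2 * wide wI loI hiI + 1 < 2 * (K - excess wI loI hiI)" by presburger
      then have n: "\<not> SI ! nat (2 * wide wI loI hiI + 1)" using nth[of "2 * wide wI loI hiI + 1"] w0 by simp
      have "2 * K - 1 = 2 * wide wI loI hiI + 1" using c(2) by simp
      then have "\<not> SI ! nat (2 * K - 1)" using n by metis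
      then show ?thesis unfolding FA_def by blast
    qed
    moreover have "\<not> FA (2 * K + 1)" using length_SI by (simp add: FA_def)
    moreover have "[0..2 * K + 1] = [0..2 * K - 1] @ [2 * K, 2 * K + 1]"
    proof -
      have "1 \<le> K" using c(2) w0 by linarith
      then show ?thesis using upto_Suc[of 0 "2 * K + 1"] upto_Suc[of 0 "2 * K"] by simp
    qed
    ultimately have "map FA [0..2 * K - 1] @ [False, False] = (False # SI) @ [False]"
      using map_FA by simp
    then have "map FA [0..2 * K - 1] @ [False] = False # SI"
      by (metis append.assoc append_Cons append_Nil append1_eq_conv)
    then show ?thesis using P c(1) by simp
  qed
qed

text \<open>Imitation gives both chains the same number of minor ends, and in both modes the number
  of bodies exceeds the excess by the same amount on both chains.\<close>

lemma balanced_O: "O.ct O.gp = O.ct O.sp"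
proof (rule O.balanced)
  have "count_list (flags wO loO hiO sO xO) True = count_list SI True"
  proof (cases "KO = K + 1")
    case False
    then have "count_list (flags wO loO hiO sO xO @ [False]) True = count_list (False # SI) True"
      using flags_O by simp
    then show ?thesis by simp
  qed (use flags_O in simp)
  then have "(\<Sum>i\<in>{loO..<hiO}. sO i) = K - excess wI loI hiI"
    using count_SI O.count_flags[of "\<lambda>_. wO" True "\<lambda>_. O.en"] unfolding flags_def by simp
  then show "O.ct O.en - (\<Sum>i\<in>{loO..<hiO}. sO i) = excess wO loO hiO"
    using flags_O mode by auto
qed

lemma ends_pos: "1 \<le> O.ct O.en"
  using flags_O mode I.D I.k I.wide_nonneg[OF I.q] by auto

end

section \<open>Tests and loops over the cells of a chain\<close>

text \<open>The cells of a chain \<open>c\<close>, with the digit \<open>c\<close> appended to their names: \<open>n\<close> length, \<open>b\<close> offset in the input,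
  \<open>a\<close> sum of the colors as signs, \<open>z\<close> whether black is minor, \<open>d\<close> excess, \<open>l\<close> and \<open>m\<close> bounds of the padded word,
  \<open>r\<close> its width; the arrays \<open>w\<close> majors, \<open>s\<close> statuses, \<open>x\<close> cuts, \<open>y\<close> bodies, \<open>e\<close> ends, \<open>f\<close> flags,
  \<open>g\<close> spines of the gaps, \<open>t\<close> stack; and \<open>u\<close>, the next position of the chain to be visited.\<close>

abbreviation "cI \<equiv> V ''i''"
abbreviation "cIp \<equiv> IAdd cI (IConst 1)"
abbreviation "cIm \<equiv> ISub cI (IConst 1)"

definition pos :: "char \<Rightarrow> string \<Rightarrow> iexp \<Rightarrow> bexp" where
  "pos x c e = ILess (IConst 0) (ICell (x # c) e)"
definition bor :: "bexp \<Rightarrow> bexp \<Rightarrow> bexp" where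
  "bor a b = BNot (BAnd (BNot a) (BNot b))"

lemma bev_simps [simp]:
  "bev (pos x c e) a \<longleftrightarrow> 0 < a (x # c) (iev e a)" "bev (bor b b') a \<longleftrightarrow> bev b a \<or> bev b' a"
  "intb (pos x c e)" "intb (bor b b') \<longleftrightarrow> intb b \<and> intb b'"
  by (auto simp: pos_def bor_def)

abbreviation "cW \<equiv> pos CHR ''w''"

definition incr :: "string \<Rightarrow> iexp \<Rightarrow> com" where
  "incr x e = Asg x (IAdd (V x) e)"

lemma incr_simps [simp]: "straight (incr x e)" "csize (incr x e) = 1"
  "eff (incr x e) a = upd x 0 (a x 0 + iev e a) a"
  by (auto simp: incr_def)

definition loop :: "string \<Rightarrow> com \<Rightarrow> com" where
  "loop c = For (V (CHR ''l'' # c)) (V (CHR ''m'' # c))"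

text \<open>Dominates \<open>52 * N + 2\<close>, the cost of a loop over \<open>N\<close> positions
  whose body has size at most 50, with the guard, the increment and the initialization
  included.\<close>

definition cost :: "int \<Rightarrow> nat" where
  "cost N = 60 * (nat N + 1)"

definition word :: "string \<Rightarrow> (int \<Rightarrow> bool) \<Rightarrow> int \<Rightarrow> int \<Rightarrow> ram \<Rightarrow> bool" where
  "word c w lo hi a \<longleftrightarrow> a (CHR ''w'' # c) = (\<lambda>i. of_bool (w i)) \<and>
     a (CHR ''l'' # c) 0 = lo \<and> a (CHR ''m'' # c) 0 = hi"

definition same :: "string set \<Rightarrow> ram \<Rightarrow> ram \<Rightarrow> bool" where
  "same X a b \<longleftrightarrow> (\<forall>x. x \<notin> X \<longrightarrow> b x = a x)"

lemma same_refl [simp]: "same X a a"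
  by (simp add: same_def)

lemma same_trans: "same X a b \<Longrightarrow> same Y b c \<Longrightarrow> X \<subseteq> Z \<Longrightarrow> Y \<subseteq> Z \<Longrightarrow> same Z a c"
  by (metis same_def subsetD)

lemma same_upd: "same X a b \<Longrightarrow> x \<in> X \<Longrightarrow> same X a (upd x k v b)"
  by (auto simp: same_def)

lemma word_same:
  "word c w lo hi a \<Longrightarrow> same X a b \<Longrightarrow> CHR ''w'' # c \<notin> X \<Longrightarrow> CHR ''l'' # c \<notin> X \<Longrightarrow> CHR ''m'' # c \<notin> X \<Longrightarrow>
    word c w lo hi b"
  by (simp add: word_def same_def)

lemma wp_loop:
  assumes "straight c" "csize c \<le> 50" "word d w lo hi a" "lo \<le> hi" "''i'' \<in> X"
    "CHR ''w'' # d \<notin> X" "CHR ''l'' # d \<notin> X" "CHR ''m'' # d \<notin> X"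
    and "I lo (upd ''i'' 0 lo a)"
    and "\<And>i b. lo \<le> i \<Longrightarrow> i < hi \<Longrightarrow> b ''i'' 0 = i \<Longrightarrow> same X a b \<Longrightarrow> word d w lo hi b \<Longrightarrow> I i b \<Longrightarrow>
      eff c b ''i'' 0 = i \<and> same X a (eff c b) \<and> I (i + 1) (upd ''i'' 0 (i + 1) (eff c b))"
    and "\<And>b. same X a b \<Longrightarrow> word d w lo hi b \<Longrightarrow> I hi b \<Longrightarrow> Q b"
  shows "wp (loop d c) (cost (hi - lo)) Q a"
  unfolding loop_def
proof (rule wp_For[where lo = lo and hi = hi and I = "\<lambda>i b. b ''i'' 0 = i \<and> same X a b \<and> I i b"])
  have w: "word d w lo hi b" if "same X a b" for b
    using word_same[OF assms(3) that] assms(6-8) by simp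
  show "iev (V (CHR ''l'' # d)) a = lo" using assms(3) by (simp add: word_def)
  show "upd ''i'' 0 lo a ''i'' 0 = lo \<and> same X a (upd ''i'' 0 lo a) \<and> I lo (upd ''i'' 0 lo a)"
    using assms(5,9) by (simp add: same_upd)
  show "upd ''i'' 0 (eff c b ''i'' 0 + 1) (eff c b) ''i'' 0 = i + 1 \<and>
      same X a (upd ''i'' 0 (eff c b ''i'' 0 + 1) (eff c b)) \<and> I (i + 1) (upd ''i'' 0 (eff c b ''i'' 0 + 1) (eff c b))"
    if "lo \<le> i" "i < hi" "b ''i'' 0 = i \<and> same X a b \<and> I i b" for i b
    using assms(5) assms(10)[of i b] that w[of b] by (auto intro: same_upd)
  show "b ''i'' 0 = i \<and> iev (V (CHR ''m'' # d)) b = hi"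
    if "lo \<le> i" "i \<le> hi" "b ''i'' 0 = i \<and> same X a b \<and> I i b" for i b
    using that w[of b] by (simp add: word_def)
  show "Q b" if "b ''i'' 0 = hi \<and> same X a b \<and> I hi b" for b
    using that w[of b] assms(11) by blast
  have "nat (hi - lo) * csize c \<le> nat (hi - lo) * 50" using assms(2) by (rule mult_left_mono) simp
  then show "nat (hi - lo) * (csize c + 2) + 2 \<le> cost (hi - lo)"
    unfolding cost_def add_mult_distrib2 by linarith
qed (use assms(1,4) in auto)

section \<open>Statuses\<close>

definition isT :: "string \<Rightarrow> bexp" where
  "isT c = BAnd (BNot (cW c cI)) (BAnd (cW c cIm) (BNot (cW c cIp)))"
definition isH :: "string \<Rightarrow> bexp" where
  "isH c = BAnd (BNot (cW c cI)) (BAnd (BNot (cW c cIm)) (cW c cIp))"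
definition isM :: "string \<Rightarrow> bexp" where
  "isM c = BAnd (BNot (cW c cI)) (BAnd (BNot (cW c cIm)) (BNot (cW c cIp)))"
definition isO :: "string \<Rightarrow> bexp" where
  "isO c = BAnd (BNot (cW c cI)) (BAnd (cW c cIm) (cW c cIp))"

lemma bev_class:
  assumes "word c w lo hi b" "b ''i'' 0 = i" "lo \<le> i" "i < hi"
  shows "bev (isT c) b \<longleftrightarrow> tails w lo hi i" "bev (isH c) b \<longleftrightarrow> heads w lo hi i"
    "bev (isM c) b \<longleftrightarrow> mids w lo hi i" "bev (isO c) b \<longleftrightarrow> ones w lo hi i"
    "intb (isT c)" "intb (isH c)" "intb (isM c)" "intb (isO c)"
  using assms by (auto simp: isT_def isH_def isM_def isO_def word_def classes)

text \<open>Comparing the remaining budget with \<open>d\<close> replaces counting: each minor of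
  the class is served while \<open>d\<close> can be afforded, which selects the first
  \<open>h div d\<close> of them.\<close>

definition passc :: "(string \<Rightarrow> bexp) \<Rightarrow> int \<Rightarrow> string \<Rightarrow> com" where
  "passc cls d c = loop c (Cond (BAnd (cls c) (ILess (IConst (d - 1)) (V ''h'')))
     (Sequ (IAssign (CHR ''s'' # c) cI (IAdd (ICell (CHR ''s'' # c) cI) (IConst d))) (incr ''h'' (IConst (- d))))
     Skip)"

lemma wp_pass:
  assumes "word c w lo hi a" "lo \<le> hi" "0 < d" "0 \<le> h" "a ''h'' 0 = h"
    and cls: "\<And>b i. word c w lo hi b \<Longrightarrow> b ''i'' 0 = i \<Longrightarrow> lo \<le> i \<Longrightarrow> i < hi \<Longrightarrow> bev (cls c) b \<longleftrightarrow> P i" "intb (cls c)"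
    and P: "\<And>i. P i \<Longrightarrow> lo \<le> i \<and> i < hi"
    and n: "n = min (h div d) (cnt lo hi P)"
  shows "wp (passc cls d c) (cost (hi - lo)) (\<lambda>b. same {''i'', ''h'', CHR ''s'' # c} a b \<and> word c w lo hi b \<and>
     b ''h'' 0 = h - d * n \<and> b (CHR ''s'' # c) = (\<lambda>i. a (CHR ''s'' # c) i + d * first lo P n i)) a"
  unfolding passc_def
proof (rule wp_loop[OF _ _ assms(1,2), where X = "{''i'', ''h'', CHR ''s'' # c}" and
    I = "\<lambda>i b. b ''h'' 0 = h - d * min (h div d) (cnt lo i P) \<and>
      (\<forall>j. b (CHR ''s'' # c) j = a (CHR ''s'' # c) j + (if j < i then d * first lo P (h div d) j else 0))"])
  let ?body = "Cond (BAnd (cls c) (ILess (IConst (d - 1)) (V ''h'')))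
    (Sequ (IAssign (CHR ''s'' # c) cI (IAdd (ICell (CHR ''s'' # c) cI) (IConst d))) (incr ''h'' (IConst (- d)))) Skip"
  have h: "0 \<le> h div d" using assms(3,4) by (simp add: pos_imp_zdiv_nonneg_iff)
  have f0: "first lo P m j = 0" if "j < lo" for j m using that P[of j] by (auto simp: first_def)
  show "upd ''i'' 0 lo a ''h'' 0 = h - d * min (h div d) (cnt lo lo P) \<and>
     (\<forall>j. upd ''i'' 0 lo a (CHR ''s'' # c) j = a (CHR ''s'' # c) j + (if j < lo then d * first lo P (h div d) j else 0))"
    using assms(5) h f0 by simp
  show "eff ?body b ''i'' 0 = i \<and>
      same {''i'', ''h'', CHR ''s'' # c} a (eff ?body b) \<and>
      upd ''i'' 0 (i + 1) (eff ?body b) ''h'' 0 =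
        h - d * min (h div d) (cnt lo (i + 1) P) \<and>
      (\<forall>j. upd ''i'' 0 (i + 1) (eff ?body b) (CHR ''s'' # c) j =
        a (CHR ''s'' # c) j + (if j < i + 1 then d * first lo P (h div d) j else 0))"
    if i: "lo \<le> i" "i < hi" "b ''i'' 0 = i" "same {''i'', ''h'', CHR ''s'' # c} a b" "word c w lo hi b" and
      I: "b ''h'' 0 = h - d * min (h div d) (cnt lo i P) \<and>
      (\<forall>j. b (CHR ''s'' # c) j = a (CHR ''s'' # c) j + (if j < i then d * first lo P (h div d) j else 0))" for i b
  proof -
    have g: "d - 1 < b ''h'' 0 \<longleftrightarrow> cnt lo i P < h div d"
    proof
      assume "d - 1 < b ''h'' 0"
      show "cnt lo i P < h div d"
      proof (rule ccontr)
        assume "\<not> cnt lo i P < h div d"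
        then have "b ''h'' 0 = h - d * (h div d)" using I by simp
        then have "b ''h'' 0 = h mod d" by (simp add: minus_mult_div_eq_mod)
        moreover have "h mod d < d" using assms(3) by simp
        ultimately show False using \<open>d - 1 < b ''h'' 0\<close> by linarith
      qed
    next
      assume c: "cnt lo i P < h div d"
      then have "d * (cnt lo i P + 1) \<le> d * (h div d)" using assms(3) by (intro mult_left_mono) auto
      also have "\<dots> \<le> h" using assms(3) by (simp add: mult.commute minus_mod_eq_mult_div[symmetric])
      finally show "d - 1 < b ''h'' 0" using I c by (simp add: algebra_simps)
    qed
    have t: "bev (cls c) b \<longleftrightarrow> P i" using cls(1)[OF i(5,3,1,2)] .
    have j: "j < i + 1 \<longleftrightarrow> j < i \<or> j = i" for j by auto
    show ?thesis
    proof (cases "P i \<and> cnt lo i P < h div d")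
      case True
      then have "min (h div d) (cnt lo (i + 1) P) = min (h div d) (cnt lo i P) + 1" "first lo P (h div d) i = 1"
        using i(1) by (auto simp: cnt_Suc first_def)
      then show ?thesis using i I g t True unfolding j
        by (simp add: distrib_left same_upd)
    next
      case False
      then have "min (h div d) (cnt lo (i + 1) P) = min (h div d) (cnt lo i P)" "first lo P (h div d) i = 0"
        using i(1) by (auto simp: cnt_Suc first_def)
      then show ?thesis using i I g t False unfolding j by auto
    qed
  qed
  show "same {''i'', ''h'', CHR ''s'' # c} a b \<and> word c w lo hi b \<and> b ''h'' 0 = h - d * n \<and>
      b (CHR ''s'' # c) = (\<lambda>i. a (CHR ''s'' # c) i + d * first lo P n i)"
    if b: "same {''i'', ''h'', CHR ''s'' # c} a b" "word c w lo hi b" and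
      I: "b ''h'' 0 = h - d * min (h div d) (cnt lo hi P) \<and>
      (\<forall>j. b (CHR ''s'' # c) j = a (CHR ''s'' # c) j + (if j < hi then d * first lo P (h div d) j else 0))" for b
  proof -
    have "(if j < hi then d * first lo P (h div d) j else 0) = d * first lo P n j" for j
    proof (cases "P j")
      case True
      then have j: "lo \<le> j" "j < hi" using P by auto
      have "cnt lo (j + 1) P \<le> cnt lo hi P" using j by (intro cnt_mono) simp
      then have "cnt lo j P < cnt lo hi P" using True j by (simp add: cnt_Suc)
      then show ?thesis using j by (auto simp: first_def n)
    qed (simp add: first_def)
    then show ?thesis using b I by (auto simp: n)
  qed
qed (use cls in auto)

definition greedyc :: "string \<Rightarrow> com" where
  "greedyc c = Sequ (passc isT 1 c) (Sequ (passc isH 1 c) (Sequ (passc isM 2 c) (Sequ (passc isT 1 c)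
     (Sequ (passc isH 1 c) (Sequ (passc isO 1 c) (passc isO 1 c))))))"

lemma wp_greedy:
  assumes "greedy w lo hi h" "word c w lo hi a" "a ''h'' 0 = h" "a (CHR ''s'' # c) = (\<lambda>i. 0)"
  shows "wp (greedyc c) (7 * cost (hi - lo)) (\<lambda>b. same {''i'', ''h'', CHR ''s'' # c} a b \<and> word c w lo hi b \<and>
     b (CHR ''s'' # c) = greedy.status w lo hi h) a"
proof -
  interpret greedy w lo hi h by (rule assms(1))
  let ?X = "{''i'', ''h'', CHR ''s'' # c}"
  define S where "S k g b \<longleftrightarrow> same ?X a b \<and> word c w lo hi b \<and> b ''h'' 0 = k \<and> b (CHR ''s'' # c) = g" for k g b
  have P: "wp (passc cls d c) (cost (hi - lo)) (S (k - d * n) (\<lambda>i. g i + d * first lo P n i)) b"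
    if "S k g b" "0 < d" "0 \<le> k"
      "\<And>b i. word c w lo hi b \<Longrightarrow> b ''i'' 0 = i \<Longrightarrow> lo \<le> i \<Longrightarrow> i < hi \<Longrightarrow> bev (cls c) b \<longleftrightarrow> P i" "intb (cls c)"
      "\<And>i. P i \<Longrightarrow> lo \<le> i \<and> i < hi" "n = min (k div d) (ct P)" for cls d k g b P n
  proof -
    have "wp (passc cls d c) (cost (hi - lo)) (\<lambda>b'. same ?X b b' \<and> word c w lo hi b' \<and>
       b' ''h'' 0 = k - d * n \<and> b' (CHR ''s'' # c) = (\<lambda>i. b (CHR ''s'' # c) i + d * first lo P n i)) b"
      using that ne by (intro wp_pass) (auto simp: S_def)
    then show ?thesis
      by (rule wp_mono) (use that(1) in \<open>auto simp: S_def elim: same_trans\<close>)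
  qed
  have 0: "S h (\<lambda>i. 0) a" using assms by (simp add: S_def)
  note B = m_bounds
  note T = bev_class(1)[where c = c] bev_class(5)[where c = c]
  have c1: "\<And>i. ta i \<Longrightarrow> lo \<le> i \<and> i < hi" "\<And>i. he i \<Longrightarrow> lo \<le> i \<and> i < hi"
    "\<And>i. md i \<Longrightarrow> lo \<le> i \<and> i < hi" "\<And>i. on i \<Longrightarrow> lo \<le> i \<and> i < hi" by (auto simp: classes)
  have i: "intb (isT c)" "intb (isH c)" "intb (isM c)" "intb (isO c)"
    by (auto simp: isT_def isH_def isM_def isO_def)
  have "wp (greedyc c) (cost (hi - lo) + (cost (hi - lo) + (cost (hi - lo) + (cost (hi - lo) + (cost (hi - lo) +
      (cost (hi - lo) + cost (hi - lo))))))) 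
     (S (h - 1 * m1 - 1 * m2 - 2 * m3 - 1 * m4 - 1 * m5 - 1 * m6 - 1 * m7)
       (\<lambda>i. 0 + 1 * first lo ta m1 i + 1 * first lo he m2 i + 2 * first lo md m3 i + 1 * first lo ta m4 i
         + 1 * first lo he m5 i + 1 * first lo on m6 i + 1 * first lo on m7 i)) a"
    unfolding greedyc_def
    by (rule wp_sequ, rule P[where cls = isT and P = ta and n = m1 and d = 1], rule 0, simp, (use B in simp), rule bev_class(1), assumption+, rule i(1), rule c1(1), assumption, simp add: m1_def,
        rule wp_sequ, rule P[where cls = isH and P = he and n = m2 and d = 1], assumption, simp, (use B in simp), rule bev_class(2), assumption+, rule i(2), rule c1(2), assumption, simp add: m2_def,
        rule wp_sequ, rule P[where cls = isM and P = md and n = m3 and d = 2], assumption, simp, (use B in simp), rule bev_class(3), assumption+, rule i(3), rule c1(3), assumption, simp add: m3_def,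
        rule wp_sequ, rule P[where cls = isT and P = ta and n = m4 and d = 1], assumption, simp, (use B in simp), rule bev_class(1), assumption+, rule i(1), rule c1(1), assumption, simp add: m4_def,
        rule wp_sequ, rule P[where cls = isH and P = he and n = m5 and d = 1], assumption, simp, (use B in simp), rule bev_class(2), assumption+, rule i(2), rule c1(2), assumption, simp add: m5_def,
        rule wp_sequ, rule P[where cls = isO and P = on and n = m6 and d = 1], assumption, simp, (use B in simp), rule bev_class(4), assumption+, rule i(4), rule c1(4), assumption, simp add: m6_def,
        rule P[where cls = isO and P = on and n = m7 and d = 1], assumption, simp, (use B in simp), rule bev_class(4), assumption+, rule i(4), rule c1(4), assumption, simp add: m7_def)
  then show ?thesis
    by (rule wp_mono) (auto simp: S_def status_def)
qed

section \<open>Cuts and ends of bodies\<close>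

definition skipc :: "string \<Rightarrow> iexp \<Rightarrow> com" where
  "skipc c e = Sequ (Asg ''k'' (ISub (IConst 0) e)) (loop c (Cond (cW c cI) (incr ''k'' (IConst 1))
     (Cond (ILess (IConst 1) (ICell (CHR ''s'' # c) cI)) (incr ''k'' (IConst 1)) Skip)))"

lemma wp_skip:
  assumes "statuses w lo hi s" "word c w lo hi a" "a (CHR ''s'' # c) = s" "iev e a = T"
  shows "wp (skipc c e) (cost (hi - lo) + 1) (\<lambda>b. same {''i'', ''k''} a b \<and> word c w lo hi b \<and>
    b ''k'' 0 = skip w lo hi s T) a"
proof -
  interpret statuses w lo hi s by (rule assms(1))
  let ?X = "{''i'', ''k''}"
  define b0 where "b0 = upd ''k'' 0 (- T) a"
  have b0: "word c w lo hi b0" "same ?X a b0"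
    using assms(2) by (auto simp: b0_def word_def same_upd)
  have "wp (loop c (Cond (cW c cI) (incr ''k'' (IConst 1))
     (Cond (ILess (IConst 1) (ICell (CHR ''s'' # c) cI)) (incr ''k'' (IConst 1)) Skip))) (cost (hi - lo))
     (\<lambda>b. same ?X a b \<and> word c w lo hi b \<and> b ''k'' 0 = skip w lo hi s T) b0"
  proof (rule wp_loop[where X = ?X and I = "\<lambda>i b. b ''k'' 0 = cnt lo i w + cnt lo i (\<lambda>j. s j = 2) - T", OF _ _ b0(1)],
      goal_cases)
    case (9 i b)
    then have "b (CHR ''w'' # c) i = of_bool (w i)" "b (CHR ''s'' # c) i = s i"
      using assms(3) b0(2) by (auto simp: word_def same_def)
    moreover have "w i \<Longrightarrow> s i \<noteq> 2" using major0[of i] by (simp add: classes)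
    ultimately show ?case
      using 9 range012[of i] by (auto simp: cnt_Suc same_upd)
  next
    case (10 b)
    then show ?case using same_trans[OF b0(2) 10(1)] by (simp add: skip_def)
  qed (use ne b0 in \<open>auto simp: b0_def\<close>)
  note L = this
  have A: "wp (Asg ''k'' (ISub (IConst 0) e)) 1 (\<lambda>b. b = b0) a"
    by (rule wp_straight) (simp_all add: assms(4) b0_def)
  show ?thesis
    unfolding skipc_def add.commute[of "cost (hi - lo)" 1]
    by (rule wp_sequ[OF A]) (simp add: L)
qed

text \<open>The cell \<open>k\<close> counts down the places still to be spared. Bodies are marked
  in the same pass, since whether a single minor of status 0 belongs to a body is decided together
  with its cut.\<close>

definition cutc :: "string \<Rightarrow> com" where
  "cutc c = (let take = Cond (ILess (IConst 0) (V ''k'')) (incr ''k'' (IConst (- 1)));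
      cut = IAssign (CHR ''x'' # c) cI (IConst 1); bdy = IAssign (CHR ''y'' # c) cI (IConst 1) in
    loop c (Cond (cW c cI)
      (Sequ bdy (Cond (cW c cIp) (take cut) Skip))
      (Cond (ILess (IConst 0) (ICell (CHR ''s'' # c) cI)) bdy
        (Cond (BAnd (cW c cIm) (cW c cIp)) (Cond (ILess (IConst 0) (V ''k'')) (Sequ (incr ''k'' (IConst (- 1))) bdy) cut) Skip))))"

lemma wp_cut:
  assumes "statuses w lo hi s" "word c w lo hi a" "a (CHR ''s'' # c) = s" "a (CHR ''x'' # c) = (\<lambda>i. 0)"
    "a (CHR ''y'' # c) = (\<lambda>i. 0)" "0 \<le> a ''k'' 0"
  shows "wp (cutc c) (cost (hi - lo)) (\<lambda>b. same {''i'', ''k'', CHR ''x'' # c, CHR ''y'' # c} a b \<and> word c w lo hi b \<and>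
    b (CHR ''x'' # c) = (\<lambda>i. of_bool (cuts w lo hi s (a ''k'' 0) i)) \<and>
    b (CHR ''y'' # c) = (\<lambda>i. of_bool (body w lo hi s (cuts w lo hi s (a ''k'' 0)) i))) a"
proof -
  interpret statuses w lo hi s by (rule assms(1))
  let ?X = "{''i'', ''k'', CHR ''x'' # c, CHR ''y'' # c}"
  define K where "K = a ''k'' 0"
  define P where "P = place w lo hi s"
  define x where "x = cuts w lo hi s K"
  define y where "y = body w lo hi s x"
  show ?thesis
    unfolding cutc_def Let_def K_def[symmetric] x_def[symmetric] y_def[symmetric]
  proof (rule wp_loop[where X = ?X and I = "\<lambda>i b. b ''k'' 0 = max 0 (K - cnt lo i P) \<and>
      (\<forall>j. b (CHR ''x'' # c) j = of_bool (j < i \<and> x j)) \<and> (\<forall>j. b (CHR ''y'' # c) j = of_bool (j < i \<and> y j))",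
      OF _ _ assms(2)], goal_cases)
    case 8
    have "\<not> (j < lo \<and> x j)" "\<not> (j < lo \<and> y j)" for j
      using range[of j] by (auto simp: x_def y_def cuts_def place_def body_def classes)
    then show ?case using assms(4-6) by (auto simp: K_def)
  next
    case (9 i b)
    have w: "b (CHR ''w'' # c) j = of_bool (w j)" for j using 9(5) by (simp add: word_def)
    have s: "b (CHR ''s'' # c) = s" using 9(4) assms(3) by (simp add: same_def)
    have k: "0 < b ''k'' 0 \<longleftrightarrow> cnt lo i P < K" using 9(6) by auto
    have xi: "x i \<longleftrightarrow> P i \<and> K \<le> cnt lo i P" by (simp add: x_def cuts_def P_def)
    have c': "cnt lo (i + 1) P = cnt lo i P + of_bool (P i)" using 9(1) by (rule cnt_Suc)
    have j: "j < i + 1 \<longleftrightarrow> j < i \<or> j = i" for j by auto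
    have on: "ones w lo hi i \<longleftrightarrow> \<not> w i \<and> w (i - 1) \<and> w (i + 1)" using 9(1,2) by (auto simp: classes)
    have Pi: "P i \<longleftrightarrow> (w i \<and> w (i + 1)) \<or> (\<not> w i \<and> w (i - 1) \<and> w (i + 1) \<and> s i = 0)"
      using on by (auto simp: P_def place_def pairs_def)
    have yi: "y i \<longleftrightarrow> w i \<or> 0 < s i \<or> (\<not> w i \<and> w (i - 1) \<and> w (i + 1) \<and> \<not> x i)"
      using on 9(1,2) by (auto simp: y_def body_def)
    have s0: "s i = 0 \<longleftrightarrow> \<not> 0 < s i" using range012[of i] by auto
    have i: "b ''i'' 0 = i" by (rule 9(3))
    have sm: "same ?X a b" by (rule 9(4))
    note I = 9(6)
    show ?case
    proof (cases "P i")
      case True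
      show ?thesis
      proof (cases "cnt lo i P < K")
        case k': True
        then have "max 0 (K - cnt lo (i + 1) P) = max 0 (K - cnt lo i P) - 1" using c' True by simp
        then show ?thesis using I w s i k k' True sm xi yi Pi s0 unfolding j
          by (auto simp: same_upd)
      next
        case k': False
        then have "max 0 (K - cnt lo (i + 1) P) = max 0 (K - cnt lo i P)" using c' True by simp
        then show ?thesis using I w s i k k' True sm xi yi Pi s0 unfolding j
          by (auto simp: same_upd)
      qed
    next
      case False
      then have "cnt lo (i + 1) P = cnt lo i P" using c' by simp
      then show ?thesis using I w s i k False sm xi yi Pi s0 unfolding j
        by (auto simp: same_upd)
    qed
  next
    case (10 b)
    have "x j \<Longrightarrow> j < hi" "y j \<Longrightarrow> j < hi" for j
      using range[of j] by (auto simp: x_def y_def cuts_def place_def body_def classes)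
    then show ?case using 10 by (auto simp: fun_eq_iff)
  qed (use ne in auto)
qed

text \<open>Lists are stored from cell 1 on, with \<open>False\<close> elsewhere, which is what the
  untouched cells of the array contain. Reading before or after the list is thus harmless and agrees
  with \<open>FA\<close>.\<close>

definition lookup :: "bool list \<Rightarrow> int \<Rightarrow> bool" where
  "lookup xs j \<longleftrightarrow> 1 \<le> j \<and> j \<le> int (length xs) \<and> xs ! nat (j - 1)"

lemma lookup_snoc: "lookup (xs @ [v]) j \<longleftrightarrow> (if j = int (length xs) + 1 then v else lookup xs j)"
  by (auto simp: lookup_def nth_append nat_less_iff)

definition pushc :: "string \<Rightarrow> com" where
  "pushc c = Sequ (IAssign (CHR ''f'' # c) (V ''p'') (ISub (IConst 1) (ICell (CHR ''w'' # c) cI))) (incr ''p'' (IConst 1))"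

lemma push_simps [simp]: "straight (pushc c)" "csize (pushc c) = 2"
  by (auto simp: pushc_def)

lemma eff_push:
  assumes "b ''i'' 0 = i" "b (CHR ''w'' # c) i = of_bool v" "b ''p'' 0 = int (length xs) + 1"
    "\<And>j. b (CHR ''f'' # c) j = of_bool (lookup xs j)"
  shows "eff (pushc c) b ''p'' 0 = int (length (xs @ [\<not> v])) + 1"
    "eff (pushc c) b (CHR ''f'' # c) j = of_bool (lookup (xs @ [\<not> v]) j)"
    "same {''p'', CHR ''f'' # c} b (eff (pushc c) b)"
  using assms by (auto simp: pushc_def lookup_snoc same_def)

text \<open>The mark \<open>e\<close> of the previous position is final when \<open>i\<close> is
  reached, so a left end is recognized by looking at \<open>i - 1\<close> only. The last two
  comparisons together test whether the status plus the major bit on the left equals 1, the third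
  clause of \<open>joined\<close>.\<close>

definition endsc :: "string \<Rightarrow> com" where
  "endsc c = (let push = pushc c; bd = pos CHR ''y'' c; en = IAssign (CHR ''e'' # c) cI (IConst 1); fin = Sequ en push in
    Sequ (Asg ''p'' (IConst 1)) (loop c (Cond (bd cI)
      (Sequ (Cond (BAnd (bd cIm) (BNot (pos CHR ''e'' c cIm))) Skip push)
        (Cond (cW c cI)
          (Cond (cW c cIp) (Cond (pos CHR ''x'' c cI) fin Skip)
            (Cond (BAnd (bd cIp) (ILess (ICell (CHR ''s'' # c) cIp) (IConst 2))) Skip fin))
          (Cond (BAnd (cW c cIp) (BAnd (ILess (IAdd (ICell (CHR ''s'' # c) cI) (ICell (CHR ''w'' # c) cIm)) (IConst 2))
              (ILess (IConst 0) (IAdd (ICell (CHR ''s'' # c) cI) (ICell (CHR ''w'' # c) cIm))))) Skip fin)))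
      Skip)))"

lemma wp_ends:
  assumes "labelled w lo hi s x" "word c w lo hi a" "a (CHR ''s'' # c) = s" "a (CHR ''x'' # c) = (\<lambda>i. of_bool (x i))"
    "a (CHR ''y'' # c) = (\<lambda>i. of_bool (body w lo hi s x i))" "a (CHR ''e'' # c) = (\<lambda>i. 0)" "a (CHR ''f'' # c) = (\<lambda>i. 0)"
  shows "wp (endsc c) (cost (hi - lo) + 1) (\<lambda>b. same {''i'', ''p'', CHR ''e'' # c, CHR ''f'' # c} a b \<and> word c w lo hi b \<and>
    b (CHR ''e'' # c) = (\<lambda>i. of_bool (ends w lo hi s x i)) \<and>
    b (CHR ''f'' # c) = (\<lambda>i. of_bool (lookup (flags w lo hi s x) i))) a"
proof -
  interpret labelled w lo hi s x by (rule assms(1))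
  let ?X = "{''i'', ''p'', CHR ''e'' # c, CHR ''f'' # c}"
  let ?body = "Cond (pos CHR ''y'' c cI)
      (Sequ (Cond (BAnd (pos CHR ''y'' c cIm) (BNot (pos CHR ''e'' c cIm))) Skip (pushc c))
        (Cond (cW c cI)
          (Cond (cW c cIp) (Cond (pos CHR ''x'' c cI) (Sequ (IAssign (CHR ''e'' # c) cI (IConst 1)) (pushc c)) Skip)
            (Cond (BAnd (pos CHR ''y'' c cIp) (ILess (ICell (CHR ''s'' # c) cIp) (IConst 2))) Skip (Sequ (IAssign (CHR ''e'' # c) cI (IConst 1)) (pushc c))))
          (Cond (BAnd (cW c cIp) (BAnd (ILess (IAdd (ICell (CHR ''s'' # c) cI) (ICell (CHR ''w'' # c) cIm)) (IConst 2))
              (ILess (IConst 0) (IAdd (ICell (CHR ''s'' # c) cI) (ICell (CHR ''w'' # c) cIm))))) Skip (Sequ (IAssign (CHR ''e'' # c) cI (IConst 1)) (pushc c)))))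
      Skip"
  define F where "F i = slots (\<lambda>_. w) (\<lambda>_. en) True True (bodies i)" for i
  define b0 where "b0 = upd ''p'' 0 1 a"
  have b0: "word c w lo hi b0" "same ?X a b0"
    using assms(2) by (auto simp: b0_def word_def same_upd)
  show ?thesis
    unfolding endsc_def Let_def flags_def F_def[symmetric]
    unfolding add.commute[of "cost (hi - lo)" 1]
  proof (rule wp_sequ[where R = "\<lambda>b. b = b0"])
    show "wp (Asg ''p'' (IConst 1)) 1 (\<lambda>b. b = b0) a"
      by (rule wp_straight) (simp_all add: b0_def)
    fix b1 assume "b1 = b0"
    then have b1: "word c w lo hi b1" "same ?X a b1" "b1 ''p'' 0 = 1"
      "b1 (CHR ''e'' # c) = (\<lambda>i. 0)" "b1 (CHR ''f'' # c) = (\<lambda>i. 0)"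
      using b0 assms(6,7) by (simp_all add: b0_def)
    show "wp (loop c ?body) (cost (hi - lo)) (\<lambda>b. same ?X a b \<and> word c w lo hi b \<and> b (CHR ''e'' # c) = (\<lambda>i. of_bool (en i)) \<and>
        b (CHR ''f'' # c) = (\<lambda>i. of_bool (lookup (F hi) i))) b1"
    proof (rule wp_loop[where X = ?X and I = "\<lambda>i b. b ''p'' 0 = int (length (F i)) + 1 \<and>
        (\<forall>j. b (CHR ''e'' # c) j = of_bool (j < i \<and> en j)) \<and> (\<forall>j. b (CHR ''f'' # c) j = of_bool (lookup (F i) j))",
        OF _ _ b1(1)], goal_cases)
      case 8
      have "\<not> (j < lo \<and> en j)" for j by (auto simp: ends_def body_def)
      then show ?case using b1(3-5) by (simp add: F_def lookup_def)
    next
      case (9 i b)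
      have sab: "same ?X a b" using same_trans[OF b1(2) 9(4), of ?X] by simp
      have w: "b (CHR ''w'' # c) j = of_bool (w j)" for j using 9(5) by (simp add: word_def)
      have s: "b (CHR ''s'' # c) = s" and x: "b (CHR ''x'' # c) j = of_bool (x j)"
        and y: "b (CHR ''y'' # c) j = of_bool (bo j)" for j
        using sab assms(3-5) by (auto simp: same_def)
      have i: "b ''i'' 0 = i" by (rule 9(3))
      have I: "b ''p'' 0 = int (length (F i)) + 1" "\<And>j. b (CHR ''e'' # c) j = of_bool (j < i \<and> en j)"
        "\<And>j. b (CHR ''f'' # c) j = of_bool (lookup (F i) j)" using 9(6) by auto
      have F: "F (i + 1) = F i @ (if starts i then [\<not> w i] else []) @ (if en i then [\<not> w i] else [])"
        unfolding F_def by (rule slots_bodies) (use 9(1) in auto)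
      have F2: "F (i + 1) = (if starts i then F i @ [\<not> w i] else F i) @ (if en i then [\<not> w i] else [])"
        using F by simp
      have j: "j < i + 1 \<longleftrightarrow> j < i \<or> j = i" for j by auto
      \<comment> \<open>The round is split into stages: \<open>b1'\<close> after recording a left
        end, \<open>b2\<close> after marking a right end, \<open>b3\<close> after recording that one
        too.\<close>
      define b1' where "b1' = (if starts i then eff (pushc c) b else b)"
      define xs1 where "xs1 = (if starts i then F i @ [\<not> w i] else F i)"
      have 1: "b1' ''p'' 0 = int (length xs1) + 1" "\<And>j. b1' (CHR ''f'' # c) j = of_bool (lookup xs1 j)"
        "same {''p'', CHR ''f'' # c} b b1'"
        using eff_push[OF i w I(1,3)] I by (auto simp: b1'_def xs1_def)
      define b2 where "b2 = upd (CHR ''e'' # c) i 1 b1'"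
      have 2: "b2 ''i'' 0 = i" "b2 (CHR ''w'' # c) i = of_bool (w i)" "b2 ''p'' 0 = int (length xs1) + 1"
        "\<And>j. b2 (CHR ''f'' # c) j = of_bool (lookup xs1 j)" "same {''p'', CHR ''f'' # c, CHR ''e'' # c} b b2"
        using 1 i w by (auto simp: b2_def same_def)
      define b3 where "b3 = (if en i then eff (pushc c) b2 else b1')"
      define xs2 where "xs2 = xs1 @ (if en i then [\<not> w i] else [])"
      have 3: "b3 ''p'' 0 = int (length xs2) + 1" "\<And>j. b3 (CHR ''f'' # c) j = of_bool (lookup xs2 j)"
        using eff_push[OF 2(1-4)] 1 by (auto simp: b3_def xs2_def)
      have 4: "same {''p'', CHR ''f'' # c, CHR ''e'' # c} b b3"
      proof (cases "en i")
        case True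
        then show ?thesis using same_trans[OF 2(5) eff_push(3)[OF 2(1-4)]] by (simp add: b3_def)
      next
        case False
        then show ?thesis using same_trans[OF 1(3) same_refl[of "{}"]] by (auto simp: b3_def same_def)
      qed
      have 5: "b3 (CHR ''e'' # c) k = of_bool (k < i + 1 \<and> en k)" for k
      proof (cases "en i")
        case True
        have "eff (pushc c) b2 (CHR ''e'' # c) = b2 (CHR ''e'' # c)"
          using eff_push(3)[OF 2(1-4)] by (simp add: same_def)
        moreover have "b1' (CHR ''e'' # c) = b (CHR ''e'' # c)" using 1(3) by (simp add: same_def)
        ultimately show ?thesis using True I(2)[of k] unfolding j by (auto simp: b3_def b2_def)
      next
        case False
        have "b1' (CHR ''e'' # c) = b (CHR ''e'' # c)" using 1(3) by (simp add: same_def)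
        then show ?thesis using False I(2)[of k] unfolding j by (auto simp: b3_def)
      qed
      have 6: "xs2 = F (i + 1)" using F2 by (simp add: xs2_def xs1_def)
      have rd: "b1' (CHR ''w'' # c) k = of_bool (w k)" "b1' (CHR ''y'' # c) k = of_bool (bo k)"
        "b1' (CHR ''x'' # c) k = of_bool (x k)" "b1' (CHR ''s'' # c) = s" "b1' ''i'' 0 = i" for k
        using 1(3) w x y s i by (auto simp: same_def)
      have 7: "eff ?body b = b3"
      proof (cases "bo i")
        case False
        then have "\<not> starts i" "\<not> en i" by (auto simp: starts_def ends_def)
        then show ?thesis using False y i by (simp add: b3_def b1'_def)
      next
        case True
        have st: "starts i \<longleftrightarrow> \<not> (bo (i - 1) \<and> \<not> en (i - 1))" using True by (auto simp: starts_def)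
        have e: "en i \<longleftrightarrow> (if w i then if w (i + 1) then x i else \<not> (bo (i + 1) \<and> s (i + 1) < 2)
            else \<not> (w (i + 1) \<and> s i + of_bool (w (i - 1)) < 2 \<and> 0 < s i + of_bool (w (i - 1))))"
          using True by (auto simp: ends_def joined_def pairs_def)
        have A: "eff (Cond (BAnd (pos CHR ''y'' c cIm) (BNot (pos CHR ''e'' c cIm))) Skip (pushc c)) b = b1'"
          using st y i I(2)[of "i - 1"] by (simp add: b1'_def)
        have B: "eff (Sequ (IAssign (CHR ''e'' # c) cI (IConst 1)) (pushc c)) b1' = eff (pushc c) b2"
          using rd by (simp add: b2_def)
        have "eff ?body b = eff (Cond (cW c cI)
          (Cond (cW c cIp) (Cond (pos CHR ''x'' c cI) (Sequ (IAssign (CHR ''e'' # c) cI (IConst 1)) (pushc c)) Skip)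
            (Cond (BAnd (pos CHR ''y'' c cIp) (ILess (ICell (CHR ''s'' # c) cIp) (IConst 2))) Skip (Sequ (IAssign (CHR ''e'' # c) cI (IConst 1)) (pushc c))))
          (Cond (BAnd (cW c cIp) (BAnd (ILess (IAdd (ICell (CHR ''s'' # c) cI) (ICell (CHR ''w'' # c) cIm)) (IConst 2))
              (ILess (IConst 0) (IAdd (ICell (CHR ''s'' # c) cI) (ICell (CHR ''w'' # c) cIm))))) Skip (Sequ (IAssign (CHR ''e'' # c) cI (IConst 1)) (pushc c)))) b1'"
          using True y i A by (simp only: eff.simps bev_simps iev.simps) simp
        also have "\<dots> = b3"
          unfolding eff.simps(3) B b3_def e using rd by (simp add: algebra_simps)
        finally show ?thesis .
      qed
      have "b3 ''i'' 0 = i" using 4 i by (simp add: same_def)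
      moreover have "same ?X b1 b3" using same_trans[OF 9(4) 4, of ?X] by simp
      ultimately show ?case unfolding 7 using 3 5 unfolding 6 by (auto intro: same_upd)
    next
      case (10 b)
      have "en j \<Longrightarrow> j < hi" for j by (auto simp: ends_def body_def)
      then show ?case using 10 same_trans[OF b1(2) 10(1)] by (auto simp: fun_eq_iff)
    qed (use ne in auto)
  qed
qed

text \<open>The cell \<open>p\<close> runs through the indices of the wanted ends. It starts at 1 if
  the chain begins with a major, because that major already stands for index 0.\<close>

definition attachc :: "string \<Rightarrow> string \<Rightarrow> com" where
  "attachc d c = Sequ (Asg ''p'' (ICell (CHR ''w'' # d) (V (CHR ''l'' # d))))
     (loop d (Cond (bor (isT d) (isH d)) (Sequ (IAssign (CHR ''s'' # d) cI (ICell (CHR ''f'' # c) (V ''p''))) (incr ''p'' (IConst 1))) Skip))"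

lemma wp_attach:
  assumes "chain w lo hi" "word d w lo hi a" "a (CHR ''s'' # d) = (\<lambda>i. 0)" "a (CHR ''f'' # c) = (\<lambda>i. of_bool (F i))"
  shows "wp (attachc d c) (cost (hi - lo) + 1) (\<lambda>b. same {''i'', ''p'', CHR ''s'' # d} a b \<and> word d w lo hi b \<and>
    b (CHR ''s'' # d) = attach w lo hi F) a"
proof -
  interpret chain w lo hi by (rule assms(1))
  let ?X = "{''i'', ''p'', CHR ''s'' # d}"
  let ?th = "\<lambda>j. ta j \<or> he j"
  define b0 where "b0 = upd ''p'' 0 (of_bool (w lo)) a"
  have b0: "word d w lo hi b0" "same ?X a b0"
    using assms(2) by (auto simp: b0_def word_def same_upd)
  show ?thesis
    unfolding attachc_def add.commute[of "cost (hi - lo)" 1]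
  proof (rule wp_sequ[where R = "\<lambda>b. b = b0"])
    show "wp (Asg ''p'' (ICell (CHR ''w'' # d) (V (CHR ''l'' # d)))) 1 (\<lambda>b. b = b0) a"
      by (rule wp_straight) (use assms(2) in \<open>simp_all add: b0_def word_def\<close>)
    fix b1 assume "b1 = b0"
    then have b1: "word d w lo hi b1" "same ?X a b1" "b1 ''p'' 0 = of_bool (w lo)" "b1 (CHR ''s'' # d) = (\<lambda>i. 0)"
      using b0 assms(3) by (auto simp: b0_def)
    show "wp (loop d (Cond (bor (isT d) (isH d)) (Sequ (IAssign (CHR ''s'' # d) cI (ICell (CHR ''f'' # c) (V ''p''))) (incr ''p'' (IConst 1))) Skip))
       (cost (hi - lo)) (\<lambda>b. same ?X a b \<and> word d w lo hi b \<and> b (CHR ''s'' # d) = attach w lo hi F) b1"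
    proof (rule wp_loop[where X = ?X and I = "\<lambda>i b. b ''p'' 0 = of_bool (w lo) + cnt lo i ?th \<and>
        (\<forall>j. b (CHR ''s'' # d) j = (if j < i then attach w lo hi F j else 0))", OF _ _ b1(1)], goal_cases)
      case 8
      have "attach w lo hi F j = 0" if "j < lo" for j using that by (auto simp: attach_def classes)
      then show ?case using b1 by simp
    next
      case (9 i b)
      have f: "b (CHR ''f'' # c) j = of_bool (F j)" for j
        using same_trans[OF b1(2) 9(4), of ?X] assms(4) by (simp add: same_def)
      have t: "bev (isT d) b \<longleftrightarrow> ta i" "bev (isH d) b \<longleftrightarrow> he i"
        using bev_class[OF 9(5,3,1,2)] by auto
      have j: "j < i + 1 \<longleftrightarrow> j < i \<or> j = i" for j by auto
      have at: "attach w lo hi F i = of_bool (?th i \<and> F (of_bool (w lo) + cnt lo i ?th))" by (simp add: attach_def)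
      show ?case using 9(3,4,6) f t at cnt_Suc[OF 9(1), of ?th] unfolding j
        by (cases "?th i") (auto simp: same_upd)
    next
      case (10 b)
      have "attach w lo hi F j = 0" if "hi \<le> j" for j using that by (auto simp: attach_def classes)
      then show ?case using 10 same_trans[OF b1(2) 10(1)] by (auto simp: fun_eq_iff)
    qed (use ne in \<open>auto simp: isT_def isH_def\<close>)
  qed
qed

section \<open>Matching gaps and spines with a stack\<close>

context labelled
begin

definition settled :: "int list \<Rightarrow> int \<Rightarrow> int \<Rightarrow> bool" where
  "settled T i k \<longleftrightarrow> gp k \<and> k < i \<and> k \<notin> set T"

text \<open>Gaps and spines both go onto the stack, since a spine may precede or follow its gap.
  Unlike letters are matched when they meet, so the stack is always of one kind and its composition
  records the difference of the two counts. That no matched pair encloses an element of the stack is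
  what keeps future pairs from interleaving with old ones.\<close>

definition stacked :: "int \<Rightarrow> int list \<Rightarrow> (int \<Rightarrow> int) \<Rightarrow> bool" where
  "stacked i T M \<longleftrightarrow> sorted_wrt (<) T \<and> (\<forall>k\<in>set T. (gp k \<or> sp k) \<and> k < i) \<and>
     (\<forall>k\<in>set T. \<forall>l\<in>set T. w k = w l) \<and>
     (\<forall>k. settled T i k \<longrightarrow> sp (M k) \<and> M k < i \<and> M k \<notin> set T) \<and>
     (\<forall>j k. settled T i j \<longrightarrow> settled T i k \<longrightarrow> M j = M k \<longrightarrow> j = k) \<and>
     (\<forall>k. sp k \<longrightarrow> k < i \<longrightarrow> k \<notin> set T \<longrightarrow> (\<exists>j. settled T i j \<and> M j = k)) \<and>
     (\<forall>j k. settled T i j \<longrightarrow> settled T i k \<longrightarrow> j \<noteq> k \<longrightarrow> \<not> interleaved j (M j) k (M k)) \<and>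
     (\<forall>k t. settled T i k \<longrightarrow> t \<in> set T \<longrightarrow> \<not> (min k (M k) < t \<and> t < max k (M k))) \<and>
     cnt lo i gp - cnt lo i sp = int (length (filter w T)) - int (length (filter (\<lambda>k. \<not> w k) T))"

lemma stackedD:
  assumes "stacked i T M"
  shows "sorted_wrt (<) T" "\<forall>k\<in>set T. (gp k \<or> sp k) \<and> k < i"
    "\<forall>k\<in>set T. \<forall>l\<in>set T. w k = w l"
    "\<forall>k. settled T i k \<longrightarrow> sp (M k) \<and> M k < i \<and> M k \<notin> set T"
    "\<forall>j k. settled T i j \<longrightarrow> settled T i k \<longrightarrow> M j = M k \<longrightarrow> j = k"
    "\<forall>k. sp k \<longrightarrow> k < i \<longrightarrow> k \<notin> set T \<longrightarrow> (\<exists>j. settled T i j \<and> M j = k)"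
    "\<forall>j k. settled T i j \<longrightarrow> settled T i k \<longrightarrow> j \<noteq> k \<longrightarrow> \<not> interleaved j (M j) k (M k)"
    "\<forall>k t. settled T i k \<longrightarrow> t \<in> set T \<longrightarrow> \<not> (min k (M k) < t \<and> t < max k (M k))"
    "cnt lo i gp - cnt lo i sp = int (length (filter w T)) - int (length (filter (\<lambda>k. \<not> w k) T))"
  by (insert assms[unfolded stacked_def], (elim conjE, assumption)+)

lemma letter_w: "gp k \<Longrightarrow> w k" "sp k \<Longrightarrow> \<not> w k"
  by (auto simp: gaps_def pairs_def spines_def classes)

lemma stacked_none:
  assumes "stacked i T M" "\<not> gp i" "\<not> sp i" "lo \<le> i"
  shows "stacked (i + 1) T M"
proof -
  have l: "k < i + 1 \<longleftrightarrow> k < i \<or> k = i" for k by auto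
  have "settled T (i + 1) = settled T i" using assms(2) by (auto simp: settled_def order_le_less fun_eq_iff)
  moreover have "cnt lo (i + 1) gp = cnt lo i gp" "cnt lo (i + 1) sp = cnt lo i sp"
    using assms(2-4) by (simp_all add: cnt_Suc)
  moreover have "\<forall>k\<in>set T. (gp k \<or> sp k) \<and> k < i + 1" using stackedD(2)[OF assms(1)] unfolding l by blast
  moreover have "\<forall>k. settled T i k \<longrightarrow> sp (M k) \<and> M k < i + 1 \<and> M k \<notin> set T"
    using stackedD(4)[OF assms(1)] unfolding l by blast
  moreover have "\<forall>k. sp k \<longrightarrow> k < i + 1 \<longrightarrow> k \<notin> set T \<longrightarrow> (\<exists>j. settled T i j \<and> M j = k)"
    using stackedD(6)[OF assms(1)] assms(3) unfolding l by blast
  ultimately show ?thesis unfolding stacked_def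
    using stackedD(1)[OF assms(1)] stackedD(3)[OF assms(1)] stackedD(5)[OF assms(1)]
      stackedD(7-9)[OF assms(1)] by (intro conjI) (simp only:)+
qed

lemma stacked_push:
  assumes "stacked i T M" "gp i \<or> sp i" "T = [] \<or> w (last T) = w i" "lo \<le> i"
  shows "stacked (i + 1) (T @ [i]) M"
proof -
  have l: "k < i + 1 \<longleftrightarrow> k < i \<or> k = i" for k by auto
  have lt: "k < i" if "k \<in> set T" for k using assms(1) that by (simp add: stacked_def)
  have s: "settled (T @ [i]) (i + 1) = settled T i" by (auto simp: settled_def order_le_less fun_eq_iff)
  have mono: "\<forall>k\<in>set T. \<forall>l\<in>set T. w k = w l" using stackedD(3)[OF assms(1)] .
  have m: "w k = w i" if "k \<in> set T" for k
    using assms(3) that last_in_set[of T] mono by fastforce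
  have ii: "w i \<longleftrightarrow> gp i" "w i \<longleftrightarrow> \<not> sp i" using assms(2) letter_w by auto
  have "\<not> (min k (M k) < i \<and> i < max k (M k))" if "settled T i k" for k
  proof -
    have "M k < i" "k < i" using stackedD(4)[OF assms(1)] that by (auto simp: settled_def)
    then show ?thesis by linarith
  qed
  note b = this
  note A1 = stackedD(1)[OF assms(1)] and A2 = stackedD(2)[OF assms(1)] and A4 = stackedD(4)[OF assms(1)]
    and A5 = stackedD(5)[OF assms(1)] and A8 = stackedD(6)[OF assms(1)] and A6 = stackedD(7)[OF assms(1)]
    and A7 = stackedD(8)[OF assms(1)] and A9 = stackedD(9)[OF assms(1)]
  have 1: "sorted_wrt (<) (T @ [i])" using A1 lt by (simp add: sorted_wrt_append)
  have 2: "\<forall>k\<in>set (T @ [i]). (gp k \<or> sp k) \<and> k < i + 1" using A2 assms(2) unfolding l by auto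
  have 3: "\<forall>k\<in>set (T @ [i]). \<forall>l\<in>set (T @ [i]). w k = w l"
  proof (intro ballI)
    fix k l assume "k \<in> set (T @ [i])" "l \<in> set (T @ [i])"
    then have "w k = w i" "w l = w i" using m by auto
    then show "w k = w l" by simp
  qed
  have 4: "\<forall>k. settled T i k \<longrightarrow> sp (M k) \<and> M k < i + 1 \<and> M k \<notin> set (T @ [i])"
    using A4 unfolding l by fastforce
  have 5: "\<forall>k. sp k \<longrightarrow> k < i + 1 \<longrightarrow> k \<notin> set (T @ [i]) \<longrightarrow> (\<exists>j. settled T i j \<and> M j = k)"
    using A8 unfolding l by simp
  have 6: "\<forall>k t. settled T i k \<longrightarrow> t \<in> set (T @ [i]) \<longrightarrow> \<not> (min k (M k) < t \<and> t < max k (M k))"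
    using A7 b by auto
  have 7: "cnt lo (i + 1) gp - cnt lo (i + 1) sp =
      int (length (filter w (T @ [i]))) - int (length (filter (\<lambda>k. \<not> w k) (T @ [i])))"
    using A9 assms(4) ii by (cases "w i") (simp_all add: cnt_Suc)
  show ?thesis unfolding stacked_def s by (intro conjI 1 2 3 4 A5 5 A6 6 7)
qed

text \<open>The new pair reaches from the top \<open>y\<close> of the stack to the current position.
  An old pair lies before \<open>i\<close> and does not enclose \<open>y\<close>, so it is either
  inside of the new pair or to the left of it.\<close>

lemma stacked_pop:
  assumes "stacked i (T @ [y]) M" "gp i \<or> sp i" "w y \<noteq> w i" "lo \<le> i"
  shows "stacked (i + 1) T (if w i then M(i := y) else M(y := i))"
proof -
  let ?M = "if w i then M(i := y) else M(y := i)"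
  \<comment> \<open>The gap and the spine of the new pair, whichever of the two comes first.\<close>
  define g where "g = (if w i then i else y)"
  define h where "h = (if w i then y else i)"
  have M: "?M = M(g := h)" by (simp add: g_def h_def)
  have l: "k < i + 1 \<longleftrightarrow> k < i \<or> k = i" for k by auto
  note A1 = stackedD(1)[OF assms(1)] and A2 = stackedD(2)[OF assms(1)] and A3 = stackedD(3)[OF assms(1)]
    and A4 = stackedD(4)[OF assms(1)] and A5 = stackedD(5)[OF assms(1)] and A8 = stackedD(6)[OF assms(1)]
    and A6 = stackedD(7)[OF assms(1)] and A7 = stackedD(8)[OF assms(1)] and A9 = stackedD(9)[OF assms(1)]
  have ys: "(gp y \<or> sp y) \<and> y < i" "y \<notin> set T" and Ty: "\<And>t. t \<in> set T \<Longrightarrow> t < y"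
    and Tl: "\<And>t. t \<in> set T \<Longrightarrow> gp t \<or> sp t"
    using A1 A2 by (auto simp: sorted_wrt_append)
  have iT: "i \<notin> set T" using Ty[of i] ys by fastforce
  have gh: "gp g" "sp h" "g \<noteq> h" "{g, h} = {y, i}"
    using assms(2,3) ys letter_w by (auto simp: g_def h_def)
  have gh2: "g = y \<and> h = i \<or> g = i \<and> h = y" by (auto simp: g_def h_def)
  have s: "settled T (i + 1) k \<longleftrightarrow> settled (T @ [y]) i k \<or> k = g" for k
    using gh(1) gh2 ys iT assms(2) letter_w gh(2) by (auto simp: settled_def order_le_less)
  have ng: "\<not> settled (T @ [y]) i g" using gh2 by (auto simp: settled_def)
  have old: "sp (M k)" "M k < i" "M k \<notin> set T" "M k \<noteq> y" "k < i" "k \<noteq> y"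
    "\<not> (min k (M k) < y \<and> y < max k (M k))" if "settled (T @ [y]) i k" for k
    using A4 A7 that by (simp_all add: settled_def)
  have oh: "M k \<noteq> h" if "settled (T @ [y]) i k" for k using old[OF that] gh2 by auto
  have Mk: "?M k = M k" if "settled (T @ [y]) i k" for k using that ng unfolding M by auto
  have Mg: "?M g = h" unfolding M by simp
  have hT: "h \<notin> set T" "h < i + 1" using gh2 ys Ty by fastforce+
  have mm: "min g h = y" "max g h = i" using gh2 ys by auto
  have N: "\<not> interleaved g h k (M k)" "\<not> interleaved k (M k) g h" if "settled (T @ [y]) i k" for k
    using old[OF that] mm ys(1) by (auto simp: interleaved_def)
  have 1: "sorted_wrt (<) T" "\<forall>k\<in>set T. (gp k \<or> sp k) \<and> k < i + 1"
    using A1 A2 by (auto simp: sorted_wrt_append)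
  have mn: "\<forall>k\<in>set T. \<forall>l\<in>set T. w k = w l"
    using A3 unfolding set_append by blast
  have 2: "sp (?M k) \<and> ?M k < i + 1 \<and> ?M k \<notin> set T" if "settled T (i + 1) k" for k
  proof (cases "k = g")
    case True
    then show ?thesis unfolding True Mg using gh(2) hT by blast
  next
    case False
    then have k: "settled (T @ [y]) i k" using that s by blast
    show ?thesis unfolding Mk[OF k] using old[OF k] by simp
  qed
  have 3: "j = k" if "settled T (i + 1) j" "settled T (i + 1) k" "?M j = ?M k" for j k
  proof -
    have "j = k" if "settled (T @ [y]) i j" "settled (T @ [y]) i k" "M j = M k"
      using A5 that by blast
    then show ?thesis using that Mk[of j] Mk[of k] Mg oh[of j] oh[of k] unfolding s by metis
  qed
  have 4: "\<exists>j. settled T (i + 1) j \<and> ?M j = k" if "sp k" "k < i + 1" "k \<notin> set T" for k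
  proof (cases "k = h")
    case True
    then show ?thesis using s Mg by blast
  next
    case False
    have "k \<noteq> g" using that(1) gh(1) letter_w by blast
    then have "k < i" "k \<notin> set (T @ [y])" "sp k" using that False gh2 by auto
    then obtain j where "settled (T @ [y]) i j" "M j = k"
      using A8 by blast
    then show ?thesis using s Mk by blast
  qed
  have 5: "\<not> interleaved j (?M j) k (?M k)" if "settled T (i + 1) j" "settled T (i + 1) k" "j \<noteq> k" for j k
  proof -
    have "\<not> interleaved j (M j) k (M k)" if "settled (T @ [y]) i j" "settled (T @ [y]) i k"
      using A6 that \<open>j \<noteq> k\<close> by blast
    then show ?thesis using that Mk[of j] Mk[of k] Mg N[of j] N[of k] unfolding s by metis
  qed
  have 6: "\<not> (min k (?M k) < t \<and> t < max k (?M k))" if "settled T (i + 1) k" "t \<in> set T" for k t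
  proof (cases "k = g")
    case True
    then show ?thesis using Mg mm Ty[OF that(2)] by simp
  next
    case False
    then have "settled (T @ [y]) i k" using that(1) s by blast
    then show ?thesis using A7 that(2) Mk[of k] by simp
  qed
  have 7: "cnt lo (i + 1) gp - cnt lo (i + 1) sp = int (length (filter w T)) - int (length (filter (\<lambda>k. \<not> w k) T))"
  proof -
    have "cnt lo i gp - cnt lo i sp = int (length (filter w (T @ [y]))) - int (length (filter (\<lambda>k. \<not> w k) (T @ [y])))"
      by (rule A9)
    then show ?thesis using assms(2-4) letter_w[of i] by (cases "w i") (auto simp: cnt_Suc)
  qed
  have 2: "\<forall>k. settled T (i + 1) k \<longrightarrow> sp (?M k) \<and> ?M k < i + 1 \<and> ?M k \<notin> set T" using 2 by blast
  have 3: "\<forall>j k. settled T (i + 1) j \<longrightarrow> settled T (i + 1) k \<longrightarrow> ?M j = ?M k \<longrightarrow> j = k" using 3 by blast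
  have 4: "\<forall>k. sp k \<longrightarrow> k < i + 1 \<longrightarrow> k \<notin> set T \<longrightarrow> (\<exists>j. settled T (i + 1) j \<and> ?M j = k)" using 4 by blast
  have 5: "\<forall>j k. settled T (i + 1) j \<longrightarrow> settled T (i + 1) k \<longrightarrow> j \<noteq> k \<longrightarrow> \<not> interleaved j (?M j) k (?M k)"
    using 5 by blast
  have 6: "\<forall>k t. settled T (i + 1) k \<longrightarrow> t \<in> set T \<longrightarrow> \<not> (min k (?M k) < t \<and> t < max k (?M k))" using 6 by blast
  show ?thesis unfolding stacked_def by (intro conjI 1 mn 2 3 4 5 6 7)
qed

text \<open>With equally many gaps and spines, a stack holding one kind only must be empty, so
  everything has been matched.\<close>

lemma stacked_final:
  assumes "stacked hi T M" "ct gp = ct sp"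
  shows "gp i \<Longrightarrow> sp (M i)" "inj_on M {i. gp i}" "sp j \<Longrightarrow> \<exists>i. gp i \<and> M i = j"
    "gp i \<Longrightarrow> gp j \<Longrightarrow> i \<noteq> j \<Longrightarrow> \<not> interleaved i (M i) j (M j)"
proof -
  have "ct gp - ct sp = int (length (filter w T)) - int (length (filter (\<lambda>k. \<not> w k) T))"
    using stackedD(9)[OF assms(1)] .
  then have len: "length (filter w T) = length (filter (\<lambda>k. \<not> w k) T)" using assms(2) by simp
  have T: "T = []"
  proof (cases T)
    case (Cons t T')
    have "\<forall>k\<in>set T. \<forall>l\<in>set T. w k = w l" using stackedD(3)[OF assms(1)] .
    moreover have "t \<in> set T" using Cons by simp
    ultimately have same: "w k = w t" if "k \<in> set T" for k using that by blast
    show ?thesis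
    proof (cases "w t")
      case True
      then have w: "w k" if "k \<in> set T" for k using same[OF that] by blast
      then have "filter w T = T" by (intro filter_True) blast
      moreover have "filter (\<lambda>k. \<not> w k) T = []" using w by (intro filter_False) blast
      ultimately show ?thesis using len by simp
    next
      case False
      then have w: "\<not> w k" if "k \<in> set T" for k using same[OF that] by blast
      then have "filter w T = []" by (intro filter_False) blast
      moreover have "filter (\<lambda>k. \<not> w k) T = T" using w by (intro filter_True) blast
      ultimately show ?thesis using len by simp
    qed
  qed simp
  have lt: "gp k \<Longrightarrow> k < hi" "sp k \<Longrightarrow> k < hi" for k
    using range[of k] by (auto simp: gaps_def pairs_def spines_def classes)
  have s: "settled T hi k \<longleftrightarrow> gp k" for k using lt T by (auto simp: settled_def)
  show "gp i \<Longrightarrow> sp (M i)" "inj_on M {i. gp i}" "sp j \<Longrightarrow> \<exists>i. gp i \<and> M i = j"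
    "gp i \<Longrightarrow> gp j \<Longrightarrow> i \<noteq> j \<Longrightarrow> \<not> interleaved i (M i) j (M j)"
    using stackedD(4)[OF assms(1)] stackedD(5)[OF assms(1)] stackedD(6)[OF assms(1)] stackedD(7)[OF assms(1)] lt T
    unfolding s inj_on_def by (blast, blast, fastforce, blast)
qed

end

definition stackc :: "string \<Rightarrow> com" where
  "stackc c = Sequ (Asg ''q'' (IConst 0)) (loop c
     (Cond (bor (BAnd (cW c cI) (BAnd (cW c cIp) (BNot (pos CHR ''x'' c cI)))) (BAnd (BNot (cW c cI)) (BNot (pos CHR ''y'' c cI))))
       (Cond (BAnd (ILess (IConst 0) (V ''q''))
           (bor (BAnd (cW c cI) (BNot (cW c (ICell (CHR ''t'' # c) (ISub (V ''q'') (IConst 1))))))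
                (BAnd (BNot (cW c cI)) (cW c (ICell (CHR ''t'' # c) (ISub (V ''q'') (IConst 1)))))))
         (Sequ (incr ''q'' (IConst (- 1))) (Cond (cW c cI) (IAssign (CHR ''g'' # c) cI (ICell (CHR ''t'' # c) (V ''q'')))
            (IAssign (CHR ''g'' # c) (ICell (CHR ''t'' # c) (V ''q'')) cI)))
         (Sequ (IAssign (CHR ''t'' # c) (V ''q'') cI) (incr ''q'' (IConst 1))))
       Skip))"

lemma wp_stack:
  assumes "labelled w lo hi s x" "word c w lo hi a" "a (CHR ''x'' # c) = (\<lambda>i. of_bool (x i))"
    "a (CHR ''y'' # c) = (\<lambda>i. of_bool (body w lo hi s x i))"
  shows "wp (stackc c) (cost (hi - lo) + 1) (\<lambda>b. same {''i'', ''q'', CHR ''g'' # c, CHR ''t'' # c} a b \<and> word c w lo hi b \<and>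
    (\<exists>T. labelled.stacked w lo hi s x hi T (b (CHR ''g'' # c)))) a"
proof -
  interpret labelled w lo hi s x by (rule assms(1))
  let ?body = "Cond (bor (BAnd (cW c cI) (BAnd (cW c cIp) (BNot (pos CHR ''x'' c cI)))) (BAnd (BNot (cW c cI)) (BNot (pos CHR ''y'' c cI))))
       (Cond (BAnd (ILess (IConst 0) (V ''q''))
           (bor (BAnd (cW c cI) (BNot (cW c (ICell (CHR ''t'' # c) (ISub (V ''q'') (IConst 1))))))
                (BAnd (BNot (cW c cI)) (cW c (ICell (CHR ''t'' # c) (ISub (V ''q'') (IConst 1)))))))
         (Sequ (incr ''q'' (IConst (- 1))) (Cond (cW c cI) (IAssign (CHR ''g'' # c) cI (ICell (CHR ''t'' # c) (V ''q'')))
            (IAssign (CHR ''g'' # c) (ICell (CHR ''t'' # c) (V ''q'')) cI)))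
         (Sequ (IAssign (CHR ''t'' # c) (V ''q'') cI) (incr ''q'' (IConst 1))))
       Skip"
  let ?X = "{''i'', ''q'', CHR ''g'' # c, CHR ''t'' # c}"
  define b0 where "b0 = upd ''q'' 0 0 a"
  have A: "wp (Asg ''q'' (IConst 0)) 1 (\<lambda>b. b = b0) a"
    by (rule wp_straight) (simp_all add: b0_def)
  show ?thesis
    unfolding stackc_def add.commute[of "cost (hi - lo)" 1]
  proof (rule wp_sequ[OF A])
    fix b1 assume "b1 = b0"
    then have b1: "word c w lo hi b1" "same ?X a b1" "b1 ''q'' 0 = 0"
      using assms(2) by (auto simp: b0_def word_def same_upd)
    show "wp (loop c ?body) (cost (hi - lo)) (\<lambda>b. same ?X a b \<and> word c w lo hi b \<and> (\<exists>T. stacked hi T (b (CHR ''g'' # c)))) b1"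
    proof (rule wp_loop[where X = ?X and I = "\<lambda>i b. \<exists>T. b ''q'' 0 = int (length T) \<and>
        (\<forall>n<length T. b (CHR ''t'' # c) (int n) = T ! n) \<and> stacked i T (b (CHR ''g'' # c))", OF _ _ b1(1)], goal_cases)
      case 8
      have "\<not> settled [] lo k" "\<not> (sp k \<and> k < lo)" for k
        using range[of k] by (auto simp: settled_def gaps_def pairs_def spines_def classes)
      then show ?case using b1 by (intro exI[of _ "[]"]) (auto simp: stacked_def)
    next
      case (9 i b)
      then obtain T where T: "b ''q'' 0 = int (length T)" "\<And>n. n < length T \<Longrightarrow> b (CHR ''t'' # c) (int n) = T ! n"
        "stacked i T (b (CHR ''g'' # c))" by blast
      have w: "b (CHR ''w'' # c) j = of_bool (w j)" for j using 9(5) by (simp add: word_def)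
      have x: "b (CHR ''x'' # c) j = of_bool (x j)" and y: "b (CHR ''y'' # c) j = of_bool (bo j)" for j
        using same_trans[OF b1(2) 9(4), of ?X] assms(3,4) by (auto simp: same_def)
      have i: "b ''i'' 0 = i" by (rule 9(3))
      have lt: "gp i \<or> sp i \<longleftrightarrow> (w i \<and> w (i + 1) \<and> \<not> x i) \<or> (\<not> w i \<and> \<not> bo i)"
        using 9(1,2) by (auto simp: gaps_def pairs_def spines_def classes)
      show ?case
      proof (cases "gp i \<or> sp i")
        case False
        then have "stacked (i + 1) T (b (CHR ''g'' # c))" using stacked_none T(3) 9(1) by blast
        then show ?thesis using False T 9(4) w x y i lt by auto
      next
        case True
        show ?thesis
        proof (cases "T \<noteq> [] \<and> w (last T) \<noteq> w i")
          case pop: True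
          then obtain R t where R: "T = R @ [t]" by (cases T rule: rev_cases) auto
          have wt: "w t \<noteq> w i" using pop R by simp
          have top: "b (CHR ''t'' # c) (int (length R)) = t" using T(2)[of "length R"] R by simp
          have st: "stacked (i + 1) R (if w i then (b (CHR ''g'' # c))(i := t) else (b (CHR ''g'' # c))(t := i))"
            using stacked_pop[of i R t] T(3) True wt 9(1) unfolding R by blast
          have elems: "b (CHR ''t'' # c) (int n) = R ! n" if "n < length R" for n
            using T(2)[of n] that R by (simp add: nth_append)
          show ?thesis
            using True T(1) 9(4) w x y i lt top wt st elems R
            by (cases "w i") (auto simp: same_upd intro!: exI[of _ R])
        next
          case push: False
          have st: "stacked (i + 1) (T @ [i]) (b (CHR ''g'' # c))"
            using stacked_push[OF T(3) True _ 9(1)] push by blast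
          have top: "w (b (CHR ''t'' # c) (int (length T) - 1)) = w i" if "T \<noteq> []"
          proof -
            have "b (CHR ''t'' # c) (int (length T) - 1) = last T"
              using T(2)[of "length T - 1"] that by (simp add: last_conv_nth of_nat_diff Suc_leI)
            then show ?thesis using push that by simp
          qed
          show ?thesis
            using True T(1,2) 9(4) w x y i lt top st
            by (cases "T = []"; cases "w i") (auto simp: same_upd nth_append less_Suc_eq intro!: exI[of _ "T @ [i]"])
        qed
      qed
    next
      case (10 b)
      then show ?case using same_trans[OF b1(2) 10(1), of ?X] by blast
    qed (use ne in auto)
  qed
qed

section \<open>Writing the path\<close>

definition written :: "ram \<Rightarrow> int list \<Rightarrow> bool" where
  "written a xs \<longleftrightarrow> a ''v'' 0 = int (length xs) \<and> (\<forall>n<length xs. a ''path'' (int n) = xs ! n)"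

text \<open>The test suppresses the added majors at positions \<open>-1\<close> and
  \<open>n\<close>; adding the offset translates a position in the chain into one in the input
  list.\<close>

definition outc :: "string \<Rightarrow> iexp \<Rightarrow> com" where
  "outc c e = Cond (BAnd (BNot (ILess e (IConst 0))) (ILess e (V (CHR ''n'' # c))))
     (Sequ (IAssign ''path'' (V ''v'') (IAdd e (V (CHR ''b'' # c)))) (incr ''v'' (IConst 1))) Skip"

lemma out_simps [simp]: "straight (outc c e)" "csize (outc c e) = 4"
  by (auto simp: outc_def)

lemma eff_out:
  assumes "written a xs" "iev e a = x" "a (CHR ''n'' # c) 0 = N" "a (CHR ''b'' # c) 0 = k"
  shows "written (eff (outc c e) a) (xs @ (if 0 \<le> x \<and> x < N then [k + x] else []))"
    "same {''v'', ''path''} a (eff (outc c e) a)"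
  using assms by (auto simp: outc_def written_def same_def nth_append less_Suc_eq)

definition stepc :: "string \<Rightarrow> int \<Rightarrow> com" where
  "stepc c k = (let u = V (CHR ''u'' # c) in
     Cond (ILess u (V (CHR ''m'' # c)))
       (Sequ
         (Cond (pos CHR ''y'' c u)
           (Sequ (outc c u) (Cond (pos CHR ''e'' c u) (Asg ''z'' (IConst k))
             (Cond (BAnd (cW c u) (cW c (IAdd u (IConst 1)))) (outc c (ICell (CHR ''g'' # c) u)) Skip)))
           Skip)
         (incr (CHR ''u'' # c) (IConst 1)))
       Skip)"

text \<open>Each round advances the pointer of the current chain, so the total length of the padded
  words suffices as number of rounds; once the current chain is exhausted, the remaining rounds do
  nothing.\<close>

definition emitc :: "string \<Rightarrow> string \<Rightarrow> com" where
  "emitc o1 c = Sequ (Sequ (Sequ (Asg (CHR ''u'' # o1) (V (CHR ''l'' # o1))) (Asg (CHR ''u'' # c) (V (CHR ''l'' # c))))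
      (Sequ (Asg ''z'' (IConst 1)) (Asg ''v'' (IConst 0))))
     (For (IConst 0) (IAdd (ISub (V (CHR ''m'' # o1)) (V (CHR ''l'' # o1))) (ISub (V (CHR ''m'' # c)) (V (CHR ''l'' # c))))
       (Cond (ILess (IConst 0) (V ''z'')) (stepc o1 0) (stepc c 1)))"

lemma step_simps [simp]: "straight (stepc c k)" "csize (stepc c k) = 17"
  by (auto simp: stepc_def Let_def)

context matched
begin

definition "remaining b u = filter (B b) [u..H b - 1]"

context
  fixes nm :: "bool \<Rightarrow> string" and N off :: "bool \<Rightarrow> int"
  assumes nm: "nm True \<noteq> nm False"
begin

definition genuine :: "bool \<times> int \<Rightarrow> bool" where
  "genuine p \<longleftrightarrow> 0 \<le> snd p \<and> snd p < N (fst p)"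
definition index :: "bool \<times> int \<Rightarrow> int" where
  "index p = off (fst p) + snd p"

definition presents :: "ram \<Rightarrow> bool" where
  "presents a \<longleftrightarrow> (\<forall>b. word (nm b) (W b) (L b) (H b) a \<and> a (CHR ''y'' # nm b) = (\<lambda>i. of_bool (B b i)) \<and>
     a (CHR ''e'' # nm b) = (\<lambda>i. of_bool (EN b i)) \<and> a (CHR ''g'' # nm b) = M b \<and>
     a (CHR ''n'' # nm b) 0 = N b \<and> a (CHR ''b'' # nm b) 0 = off b)"

abbreviation (input) "ptr a b \<equiv> a (CHR ''u'' # nm b) 0"

text \<open>The alternative in the last clause describes the idle rounds: the path can be complete
  while the other chain still has positions outside of bodies ahead.\<close>

definition emitting :: "int \<Rightarrow> ram \<Rightarrow> bool" where
  "emitting j a \<longleftrightarrow> (\<exists>P s. route = P @ emit EN GP M s (remaining s (ptr a s)) (remaining (\<not> s) (ptr a (\<not> s))) \<and>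
     a ''z'' 0 = of_bool s \<and> written a (map index (filter genuine P)) \<and> (\<forall>b. L b \<le> ptr a b \<and> ptr a b \<le> H b) \<and>
     (j = (ptr a True - L True) + (ptr a False - L False) \<or> ptr a s = H s))"

lemma nm_neq: "nm b = nm c \<longleftrightarrow> b = c"
  using nm by (cases b; cases c) auto

lemma remaining_Cons: "u < H b \<Longrightarrow> remaining b u = (if B b u then [u] else []) @ remaining b (u + 1)"
  by (simp add: remaining_def upto_rec1)

lemma gap_iff: "B b u \<Longrightarrow> \<not> EN b u \<Longrightarrow> GP b u \<longleftrightarrow> W b u \<and> W b (u + 1)"
  by (auto simp: B_def EN_def GP_def ends_def joined_def gaps_def pairs_def)

text \<open>The program consumes one position per round, \<open>emit\<close> one body position. A
  position outside of bodies leaves the remaining lists unchanged, so the suffix of the route still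
  to be written is the same.\<close>

lemma eff_step:
  assumes "presents a" "route = P @ emit EN GP M s (remaining s (ptr a s)) (remaining (\<not> s) (ptr a (\<not> s)))"
    "a ''z'' 0 = of_bool s" "written a (map index (filter genuine P))" "ptr a s < H s"
  defines "b \<equiv> eff (stepc (nm s) (of_bool (\<not> s))) a"
  shows "\<exists>P t. route = P @ emit EN GP M t (remaining t (ptr b t)) (remaining (\<not> t) (ptr b (\<not> t))) \<and>
     b ''z'' 0 = of_bool t \<and> written b (map index (filter genuine P))"
    "ptr b s = ptr a s + 1" "ptr b (\<not> s) = ptr a (\<not> s)"
    "same {''v'', ''path'', ''z'', CHR ''u'' # nm s} a b"
proof -
  let ?c = "nm s"
  define u where "u = ptr a s"
  define b1 where "b1 = eff (outc ?c (V (CHR ''u'' # ?c))) a"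
  define b2 where "b2 = eff (outc ?c (ICell (CHR ''g'' # ?c) (V (CHR ''u'' # ?c)))) b1"
  define P1 where "P1 = P @ [(s, u)]"
  define P2 where "P2 = P1 @ [(s, M s u)]"
  have A: "a (CHR ''m'' # ?c) 0 = H s" "a (CHR ''w'' # ?c) i = of_bool (W s i)" "a (CHR ''y'' # ?c) i = of_bool (B s i)"
    "a (CHR ''e'' # ?c) i = of_bool (EN s i)" "a (CHR ''g'' # ?c) = M s"
    "a (CHR ''n'' # ?c) 0 = N s" "a (CHR ''b'' # ?c) 0 = off s" for i
    using assms(1) unfolding presents_def word_def by auto
  have out: "map index (filter genuine (Q @ [(s, x)])) = map index (filter genuine Q) @
      (if 0 \<le> x \<and> x < N s then [off s + x] else [])" for Q x
    by (simp add: genuine_def index_def)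
  have 1: "written b1 (map index (filter genuine P1))" "same {''v'', ''path''} a b1"
    unfolding P1_def out b1_def by (rule eff_out[OF assms(4) _ A(6,7)], simp add: u_def)+
  have A1: "b1 (CHR ''w'' # ?c) i = of_bool (W s i)" "b1 (CHR ''e'' # ?c) i = of_bool (EN s i)" "b1 (CHR ''g'' # ?c) = M s"
    "b1 (CHR ''n'' # ?c) 0 = N s" "b1 (CHR ''b'' # ?c) 0 = off s" "ptr b1 s = u" "b1 ''z'' 0 = of_bool s"
    "ptr b1 (\<not> s) = ptr a (\<not> s)" for i
    using 1(2) A assms(3) unfolding same_def u_def by auto
  have 2: "written b2 (map index (filter genuine P2))" "same {''v'', ''path''} b1 b2"
    unfolding P2_def out b2_def by (rule eff_out[OF 1(1) _ A1(4,5)], simp add: A1)+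
  have A2: "ptr b2 s = u" "ptr b2 (\<not> s) = ptr a (\<not> s)" "b2 ''z'' 0 = of_bool s"
    using 2(2) A1 unfolding same_def by auto
  have w: "written (upd x k v d) xs \<longleftrightarrow> written d xs" if "x \<noteq> ''v''" "x \<noteq> ''path''" for x k v d xs
    using that by (simp add: written_def)
  have b: "b = upd (CHR ''u'' # ?c) 0 (u + 1) (if B s u then if EN s u then upd ''z'' 0 (of_bool (\<not> s)) b1
      else if W s u \<and> W s (u + 1) then b2 else b1 else a)"
    using assms(5) A A1 A2
    unfolding b_def stepc_def Let_def eff.simps b1_def[symmetric] b2_def[symmetric]
    by (simp add: u_def[symmetric] b1_def[symmetric] b2_def[symmetric])
  have s12: "same {''v'', ''path'', ''z'', CHR ''u'' # nm s} a b1" "same {''v'', ''path'', ''z'', CHR ''u'' # nm s} a b2"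
    using 1(2) 2(2) by (auto simp: same_def)
  show "same {''v'', ''path'', ''z'', CHR ''u'' # nm s} a b"
    unfolding b using s12 by (auto intro!: same_upd)
  have n: "nm s \<noteq> nm (\<not> s)" by (simp add: nm_neq)
  show p: "ptr b s = ptr a s + 1" unfolding b u_def by simp
  show q: "ptr b (\<not> s) = ptr a (\<not> s)" unfolding b using A1 A2 n by auto
  have r: "remaining s u = (if B s u then [u] else []) @ remaining s (u + 1)"
    using assms(5) remaining_Cons unfolding u_def by blast
  note R = assms(2)[folded u_def, unfolded r]
  show "\<exists>P t. route = P @ emit EN GP M t (remaining t (ptr b t)) (remaining (\<not> t) (ptr b (\<not> t))) \<and>
     b ''z'' 0 = of_bool t \<and> written b (map index (filter genuine P))"
  proof (cases "B s u")
    case False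
    have "route = P @ emit EN GP M s (remaining s (ptr b s)) (remaining (\<not> s) (ptr b (\<not> s)))"
      using R False unfolding p q u_def by simp
    moreover have "b ''z'' 0 = of_bool s" "written b (map index (filter genuine P))"
      using False assms(3,4) by (simp_all add: b w)
    ultimately show ?thesis by blast
  next
    case B: True
    show ?thesis
    proof (cases "EN s u")
      case True
      have "route = P1 @ emit EN GP M (\<not> s) (remaining (\<not> s) (ptr b (\<not> s))) (remaining (\<not> \<not> s) (ptr b (\<not> \<not> s)))"
        using R B True p q unfolding u_def P1_def by simp
      moreover have "b ''z'' 0 = of_bool (\<not> s)" "written b (map index (filter genuine P1))"
        using B True 1(1) by (simp_all add: b w)
      ultimately show ?thesis by blast
    next
      case False
      note g = gap_iff[OF B False]
      show ?thesis
      proof (cases "W s u \<and> W s (u + 1)")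
        case True
        have "route = P2 @ emit EN GP M s (remaining s (ptr b s)) (remaining (\<not> s) (ptr b (\<not> s)))"
          using R B False g True p q unfolding u_def P1_def P2_def by simp
        moreover have "b ''z'' 0 = of_bool s" "written b (map index (filter genuine P2))"
          using B False True 2(1) A2 by (simp_all add: b w)
        ultimately show ?thesis by blast
      next
        case n: False
        have "route = P1 @ emit EN GP M s (remaining s (ptr b s)) (remaining (\<not> s) (ptr b (\<not> s)))"
          using R B False g n p q unfolding u_def P1_def by simp
        moreover have "b ''z'' 0 = of_bool s" "written b (map index (filter genuine P1))"
          unfolding b if_P[OF B] if_not_P[OF False] if_not_P[OF n] using 1(1) A1(7) by (simp_all add: w)
        ultimately show ?thesis by blast
      qed
    qed
  qed
qed

lemma wp_emit:
  assumes "presents a"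
  shows "wp (emitc (nm True) (nm False)) (cost ((H True - L True) + (H False - L False)) + 4)
    (\<lambda>b. written b (map index (filter genuine route))) a"
proof -
  have LH: "L b < H b" for b
  proof -
    interpret l: labelled "W b" "L b" "H b" "S b" "X b" by (rule lab)
    show ?thesis by (rule l.ne)
  qed
  let ?X = "{''i'', ''v'', ''path'', ''z'', CHR ''u'' # nm True, CHR ''u'' # nm False}"
  let ?N = "(H True - L True) + (H False - L False)"
  have pres: "presents b" if "same ?X a b" for b
    using assms that unfolding presents_def word_def same_def by simp
  have bnd: "a (CHR ''l'' # nm b) 0 = L b" "a (CHR ''m'' # nm b) 0 = H b" if "presents a" for a b
    using that unfolding presents_def word_def by blast+
  define b0 where "b0 = upd ''v'' 0 0 (upd ''z'' 0 1 (upd (CHR ''u'' # nm False) 0 (L False) (upd (CHR ''u'' # nm True) 0 (L True) a)))"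
  have b0: "same ?X a b0" "emitting 0 (upd ''i'' 0 0 b0)"
  proof -
    show "same ?X a b0" by (simp add: b0_def same_def)
    have ptr0: "ptr (upd ''i'' 0 0 b0) b = L b" for b using nm by (cases b) (simp_all add: b0_def)
    have z: "upd ''i'' 0 0 b0 ''z'' 0 = of_bool True" "written (upd ''i'' 0 0 b0) (map index (filter genuine []))"
      by (simp_all add: b0_def written_def)
    show "emitting 0 (upd ''i'' 0 0 b0)"
      unfolding emitting_def
      by (rule exI[of _ "[]"], rule exI[of _ True])
        (use z LH in \<open>simp add: ptr0 route_def remaining_def bds_def less_imp_le del: upd_apply\<close>)
  qed
  show ?thesis
    unfolding emitc_def add.commute[of _ 4]
  proof (rule wp_sequ[where R = "\<lambda>b. b = b0"], goal_cases)
    case 1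
    show ?case
      by (rule wp_straight) (use bnd[OF assms] in \<open>simp_all add: b0_def\<close>)
  next
    case (2 b1)
    show ?case unfolding 2
    proof (rule wp_For[where lo = 0 and hi = ?N and I = "\<lambda>j b. b ''i'' 0 = j \<and> same ?X a b \<and> emitting j b"], goal_cases)
      case 3
      show ?case using LH[of True] LH[of False] by simp
    next
      case 4
      show ?case using b0 by (simp add: same_upd)
    next
      case (5 j b)
      let ?d = "eff (Cond (ILess (IConst 0) (V ''z'')) (stepc (nm True) 0) (stepc (nm False) 1)) b"
      have pb: "presents b" using 5(3) pres by blast
      obtain P s where I: "route = P @ emit EN GP M s (remaining s (ptr b s)) (remaining (\<not> s) (ptr b (\<not> s)))"
        "b ''z'' 0 = of_bool s" "written b (map index (filter genuine P))" "\<forall>t. L t \<le> ptr b t \<and> ptr b t \<le> H t"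
        "j = (ptr b True - L True) + (ptr b False - L False) \<or> ptr b s = H s"
        using 5(3) unfolding emitting_def by blast
      have d: "?d = eff (stepc (nm s) (of_bool (\<not> s))) b" using I(2) by (cases s) simp_all
      show ?case
      proof (cases "ptr b s < H s")
        case False
        then have e: "ptr b s = H s" using I(4) by (metis order_le_less)
        have "?d = b" unfolding d using bnd(2)[OF pb, of s] False by (simp add: stepc_def Let_def)
        moreover have "emitting (j + 1) (upd ''i'' 0 (j + 1) b)"
          unfolding emitting_def using I e by (intro exI[of _ P] exI[of _ s]) (simp add: written_def)
        ultimately show ?thesis using 5(3) by (simp add: same_upd)
      next
        case True
        note E = eff_step[OF pb I(1-3) True, folded d]
        have sm: "same ?X a ?d"
        proof -
          have "same ?X b ?d" using E(4) by (cases s) (auto simp: same_def)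
          then show ?thesis using same_trans[of ?X a b ?X ?d ?X] 5(3) by blast
        qed
        have iv: "?d ''i'' 0 = j" using E(4) 5(3) by (simp add: same_def)
        obtain P' t where P': "route = P' @ emit EN GP M t (remaining t (ptr ?d t)) (remaining (\<not> t) (ptr ?d (\<not> t)))"
          "?d ''z'' 0 = of_bool t" "written ?d (map index (filter genuine P'))"
          using E(1) by blast
        have sum: "(ptr ?d True - L True) + (ptr ?d False - L False) = j + 1"
        proof -
          have "j = (ptr b True - L True) + (ptr b False - L False)" using I(5) True by auto
          then show ?thesis using E(2,3) by (cases s) simp_all
        qed
        have range: "L r \<le> ptr ?d r \<and> ptr ?d r \<le> H r" for r
        proof (cases "r = s")
          case r: True
          have "L s \<le> ptr b s" using I(4) by blast
          then show ?thesis unfolding r E(2) using True by linarith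
        next
          case False
          then have "r = (\<not> s)" by blast
          show ?thesis unfolding \<open>r = (\<not> s)\<close> E(3) using I(4) by blast
        qed
        have "emitting (j + 1) (upd ''i'' 0 (j + 1) ?d)"
          unfolding emitting_def
          by (rule exI[of _ P'], rule exI[of _ t]) (use P' sum range in \<open>simp add: written_def del: eff.simps\<close>)
        then show ?thesis using sm iv by (simp add: same_upd del: eff.simps)
      qed
    next
      case (6 j b)
      then have "presents b" using pres by blast
      then show ?case using 6 bnd[of b] by simp
    next
      case (7 b)
      then obtain P s where I: "route = P @ emit EN GP M s (remaining s (ptr b s)) (remaining (\<not> s) (ptr b (\<not> s)))"
        "written b (map index (filter genuine P))" "\<forall>t. L t \<le> ptr b t \<and> ptr b t \<le> H t"
        "?N = (ptr b True - L True) + (ptr b False - L False) \<or> ptr b s = H s"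
        unfolding emitting_def by blast
      have "ptr b s = H s"
        using I(4)
      proof
        assume "?N = (ptr b True - L True) + (ptr b False - L False)"
        moreover have "ptr b True \<le> H True" "ptr b False \<le> H False" using I(3) by blast+
        ultimately have "ptr b True = H True" "ptr b False = H False" by linarith+
        then show ?thesis by (cases s) simp_all
      qed
      then have "remaining s (ptr b s) = []" by (simp add: remaining_def)
      then have "route = P" using I(1) by simp
      then show ?case using I(2) by simp
    next
      case 8
      show ?case by (simp add: cost_def)
    qed simp_all
  qed
qed

end

end

section \<open>Padding the two words\<close>

context chain
begin

lemma left_chain: "chain (w(lo - 1 := True)) (lo - 1) hi"
proof
  show "lo - 1 \<le> i \<and> i < hi" if "(w(lo - 1 := True)) i" for i
    using that range[of i] ne by (auto split: if_splits)
qed (use ne in simp)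

lemma right_chain: "chain (w(hi := True)) lo (hi + 1)"
proof
  show "lo \<le> i \<and> i < hi + 1" if "(w(hi := True)) i" for i
    using that range[of i] ne by (auto split: if_splits)
qed (use ne in simp)

lemma count_left: "cnt (lo - 1) hi (w(lo - 1 := True)) = ct w + 1"
proof -
  have "{lo - 1..<hi} = insert (lo - 1) {lo..<hi}" using ne by auto
  moreover have "(\<Sum>i\<in>{lo..<hi}. of_bool ((w(lo - 1 := True)) i)) = (\<Sum>i\<in>{lo..<hi}. of_bool (w i) :: int)"
    by (rule sum.cong) auto
  ultimately show ?thesis unfolding cnt_def by (simp del: sum_of_bool_eq fun_upd_apply) simp
qed

lemma count_right: "cnt lo (hi + 1) (w(hi := True)) = ct w + 1"
proof -
  have "{lo..<hi + 1} = insert hi {lo..<hi}" using ne by auto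
  moreover have "(\<Sum>i\<in>{lo..<hi}. of_bool ((w(hi := True)) i)) = (\<Sum>i\<in>{lo..<hi}. of_bool (w i) :: int)"
    by (rule sum.cong) auto
  ultimately show ?thesis unfolding cnt_def by (simp del: sum_of_bool_eq fun_upd_apply) simp
qed

lemma minors_left: "cnt (lo - 1) hi (mino (w(lo - 1 := True)) (lo - 1) hi) = ct mi"
  using chain.count_length[OF left_chain] count_left count_length by linarith

lemma minors_right: "cnt lo (hi + 1) (mino (w(hi := True)) lo (hi + 1)) = ct mi"
  using chain.count_length[OF right_chain] count_right count_length by linarith

end

text \<open>Both additional majors end up at an end of the path.\<close>

definition pad :: "(int \<Rightarrow> bool) \<Rightarrow> int \<Rightarrow> bool \<Rightarrow> bool \<Rightarrow> int \<Rightarrow> bool" where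
  "pad v n l r i \<longleftrightarrow> (0 \<le> i \<and> i < n \<and> v i) \<or> (i = -1 \<and> l) \<or> (i = n \<and> r)"

abbreviation "base v n \<equiv> pad v n False False"

lemma pad_left: "0 \<le> n \<Longrightarrow> pad v n True r = (pad v n False r)(0 - 1 := True)"
  by (auto simp: pad_def fun_eq_iff)

lemma pad_right: "0 \<le> n \<Longrightarrow> pad v n l True = (pad v n l False)(n := True)"
  by (auto simp: pad_def fun_eq_iff)

lemma pad_chain: "1 \<le> n \<Longrightarrow> chain (pad v n l r) (- of_bool l) (n + of_bool r)"
  by unfold_locales (auto simp: pad_def split: if_splits)

lemma pad_counts:
  assumes "1 \<le> n"
  shows "excess (pad v n l r) (- of_bool l) (n + of_bool r) = excess (base v n) 0 n + of_bool l + of_bool r"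
    "cnt (- of_bool l) (n + of_bool r) (mino (pad v n l r) (- of_bool l) (n + of_bool r)) = cnt 0 n (mino (base v n) 0 n)"
    "cnt (- of_bool l) (n + of_bool r) (pad v n l r) = cnt 0 n (base v n) + of_bool l + of_bool r"
proof -
  have 1: "cnt 0 (n + of_bool r) (pad v n False r) = cnt 0 n (base v n) + of_bool r \<and>
    cnt 0 (n + of_bool r) (mino (pad v n False r) 0 (n + of_bool r)) = cnt 0 n (mino (base v n) 0 n)" for r
    using chain.count_right[OF pad_chain[OF assms, of v False False]]
      chain.minors_right[OF pad_chain[OF assms, of v False False]] pad_right[of n v False] assms
    by (cases r) simp_all
  have 2: "cnt (- of_bool l) (n + of_bool r) (pad v n l r) = cnt 0 (n + of_bool r) (pad v n False r) + of_bool l \<and>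
    cnt (- of_bool l) (n + of_bool r) (mino (pad v n l r) (- of_bool l) (n + of_bool r)) =
    cnt 0 (n + of_bool r) (mino (pad v n False r) 0 (n + of_bool r))"
    using chain.count_left[OF pad_chain[OF assms, of v False r]]
      chain.minors_left[OF pad_chain[OF assms, of v False r]] pad_left[of n v r] assms
    by (cases l) simp_all
  show "cnt (- of_bool l) (n + of_bool r) (mino (pad v n l r) (- of_bool l) (n + of_bool r)) = cnt 0 n (mino (base v n) 0 n)"
    "cnt (- of_bool l) (n + of_bool r) (pad v n l r) = cnt 0 n (base v n) + of_bool l + of_bool r"
    using 1[of r] 2 by auto
  then show "excess (pad v n l r) (- of_bool l) (n + of_bool r) = excess (base v n) 0 n + of_bool l + of_bool r"
    by (simp add: excess_def)
qed

lemma wide_pad_mono: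
  assumes "1 \<le> n" "l \<Longrightarrow> l'" "r \<Longrightarrow> r'"
  shows "wide (pad v n l r) (- of_bool l) (n + of_bool r) \<le> wide (pad v n l' r') (- of_bool l') (n + of_bool r')"
proof -
  have "wide (pad v n l r) (- of_bool l) (n + of_bool r) \<le> wide (pad v n l r') (- of_bool l) (n + of_bool r')"
    using chain.wide_right[OF pad_chain[OF assms(1), of v l False]] pad_right[of n v l] assms(1,3)
    by (cases r; cases r') auto
  also have "\<dots> \<le> wide (pad v n l' r') (- of_bool l') (n + of_bool r')"
    using chain.wide_left[OF pad_chain[OF assms(1), of v False r']] pad_left[of n v r'] assms(1,2)
    by (cases l; cases l') auto
  finally show ?thesis .
qed

section \<open>Choosing the outer chain and the padding\<close>

locale two_words =
  fixes v :: "bool \<Rightarrow> int \<Rightarrow> bool" and n :: "bool \<Rightarrow> int"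
  assumes n_pos: "1 \<le> n b" and n_le: "n b \<le> 4 * n (\<not> b)"
    and exc: "0 \<le> excess (base (v b) (n b)) 0 (n b)"
    and diff: "excess (base (v b) (n b)) 0 (n b) \<le> excess (base (v (\<not> b)) (n (\<not> b))) 0 (n (\<not> b)) + 1"
begin

definition "D b = excess (base (v b) (n b)) 0 (n b)"
definition "P b l r = pad (v b) (n b) l r"
definition "wid b l r = wide (P b l r) (- of_bool l) (n b + of_bool r)"

lemma base_chain: "chain (base (v b) (n b)) 0 (n b)"
  using pad_chain[OF n_pos[of b], of "v b" False False] by simp

lemma majors: "1 \<le> cnt 0 (n b) (base (v b) (n b))"
proof -
  interpret chain "base (v b) (n b)" 0 "n b" by (rule base_chain)
  show ?thesis using exc[of b] count_length n_pos[of b] by (simp add: excess_def)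
qed

lemma minors: "2 * cnt 0 (n b) (mino (base (v b) (n b)) 0 (n b)) \<le> n b"
proof -
  interpret chain "base (v b) (n b)" 0 "n b" by (rule base_chain)
  show ?thesis using exc[of b] count_length by (simp add: excess_def)
qed

lemma D_le: "D b \<le> n b"
proof -
  interpret chain "base (v b) (n b)" 0 "n b" by (rule base_chain)
  show ?thesis using count_length cnt_nonneg[of 0 "n b" mi] by (simp add: excess_def D_def)
qed

lemma wid_le: "4 * wid b l r \<le> n b"
proof -
  have "2 * wid b l r \<le> cnt 0 (n b) (mino (base (v b) (n b)) 0 (n b))"
    using chain.wide_bound[OF pad_chain[OF n_pos[of b], of "v b" l r]] pad_counts(2)[OF n_pos[of b], where v = "v b" and l = l and r = r]
    by (simp add: wid_def P_def)
  then show ?thesis using minors[of b] by linarith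
qed

lemma decomposition_pad:
  assumes "D b + of_bool l + of_bool r \<le> k" "wid b l r + 1 \<le> k" "k \<le> n b + of_bool l + of_bool r"
  shows "decomposition (P b l r) (- of_bool l) (n b + of_bool r) k"
proof -
  interpret chain "P b l r" "- of_bool l" "n b + of_bool r" unfolding P_def by (rule pad_chain[OF n_pos])
  show ?thesis
    using assms majors[of b] exc[of b] pad_counts[OF n_pos[of b], where v = "v b" and l = l and r = r]
    by unfold_locales (auto simp: wid_def P_def D_def)
qed

text \<open>The number \<open>k\<close> of inner bodies must reach the outer width and the inner
  excess, exceed the inner width, and stay within the inner length. The second assumption gives the
  strict bound. For the length, the outer width is at most a quarter of the outer length, which is
  at most four times the inner one.\<close>

lemma engine_outer:
  assumes "D s + of_bool l + of_bool r = D (\<not> s) + 1"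
    and "wid (\<not> s) False False < wid s l r \<or> wid (\<not> s) False False < D (\<not> s)"
    and "k = max (wid s l r) (D (\<not> s))"
  shows "engine (P s l r) (- of_bool l) (n s + of_bool r) (P (\<not> s) False False) 0 (n (\<not> s)) k (k + 1)"
proof -
  interpret O: chain "P s l r" "- of_bool l" "n s + of_bool r" unfolding P_def by (rule pad_chain[OF n_pos])
  have "4 * wid s l r \<le> 4 * n (\<not> s)" using wid_le[of s l r] n_le[of s] by linarith
  then have "k \<le> n (\<not> s)" using D_le[of "\<not> s"] assms(3) by simp
  then interpret I: decomposition "P (\<not> s) False False" 0 "n (\<not> s)" k
    using decomposition_pad[of "\<not> s" False False k] assms(2,3) by force
  show ?thesis
  proof unfold_locales
    have "excess (P s l r) (- of_bool l) (n s + of_bool r) = excess (P (\<not> s) False False) 0 (n (\<not> s)) + 1"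
      using assms(1) pad_counts(1)[OF n_pos[of s], of "v s" l r] by (simp add: P_def D_def)
    moreover have "k = wide (P s l r) (- of_bool l) (n s + of_bool r) \<or>
        (wide (P s l r) (- of_bool l) (n s + of_bool r) \<le> k \<and> k = excess (P (\<not> s) False False) 0 (n (\<not> s)))"
      using assms(3) by (auto simp: wid_def P_def D_def max_def)
    ultimately show "(k + 1 = k + 1 \<and> excess (P s l r) (- of_bool l) (n s + of_bool r) = excess (P (\<not> s) False False) 0 (n (\<not> s)) + 1 \<and>
        (k = wide (P s l r) (- of_bool l) (n s + of_bool r) \<or>
        (wide (P s l r) (- of_bool l) (n s + of_bool r) \<le> k \<and> k = excess (P (\<not> s) False False) 0 (n (\<not> s))))) \<or>
      (k + 1 = k \<and> k = wide (P (\<not> s) False False) 0 (n (\<not> s)) + 1 \<and>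
        wide (P s l r) (- of_bool l) (n s + of_bool r) = wide (P (\<not> s) False False) 0 (n (\<not> s)) \<and>
        excess (P s l r) (- of_bool l) (n s + of_bool r) = excess (P (\<not> s) False False) 0 (n (\<not> s)) \<and>
        1 \<le> excess (P (\<not> s) False False) 0 (n (\<not> s)))"
      by blast
  qed
qed

text \<open>If the first chain cannot serve as the outer one and neither can the second one, then the monotonicity of
  the width under padding forces all widths to be equal.\<close>

lemma engine_equal:
  assumes "\<not> (wid False False False < wid True (D True \<le> D False) (D True < D False) \<or> wid False False False < D False)"
    and "\<not> (wid True False False < wid False (D False < D True) (D False \<le> D True) \<or> wid True False False < D True)"
    and "k = wid False False (D False \<le> D True) + 1"
  shows "engine (P True (D True \<le> D False) False) (- of_bool (D True \<le> D False)) (n True)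
     (P False False (D False \<le> D True)) 0 (n False + of_bool (D False \<le> D True)) k k"
proof -
  let ?l = "D True \<le> D False" and ?r = "D False \<le> D True"
  have m: "wid b l r \<le> wid b l' r'" if "l \<longrightarrow> l'" "r \<longrightarrow> r'" for b l r l' r'
    unfolding wid_def P_def using that by (intro wide_pad_mono[OF n_pos]) auto
  have 1: "wid True False False \<le> wid True ?l False" "wid True ?l False \<le> wid True ?l (D True < D False)"
    "wid False False False \<le> wid False False ?r" "wid False False ?r \<le> wid False (D False < D True) ?r"
    by (intro m; simp)+
  then have e: "wid True ?l False = k - 1" "wid False False ?r = k - 1" "D True \<le> k - 1" "D False \<le> k - 1"
    using assms by linarith+
  \<comment> \<open>If the excesses are equal, both chains get a major, otherwise only the one with
    the smaller excess. Afterwards the excesses are equal and positive.\<close>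
  have e2: "D True + of_bool ?l = D False + of_bool ?r" "1 \<le> D False + of_bool ?r" "D False + of_bool ?r \<le> k"
    using diff[of True] diff[of False] exc[of True] exc[of False] e(3,4) by (auto simp: D_def)
  interpret O: chain "P True ?l False" "- of_bool ?l" "n True"
    using pad_chain[OF n_pos[of True], of "v True" ?l False] by (simp add: P_def)
  have "4 * (k - 1) \<le> n False" using wid_le[of False False ?r] e(2) by simp
  \<comment> \<open>The quarter bound leaves room for the one additional body.\<close>
  then have "k \<le> n False" using n_pos[of False] by presburger
  then interpret I: decomposition "P False False ?r" 0 "n False + of_bool ?r" k
    using decomposition_pad[of False False ?r k] e e2 by simp
  show ?thesis
  proof unfold_locales
    have x: "excess (P True ?l False) (- of_bool ?l) (n True) = D True + of_bool ?l"
      "excess (P False False ?r) 0 (n False + of_bool ?r) = D False + of_bool ?r"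
      using pad_counts(1)[OF n_pos[of True], of "v True" ?l False] pad_counts(1)[OF n_pos[of False], of "v False" False ?r]
      by (simp_all add: P_def D_def)
    have y: "wide (P True ?l False) (- of_bool ?l) (n True) = k - 1" "wide (P False False ?r) 0 (n False + of_bool ?r) = k - 1"
      using e(1,2) by (simp_all add: wid_def)
    show "(k = k + 1 \<and> excess (P True ?l False) (- of_bool ?l) (n True) = excess (P False False ?r) 0 (n False + of_bool ?r) + 1 \<and>
       (k = wide (P True ?l False) (- of_bool ?l) (n True) \<or>
        (wide (P True ?l False) (- of_bool ?l) (n True) \<le> k \<and> k = excess (P False False ?r) 0 (n False + of_bool ?r)))) \<or>
      (k = k \<and> k = wide (P False False ?r) 0 (n False + of_bool ?r) + 1 \<and>
       wide (P True ?l False) (- of_bool ?l) (n True) = wide (P False False ?r) 0 (n False + of_bool ?r) \<and>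
       excess (P True ?l False) (- of_bool ?l) (n True) = excess (P False False ?r) 0 (n False + of_bool ?r) \<and>
       1 \<le> excess (P False False ?r) 0 (n False + of_bool ?r))"
      unfolding x y using e2 by simp
  qed
qed

end

section \<open>The tour\<close>

text \<open>The combinatorial form of the desired path, with no reference to points. Positions of
  both chains are numbered from 0, without the added majors.\<close>

definition tour :: "(bool \<Rightarrow> int) \<Rightarrow> (bool \<times> int \<Rightarrow> bool) \<Rightarrow> (bool \<times> int) list \<Rightarrow> bool" where
  "tour N c xs \<longleftrightarrow> distinct xs \<and> set xs = {(b, i). 0 \<le> i \<and> i < N b} \<and>
     (\<forall>p q. (p, q) \<in> edges xs \<longrightarrow> c p \<noteq> c q) \<and> (\<forall>e\<in>edges xs. \<forall>f\<in>edges xs. uncrossed e f)"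

lemma edges_set: "(p, q) \<in> edges xs \<Longrightarrow> p \<in> set xs \<and> q \<in> set xs"
  by (cases xs) (auto simp: edges_def dest: set_zip_leftD set_zip_rightD)

lemma (in linked_up) tour_route:
  assumes "\<And>b. L b \<le> 0" "\<And>b. N b \<le> H b"
    and "\<And>b i. L b \<le> i \<Longrightarrow> i < H b \<Longrightarrow> \<not> (0 \<le> i \<and> i < N b) \<Longrightarrow> (b, i) = hd route \<or> (b, i) = last route"
    and "\<And>b i. 0 \<le> i \<Longrightarrow> i < N b \<Longrightarrow> c (b, i) = color (b, i)"
  shows "tour N c (filter (\<lambda>p. 0 \<le> snd p \<and> snd p < N (fst p)) route)"
proof -
  let ?r = "\<lambda>p. 0 \<le> snd p \<and> snd p < N (fst p)"
  have E: "edges (filter ?r route) \<subseteq> edges route"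
  proof (rule edges_filter_ends[OF route_distinct])
    fix p assume "p \<in> set route" "\<not> ?r p"
    then show "p = hd route \<or> p = last route"
      using assms(3)[of "fst p" "snd p"] unfolding route_set by (cases p; cases "fst p") auto
  qed
  have S: "set (filter ?r route) = {(b, i). 0 \<le> i \<and> i < N b}"
  proof -
    have "p \<in> set route" if "?r p" for p
      using that assms(1,2)[of "fst p"] unfolding route_set by (cases p; cases "fst p") auto
    then show ?thesis by fastforce
  qed
  have "c p \<noteq> c q" if "(p, q) \<in> edges (filter ?r route)" for p q
  proof -
    have "p \<in> set (filter ?r route)" "q \<in> set (filter ?r route)"
      using edges_set[OF that] by blast+
    then have "c p = color p" "c q = color q" using S assms(4)[of "snd p" "fst p"] assms(4)[of "snd q" "fst q"] by auto
    then show ?thesis using route_color E that by blast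
  qed
  note C = this
  have U: "\<forall>e\<in>edges (filter ?r route). \<forall>f\<in>edges (filter ?r route). uncrossed e f"
    using route_uncrossed E by blast
  show ?thesis unfolding tour_def
  proof (intro conjI allI impI)
    show "distinct (filter ?r route)" by (rule distinct_filter[OF route_distinct])
  qed (use S C U in blast)+
qed

context engine
begin

abbreviation "sd a b \<equiv> \<lambda>s. if s then a else b"

lemma tour_engine:
  assumes M: "matched (sd wO wI) (sd loO loI) (sd hiO hiI) (sd sO I.status) (sd xO I.xcut) M"
    and N: "loO \<le> 0" "loI = 0" "NO \<le> hiO" "NI \<le> hiI"
    and "loO < 0 \<Longrightarrow> loO = -1 \<and> wO (-1)" "NO < hiO \<Longrightarrow> KO = K + 1 \<and> hiO = NO + 1 \<and> wO NO"
      "NI < hiI \<Longrightarrow> KO = K \<and> hiI = NI + 1 \<and> wI NI"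
    and c: "\<And>i. 0 \<le> i \<Longrightarrow> i < NO \<Longrightarrow> c (True, i) = wO i" "\<And>i. 0 \<le> i \<Longrightarrow> i < NI \<Longrightarrow> c (False, i) = (\<not> wI i)"
  shows "tour (sd NO NI) c (filter (\<lambda>p. 0 \<le> snd p \<and> snd p < sd NO NI (fst p))
     (matched.route (sd wO wI) (sd loO loI) (sd hiO hiI) (sd sO I.status) (sd xO I.xcut) M))"
proof -
  interpret m: matched "sd wO wI" "sd loO loI" "sd hiO hiI" "sd sO I.status" "sd xO I.xcut" M by (rule M)
  have fO: "flags wO loO hiO sO xO = slots (sd wO wI) m.EN True True (m.bds True)"
  proof -
    have "O.en = m.EN True" "O.bo = m.B True" by (simp_all add: m.EN_def m.B_def fun_eq_iff)
    then show ?thesis unfolding flags_def m.bds_def using slots_cong[of "\<lambda>_. wO" True "sd wO wI" True] by simp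
  qed
  have fI: "SI = slots (sd wO wI) m.EN False True (m.bds False)"
  proof -
    have "ends wI loI hiI I.status I.xcut = m.EN False" "body wI loI hiI I.status I.xcut = m.B False"
      by (simp_all add: m.EN_def m.B_def fun_eq_iff)
    then show ?thesis unfolding SI_def flags_def m.bds_def using slots_cong[of "\<lambda>_. wI" True "sd wO wI" False] by simp
  qed
  have ne: "m.bds True \<noteq> []"
  proof -
    obtain i where "loO \<le> i" "i < hiO" "O.en i" using cnt_pos_ex[OF ends_pos] by blast
    then have "i \<in> set (m.bds True)" by (auto simp: m.bds_def m.B_def ends_def)
    then show ?thesis by force
  qed
  have tl: "slots (sd wO wI) m.EN True False (m.bds True) = tl (flags wO loO hiO sO xO)"
    unfolding fO using ne by (cases "m.bds True") simp_all
  have fne: "flags wO loO hiO sO xO \<noteq> []" unfolding fO using ne by (cases "m.bds True") simp_all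
  have sl: "if KO = K + 1 then slots (sd wO wI) m.EN True False (m.bds True) = slots (sd wO wI) m.EN False True (m.bds False) @ [False]
    else slots (sd wO wI) m.EN True False (m.bds True) @ [False] = slots (sd wO wI) m.EN False True (m.bds False)"
    unfolding tl fI[symmetric] using flags_O fne
    by (cases "flags wO loO hiO sO xO") (auto split: if_splits)
  interpret m: linked_up "sd wO wI" "sd loO loI" "sd hiO hiI" "sd sO I.status" "sd xO I.xcut" M
  proof
    show "step1 (slots (sd wO wI) m.EN True False (m.bds True)) (slots (sd wO wI) m.EN False True (m.bds False))"
    proof (cases "KO = K + 1")
      case True
      then show ?thesis unfolding step1_def using sl by auto
    next
      case False
      then have "slots (sd wO wI) m.EN False True (m.bds False) = slots (sd wO wI) m.EN True False (m.bds True) @ [False]"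
        using sl by simp
      then show ?thesis unfolding step1_def by blast
    qed
  qed (rule ne)
  show ?thesis
  proof (rule m.tour_route)
    fix b i assume i: "sd loO loI b \<le> i" "i < sd hiO hiI b" "\<not> (0 \<le> i \<and> i < sd NO NI b)"
    have "i < 0 \<or> sd NO NI b \<le> i" using i(3) by auto
    then show "(b, i) = hd m.route \<or> (b, i) = last m.route"
    proof
      assume "i < 0"
      then have b: "b" "loO = -1" "wO (-1)" "i = -1" using i(1) N(2) assms(6) by (auto split: if_splits)
      then show ?thesis using m.hd_route by simp
    next
      assume r: "sd NO NI b \<le> i"
      show ?thesis
      proof (cases b)
        case True
        then have h: "KO = K + 1" "i = NO" "hiO = NO + 1" "wO NO" using i(2) r assms(7) by auto
        then have "last m.route = (True, last (m.bds True))" using m.last_route(1)[of False] sl by simp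
        moreover have "last (m.bds True) = NO" using m.last_bds[of True] h by simp
        ultimately show ?thesis using True h by simp
      next
        case False
        then have h: "KO = K" "i = NI" "hiI = NI + 1" "wI NI" using i(2) r assms(8) by auto
        then have "last m.route = (False, last (m.bds False))" using m.last_route(2)[of False] sl by simp
        moreover have "last (m.bds False) = NI" using m.last_bds[of False] h by simp
        ultimately show ?thesis using False h by simp
      qed
    qed
  qed (use N c in \<open>auto simp: m.color_def split: if_splits\<close>)
qed

end

section \<open>The program for fixed roles of the chains\<close>

definition enginec :: "string \<Rightarrow> string \<Rightarrow> com" where
  "enginec d c = Sequ (Asg ''h'' (ISub (V ''K'') (IAdd (V (CHR ''d'' # c))
       (ISub (ISub (V (CHR ''m'' # c)) (V (CHR ''n'' # c))) (V (CHR ''l'' # c))))))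
     (Sequ (greedyc c) (Sequ (skipc c (V ''K'')) (Sequ (cutc c) (Sequ (endsc c) (Sequ (attachc d c)
       (Sequ (skipc d (V ''J'')) (Sequ (cutc d) (Sequ (endsc d) (Sequ (stackc c) (Sequ (stackc d) (emitc d c)))))))))))"

context engine
begin

lemma skip_O_nonneg: "0 \<le> skip wO loO hiO sO KO"
proof -
  have "0 \<le> O.ct wO - wide wO loO hiO - 1"
    using cnt_nonneg[of loO hiO "place wO loO hiO sO"] place_O by simp
  then show ?thesis
    using mode cnt_nonneg[of loO hiO O.mi] unfolding skip_O excess_def[of wO] by auto
qed

lemma wp_engine:
  fixes d c :: string
  assumes dc: "d \<noteq> c" and "word d wO loO hiO a" "word c wI loI hiI a" "a ''K'' 0 = K" "a ''J'' 0 = KO"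
    and "a (CHR ''d'' # c) 0 + (hiI - a (CHR ''n'' # c) 0 - loI) = excess wI loI hiI"
    and "a (CHR ''n'' # d) 0 = NO" "a (CHR ''n'' # c) 0 = NI" "a (CHR ''b'' # d) 0 = bO" "a (CHR ''b'' # c) 0 = bI"
    and "\<And>x e. x \<in> set ''sxyef'' \<Longrightarrow> e \<in> {d, c} \<Longrightarrow> a (x # e) = (\<lambda>_. 0)"
  defines "W \<equiv> sd wO wI" and "L \<equiv> sd loO loI" and "H \<equiv> sd hiO hiI" and "S \<equiv> sd sO I.status" and "X \<equiv> sd xO I.xcut"
  shows "wp (enginec d c) (20 * cost ((hiO - loO) + (hiI - loI))) (\<lambda>b. \<exists>M. matched W L H S X M \<and>
     written b (map (\<lambda>p. sd bO bI (fst p) + snd p)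
       (filter (\<lambda>p. 0 \<le> snd p \<and> snd p < sd NO NI (fst p)) (matched.route W L H S X M)))) a"
proof -
  define base where "base b \<longleftrightarrow> word d wO loO hiO b \<and> word c wI loI hiI b \<and> b ''K'' 0 = K \<and> b ''J'' 0 = KO \<and>
    b (CHR ''n'' # d) 0 = NO \<and> b (CHR ''n'' # c) 0 = NI \<and> b (CHR ''b'' # d) 0 = bO \<and> b (CHR ''b'' # c) 0 = bI" for b
  define Z where "Z x e b \<longleftrightarrow> b (x # e) = (\<lambda>_. 0 :: int)" for x :: char and e and b :: ram
  define A where "A x e f b \<longleftrightarrow> b (x # e) = (\<lambda>i. of_bool (f i) :: int)" for x :: char and e f and b :: ram
  \<comment> \<open>The assertions between the phases. Besides the arrays already computed, each
    lists those that must still be zero, because every later phase relies on untouched cells as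
    default values.\<close>
  define R1 where "R1 b \<longleftrightarrow> base b \<and> b ''h'' 0 = K - excess wI loI hiI \<and> Z CHR ''s'' c b \<and> Z CHR ''x'' c b \<and> Z CHR ''y'' c b \<and>
    Z CHR ''e'' c b \<and> Z CHR ''f'' c b \<and> Z CHR ''s'' d b \<and> Z CHR ''x'' d b \<and> Z CHR ''y'' d b \<and> Z CHR ''e'' d b \<and> Z CHR ''f'' d b" for b
  define R2 where "R2 b \<longleftrightarrow> base b \<and> b (CHR ''s'' # c) = I.status \<and> Z CHR ''x'' c b \<and> Z CHR ''y'' c b \<and>
    Z CHR ''e'' c b \<and> Z CHR ''f'' c b \<and> Z CHR ''s'' d b \<and> Z CHR ''x'' d b \<and> Z CHR ''y'' d b \<and> Z CHR ''e'' d b \<and> Z CHR ''f'' d b" for b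
  define R3 where "R3 b \<longleftrightarrow> R2 b \<and> b ''k'' 0 = skip wI loI hiI I.status K" for b
  define C where "C b \<longleftrightarrow> A CHR ''x'' c I.xcut b \<and> A CHR ''y'' c (body wI loI hiI I.status I.xcut) b" for b
  define R4 where "R4 b \<longleftrightarrow> base b \<and> b (CHR ''s'' # c) = I.status \<and> C b \<and>
    Z CHR ''e'' c b \<and> Z CHR ''f'' c b \<and> Z CHR ''s'' d b \<and> Z CHR ''x'' d b \<and> Z CHR ''y'' d b \<and> Z CHR ''e'' d b \<and> Z CHR ''f'' d b" for b
  define C' where "C' b \<longleftrightarrow> C b \<and> A CHR ''e'' c (ends wI loI hiI I.status I.xcut) b" for b
  define R5 where "R5 b \<longleftrightarrow> base b \<and> C' b \<and> A CHR ''f'' c FA b \<and>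
    Z CHR ''s'' d b \<and> Z CHR ''x'' d b \<and> Z CHR ''y'' d b \<and> Z CHR ''e'' d b \<and> Z CHR ''f'' d b" for b
  define R6 where "R6 b \<longleftrightarrow> base b \<and> C' b \<and> b (CHR ''s'' # d) = sO \<and>
    Z CHR ''x'' d b \<and> Z CHR ''y'' d b \<and> Z CHR ''e'' d b \<and> Z CHR ''f'' d b" for b
  define R7 where "R7 b \<longleftrightarrow> R6 b \<and> b ''k'' 0 = skip wO loO hiO sO KO" for b
  define E where "E b \<longleftrightarrow> A CHR ''x'' d xO b \<and> A CHR ''y'' d (body wO loO hiO sO xO) b" for b
  define R8 where "R8 b \<longleftrightarrow> base b \<and> C' b \<and> E b \<and> b (CHR ''s'' # d) = sO \<and> Z CHR ''e'' d b \<and> Z CHR ''f'' d b" for b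
  define R9 where "R9 b \<longleftrightarrow> base b \<and> C' b \<and> E b \<and> A CHR ''e'' d (ends wO loO hiO sO xO) b" for b
  define R10 where "R10 b \<longleftrightarrow> R9 b \<and> (\<exists>T. labelled.stacked wI loI hiI I.status I.xcut hiI T (b (CHR ''g'' # c)))" for b
  define R11 where "R11 b \<longleftrightarrow> R10 b \<and> (\<exists>T. labelled.stacked wO loO hiO sO xO hiO T (b (CHR ''g'' # d)))" for b
  note Z = base_def Z_def A_def C_def C'_def E_def word_def same_def
  note cd = dc dc[symmetric]
  let ?cI = "cost (hiI - loI)" and ?cO = "cost (hiO - loO)"
  have FA: "FA = lookup SI" by (simp add: FA_def lookup_def fun_eq_iff)
  \<comment> \<open>The cell \<open>d\<close> holds the excess of the chain without padding;
    \<open>m - n - l\<close> adds the number of majors attached at its borders.\<close>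
  have 1: "wp (Asg ''h'' (ISub (V ''K'') (IAdd (V (CHR ''d'' # c))
       (ISub (ISub (V (CHR ''m'' # c)) (V (CHR ''n'' # c))) (V (CHR ''l'' # c)))))) 1 R1 a"
    by (rule wp_straight) (use assms(2-10) assms(11) in \<open>simp_all add: R1_def Z\<close>)
  have 2: "wp (greedyc c) (7 * ?cI) R2 b" if "R1 b" for b
    by (rule wp_mono[OF wp_greedy[where w = wI and lo = loI and hi = hiI and h = "K - excess wI loI hiI"]])
      (use that cd I.greedy_axioms in \<open>simp_all add: R1_def R2_def Z\<close>)
  have 3: "wp (skipc c (V ''K'')) (?cI + 1) R3 b" if "R2 b" for b
    by (rule wp_mono[OF wp_skip[where T = K and s = I.status and w = wI and lo = loI and hi = hiI]])
      (use that cd I.statuses_axioms in \<open>simp_all add: R3_def R2_def Z\<close>)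
  have 4: "wp (cutc c) ?cI R4 b" if "R3 b" for b
    by (rule wp_mono[OF wp_cut[where s = I.status and w = wI and lo = loI and hi = hiI]])
      (use that cd I.statuses_axioms I.skip_bounds in \<open>simp_all add: R3_def R2_def R4_def Z\<close>)
  have 5: "wp (endsc c) (?cI + 1) R5 b" if "R4 b" for b
    by (rule wp_mono[OF wp_ends[where s = I.status and x = I.xcut and w = wI and lo = loI and hi = hiI]])
      (use that cd I.labelled_axioms in \<open>simp_all add: R4_def R5_def FA SI_def Z\<close>)
  have 6: "wp (attachc d c) (?cO + 1) R6 b" if "R5 b" for b
    by (rule wp_mono[OF wp_attach[where F = FA and w = wO and lo = loO and hi = hiO]])
      (use that cd O.chain_axioms in \<open>simp_all add: R5_def R6_def sO_def Z\<close>)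
  have 7: "wp (skipc d (V ''J'')) (?cO + 1) R7 b" if "R6 b" for b
    by (rule wp_mono[OF wp_skip[where T = KO and s = sO and w = wO and lo = loO and hi = hiO]])
      (use that cd O.statuses_axioms in \<open>simp_all add: R6_def R7_def Z\<close>)
  have 8: "wp (cutc d) ?cO R8 b" if "R7 b" for b
    by (rule wp_mono[OF wp_cut[where s = sO and w = wO and lo = loO and hi = hiO]])
      (use that cd O.statuses_axioms skip_O_nonneg in \<open>simp_all add: R6_def R7_def R8_def xO_def Z\<close>)
  have 9: "wp (endsc d) (?cO + 1) R9 b" if "R8 b" for b
    by (rule wp_mono[OF wp_ends[where s = sO and x = xO and w = wO and lo = loO and hi = hiO]])
      (use that cd O.labelled_axioms in \<open>simp_all add: R8_def R9_def Z\<close>)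
  have 10: "wp (stackc c) (?cI + 1) R10 b" if "R9 b" for b
    by (rule wp_mono[OF wp_stack[where s = I.status and x = I.xcut and w = wI and lo = loI and hi = hiI]])
      (use that cd I.labelled_axioms in \<open>simp_all add: R9_def R10_def Z\<close>)
  have 11: "wp (stackc d) (?cO + 1) R11 b" if "R10 b" for b
    by (rule wp_mono[OF wp_stack[where s = sO and x = xO and w = wO and lo = loO and hi = hiO]])
      (use that cd O.labelled_axioms in \<open>simp_all add: R9_def R10_def R11_def Z\<close>)
  have 12: "wp (emitc d c) (cost ((hiO - loO) + (hiI - loI)) + 4) (\<lambda>b. \<exists>M. matched W L H S X M \<and>
     written b (map (\<lambda>p. sd bO bI (fst p) + snd p)
       (filter (\<lambda>p. 0 \<le> snd p \<and> snd p < sd NO NI (fst p)) (matched.route W L H S X M)))) b"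
    if R: "R11 b" for b
  proof -
    define M where "M = sd (b (CHR ''g'' # d)) (b (CHR ''g'' # c))"
    obtain T where T: "I.stacked hiI T (b (CHR ''g'' # c))" using R unfolding R11_def R10_def by blast
    obtain U where U: "O.stacked hiO U (b (CHR ''g'' # d))" using R unfolding R11_def by blast
    note fI = I.stacked_final[OF T I.balanced_k] and fO = O.stacked_final[OF U balanced_O]
    have m: "matched W L H S X M"
    proof (rule matched.intro)
      fix s i j
      show "labelled (W s) (L s) (H s) (S s) (X s)"
        using O.labelled_axioms I.labelled_axioms by (simp add: W_def L_def H_def S_def X_def)
      show "gaps (W s) (X s) i \<Longrightarrow> spines (W s) (L s) (H s) (S s) (X s) (M s i)"
        using fI(1) fO(1) by (simp add: W_def L_def H_def S_def X_def M_def split: if_splits)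
      show "inj_on (M s) {i. gaps (W s) (X s) i}"
        using fI(2) fO(2) by (simp add: W_def X_def M_def)
      show "spines (W s) (L s) (H s) (S s) (X s) j \<Longrightarrow> \<exists>i. gaps (W s) (X s) i \<and> M s i = j"
        using fI(3) fO(3) by (simp add: W_def L_def H_def S_def X_def M_def split: if_splits)
      show "gaps (W s) (X s) i \<Longrightarrow> gaps (W s) (X s) j \<Longrightarrow> i \<noteq> j \<Longrightarrow> \<not> interleaved i (M s i) j (M s j)"
        using fI(4) fO(4) by (simp add: W_def X_def M_def split: if_splits)
    qed
    interpret m: matched W L H S X M by (rule m)
    have nm: "sd d c True \<noteq> sd d c False" using dc by simp
    have BE: "m.B = (\<lambda>s. if s then body wO loO hiO sO xO else body wI loI hiI I.status I.xcut)"
      "m.EN = (\<lambda>s. if s then ends wO loO hiO sO xO else ends wI loI hiI I.status I.xcut)"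
      by (intro ext; simp only: m.B_def m.EN_def; simp add: W_def L_def H_def S_def X_def)+
    have pr: "m.presents (sd d c) (sd NO NI) (sd bO bI) b"
      unfolding m.presents_def[OF nm] unfolding BE unfolding W_def L_def H_def M_def
    proof
      fix s
      have "base b" "A CHR ''y'' d (body wO loO hiO sO xO) b" "A CHR ''y'' c (body wI loI hiI I.status I.xcut) b"
        "A CHR ''e'' d (ends wO loO hiO sO xO) b" "A CHR ''e'' c (ends wI loI hiI I.status I.xcut) b"
        using R unfolding R11_def R10_def R9_def C'_def C_def E_def by blast+
      then show "word (sd d c s) (sd wO wI s) (sd loO loI s) (sd hiO hiI s) b \<and>
        b (CHR ''y'' # sd d c s) = (\<lambda>i. of_bool ((if s then body wO loO hiO sO xO else body wI loI hiI I.status I.xcut) i)) \<and>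
        b (CHR ''e'' # sd d c s) = (\<lambda>i. of_bool ((if s then ends wO loO hiO sO xO else ends wI loI hiI I.status I.xcut) i)) \<and>
        b (CHR ''g'' # sd d c s) = sd (b (CHR ''g'' # d)) (b (CHR ''g'' # c)) s \<and>
        b (CHR ''n'' # sd d c s) 0 = sd NO NI s \<and> b (CHR ''b'' # sd d c s) 0 = sd bO bI s"
        unfolding base_def A_def by (cases s) simp_all
    qed
    note e = m.wp_emit[OF nm pr]
    have g: "m.genuine (sd NO NI) = (\<lambda>p. 0 \<le> snd p \<and> snd p < sd NO NI (fst p))"
      "m.index (sd bO bI) = (\<lambda>p. sd bO bI (fst p) + snd p)"
      by (simp_all add: fun_eq_iff m.genuine_def[OF nm] m.index_def[OF nm])
    have LH: "(H True - L True) + (H False - L False) = (hiO - loO) + (hiI - loI)" by (simp add: H_def L_def)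
    show ?thesis
      by (rule wp_mono[OF e[unfolded LH g if_True if_False]], rule le_refl, use m in blast)
  qed
  have "wp (enginec d c) (1 + (7 * ?cI + ((?cI + 1) + (?cI + ((?cI + 1) + ((?cO + 1) + ((?cO + 1) + (?cO + ((?cO + 1) +
      ((?cI + 1) + ((?cO + 1) + (cost ((hiO - loO) + (hiI - loI)) + 4)))))))))))) (\<lambda>b. \<exists>M. matched W L H S X M \<and>
     written b (map (\<lambda>p. sd bO bI (fst p) + snd p)
       (filter (\<lambda>p. 0 \<le> snd p \<and> snd p < sd NO NI (fst p)) (matched.route W L H S X M)))) a"
    unfolding enginec_def
    by (rule wp_sequ[OF 1 wp_sequ[OF 2 wp_sequ[OF 3 wp_sequ[OF 4 wp_sequ[OF 5 wp_sequ[OF 6 wp_sequ[OF 7 wp_sequ[OF 8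
      wp_sequ[OF 9 wp_sequ[OF 10 wp_sequ[OF 11 12]]]]]]]]]]])
  then show ?thesis
    by (rule wp_mono) (use O.ne I.ne in \<open>auto simp: cost_def nat_add_distrib\<close>)
qed

end

section \<open>Reading the colors\<close>

definition scan :: "string \<Rightarrow> com \<Rightarrow> com" where
  "scan c = For (IConst 0) (V (CHR ''n'' # c))"

lemma wp_scan:
  assumes "straight c" "csize c \<le> 50" "a (CHR ''n'' # d) 0 = N" "0 \<le> N" "''i'' \<in> X" "CHR ''n'' # d \<notin> X"
    and "I 0 (upd ''i'' 0 0 a)"
    and "\<And>i b. 0 \<le> i \<Longrightarrow> i < N \<Longrightarrow> b ''i'' 0 = i \<Longrightarrow> same X a b \<Longrightarrow> I i b \<Longrightarrow>
      eff c b ''i'' 0 = i \<and> same X a (eff c b) \<and> I (i + 1) (upd ''i'' 0 (i + 1) (eff c b))"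
    and "\<And>b. same X a b \<Longrightarrow> I N b \<Longrightarrow> Q b"
  shows "wp (scan d c) (cost N) Q a"
  unfolding scan_def
proof (rule wp_For[where lo = 0 and hi = N and I = "\<lambda>i b. b ''i'' 0 = i \<and> same X a b \<and> I i b"])
  show "upd ''i'' 0 (eff c b ''i'' 0 + 1) (eff c b) ''i'' 0 = i + 1 \<and>
      same X a (upd ''i'' 0 (eff c b ''i'' 0 + 1) (eff c b)) \<and> I (i + 1) (upd ''i'' 0 (eff c b ''i'' 0 + 1) (eff c b))"
    if "0 \<le> i" "i < N" "b ''i'' 0 = i \<and> same X a b \<and> I i b" for i b
    using assms(5) assms(8)[of i b] that by (auto intro: same_upd)
  have "nat N * csize c \<le> nat N * 50" using assms(2) by (rule mult_left_mono) simp
  then show "nat (N - 0) * (csize c + 2) + 2 \<le> cost N"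
    unfolding cost_def add_mult_distrib2 diff_zero by linarith
qed (use assms in \<open>auto simp: same_upd same_def\<close>)

definition color_at :: "string \<Rightarrow> iexp" where
  "color_at c = ICell ''black'' (IAdd (V (CHR ''b'' # c)) cI)"

definition colorc :: "string \<Rightarrow> com" where
  "colorc c = scan c (incr (CHR ''a'' # c) (IAdd (color_at c) (ISub (color_at c) (IConst 1))))"

lemma wp_color:
  assumes "a (CHR ''n'' # c) 0 = N" "0 \<le> N" "a (CHR ''a'' # c) 0 = 0"
    and "\<And>i. 0 \<le> i \<Longrightarrow> i < N \<Longrightarrow> a ''black'' (a (CHR ''b'' # c) 0 + i) = of_bool (q i)"
  shows "wp (colorc c) (cost N) (\<lambda>b. same {''i'', CHR ''a'' # c} a b \<and> b (CHR ''a'' # c) 0 = 2 * cnt 0 N q - N) a"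
  unfolding colorc_def
proof (rule wp_scan[where X = "{''i'', CHR ''a'' # c}" and I = "\<lambda>i b. b (CHR ''a'' # c) 0 = 2 * cnt 0 i q - i" and d = c and N = N],
    goal_cases)
  case (8 i b)
  then have "b (CHR ''b'' # c) 0 = a (CHR ''b'' # c) 0" "b ''black'' = a ''black''" by (simp_all add: same_def)
  then show ?case using 8 assms(4)[of i] by (simp add: cnt_Suc color_at_def same_upd)
qed (use assms in auto)

definition buildc :: "string \<Rightarrow> com" where
  "buildc c = scan c (Cond (ILess (IConst 0) (V (CHR ''z'' # c)))
     (IAssign (CHR ''w'' # c) cI (ISub (IConst 1) (color_at c))) (IAssign (CHR ''w'' # c) cI (color_at c)))"

lemma wp_build:
  assumes "a (CHR ''n'' # c) 0 = N" "0 \<le> N" "a (CHR ''w'' # c) = (\<lambda>_. 0)" "a (CHR ''z'' # c) 0 = of_bool z"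
    and "\<And>i. 0 \<le> i \<Longrightarrow> i < N \<Longrightarrow> a ''black'' (a (CHR ''b'' # c) 0 + i) = of_bool (q i)"
  shows "wp (buildc c) (cost N) (\<lambda>b. same {''i'', CHR ''w'' # c} a b \<and>
    b (CHR ''w'' # c) = (\<lambda>i. of_bool (base (\<lambda>i. q i \<noteq> z) N i))) a"
  unfolding buildc_def
proof (rule wp_scan[where X = "{''i'', CHR ''w'' # c}" and
    I = "\<lambda>i b. \<forall>j. b (CHR ''w'' # c) j = of_bool (0 \<le> j \<and> j < i \<and> q j \<noteq> z)" and d = c and N = N], goal_cases)
  case (8 i b)
  then have "b (CHR ''b'' # c) 0 = a (CHR ''b'' # c) 0" "b ''black'' = a ''black''" "b (CHR ''z'' # c) 0 = of_bool z"
    using assms(4) by (simp_all add: same_def)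
  moreover have "j < i + 1 \<longleftrightarrow> j < i \<or> j = i" for j by auto
  ultimately show ?case using 8 assms(5)[of i] by (cases z) (auto simp: color_at_def same_upd)
next
  case (9 b)
  then show ?case by (auto simp: pad_def fun_eq_iff)
qed (use assms in auto)

section \<open>Padding and widths\<close>

text \<open>The border cells are written in either case, so a later call with other sides undoes an
  earlier padding. The program changes the padding up to three times.\<close>

definition padc :: "string \<Rightarrow> bexp \<Rightarrow> bexp \<Rightarrow> com" where
  "padc c l r = Sequ
     (Cond l (Sequ (IAssign (CHR ''w'' # c) (IConst (- 1)) (IConst 1)) (Asg (CHR ''l'' # c) (IConst (- 1))))
        (Sequ (IAssign (CHR ''w'' # c) (IConst (- 1)) (IConst 0)) (Asg (CHR ''l'' # c) (IConst 0))))
     (Cond r (Sequ (IAssign (CHR ''w'' # c) (V (CHR ''n'' # c)) (IConst 1)) (Asg (CHR ''m'' # c) (IAdd (V (CHR ''n'' # c)) (IConst 1))))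
        (Sequ (IAssign (CHR ''w'' # c) (V (CHR ''n'' # c)) (IConst 0)) (Asg (CHR ''m'' # c) (V (CHR ''n'' # c)))))"

lemma wp_pad:
  assumes "a (CHR ''n'' # c) 0 = N" "1 \<le> N" "a (CHR ''w'' # c) = (\<lambda>i. of_bool (pad v N l0 r0 i))"
    and "intb le" "intb re" "bev le a \<longleftrightarrow> l" "\<And>b. same {CHR ''w'' # c, CHR ''l'' # c} a b \<Longrightarrow> bev re b \<longleftrightarrow> r"
  shows "wp (padc c le re) 10 (\<lambda>b. same {CHR ''w'' # c, CHR ''l'' # c, CHR ''m'' # c} a b \<and>
    word c (pad v N l r) (- of_bool l) (N + of_bool r) b) a"
proof (rule wp_straight)
  define a1 where "a1 = eff (Cond le (Sequ (IAssign (CHR ''w'' # c) (IConst (- 1)) (IConst 1)) (Asg (CHR ''l'' # c) (IConst (- 1))))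
        (Sequ (IAssign (CHR ''w'' # c) (IConst (- 1)) (IConst 0)) (Asg (CHR ''l'' # c) (IConst 0)))) a"
  have a1: "same {CHR ''w'' # c, CHR ''l'' # c} a a1" "a1 (CHR ''l'' # c) 0 = - of_bool l"
    "a1 (CHR ''w'' # c) = (\<lambda>i. of_bool (pad v N l r0 i))" "a1 (CHR ''n'' # c) 0 = N"
    using assms(1-3,6) by (auto simp: a1_def same_def pad_def fun_eq_iff)
  show "same {CHR ''w'' # c, CHR ''l'' # c, CHR ''m'' # c} a (eff (padc c le re) a) \<and>
    word c (pad v N l r) (- of_bool l) (N + of_bool r) (eff (padc c le re) a)"
    unfolding padc_def eff.simps(2) a1_def[symmetric]
    using a1 assms(2) assms(7)[OF a1(1)] by (cases r) (auto simp: same_def word_def pad_def fun_eq_iff)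
qed (use assms(4,5) in \<open>simp_all add: padc_def\<close>)

text \<open>Follows \<open>wide_def\<close>: the last major of each run adds one, each single minor
  between majors subtracts one, and the initial \<open>-1\<close> accounts for there being one block
  less than runs.\<close>

definition statsc :: "string \<Rightarrow> com" where
  "statsc c = Sequ (Asg (CHR ''r'' # c) (IConst (- 1))) (loop c
     (Cond (cW c cI) (Cond (cW c cIp) Skip (incr (CHR ''r'' # c) (IConst 1)))
       (Cond (BAnd (cW c cIm) (cW c cIp)) (incr (CHR ''r'' # c) (IConst (- 1))) Skip)))"

lemma wp_stats:
  assumes "word c w lo hi a" "lo \<le> hi"
  shows "wp (statsc c) (1 + cost (hi - lo)) (\<lambda>b. same {''i'', CHR ''r'' # c} a b \<and> word c w lo hi b \<and>
    b (CHR ''r'' # c) 0 = wide w lo hi) a"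
  unfolding statsc_def
proof (rule wp_sequ[where R = "\<lambda>b. b = upd (CHR ''r'' # c) 0 (- 1) a"], goal_cases)
  case 1
  show ?case by (rule wp_straight) simp_all
next
  case (2 b0)
  let ?X = "{''i'', CHR ''r'' # c}"
  have b0: "word c w lo hi b0" "same ?X a b0" "b0 (CHR ''r'' # c) 0 = -1"
    using 2 assms(1) by (auto simp: word_def same_def)
  show ?case
  proof (rule wp_loop[where X = ?X and I = "\<lambda>i b. b (CHR ''r'' # c) 0 =
      cnt lo i w - cnt lo i (pairs w) - cnt lo i (ones w lo hi) - 1", OF _ _ b0(1) assms(2)], goal_cases)
    case (8 i b)
    then have "b (CHR ''w'' # c) j = of_bool (w j)" for j by (simp add: word_def)
    then show ?case using 8 by (auto simp: cnt_Suc same_upd pairs_def classes)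
  next
    case (9 b)
    then show ?case using same_trans[OF b0(2) 9(1), of ?X] by (simp add: wide_def)
  qed (use b0 in auto)
qed

section \<open>The program\<close>

definition nm :: "bool \<Rightarrow> string" where "nm b = (if b then ''1'' else ''2'')"

lemma nm_neq: "nm b \<noteq> nm (\<not> b)" "nm (\<not> b) \<noteq> nm b"
  by (simp_all add: nm_def)

definition confc :: "(bool \<Rightarrow> bexp) \<Rightarrow> (bool \<Rightarrow> bexp) \<Rightarrow> com" where
  "confc l r = Sequ (padc (nm True) (l True) (r True)) (Sequ (padc (nm False) (l False) (r False))
     (Sequ (statsc (nm True)) (statsc (nm False))))"

definition outerc :: "bool \<Rightarrow> com" where
  "outerc s = Sequ (Sequ (Cond (ILess (V (CHR ''r'' # nm s)) (V (CHR ''d'' # nm (\<not> s))))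
       (Asg ''K'' (V (CHR ''d'' # nm (\<not> s)))) (Asg ''K'' (V (CHR ''r'' # nm s))))
     (Asg ''J'' (IAdd (V ''K'') (IConst 1)))) (enginec (nm s) (nm (\<not> s)))"

definition never :: bexp where "never = ILess (IConst 0) (IConst 0)"
definition lessD :: "bool \<Rightarrow> bexp" where "lessD s = ILess (V (CHR ''d'' # nm s)) (V (CHR ''d'' # nm (\<not> s)))"
definition leD :: "bool \<Rightarrow> bexp" where "leD s = BNot (lessD (\<not> s))"
definition test :: "bool \<Rightarrow> bexp" where
  "test s = bor (ILess (V (CHR ''r'' # nm (\<not> s))) (V (CHR ''r'' # nm s))) (ILess (V (CHR ''r'' # nm (\<not> s))) (V (CHR ''d'' # nm (\<not> s))))"

text \<open>The sums of the two chains add up to at most 1 in absolute value, so they can be given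
  opposite signs with 0 fitting either. If the first sum is 0, the sign of the second one decides;
  thus neither excess becomes negative.\<close>

definition signc :: com where
  "signc = Cond (bor (ILess (IConst 0) (V ''a1'')) (BAnd (BNot (ILess (V ''a1'') (IConst 0))) (BNot (ILess (IConst 0) (V ''a2'')))))
     (Sequ (Sequ (Asg ''z1'' (IConst 0)) (Asg ''z2'' (IConst 1))) (Sequ (Asg ''d1'' (V ''a1'')) (Asg ''d2'' (ISub (IConst 0) (V ''a2'')))))
     (Sequ (Sequ (Asg ''z1'' (IConst 1)) (Asg ''z2'' (IConst 0))) (Sequ (Asg ''d1'' (ISub (IConst 0) (V ''a1''))) (Asg ''d2'' (V ''a2''))))"

text \<open>Since the excesses differ by at most one, their comparison alone determines the padding
  of all three configurations. The widths depend on the padding and are measured anew each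
  time.\<close>

definition solvec :: com where
  "solvec = Sequ (confc (\<lambda>s. if s then leD True else never) (\<lambda>s. if s then lessD True else never))
     (Cond (test True) (outerc True)
       (Sequ (confc (\<lambda>s. if s then never else lessD False) (\<lambda>s. if s then never else leD False))
         (Cond (test False) (outerc False)
           (Sequ (confc (\<lambda>s. if s then leD True else never) (\<lambda>s. if s then never else leD False))
             (Sequ (Sequ (Asg ''K'' (IAdd (V (CHR ''r'' # nm False)) (IConst 1))) (Asg ''J'' (V ''K'')))
               (enginec (nm True) (nm False)))))))"

definition mainc :: com where
  "mainc = Sequ (Asg ''b2'' (V ''n1'')) (Sequ (colorc ''1'') (Sequ (colorc ''2'') (Sequ signc
     (Sequ (buildc ''1'') (Sequ (buildc ''2'') solvec)))))"

text \<open>The engine names the chains by their roles, the input by their numbers; \<open>t\<close>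
  is the chain that was taken as the outer one. \<open>u\<close> permits a global exchange of the
  colors, which does not affect alternation.\<close>

lemma tour_rename:
  assumes "tour N c xs" "\<And>s. N s = n (s = t)" "\<And>s i. 0 \<le> i \<Longrightarrow> i < N s \<Longrightarrow> c (s, i) \<longleftrightarrow> (q (s = t) i = u)"
  shows "tour n (\<lambda>(s, i). q s i) (map (\<lambda>(s, i). (s = t, i)) xs)"
proof -
  let ?f = "\<lambda>(s, i :: int). (s = t, i)"
  have inj: "inj ?f" by (auto simp: inj_on_def)
  have s: "set xs = {(b, i). 0 \<le> i \<and> i < N b}" using assms(1) by (simp add: tour_def)
  have E: "edges (map ?f xs) = map_prod ?f ?f ` edges xs"
    by (simp add: edges_def map_tl[symmetric] zip_map_map map_prod_def)
  have bt: "((b = t) = t) = b" for b by auto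
  have "set (map ?f xs) = {(b, i). 0 \<le> i \<and> i < n b}"
  proof -
    have "(b, i) \<in> ?f ` set xs" if "0 \<le> i" "i < n b" for b i
      using that assms(2)[of "b = t"] bt[of b] unfolding s by (intro image_eqI[of _ _ "(b = t, i)"]) auto
    then show ?thesis unfolding set_map using assms(2) s by auto
  qed
  moreover have "q (fst (?f x)) (snd (?f x)) \<noteq> q (fst (?f y)) (snd (?f y))" if "(x, y) \<in> edges xs" for x y
  proof -
    have "c x \<noteq> c y" using assms(1) that unfolding tour_def by blast
    moreover have "x \<in> set xs" "y \<in> set xs" using edges_set[OF that] by blast+
    ultimately show ?thesis
      using assms(3)[of "snd x" "fst x"] assms(3)[of "snd y" "fst y"] unfolding s by auto
  qed
  moreover have "uncrossed (map_prod ?f ?f e) (map_prod ?f ?f f)" if "e \<in> edges xs" "f \<in> edges xs" for e f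
  proof -
    have "uncrossed e f" using assms(1) that by (simp add: tour_def)
    then show ?thesis by (cases e; cases f; cases "fst (fst e)"; cases "fst (snd e)"; cases "fst (fst f)"; cases "fst (snd f)"; cases t)
      (auto split: if_splits)
  qed
  moreover have "distinct (map ?f xs)"
    using assms(1) inj by (auto simp: distinct_map tour_def intro: inj_on_subset)
  ultimately show ?thesis unfolding tour_def E by auto
qed

lemma cost_mono: "N \<le> M \<Longrightarrow> cost N \<le> cost M"
  unfolding cost_def by (simp add: nat_mono)

context two_words
begin

definition "off s = (if s then 0 else n True)"

definition ready :: "ram \<Rightarrow> bool" where
  "ready b \<longleftrightarrow> (\<forall>s. b (CHR ''n'' # nm s) 0 = n s \<and> b (CHR ''d'' # nm s) 0 = D s \<and> b (CHR ''b'' # nm s) 0 = off s \<and>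
     (\<forall>x\<in>set ''sxyef''. b (x # nm s) = (\<lambda>_. 0)))"

definition dressed :: "(bool \<Rightarrow> bool) \<Rightarrow> (bool \<Rightarrow> bool) \<Rightarrow> ram \<Rightarrow> bool" where
  "dressed l r b \<longleftrightarrow> ready b \<and> (\<forall>s. word (nm s) (P s (l s) (r s)) (- of_bool (l s)) (n s + of_bool (r s)) b)"

definition measured :: "(bool \<Rightarrow> bool) \<Rightarrow> (bool \<Rightarrow> bool) \<Rightarrow> ram \<Rightarrow> bool" where
  "measured l r b \<longleftrightarrow> dressed l r b \<and> (\<forall>s. b (CHR ''r'' # nm s) 0 = wid s (l s) (r s))"

text \<open>The summand 4 leaves room for an added major at both borders of both chains.\<close>

abbreviation "bound \<equiv> cost (n True + n False + 4)"

lemma ready_same: "ready a \<Longrightarrow> same X a b \<Longrightarrow> \<forall>x\<in>X. hd x \<notin> set ''ndbsxyef'' \<Longrightarrow> ready b"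
proof -
  assume r: "ready a" and s: "same X a b" and X: "\<forall>x\<in>X. hd x \<notin> set ''ndbsxyef''"
  have "b (x # nm t) = a (x # nm t)" if "x \<in> set ''ndbsxyef''" for x t
  proof -
    have "x # nm t \<notin> X" using X that by force
    then show ?thesis using s by (simp add: same_def)
  qed
  then show "ready b" using r by (simp add: ready_def)
qed

lemma bev_D:
  "ready b \<Longrightarrow> bev (lessD s) b \<longleftrightarrow> D s < D (\<not> s)" "ready b \<Longrightarrow> bev (leD s) b \<longleftrightarrow> D s \<le> D (\<not> s)"
  "bev never b \<longleftrightarrow> False" "intb (lessD s)" "intb (leD s)" "intb never"
  by (auto simp: lessD_def leD_def never_def ready_def)

lemma bev_test: "measured l r b \<Longrightarrow> bev (test s) b \<longleftrightarrow>
    wid (\<not> s) (l (\<not> s)) (r (\<not> s)) < wid s (l s) (r s) \<or> wid (\<not> s) (l (\<not> s)) (r (\<not> s)) < D (\<not> s)"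
  "intb (test s)"
  by (auto simp: test_def measured_def dressed_def ready_def)

lemma cost_bound: "cost (n s + of_bool r + of_bool l) \<le> bound"
  using n_pos[of True] n_pos[of False] by (intro cost_mono) (cases s; cases l; cases r; simp)

lemma wp_conf:
  assumes a: "ready a" "\<And>s. a (CHR ''w'' # nm s) = (\<lambda>i. of_bool (P s (l0 s) (r0 s) i))"
    and le: "\<And>s. intb (le s)" "\<And>b s. ready b \<Longrightarrow> bev (le s) b \<longleftrightarrow> l s"
    and re: "\<And>s. intb (re s)" "\<And>b s. ready b \<Longrightarrow> bev (re s) b \<longleftrightarrow> r s"
  shows "wp (confc le re) (3 * bound) (measured l r) a"
proof -
  define wd where "wd s b \<longleftrightarrow> word (nm s) (P s (l s) (r s)) (- of_bool (l s)) (n s + of_bool (r s)) b" for s b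
  define R1 where "R1 b \<longleftrightarrow> ready b \<and> wd True b \<and> b (CHR ''w'' # nm False) = (\<lambda>i. of_bool (P False (l0 False) (r0 False) i))" for b
  define R3 where "R3 b \<longleftrightarrow> dressed l r b \<and> b (CHR ''r'' # nm True) 0 = wid True (l True) (r True)" for b
  have pad: "wp (padc (nm s) (le s) (re s)) 10 (\<lambda>b'. same {CHR ''w'' # nm s, CHR ''l'' # nm s, CHR ''m'' # nm s} b b' \<and> wd s b') b"
    if "ready b" "b (CHR ''w'' # nm s) = (\<lambda>i. of_bool (P s (l0 s) (r0 s) i))" for b s
    unfolding wd_def P_def
  proof (rule wp_pad[where ?l0.0 = "l0 s" and ?r0.0 = "r0 s"])
    show "bev (re s) b' \<longleftrightarrow> r s" if "same {CHR ''w'' # nm s, CHR ''l'' # nm s} b b'" for b'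
      using re(2) ready_same[OF \<open>ready b\<close> that] by auto
  qed (use that le re n_pos in \<open>auto simp: ready_def P_def\<close>)
  have dr: "dressed l r b \<longleftrightarrow> ready b \<and> wd True b \<and> wd False b" for b
    unfolding dressed_def wd_def all_bool_eq by blast
  have 1: "wp (padc (nm True) (le True) (re True)) 10 R1 a"
  proof (rule wp_mono[OF pad[OF a(1,2)]])
    fix b assume b: "same {CHR ''w'' # nm True, CHR ''l'' # nm True, CHR ''m'' # nm True} a b \<and> wd True b"
    then have "ready b" using ready_same[OF a(1), of "{CHR ''w'' # nm True, CHR ''l'' # nm True, CHR ''m'' # nm True}"] by simp
    then show "R1 b" using b a(2)[of False] nm_neq[of True] by (simp add: R1_def same_def)
  qed simp
  have 2: "wp (padc (nm False) (le False) (re False)) 10 (dressed l r) b" if "R1 b" for b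
  proof -
    have b: "ready b" "b (CHR ''w'' # nm False) = (\<lambda>i. of_bool (P False (l0 False) (r0 False) i))" "wd True b"
      using that by (simp_all add: R1_def)
    show ?thesis
    proof (rule wp_mono[OF pad[OF b(1,2)]])
      fix b' assume b': "same {CHR ''w'' # nm False, CHR ''l'' # nm False, CHR ''m'' # nm False} b b' \<and> wd False b'"
      then have "ready b'" using ready_same[OF b(1), of "{CHR ''w'' # nm False, CHR ''l'' # nm False, CHR ''m'' # nm False}"] by simp
      moreover have "wd True b'" using b(3) b' nm_neq[of True] unfolding wd_def word_def same_def by simp
      ultimately show "dressed l r b'" using b' dr by blast
    qed simp
  qed
  have st: "wp (statsc (nm s)) (1 + bound) (\<lambda>b'. same {''i'', CHR ''r'' # nm s} b b' \<and> dressed l r b' \<and>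
      b' (CHR ''r'' # nm s) 0 = wid s (l s) (r s)) b" if "dressed l r b" for b s
  proof (rule wp_mono[OF wp_stats[where w = "P s (l s) (r s)" and lo = "- of_bool (l s)" and hi = "n s + of_bool (r s)"]])
    show "word (nm s) (P s (l s) (r s)) (- of_bool (l s)) (n s + of_bool (r s)) b" using that by (simp add: dressed_def)
    show "- of_bool (l s) \<le> n s + of_bool (r s)" using n_pos[of s] by simp
    show "1 + cost (n s + of_bool (r s) - - of_bool (l s)) \<le> 1 + bound"
      using cost_bound[of s "r s" "l s"] by simp
    fix b' assume b': "same {''i'', CHR ''r'' # nm s} b b' \<and> word (nm s) (P s (l s) (r s)) (- of_bool (l s)) (n s + of_bool (r s)) b' \<and>
        b' (CHR ''r'' # nm s) 0 = wide (P s (l s) (r s)) (- of_bool (l s)) (n s + of_bool (r s))"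
    have rb: "ready b'" using ready_same[of b "{''i'', CHR ''r'' # nm s}" b'] b' that by (simp add: dressed_def)
    have "wd t b'" for t
      using that b' unfolding dressed_def wd_def word_def same_def by simp
    then show "same {''i'', CHR ''r'' # nm s} b b' \<and> dressed l r b' \<and> b' (CHR ''r'' # nm s) 0 = wid s (l s) (r s)"
      using rb dr b' by (simp add: wid_def)
  qed
  have 3: "wp (statsc (nm True)) (1 + bound) R3 b" if "dressed l r b" for b
    by (rule wp_mono[OF st[OF that]]) (auto simp: R3_def)
  have 4: "wp (statsc (nm False)) (1 + bound) (measured l r) b" if "R3 b" for b
  proof -
    have b: "dressed l r b" "b (CHR ''r'' # nm True) 0 = wid True (l True) (r True)" using that by (simp_all add: R3_def)
    show ?thesis
    proof (rule wp_mono[OF st[OF b(1)]])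
      fix b' assume b': "same {''i'', CHR ''r'' # nm False} b b' \<and> dressed l r b' \<and> b' (CHR ''r'' # nm False) 0 = wid False (l False) (r False)"
      then have "b' (CHR ''r'' # nm True) 0 = wid True (l True) (r True)" using b(2) nm_neq[of True] by (simp add: same_def)
      then show "measured l r b'" using b' unfolding measured_def all_bool_eq by blast
    qed simp
  qed
  have "wp (confc le re) (10 + (10 + ((1 + bound) + (1 + bound)))) (measured l r) a"
    unfolding confc_def by (rule wp_sequ[OF 1], rule wp_sequ[OF 2], assumption, rule wp_sequ[OF 3], assumption, rule 4)
  then show ?thesis by (rule wp_mono) (simp_all add: cost_def)
qed

context
  fixes q :: "bool \<Rightarrow> int \<Rightarrow> bool" and mj :: bool
  assumes qv: "0 \<le> i \<Longrightarrow> i < n s \<Longrightarrow> q s i \<longleftrightarrow> v s i = (s = mj)"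
begin

definition solved :: "ram \<Rightarrow> bool" where
  "solved b \<longleftrightarrow> (\<exists>xs. tour n (\<lambda>(s, i). q s i) xs \<and> written b (map (\<lambda>(s, i). off s + i) xs))"

lemma wp_engine_pad:
  assumes E: "engine (P s l r) (- of_bool l) (n s + of_bool r) (P (\<not> s) False r') 0 (n (\<not> s) + of_bool r') K KO"
    and "r \<Longrightarrow> KO = K + 1" "r' \<Longrightarrow> KO = K" "ready b"
    and "word (nm s) (P s l r) (- of_bool l) (n s + of_bool r) b"
    and "word (nm (\<not> s)) (P (\<not> s) False r') 0 (n (\<not> s) + of_bool r') b" "b ''K'' 0 = K" "b ''J'' 0 = KO"
  shows "wp (enginec (nm s) (nm (\<not> s))) (20 * bound) solved b"
proof -
  interpret engine "P s l r" "- of_bool l" "n s + of_bool r" "P (\<not> s) False r'" 0 "n (\<not> s) + of_bool r'" K KO by (rule E)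
  have x: "D (\<not> s) + of_bool r' = excess (P (\<not> s) False r') 0 (n (\<not> s) + of_bool r')"
    using pad_counts(1)[OF n_pos[of "\<not> s"], where v = "v (\<not> s)" and l = False and r = r'] by (simp add: P_def D_def)
  have rd: "b (CHR ''n'' # nm t) 0 = n t" "b (CHR ''d'' # nm t) 0 = D t" "b (CHR ''b'' # nm t) 0 = off t"
    "c \<in> set ''sxyef'' \<Longrightarrow> b (c # nm t) = (\<lambda>_. 0)" for t c
    using assms(4) unfolding ready_def by blast+
  show ?thesis
  proof (rule wp_mono[OF wp_engine[where NO = "n s" and NI = "n (\<not> s)" and bO = "off s" and bI = "off (\<not> s)", OF nm_neq(1) assms(5,6)]])
    have "cost (n s + of_bool r - - of_bool l + (n (\<not> s) + of_bool r' - 0)) \<le> bound"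
      by (intro cost_mono) (cases s; cases l; cases r; cases r'; simp)
    then show "20 * cost (n s + of_bool r - - of_bool l + (n (\<not> s) + of_bool r' - 0)) \<le> 20 * bound" by simp
    fix b'
    let ?W = "sd (P s l r) (P (\<not> s) False r')" and ?L = "sd (- of_bool l) 0" and ?H = "sd (n s + of_bool r) (n (\<not> s) + of_bool r')"
    assume "\<exists>M. matched ?W ?L ?H (sd sO I.status) (sd xO I.xcut) M \<and> written b' (map (\<lambda>p. sd (off s) (off (\<not> s)) (fst p) + snd p)
         (filter (\<lambda>p. 0 \<le> snd p \<and> snd p < sd (n s) (n (\<not> s)) (fst p)) (matched.route ?W ?L ?H (sd sO I.status) (sd xO I.xcut) M)))"
    then obtain M where M: "matched ?W ?L ?H (sd sO I.status) (sd xO I.xcut) M" and w: "written b' (map (\<lambda>p. sd (off s) (off (\<not> s)) (fst p) + snd p)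
         (filter (\<lambda>p. 0 \<le> snd p \<and> snd p < sd (n s) (n (\<not> s)) (fst p)) (matched.route ?W ?L ?H (sd sO I.status) (sd xO I.xcut) M)))"
      by blast
    define F where "F = filter (\<lambda>p. 0 \<le> snd p \<and> snd p < sd (n s) (n (\<not> s)) (fst p)) (matched.route ?W ?L ?H (sd sO I.status) (sd xO I.xcut) M)"
    define c where "c = (\<lambda>(t, i). if t then P s l r i else \<not> P (\<not> s) False r' i)"
    have "tour (sd (n s) (n (\<not> s))) c F"
      unfolding F_def
      by (rule tour_engine[OF M]) (use assms(2,3) n_pos[of s] n_pos[of "\<not> s"] in \<open>auto simp: c_def P_def pad_def split: if_splits\<close>)
    then have t: "tour n (\<lambda>(s, i). q s i) (map (\<lambda>(t, i). (t = s, i)) F)"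
    proof (rule tour_rename[where u = "s = mj"])
      fix t
      show "sd (n s) (n (\<not> s)) t = n (t = s)" by (cases t; cases s) simp_all
      fix i assume i: "0 \<le> i" "i < sd (n s) (n (\<not> s)) t"
      show "c (t, i) \<longleftrightarrow> (q (t = s) i = (s = mj))"
      proof (cases t)
        case True
        then show ?thesis using i qv[of i s] by (auto simp: c_def P_def pad_def)
      next
        case False
        then show ?thesis using i qv[of i "\<not> s"] by (auto simp: c_def P_def pad_def)
      qed
    qed
    have "map (\<lambda>p. sd (off s) (off (\<not> s)) (fst p) + snd p) F = map (\<lambda>(s, i). off s + i) (map (\<lambda>(t, i). (t = s, i)) F)"
      by (auto simp: off_def)
    then show "solved b'" unfolding solved_def using t w[folded F_def] by metis
  qed (use rd x assms(7,8) in auto)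
qed

lemma wp_outer:
  assumes m: "measured l r a" and lr: "\<not> l (\<not> s)" "\<not> r (\<not> s)"
    and d: "D s + of_bool (l s) + of_bool (r s) = D (\<not> s) + 1"
    and t: "wid (\<not> s) (l (\<not> s)) (r (\<not> s)) < wid s (l s) (r s) \<or> wid (\<not> s) (l (\<not> s)) (r (\<not> s)) < D (\<not> s)"
  shows "wp (outerc s) (21 * bound) solved a"
proof -
  define k where "k = max (wid s (l s) (r s)) (D (\<not> s))"
  define b where "b = upd ''J'' 0 (k + 1) (upd ''K'' 0 k a)"
  have r0: "ready a" using m by (simp add: measured_def dressed_def)
  have rd: "a (CHR ''r'' # nm s) 0 = wid s (l s) (r s)" "a (CHR ''d'' # nm (\<not> s)) 0 = D (\<not> s)"
    using m r0 by (simp_all add: measured_def ready_def)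
  have 1: "wp (Sequ (Cond (ILess (V (CHR ''r'' # nm s)) (V (CHR ''d'' # nm (\<not> s))))
       (Asg ''K'' (V (CHR ''d'' # nm (\<not> s)))) (Asg ''K'' (V (CHR ''r'' # nm s))))
     (Asg ''J'' (IAdd (V ''K'') (IConst 1)))) 4 (\<lambda>b'. b' = b) a"
    by (rule wp_straight) (use rd in \<open>simp_all add: b_def k_def max_def\<close>)
  have sm: "same {''K'', ''J''} a b" by (simp add: b_def same_def)
  have rb: "ready b" using ready_same[OF r0 sm] by auto
  have w: "word (nm t) (P t (l t) (r t)) (- of_bool (l t)) (n t + of_bool (r t)) b" for t
    using m sm unfolding measured_def dressed_def word_def same_def by simp
  have lr': "l (\<not> s) = False" "r (\<not> s) = False" using lr by simp_all
  have E: "engine (P s (l s) (r s)) (- of_bool (l s)) (n s + of_bool (r s)) (P (\<not> s) False False) 0 (n (\<not> s) + of_bool False) k (k + 1)"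
    using engine_outer[OF d _ k_def] t unfolding lr' by simp
  have 2: "wp (enginec (nm s) (nm (\<not> s))) (20 * bound) solved b"
    by (rule wp_engine_pad[OF E _ _ rb w])
      (use w[of "\<not> s", unfolded lr'] in \<open>simp_all add: b_def\<close>)
  have "wp (outerc s) (4 + 20 * bound) solved a"
    unfolding outerc_def by (rule wp_sequ[OF 1]) (use 2 in simp)
  then show ?thesis by (rule wp_mono) (simp_all add: cost_def)
qed

lemma wp_solve:
  assumes "ready a" "\<And>s. a (CHR ''w'' # nm s) = (\<lambda>i. of_bool (base (v s) (n s) i))"
  shows "wp solvec (40 * bound) solved a"
proof -
  let ?T = "confc (\<lambda>s. if s then leD True else never) (\<lambda>s. if s then never else leD False)"
  let ?B = "confc (\<lambda>s. if s then never else lessD False) (\<lambda>s. if s then never else leD False)"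
  let ?K = "Sequ (Asg ''K'' (IAdd (V (CHR ''r'' # nm False)) (IConst 1))) (Asg ''J'' (V ''K''))"
  let ?p = "D True \<le> D False" and ?p' = "D True < D False" and ?m = "D False \<le> D True" and ?m' = "D False < D True"
  \<comment> \<open>\<open>lA\<close> and \<open>rA\<close> give the padding with the first chain
    outside, \<open>lB\<close> and \<open>rB\<close> with the second one. The third configuration
    combines the left sides of the former with the right sides of the latter.\<close>
  define lA where "lA s \<longleftrightarrow> s \<and> ?p" for s
  define rA where "rA s \<longleftrightarrow> s \<and> ?p'" for s
  define lB where "lB s \<longleftrightarrow> \<not> s \<and> ?m'" for s
  define rB where "rB s \<longleftrightarrow> \<not> s \<and> ?m" for s
  note df = diff[of True, folded D_def, simplified] diff[of False, folded D_def, simplified]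
  have c: "1 \<le> bound" by (simp add: cost_def)
  have wd: "b (CHR ''w'' # nm s) = (\<lambda>i. of_bool (P s (l s) (r s) i))" "ready b" if "measured l r b" for l r b s
    using that unfolding measured_def dressed_def word_def by blast+
  have A: "wp (confc (\<lambda>s. if s then leD True else never) (\<lambda>s. if s then lessD True else never)) (3 * bound) (measured lA rA) a"
    by (rule wp_conf[OF assms(1), where ?l0.0 = "\<lambda>_. False" and ?r0.0 = "\<lambda>_. False"])
      (use assms(2) in \<open>simp_all add: P_def lA_def rA_def bev_D\<close>)
  have B: "wp ?B (3 * bound) (measured lB rB) b"
    if "measured lA rA b" for b
    by (rule wp_conf[OF wd(2,1)[OF that]]) (simp_all add: lB_def rB_def bev_D)
  have T: "wp ?T (3 * bound) (measured lA rB) b"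
    if "measured lB rB b" for b
    by (rule wp_conf[OF wd(2,1)[OF that]]) (simp_all add: lA_def rB_def bev_D)
  have oA: "wp (outerc True) (21 * bound) solved b" if "measured lA rA b" "bev (test True) b" for b
    by (rule wp_outer[OF that(1)]) (use that df in \<open>auto simp: bev_test lA_def rA_def\<close>)
  have oB: "wp (outerc False) (21 * bound) solved b" if "measured lB rB b" "bev (test False) b" for b
    by (rule wp_outer[OF that(1)]) (use that df in \<open>auto simp: bev_test lB_def rB_def\<close>)
  have eq: "wp (Sequ ?K
      (enginec (nm True) (nm False))) (21 * bound) solved b"
    if b: "measured lA rB b" and nA: "\<not> (wid False False False < wid True ?p ?p' \<or> wid False False False < D False)"
      and nB: "\<not> (wid True False False < wid False ?m' ?m \<or> wid True False False < D True)" for b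
  proof -
    define k where "k = wid False False ?m + 1"
    define b1 where "b1 = upd ''J'' 0 k (upd ''K'' 0 k b)"
    have r: "b (CHR ''r'' # nm False) 0 = wid False False ?m"
      using b by (simp add: measured_def lA_def rB_def)
    have 1: "wp ?K 2 (\<lambda>b'. b' = b1) b"
      by (rule wp_straight) (use r in \<open>simp_all add: b1_def k_def\<close>)
    have sm: "same {''K'', ''J''} b b1" by (simp add: b1_def same_def)
    have rb: "ready b1" using ready_same[OF wd(2)[OF b] sm] by auto
    have w: "word (nm t) (P t (lA t) (rB t)) (- of_bool (lA t)) (n t + of_bool (rB t)) b1" for t
      using b sm unfolding measured_def dressed_def word_def same_def by simp
    have E: "engine (P True ?p False) (- of_bool ?p) (n True + of_bool False) (P (\<not> True) False ?m) 0 (n (\<not> True) + of_bool ?m) k k"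
      using engine_equal[OF nA nB k_def] by simp
    have 2: "wp (enginec (nm True) (nm (\<not> True))) (20 * bound) solved b1"
      by (rule wp_engine_pad[OF E _ _ rb]) (use w[of True] w[of False] in \<open>simp_all add: lA_def rB_def b1_def\<close>)
    have "wp (Sequ ?K
      (enginec (nm True) (nm False))) (2 + 20 * bound) solved b"
      by (rule wp_sequ[OF 1]) (use 2 in simp)
    then show ?thesis by (rule wp_mono) (simp_all add: cost_def)
  qed
  have X2: "wp (Cond (test False) (outerc False)
           (Sequ ?T
             (Sequ ?K
               (enginec (nm True) (nm False))))) (24 * bound + 1) solved b"
    if b: "measured lB rB b" and nA: "\<not> (wid False False False < wid True ?p ?p' \<or> wid False False False < D False)" for b
  proof (rule wp_cond)
    show "wp (outerc False) (24 * bound) solved b" if "bev (test False) b"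
      by (rule wp_mono[OF oB[OF b that]]) simp_all
    assume "\<not> bev (test False) b"
    then have nB: "\<not> (wid True False False < wid False ?m' ?m \<or> wid True False False < D True)"
      using bev_test(1)[OF b, of False] by (simp add: lB_def rB_def)
    have "wp (Sequ ?T
             (Sequ ?K
               (enginec (nm True) (nm False)))) (3 * bound + 21 * bound) solved b"
      by (rule wp_sequ[OF T[OF b]], rule eq[OF _ nA nB])
    then show "wp (Sequ ?T
             (Sequ ?K
               (enginec (nm True) (nm False)))) (24 * bound) solved b"
      by (rule wp_mono) simp_all
  qed (rule bev_test(2))
  have X0: "wp (Cond (test True) (outerc True)
       (Sequ ?B
         (Cond (test False) (outerc False)
           (Sequ ?T
             (Sequ ?K
               (enginec (nm True) (nm False))))))) (3 * bound + (24 * bound + 1) + 1) solved b"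
    if b: "measured lA rA b" for b
  proof (rule wp_cond)
    show "wp (outerc True) (3 * bound + (24 * bound + 1)) solved b" if "bev (test True) b"
      by (rule wp_mono[OF oA[OF b that]]) simp_all
    assume "\<not> bev (test True) b"
    then have nA: "\<not> (wid False False False < wid True ?p ?p' \<or> wid False False False < D False)"
      using bev_test(1)[OF b, of True] by (simp add: lA_def rA_def)
    show "wp (Sequ ?B
         (Cond (test False) (outerc False)
           (Sequ ?T
             (Sequ ?K
               (enginec (nm True) (nm False)))))) (3 * bound + (24 * bound + 1)) solved b"
      by (rule wp_sequ[OF B[OF b]], rule X2[OF _ nA])
  qed (rule bev_test(2))
  have "wp solvec (3 * bound + (3 * bound + (24 * bound + 1) + 1)) solved a"
    unfolding solvec_def by (rule wp_sequ[OF A X0])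
  then show ?thesis by (rule wp_mono) (simp_all add: cost_def)
qed

end

end

lemma excess_base:
  assumes "1 \<le> N"
  shows "excess (base (\<lambda>i. q i \<noteq> z) N) 0 N = (if z then N - 2 * cnt 0 N q else 2 * cnt 0 N q - N)"
proof -
  interpret chain "base (\<lambda>i. q i \<noteq> z) N" 0 N using pad_chain[OF assms, of _ False False] by simp
  have "cnt 0 N (base (\<lambda>i. q i \<noteq> z) N) = cnt 0 N (\<lambda>i. q i \<noteq> z)"
    by (rule cnt_cong) (simp add: pad_def)
  also have "\<dots> = (if z then N - cnt 0 N q else cnt 0 N q)"
  proof (cases z)
    case True
    have "cnt 0 N q + cnt 0 N (\<lambda>i. \<not> q i) = (\<Sum>i\<in>{0..<N}. 1)"
      unfolding cnt_def sum.distrib[symmetric] by (rule sum.cong) auto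
    then show ?thesis using True assms by simp
  qed simp
  finally have w: "cnt 0 N (base (\<lambda>i. q i \<noteq> z) N) = (if z then N - cnt 0 N q else cnt 0 N q)" .
  have "excess (base (\<lambda>i. q i \<noteq> z) N) 0 N = 2 * cnt 0 N (base (\<lambda>i. q i \<noteq> z) N) - N"
    using count_length unfolding excess_def by linarith
  also have "\<dots> = (if z then N - 2 * cnt 0 N q else 2 * cnt 0 N q - N)" unfolding w by simp
  finally show ?thesis .
qed

lemma wp_main:
  fixes q :: "bool \<Rightarrow> int \<Rightarrow> bool" and n :: "bool \<Rightarrow> int"
  assumes n: "\<And>s. 1 \<le> n s" "\<And>s. n s \<le> 4 * n (\<not> s)"
    and eq: "\<bar>(2 * cnt 0 (n True) (q True) - n True) + (2 * cnt 0 (n False) (q False) - n False)\<bar> \<le> 1"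
    and a: "a ''n1'' 0 = n True" "a ''n2'' 0 = n False"
      "\<And>s i. 0 \<le> i \<Longrightarrow> i < n s \<Longrightarrow> a ''black'' ((if s then 0 else n True) + i) = of_bool (q s i)"
      "\<And>x. x \<notin> {''n1'', ''n2'', ''black''} \<Longrightarrow> a x = (\<lambda>_. 0)"
  shows "wp mainc (50 * cost (n True + n False + 4)) (\<lambda>b. \<exists>xs. tour n (\<lambda>(s, i). q s i) xs \<and>
    written b (map (\<lambda>(s, i). (if s then 0 else n True) + i) xs)) a"
proof -
  define A where "A s = 2 * cnt 0 (n s) (q s) - n s" for s
  \<comment> \<open>Whether black is the major color of the first chain; then white is that of the
    second one.\<close>
  define mj where "mj \<longleftrightarrow> 0 < A True \<or> (0 \<le> A True \<and> A False \<le> 0)"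
  define v where "v s i \<longleftrightarrow> (q s i \<noteq> (s \<noteq> mj))" for s i
  have D: "excess (base (v s) (n s)) 0 (n s) = (if s = mj then A s else - A s)" for s
    using excess_base[OF n(1)[of s], of "q s" "s \<noteq> mj"] unfolding v_def A_def by auto
  have eq': "\<bar>A True + A False\<bar> \<le> 1" using eq by (simp add: A_def)
  interpret two_words v n
  proof
    fix s
    show "0 \<le> excess (base (v s) (n s)) 0 (n s)"
      unfolding D using eq' mj_def by (cases s; cases mj) auto
    show "excess (base (v s) (n s)) 0 (n s) \<le> excess (base (v (\<not> s)) (n (\<not> s))) 0 (n (\<not> s)) + 1"
      unfolding D using eq' by (cases s; cases mj) auto
  qed (rule n)+
  have qv: "q s i \<longleftrightarrow> v s i = (s = mj)" for s i by (auto simp: v_def)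
  define inv where "inv b \<longleftrightarrow> (\<forall>s. b (CHR ''n'' # nm s) 0 = n s \<and> b (CHR ''b'' # nm s) 0 = off s \<and>
      (\<forall>x\<in>set ''sxyef''. b (x # nm s) = (\<lambda>_. 0)) \<and>
      (\<forall>i. 0 \<le> i \<longrightarrow> i < n s \<longrightarrow> b ''black'' (off s + i) = of_bool (q s i)))" for b
  have inv_same: "inv b'" if "inv b" "same X b b'" "\<forall>x\<in>X. x \<noteq> ''black'' \<and> hd x \<notin> set ''nbsxyef''" for b b' X
  proof -
    note sm = that(2) and X = that(3)
    have x': "x \<in> set ''nbsxyef'' \<longrightarrow> b' (x # nm t) = b (x # nm t)" for x t
    proof -
      have "x # nm t \<notin> X" if x: "x \<in> set ''nbsxyef''"
      proof
        assume "x # nm t \<in> X"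
        then have "hd (x # nm t) \<notin> set ''nbsxyef''" using X by blast
        then show False using x by simp
      qed
      then show ?thesis using sm by (simp add: same_def)
    qed
    moreover have "b' ''black'' = b ''black''" using that(2,3) unfolding same_def by blast
    ultimately show ?thesis using that(1) by (simp add: inv_def)
  qed
  have inv: "b (CHR ''n'' # nm s) 0 = n s" "b (CHR ''b'' # nm s) 0 = off s"
    "0 \<le> i \<Longrightarrow> i < n s \<Longrightarrow> b ''black'' (off s + i) = of_bool (q s i)" if "inv b" for b s i
    using that by (simp_all add: inv_def)
  have n0: "0 \<le> n s" for s using n(1)[of s] by simp
  have cb: "cost (n s) \<le> bound" for s using n0[of True] n0[of False] by (intro cost_mono) (cases s; simp)
  define R0 where "R0 b \<longleftrightarrow> inv b \<and> (\<forall>s. b (CHR ''w'' # nm s) = (\<lambda>_. 0) \<and> b (CHR ''a'' # nm s) 0 = 0)" for b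
  define R1 where "R1 b \<longleftrightarrow> inv b \<and> (\<forall>s. b (CHR ''w'' # nm s) = (\<lambda>_. 0)) \<and> b (CHR ''a'' # nm True) 0 = A True \<and>
    b (CHR ''a'' # nm False) 0 = 0" for b
  define R2 where "R2 b \<longleftrightarrow> inv b \<and> (\<forall>s. b (CHR ''w'' # nm s) = (\<lambda>_. 0) \<and> b (CHR ''a'' # nm s) 0 = A s)" for b
  define S where "S b \<longleftrightarrow> inv b \<and> (\<forall>s. b (CHR ''d'' # nm s) 0 = D s \<and> b (CHR ''z'' # nm s) 0 = of_bool (s \<noteq> mj))" for b
  define R3 where "R3 b \<longleftrightarrow> S b \<and> (\<forall>s. b (CHR ''w'' # nm s) = (\<lambda>_. 0))" for b
  define wb where "wb s b \<longleftrightarrow> b (CHR ''w'' # nm s) = (\<lambda>i. of_bool (base (v s) (n s) i))" for s and b :: ram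
  define R4 where "R4 b \<longleftrightarrow> S b \<and> wb True b \<and> b (CHR ''w'' # nm False) = (\<lambda>_. 0)" for b
  define R5 where "R5 b \<longleftrightarrow> S b \<and> wb True b \<and> wb False b" for b
  have 0: "wp (Asg ''b2'' (V ''n1'')) 1 R0 a"
  proof (rule wp_straight)
    define b where "b = upd ''b2'' 0 (n True) a"
    have z: "a (x # nm s) = (\<lambda>_. 0)" if "x \<notin> {CHR ''n'', CHR ''b''}" for x s
      using that by (intro a(4)) (simp add: nm_def)
    have "b (CHR ''n'' # nm s) 0 = n s \<and> b (CHR ''b'' # nm s) 0 = off s" for s
      using a(1,2) a(4)[of "''b1''"] by (cases s) (simp_all add: b_def nm_def off_def)
    moreover have "b (x # nm s) = (\<lambda>_. 0)" if "x \<in> set ''sxyef''" for x s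
    proof -
      have "x \<notin> {CHR ''n'', CHR ''b''}" using that by auto
      then show ?thesis using z[of x s] by (simp add: b_def)
    qed
    moreover have "b ''black'' (off s + i) = of_bool (q s i)" if "0 \<le> i" "i < n s" for s i
      using a(3)[OF that] by (simp add: b_def off_def)
    ultimately have "inv b" unfolding inv_def by blast
    moreover have "b (CHR ''w'' # nm s) = (\<lambda>_. 0) \<and> b (CHR ''a'' # nm s) 0 = 0" for s
      using z[of "CHR ''w''"] z[of "CHR ''a''"] by (simp add: b_def)
    ultimately show "R0 (eff (Asg ''b2'' (V ''n1'')) a)" using a(1) by (simp add: R0_def b_def)
  qed simp_all
  have col: "wp (colorc (nm s)) bound (\<lambda>b'. same {''i'', CHR ''a'' # nm s} b b' \<and> inv b' \<and> b' (CHR ''a'' # nm s) 0 = A s) b"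
    if "inv b" "b (CHR ''a'' # nm s) 0 = 0" for b s
  proof (rule wp_mono[OF wp_color[where N = "n s" and q = "q s"]])
    fix b' assume "same {''i'', CHR ''a'' # nm s} b b' \<and> b' (CHR ''a'' # nm s) 0 = 2 * cnt 0 (n s) (q s) - n s"
    then show "same {''i'', CHR ''a'' # nm s} b b' \<and> inv b' \<and> b' (CHR ''a'' # nm s) 0 = A s"
      using inv_same[OF that(1), of "{''i'', CHR ''a'' # nm s}" b'] by (simp add: A_def)
  qed (use that inv[OF that(1)] n0 cb in auto)
  have 1: "wp (colorc (nm True)) bound R1 b" if b: "R0 b" for b
  proof (rule wp_mono[OF col[of b True]])
    show "inv b" "b (CHR ''a'' # nm True) 0 = 0" using b by (simp_all add: R0_def)
    show "R1 b'" if b': "same {''i'', CHR ''a'' # nm True} b b' \<and> inv b' \<and> b' (CHR ''a'' # nm True) 0 = A True" for b'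
      using b b' nm_neq[of True] by (simp add: R0_def R1_def same_def)
  qed simp
  have 2: "wp (colorc (nm False)) bound R2 b" if b: "R1 b" for b
  proof (rule wp_mono[OF col[of b False]])
    show "inv b" "b (CHR ''a'' # nm False) 0 = 0" using b by (simp_all add: R1_def)
    show "R2 b'" if b': "same {''i'', CHR ''a'' # nm False} b b' \<and> inv b' \<and> b' (CHR ''a'' # nm False) 0 = A False" for b'
      using b b' nm_neq[of True] unfolding R2_def all_bool_eq by (simp add: R1_def same_def)
  qed simp
  have 3: "wp signc 9 R3 b" if b: "R2 b" for b
  proof (rule wp_straight)
    let ?b = "eff signc b"
    have A: "b ''a1'' 0 = A True" "b ''a2'' 0 = A False" using b unfolding R2_def all_bool_eq by (simp_all add: nm_def)
    have sm: "same {''z1'', ''z2'', ''d1'', ''d2''} b ?b" by (simp add: signc_def same_def)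
    have "inv b" using b by (simp add: R2_def)
    from inv_same[OF this sm] have i: "inv ?b" by simp
    have w: "?b (CHR ''w'' # nm s) = (\<lambda>_. 0)" for s
      using b sm by (simp add: R2_def same_def nm_def)
    have "?b (CHR ''d'' # nm s) 0 = D s \<and> ?b (CHR ''z'' # nm s) 0 = of_bool (s \<noteq> mj)" for s
    proof -
      have "D s = (if s = mj then A s else - A s)" using D by (simp add: D_def)
      moreover have "(0 < A True \<or> \<not> A True < 0 \<and> \<not> 0 < A False) = mj" by (auto simp: mj_def)
      ultimately show ?thesis using A by (cases s; cases mj) (simp_all add: signc_def nm_def)
    qed
    then show "R3 ?b" using i w by (simp add: R3_def S_def)
  qed (simp_all add: signc_def)
  have bld: "wp (buildc (nm s)) bound (\<lambda>b'. same {''i'', CHR ''w'' # nm s} b b' \<and> S b' \<and> wb s b') b"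
    if "S b" "b (CHR ''w'' # nm s) = (\<lambda>_. 0)" for b s
  proof (rule wp_mono[OF wp_build[where N = "n s" and q = "q s" and z = "s \<noteq> mj"]])
    have i: "inv b" using that(1) by (simp add: S_def)
    show "b (CHR ''z'' # nm s) 0 = of_bool (s \<noteq> mj)" using that(1) by (simp add: S_def)
    show "b ''black'' (b (CHR ''b'' # nm s) 0 + i) = of_bool (q s i)" if "0 \<le> i" "i < n s" for i
      using inv[OF i] that by simp
    show "b (CHR ''n'' # nm s) 0 = n s" using inv[OF i] by simp
    fix b' assume b': "same {''i'', CHR ''w'' # nm s} b b' \<and> b' (CHR ''w'' # nm s) = (\<lambda>i. of_bool (base (\<lambda>i. q s i \<noteq> (s \<noteq> mj)) (n s) i))"
    then have "inv b'" using inv_same[OF i, of "{''i'', CHR ''w'' # nm s}" b'] by simp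
    then have "S b'" using b' that(1) by (simp add: S_def same_def)
    then show "same {''i'', CHR ''w'' # nm s} b b' \<and> S b' \<and> wb s b'"
      using b' by (simp add: wb_def v_def[abs_def])
  qed (use that n0 cb in auto)
  have 4: "wp (buildc (nm True)) bound R4 b" if b: "R3 b" for b
  proof (rule wp_mono[OF bld[of b True]])
    show "S b" "b (CHR ''w'' # nm True) = (\<lambda>_. 0)" using b by (simp_all add: R3_def)
    show "R4 b'" if b': "same {''i'', CHR ''w'' # nm True} b b' \<and> S b' \<and> wb True b'" for b'
      using b b' nm_neq[of True] by (simp add: R3_def R4_def same_def)
  qed simp
  have 5: "wp (buildc (nm False)) bound R5 b" if b: "R4 b" for b
  proof (rule wp_mono[OF bld[of b False]])
    show "S b" "b (CHR ''w'' # nm False) = (\<lambda>_. 0)" using b by (simp_all add: R4_def)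
    show "R5 b'" if b': "same {''i'', CHR ''w'' # nm False} b b' \<and> S b' \<and> wb False b'" for b'
      using b b' nm_neq[of True] by (simp add: R4_def R5_def same_def wb_def)
  qed simp
  have 6: "wp solvec (40 * bound) (\<lambda>b. \<exists>xs. tour n (\<lambda>(s, i). q s i) xs \<and>
      written b (map (\<lambda>(s, i). (if s then 0 else n True) + i) xs)) b" if b: "R5 b" for b
  proof -
    have "ready b" using b by (simp add: R5_def S_def inv_def ready_def)
    moreover have "b (CHR ''w'' # nm s) = (\<lambda>i. of_bool (base (v s) (n s) i))" for s
      using b by (cases s) (simp_all add: R5_def wb_def)
    ultimately have "wp solvec (40 * bound) (solved q) b" using wp_solve[of q mj b] qv by blast
    then show ?thesis by (rule wp_mono) (simp_all add: solved_def[of q mj, OF qv] off_def)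
  qed
  have m: "mainc = Sequ (Asg ''b2'' (V ''n1'')) (Sequ (colorc (nm True)) (Sequ (colorc (nm False)) (Sequ signc
     (Sequ (buildc (nm True)) (Sequ (buildc (nm False)) solvec)))))" by (simp add: mainc_def nm_def)
  have "wp mainc (1 + (bound + (bound + (9 + (bound + (bound + 40 * bound)))))) (\<lambda>b. \<exists>xs. tour n (\<lambda>(s, i). q s i) xs \<and>
      written b (map (\<lambda>(s, i). (if s then 0 else n True) + i) xs)) a"
    unfolding m
    by (rule wp_sequ[OF 0], rule wp_sequ[OF 1], assumption, rule wp_sequ[OF 2], assumption, rule wp_sequ[OF 3], assumption,
      rule wp_sequ[OF 4], assumption, rule wp_sequ[OF 5], assumption, rule 6)
  then show ?thesis by (rule wp_mono) (simp_all add: cost_def)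
qed

section \<open>From tours to drawings\<close>

locale drawn =
  fixes C :: "bool \<Rightarrow> point set" and zs :: "bool \<Rightarrow> point list"
  assumes chains: "double_chain (C True) (C False)" and set_zs: "set (zs s) = C s" and ordered: "left_to_right (zs s)"
begin

definition "N s = int (length (zs s))"
definition "spot p = zs (fst p) ! nat (snd p)"
definition "ok p \<longleftrightarrow> 0 \<le> snd p \<and> snd p < N (fst p)"
text \<open>Reflects the picture where necessary, so that chain \<open>s\<close> plays the convex
  one and \<open>facing\<close> applies to edges within either chain.\<close>

definition "mir s p = (if s then p else flip p)"

lemma spot_in: "ok (s, i) \<Longrightarrow> spot (s, i) \<in> C s"
  using nth_mem[of "nat i" "zs s"] by (auto simp: ok_def spot_def N_def set_zs[symmetric])

lemma spot_less: "ok (s, i) \<Longrightarrow> ok (s, j) \<Longrightarrow> i < j \<Longrightarrow> fst (spot (s, i)) < fst (spot (s, j))"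
  using ordered[of s] unfolding left_to_right_def ok_def spot_def N_def
  by (auto simp: sorted_wrt_iff_nth_less)

lemma spot_less_iff: "ok (s, i) \<Longrightarrow> ok (s, j) \<Longrightarrow> fst (spot (s, i)) < fst (spot (s, j)) \<longleftrightarrow> i < j"
  using spot_less[of s i j] spot_less[of s j i] by (cases i j rule: linorder_cases) auto

lemma spot_inj: "ok p \<Longrightarrow> ok q \<Longrightarrow> spot p = spot q \<longleftrightarrow> p = q"
proof -
  assume ok: "ok p" "ok q"
  obtain s i t j where pq: "p = (s, i)" "q = (t, j)" by (cases p, cases q)
  show "spot p = spot q \<longleftrightarrow> p = q"
  proof (cases "s = t")
    case True
    then show ?thesis using spot_less[of s i j] spot_less[of s j i] ok unfolding pq
      by (cases i j rule: linorder_cases) auto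
  next
    case False
    have "C True \<inter> C False = {}" using chains by (simp add: double_chain_def)
    then have "spot p \<noteq> spot q" using spot_in[of s i] spot_in[of t j] ok False unfolding pq by (cases s; cases t) auto
    then show ?thesis using False pq by auto
  qed
qed

lemma mir_simps [simp]: "fst (mir s p) = fst p" "mir s p = mir s q \<longleftrightarrow> p = q"
  "noncrossing (mir s a) (mir s b) (mir s c) (mir s d) \<longleftrightarrow> noncrossing a b c d"
  by (auto simp: mir_def noncrossing_flip)

lemma mir_facing: "facing (mir s ` C s) (mir s ` C (\<not> s))"
  using double_chain_facing[OF chains] by (cases s) (simp_all add: mir_def[abs_def])

lemma mir_spot: "ok (s, i) \<Longrightarrow> mir t (spot (s, i)) \<in> mir t ` C s"
  using spot_in by simp

lemma inner_inner:
  assumes "ok (s, a)" "ok (s, b)" "ok (u, c)" "ok (u, d)" "a < b" "c < d" "(s, a, b) \<noteq> (u, c, d)"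
    and "s = u \<Longrightarrow> \<not> (a < c \<and> c < b \<and> b < d) \<and> \<not> (c < a \<and> a < d \<and> d < b)"
  shows "noncrossing (spot (s, a)) (spot (s, b)) (spot (u, c)) (spot (u, d))"
proof (cases "s = u")
  case True
  have "noncrossing (mir s (spot (s, a))) (mir s (spot (s, b))) (mir s (spot (s, c))) (mir s (spot (s, d)))"
  proof (rule noncrossing_inner[OF mir_facing])
    show "(mir s (spot (s, a)), mir s (spot (s, b))) \<noteq> (mir s (spot (s, c)), mir s (spot (s, d)))"
      using assms True spot_inj by auto
    show "fst (mir s (spot (s, a))) < fst (mir s (spot (s, b)))" "fst (mir s (spot (s, c))) < fst (mir s (spot (s, d)))"
      using spot_less[of s a b] spot_less[of s c d] assms(1-6) True by simp_all
    show "\<not> (fst (mir s (spot (s, a))) < fst (mir s (spot (s, c))) \<and> fst (mir s (spot (s, c))) < fst (mir s (spot (s, b))) \<and>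
        fst (mir s (spot (s, b))) < fst (mir s (spot (s, d))))"
      "\<not> (fst (mir s (spot (s, c))) < fst (mir s (spot (s, a))) \<and> fst (mir s (spot (s, a))) < fst (mir s (spot (s, d))) \<and>
        fst (mir s (spot (s, d))) < fst (mir s (spot (s, b))))"
      using assms(1-4,8) True by (simp_all add: spot_less_iff)
  qed (use assms(1-4) True mir_spot in simp_all)
  then show ?thesis using True by simp
next
  case False
  then have u: "u = (\<not> s)" by auto
  have "noncrossing (mir s (spot (s, a))) (mir s (spot (s, b))) (mir s (spot (u, c))) (mir s (spot (u, d)))"
    by (rule noncrossing_inner_inner[OF mir_facing])
      (use assms(1-5) spot_less[of s a b] mir_spot u in simp_all)
  then show ?thesis by simp
qed

lemma inner_cross:
  assumes "ok (s, a)" "ok (s, b)" "ok (u, c)" "ok (\<not> u, d)" "a < b"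
  shows "noncrossing (spot (s, a)) (spot (s, b)) (spot (u, c)) (spot (\<not> u, d))"
proof -
  have *: "noncrossing (spot (s, a)) (spot (s, b)) (spot (s, c)) (spot (\<not> s, d))" if "ok (s, c)" "ok (\<not> s, d)" for c d
  proof -
    have "noncrossing (mir s (spot (s, a))) (mir s (spot (s, b))) (mir s (spot (s, c))) (mir s (spot (\<not> s, d)))"
      by (rule noncrossing_inner_cross[OF mir_facing]) (use assms(1,2,5) that spot_less[of s a b] mir_spot in simp_all)
    then show ?thesis by simp
  qed
  show ?thesis
  proof (cases "s = u")
    case False
    then have "(\<not> u) = s" "u = (\<not> s)" by auto
    then show ?thesis using *[of d c] assms noncrossing_swap(2) by simp
  qed (use * assms in simp)
qed

lemma cross_cross:
  assumes "ok (True, a)" "ok (False, b)" "ok (True, c)" "ok (False, d)" "a \<le> c" "b \<le> d" "(a, b) \<noteq> (c, d)"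
  shows "noncrossing (spot (True, a)) (spot (False, b)) (spot (True, c)) (spot (False, d))"
proof (rule noncrossing_cross[where S = "C True" and T = "C False"])
  show "above x y t < 0" if "x \<in> C True" "y \<in> C True" "t \<in> C False" "fst x < fst y" for x y t
    using double_chain_facing(1)[OF chains] that unfolding facing_def by blast
  show "above x y t > 0" if "x \<in> C False" "y \<in> C False" "t \<in> C True" "fst x < fst y" for x y t
  proof -
    have "above (flip x) (flip y) (flip t) < 0"
      using double_chain_facing(2)[OF chains] that unfolding facing_def by force
    then show ?thesis by simp
  qed
  show "spot (True, a) = spot (True, c) \<or> fst (spot (True, a)) < fst (spot (True, c))"
    "spot (False, b) = spot (False, d) \<or> fst (spot (False, b)) < fst (spot (False, d))"
    using assms(5,6) spot_less[OF assms(1,3)] spot_less[OF assms(2,4)] by (auto simp: order_le_less)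
  show "(spot (True, a), spot (False, b)) \<noteq> (spot (True, c), spot (False, d))"
    using assms(7) spot_inj[OF assms(1,3)] spot_inj[OF assms(2,4)] by simp
qed (use assms(1-4) spot_in in blast)+

lemma noncrossing_uncrossed:
  assumes ok: "ok p" "ok q" "ok p'" "ok q'" and ne: "p \<noteq> q" "p' \<noteq> q'" "{p, q} \<noteq> {p', q'}"
    and un: "uncrossed (p, q) (p', q')" "uncrossed (p', q') (p, q)"
  shows "noncrossing (spot p) (spot q) (spot p') (spot q')"
proof -
  obtain s a t b u c w d where v: "p = (s, a)" "q = (t, b)" "p' = (u, c)" "q' = (w, d)"
    by (cases p, cases q, cases p', cases q')
  note ok = ok[unfolded v] and ne = ne[unfolded v] and un = un[unfolded v]
  note sw = noncrossing_swap(1)[THEN iffD1] noncrossing_swap(2)[THEN iffD1]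
  show ?thesis unfolding v
  proof (cases "s = t"; cases "u = w")
    assume e: "s = t" "u = w"
    have I: "noncrossing (spot (s, min a b)) (spot (s, max a b)) (spot (u, min c d)) (spot (u, max c d))"
    proof (rule inner_inner)
      show "(s, min a b, max a b) \<noteq> (u, min c d, max c d)"
        using ne e by (auto simp: min_def max_def split: if_splits)
      show "\<not> (min a b < min c d \<and> min c d < max a b \<and> max a b < max c d) \<and>
          \<not> (min c d < min a b \<and> min a b < max c d \<and> max c d < max a b)" if "s = u"
        using un e that by (auto simp: interleaved_def)
    qed (use ok e ne in \<open>auto simp: min_def max_def\<close>)
    show "noncrossing (spot (s, a)) (spot (t, b)) (spot (u, c)) (spot (w, d))"
      using I e noncrossing_swap by (cases "a \<le> b"; cases "c \<le> d") (simp_all add: min_def max_def)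
  next
    assume e: "s = t" "u \<noteq> w"
    then have w: "w = (\<not> u)" by auto
    have "noncrossing (spot (s, min a b)) (spot (s, max a b)) (spot (u, c)) (spot (\<not> u, d))"
      by (rule inner_cross) (use ok e ne w in \<open>auto simp: min_def max_def\<close>)
    then show "noncrossing (spot (s, a)) (spot (t, b)) (spot (u, c)) (spot (w, d))"
      using e w noncrossing_swap(1) by (cases "a \<le> b") (simp_all add: min_def max_def)
  next
    assume e: "s \<noteq> t" "u = w"
    then have w: "t = (\<not> s)" by auto
    have "noncrossing (spot (u, min c d)) (spot (u, max c d)) (spot (s, a)) (spot (\<not> s, b))"
      by (rule inner_cross) (use ok e ne w in \<open>auto simp: min_def max_def\<close>)
    then have "noncrossing (spot (u, c)) (spot (w, d)) (spot (s, a)) (spot (t, b))"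
      using e w noncrossing_swap(1) by (cases "c \<le> d") (simp_all add: min_def max_def)
    then show "noncrossing (spot (s, a)) (spot (t, b)) (spot (u, c)) (spot (w, d))" using noncrossing_sym by blast
  next
    assume e: "s \<noteq> t" "u \<noteq> w"
    \<comment> \<open>Both edges are rewritten to run from the convex to the concave chain, whatever
      direction the path takes along them.\<close>
    define x y where "x = (if s then a else b)" and "y = (if s then b else a)"
    define x' y' where "x' = (if u then c else d)" and "y' = (if u then d else c)"
    have o: "ok (True, x)" "ok (False, y)" "ok (True, x')" "ok (False, y')"
      using ok e unfolding x_def y_def x'_def y'_def by (cases s; cases t; cases u; cases w; simp)+
    have n: "(x, y) \<noteq> (x', y')"
      using ne e unfolding x_def y_def x'_def y'_def by (cases s; cases t; cases u; cases w) auto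
    have m: "x \<le> x' \<and> y \<le> y' \<or> x' \<le> x \<and> y' \<le> y"
      using un e unfolding x_def y_def x'_def y'_def by (cases s; cases t; cases u; cases w) auto
    have "noncrossing (spot (True, x)) (spot (False, y)) (spot (True, x')) (spot (False, y'))"
      using m
    proof
      assume "x \<le> x' \<and> y \<le> y'"
      then show ?thesis using cross_cross[OF o] n by blast
    next
      assume "x' \<le> x \<and> y' \<le> y"
      then show ?thesis using cross_cross[OF o(3,4,1,2)] n noncrossing_sym by fastforce
    qed
    then show "noncrossing (spot (s, a)) (spot (t, b)) (spot (u, c)) (spot (w, d))"
      using e noncrossing_swap unfolding x_def y_def x'_def y'_def by (cases s; cases t; cases u; cases w) auto
  qed
qed

lemma nhap_tour:
  assumes "tour N (\<lambda>p. col (spot p)) xs"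
  shows "nhap (C True \<union> C False) col (map spot xs)"
proof -
  have d: "distinct xs" and st: "set xs = {(b, i). 0 \<le> i \<and> i < N b}"
    and cl: "\<And>p q. (p, q) \<in> edges xs \<Longrightarrow> col (spot p) \<noteq> col (spot q)"
    and un: "\<And>e f. e \<in> edges xs \<Longrightarrow> f \<in> edges xs \<Longrightarrow> uncrossed e f"
    using assms unfolding tour_def by blast+
  have okx: "ok p \<longleftrightarrow> p \<in> set xs" for p unfolding st by (cases p) (simp add: ok_def)
  have "inj_on spot (set xs)" using spot_inj okx by (simp add: inj_on_def)
  then have "distinct (map spot xs)" using d by (simp add: distinct_map)
  moreover have "set (map spot xs) = C True \<union> C False"
  proof
    show "set (map spot xs) \<subseteq> C True \<union> C False"
    proof
      fix z assume "z \<in> set (map spot xs)"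
      then obtain p where "p \<in> set xs" "z = spot p" by auto
      moreover obtain s i where "p = (s, i)" by (cases p)
      ultimately show "z \<in> C True \<union> C False" using spot_in[of s i] okx[of p] by (cases s) auto
    qed
    have "C s \<subseteq> spot ` set xs" for s
    proof
      fix z assume "z \<in> C s"
      then obtain i where "i < length (zs s)" "z = zs s ! i" by (auto simp: set_zs[symmetric] in_set_conv_nth)
      then have "z = spot (s, int i)" "ok (s, int i)" by (simp_all add: spot_def ok_def N_def)
      then show "z \<in> spot ` set xs" using okx by blast
    qed
    then show "C True \<union> C False \<subseteq> set (map spot xs)" by auto
  qed
  moreover have "col (map spot xs ! i) \<noteq> col (map spot xs ! Suc i)" if "Suc i < length (map spot xs)" for i
    using cl[OF edges_nth] that by simp
  moreover have "noncrossing (map spot xs ! i) (map spot xs ! Suc i) (map spot xs ! j) (map spot xs ! Suc j)"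
    if "i < j" "Suc j < length (map spot xs)" for i j
  proof -
    have m: "i < length xs" "Suc i < length xs" "j < length xs" "Suc j < length xs" using that by auto
    have "noncrossing (spot (xs ! i)) (spot (xs ! Suc i)) (spot (xs ! j)) (spot (xs ! Suc j))"
    proof (rule noncrossing_uncrossed)
      show "{xs ! i, xs ! Suc i} \<noteq> {xs ! j, xs ! Suc j}"
        using that(1) m d by (auto simp: doubleton_eq_iff nth_eq_iff_index_eq)
      show "uncrossed (xs ! i, xs ! Suc i) (xs ! j, xs ! Suc j)" "uncrossed (xs ! j, xs ! Suc j) (xs ! i, xs ! Suc i)"
        using un edges_nth m by blast+
    qed (use m d okx in \<open>auto simp: nth_eq_iff_index_eq\<close>)
    then show ?thesis using m by simp
  qed
  ultimately show ?thesis unfolding nhap_def by blast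
qed

end

section \<open>Sorted chains and color counts\<close>

lemma graph_inj: "\<forall>p\<in>C. snd p = f (fst p) \<Longrightarrow> inj_on fst C"
  by (rule inj_onI) (simp add: prod_eq_iff)

lemma convex_chain_inj: "convex_chain C \<Longrightarrow> inj_on fst C"
  unfolding convex_chain_def using graph_inj by blast

lemma concave_chain_inj: "concave_chain C \<Longrightarrow> inj_on fst C"
  unfolding concave_chain_def using graph_inj by blast

lemma sorted_chain:
  assumes "finite C" "inj_on fst (C :: point set)"
  shows "\<exists>ps. set ps = C \<and> left_to_right ps"
proof -
  let ?g = "inv_into C fst"
  let ?xs = "sorted_list_of_set (fst ` C)"
  have g: "x \<in> fst ` C \<Longrightarrow> fst (?g x) = x" for x by (simp add: f_inv_into_f)
  have "set (map ?g ?xs) = C" using assms by (force simp: image_image)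
  moreover have "sorted_wrt (<) ?xs" by simp
  then have "left_to_right (map ?g ?xs)"
    unfolding left_to_right_def sorted_wrt_map
    by (rule sorted_wrt_mono_rel[rotated]) (use assms(1) g in auto)
  ultimately show ?thesis by blast
qed

lemma card_split: "finite S \<Longrightarrow> card {p \<in> S. P p} + card {p \<in> S. \<not> P p} = card S"
proof -
  assume "finite S"
  then have "card ({p \<in> S. P p} \<union> {p \<in> S. \<not> P p}) = card {p \<in> S. P p} + card {p \<in> S. \<not> P p}"
    by (intro card_Un_disjoint) auto
  moreover have "{p \<in> S. P p} \<union> {p \<in> S. \<not> P p} = S" by auto
  ultimately show ?thesis by simp
qed

context drawn
begin

lemma finite_C: "finite (C s)"
  using set_zs[of s] by (metis List.finite_set)

lemma disjoint: "C True \<inter> C False = {}"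
  using chains by (simp add: double_chain_def)

lemma count_color: "cnt 0 (N s) (\<lambda>i. col (spot (s, i))) = int (card {p \<in> C s. col p})"
proof -
  have "inj_on (\<lambda>i. spot (s, i)) {i. 0 \<le> i \<and> i < N s \<and> col (spot (s, i))}"
    using spot_inj by (auto simp: inj_on_def ok_def)
  moreover have "(\<lambda>i. spot (s, i)) ` {i. 0 \<le> i \<and> i < N s \<and> col (spot (s, i))} = {p \<in> C s. col p}"
  proof (intro subset_antisym subsetI)
    fix z assume z: "z \<in> {p \<in> C s. col p}"
    then obtain i where "i < length (zs s)" "z = zs s ! i" by (auto simp: set_zs[symmetric] in_set_conv_nth)
    then have "z = spot (s, int i)" "0 \<le> int i \<and> int i < N s" by (simp_all add: spot_def N_def)
    then show "z \<in> (\<lambda>i. spot (s, i)) ` {i. 0 \<le> i \<and> i < N s \<and> col (spot (s, i))}" using z by blast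
  next
    fix z assume "z \<in> (\<lambda>i. spot (s, i)) ` {i. 0 \<le> i \<and> i < N s \<and> col (spot (s, i))}"
    then obtain i where "0 \<le> i" "i < N s" "col (spot (s, i))" "z = spot (s, i)" by blast
    then show "z \<in> {p \<in> C s. col p}" using spot_in[of s i] by (simp add: ok_def)
  qed
  ultimately show ?thesis unfolding cnt_card using card_image by fastforce
qed

lemma N_card: "N s = int (card (C s))"
proof -
  have "cnt 0 (N s) (\<lambda>_. True) = N s" by (simp add: cnt_def N_def)
  then show ?thesis using count_color[of s "\<lambda>_. True"] by simp
qed

lemma count_equitable:
  assumes "equitable (C True \<union> C False) col"
  shows "\<bar>(2 * cnt 0 (N True) (\<lambda>i. col (spot (True, i))) - N True) + (2 * cnt 0 (N False) (\<lambda>i. col (spot (False, i))) - N False)\<bar> \<le> 1"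
proof -
  have s: "card {p \<in> C True \<union> C False. P p} = card {p \<in> C True. P p} + card {p \<in> C False. P p}" for P
  proof -
    have "{p \<in> C True \<union> C False. P p} = {p \<in> C True. P p} \<union> {p \<in> C False. P p}" by auto
    then show ?thesis using disjoint finite_C by (simp add: card_Un_disjoint disjoint_iff)
  qed
  have "card {p \<in> C s. col p} + card {p \<in> C s. \<not> col p} = card (C s)" for s
    using finite_C by (rule card_split)
  from this[of True] this[of False] assms show ?thesis
    using count_color[of True col] count_color[of False col] N_card[of True] N_card[of False]
    unfolding equitable_def s by linarith
qed

lemma program_correct:
  assumes "1 \<le> N True" "1 \<le> N False" "N True \<le> 4 * N False" "N False \<le> 4 * N True"
    and "equitable (C True \<union> C False) col"
  shows "\<exists>t s xs. exec mainc (input_store (zs True) (zs False) col) t s \<and> t \<le> 50 * cost (N True + N False + 4) \<and>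
    outputs_path s (zs True @ zs False) xs \<and> nhap (C True \<union> C False) col xs"
proof -
  let ?st = "input_store (zs True) (zs False) col"
  let ?ix = "\<lambda>(s, i). (if s then 0 else N True) + i"
  define q where "q s i = col (spot (s, i))" for s i
  have ix: "nat (?ix (s, i)) < length (zs True @ zs False) \<and> 0 \<le> ?ix (s, i) \<and>
      (zs True @ zs False) ! nat (?ix (s, i)) = spot (s, i)" if "0 \<le> i" "i < N s" for s i
    using that by (cases s) (auto simp: N_def spot_def nth_append nat_add_distrib)
  have "wp mainc (50 * cost (N True + N False + 4)) (\<lambda>b. \<exists>xs. tour N (\<lambda>(s, i). q s i) xs \<and> written b (map ?ix xs)) (ints ?st)"
  proof (rule wp_main)
    show "1 \<le> N s" "N s \<le> 4 * N (\<not> s)" for s using assms(1-4) by (cases s; simp)+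
    show "\<bar>2 * cnt 0 (N True) (q True) - N True + (2 * cnt 0 (N False) (q False) - N False)\<bar> \<le> 1"
      using count_equitable[OF assms(5)] by (simp add: q_def[abs_def])
    show "ints ?st ''n1'' 0 = N True" "ints ?st ''n2'' 0 = N False"
      by (simp_all add: input_store_def N_def Let_def)
    show "ints ?st ''black'' ((if s then 0 else N True) + i) = of_bool (q s i)" if "0 \<le> i" "i < N s" for s i
      using ix[OF that] by (auto simp: input_store_def Let_def q_def nat_less_iff)
    show "ints ?st x = (\<lambda>_. 0)" if "x \<notin> {''n1'', ''n2'', ''black''}" for x
      using that by (simp add: input_store_def Let_def fun_eq_iff)
  qed
  then obtain t s xs where r: "exec mainc ?st t s" "t \<le> 50 * cost (N True + N False + 4)"
    "tour N (\<lambda>(s, i). q s i) xs" "written (ints s) (map ?ix xs)"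
    by (rule wpD) blast
  have "tour N (\<lambda>p. col (spot p)) xs"
    using r(3) by (simp add: q_def case_prod_unfold)
  then have h: "nhap (C True \<union> C False) col (map spot xs)" by (rule nhap_tour)
  have len: "length (map spot xs) = length (zs True @ zs False)"
  proof -
    have "length (map spot xs) = card (C True \<union> C False)"
      using h unfolding nhap_def by (metis distinct_card)
    also have "\<dots> = card (C True) + card (C False)"
      using disjoint finite_C by (simp add: card_Un_disjoint)
    finally show ?thesis using N_card[of True] N_card[of False] by (simp add: N_def)
  qed
  have "outputs_path s (zs True @ zs False) (map spot xs)"
    unfolding outputs_path_def
  proof (intro conjI allI impI len)
    fix i assume "i < length (zs True @ zs False)"
    then have i: "i < length xs" using len by simp
    obtain b k where bk: "xs ! i = (b, k)" by (cases "xs ! i")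
    have "(b, k) \<in> set xs" using i bk by (metis nth_mem)
    then have k: "0 \<le> k" "k < N b" using r(3) by (auto simp: tour_def)
    have "ints s ''path'' (int i) = ?ix (b, k)" using r(4) i bk by (simp add: written_def)
    then show "\<exists>k<length (zs True @ zs False). ints s ''path'' (int i) = int k \<and> map spot xs ! i = (zs True @ zs False) ! k"
      using ix[OF k] i bk by (intro exI[of _ "nat (?ix (b, k))"]) simp
  qed
  then show ?thesis using r(1,2) h by blast
qed

end

section \<open>Universality\<close>

lemma nhap_noncrossing:
  "nhap S col xs \<Longrightarrow> i < j \<Longrightarrow> Suc j < length xs \<Longrightarrow> noncrossing (xs ! i) (xs ! Suc i) (xs ! j) (xs ! Suc j)"
  by (simp add: nhap_def)

lemma nhap_rev: "nhap S col xs \<Longrightarrow> nhap S col (rev xs)"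
proof -
  assume h: "nhap S col xs"
  define m where "m i = length xs - Suc (Suc i)" for i
  have m: "Suc (m i) < length xs \<and> rev xs ! i = xs ! Suc (m i) \<and> rev xs ! Suc i = xs ! m i" if "Suc i < length xs" for i
    using that by (auto simp: m_def rev_nth Suc_diff_Suc)
  have "col (rev xs ! i) \<noteq> col (rev xs ! Suc i)" if "Suc i < length (rev xs)" for i
    using m[of i] h that unfolding nhap_def by (metis length_rev)
  moreover have "noncrossing (rev xs ! i) (rev xs ! Suc i) (rev xs ! j) (rev xs ! Suc j)"
    if "i < j" "Suc j < length (rev xs)" for i j
  proof -
    have "m j < m i" using that by (auto simp: m_def)
    then have "noncrossing (xs ! m j) (xs ! Suc (m j)) (xs ! m i) (xs ! Suc (m i))"
      using h m[of i] that unfolding nhap_def by auto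
    then show ?thesis using m[of i] m[of j] that noncrossing_sym noncrossing_swap by auto
  qed
  ultimately show ?thesis using h unfolding nhap_def by auto
qed

lemma alternating:
  assumes "\<And>i. Suc i < n \<Longrightarrow> c i \<noteq> c (Suc i)" "i < n"
  shows "c i \<longleftrightarrow> c 0 = even i"
  using assms(2)
proof (induction i)
  case (Suc i)
  then show ?case using assms(1)[of i] by auto
qed simp

lemma count_alternating:
  assumes "\<And>i. Suc i < n \<Longrightarrow> c i \<noteq> c (Suc i)"
  shows "card {i. i < n \<and> c i} = (if c 0 then Suc n div 2 else n div 2)"
proof -
  have "card {i. i < n \<and> b = even i} = (if b then Suc n div 2 else n div 2)" for b n
  proof (induction n)
    case (Suc n)
    have "{i. i < Suc n \<and> b = even i} = (if b = even n then insert n {i. i < n \<and> b = even i} else {i. i < n \<and> b = even i})"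
      by (auto simp: less_Suc_eq)
    then show ?case using Suc by (cases b; cases "even n") (auto elim: oddE evenE)
  qed simp
  moreover have "{i. i < n \<and> c i} = {i. i < n \<and> c 0 = even i}"
    using alternating[of n c, OF assms] by auto
  ultimately show ?thesis by simp
qed

lemma universal_path:
  fixes S :: "point set"
  assumes S: "finite S" "card S = n" and ex: "\<And>col. equitable S col \<Longrightarrow> \<exists>xs. nhap S col xs"
  shows "two_color_universal S (path_vertices n) (path_edges n)"
  unfolding two_color_universal_def
proof (intro conjI allI impI)
  show "simple_graph (path_vertices n) (path_edges n)"
    by (auto simp: simple_graph_def path_vertices_def path_edges_def)
  show "\<exists>c. proper_2_coloring (path_edges n) c"
    by (rule exI[of _ even]) (auto simp: proper_2_coloring_def path_edges_def doubleton_eq_iff)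
  show "finite S" "card S = card (path_vertices n)" using S by (simp_all add: path_vertices_def)
  fix c col
  assume c: "proper_2_coloring (path_edges n) c" and eq: "card {p \<in> S. col p} = card {v \<in> path_vertices n. c v}"
  have alt: "c i \<noteq> c (Suc i)" if "Suc i < n" for i
    using c that unfolding proper_2_coloring_def path_edges_def by blast
  have cc: "card {p \<in> S. col p} = (if c 0 then Suc n div 2 else n div 2)"
    using eq count_alternating[of n c, OF alt] by (simp add: path_vertices_def)
  have "card {p \<in> S. col p} + card {p \<in> S. \<not> col p} = n" using S card_split by blast
  then have "equitable S col" using cc unfolding equitable_def by (auto split: if_splits)
  then obtain xs where xs: "nhap S col xs" using ex by blast
  have count: "(if col (ys ! 0) then Suc n div 2 else n div 2) = (if c 0 then Suc n div 2 else n div 2)" if "nhap S col ys" for ys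
  proof -
    have ys: "distinct ys" "set ys = S" "length ys = n"
      using that S unfolding nhap_def by (auto simp: distinct_card)
    have "{p \<in> S. col p} = (!) ys ` {i. i < n \<and> col (ys ! i)}"
      unfolding ys(2)[symmetric] set_conv_nth ys(3) by blast
    moreover have "inj_on ((!) ys) {i. i < n \<and> col (ys ! i)}"
      using ys by (auto simp: inj_on_def nth_eq_iff_index_eq)
    ultimately have "card {p \<in> S. col p} = card {i. i < n \<and> col (ys ! i)}" by (simp add: card_image)
    also have "\<dots> = (if col (ys ! 0) then Suc n div 2 else n div 2)"
      by (rule count_alternating) (use that ys in \<open>auto simp: nhap_def\<close>)
    finally show ?thesis using cc by simp
  qed
  have len: "length ys = n" if "nhap S col ys" for ys
    using that S unfolding nhap_def by (auto simp: distinct_card)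
  \<comment> \<open>A universal drawing also prescribes the color of the first vertex. For odd
    \<open>n\<close> it is forced by the number of black points; for even \<open>n\<close> the two
    ends of the path have different colors, so that reversing the path corrects a wrong
    start.\<close>
  have "\<exists>ys. nhap S col ys \<and> (0 < n \<longrightarrow> col (ys ! 0) = c 0)"
  proof (cases "0 < n \<longrightarrow> col (xs ! 0) = c 0")
    case False
    then have "Suc n div 2 = n div 2" "0 < n" using count[OF xs] by (auto split: if_splits)
    then have n: "even n" "0 < n" by presburger+
    have "col (rev xs ! 0) \<longleftrightarrow> col (xs ! 0) = even (n - 1)"
      using alternating[of n "\<lambda>i. col (xs ! i)" "n - 1"] xs len[OF xs] n by (simp add: nhap_def rev_nth)
    then show ?thesis using nhap_rev[OF xs] False n by (intro exI[of _ "rev xs"]) auto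
  qed (use xs in blast)
  then obtain ys where ys: "nhap S col ys" and hd: "0 < n \<Longrightarrow> col (ys ! 0) = c 0" by blast
  have Y: "distinct ys" "set ys = S" "length ys = n" using ys len unfolding nhap_def by auto
  show "\<exists>\<phi>. bij_betw \<phi> (path_vertices n) S \<and> (\<forall>v\<in>path_vertices n. col (\<phi> v) = c v) \<and>
          (\<forall>u v x y. {u, v} \<in> path_edges n \<longrightarrow> {x, y} \<in> path_edges n \<longrightarrow> {u, v} \<noteq> {x, y} \<longrightarrow>
             noncrossing (\<phi> u) (\<phi> v) (\<phi> x) (\<phi> y))"
  proof (intro exI[of _ "(!) ys"] conjI ballI allI impI)
    show "bij_betw ((!) ys) (path_vertices n) S"
      using bij_betw_nth[OF Y(1)] Y(2,3) by (simp add: path_vertices_def)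
    show "col (ys ! v) = c v" if "v \<in> path_vertices n" for v
      using that alternating[of n c v, OF alt] alternating[of n "\<lambda>i. col (ys ! i)" v] ys Y(3) hd
      by (auto simp: path_vertices_def nhap_def)
    fix u v x y
    assume e: "{u, v} \<in> path_edges n" "{x, y} \<in> path_edges n" "{u, v} \<noteq> {x, y}"
    obtain i where i: "Suc i < n" "{u, v} = {i, Suc i}" using e(1) by (auto simp: path_edges_def)
    obtain j where j: "Suc j < n" "{x, y} = {j, Suc j}" using e(2) by (auto simp: path_edges_def)
    have "i \<noteq> j" using e(3) unfolding i(2) j(2) by blast
    then have "i < j \<or> j < i" by linarith
    moreover have nc: "noncrossing (ys ! i) (ys ! Suc i) (ys ! j) (ys ! Suc j)" if "i < j" "Suc j < n" for i j
      using nhap_noncrossing[OF ys] Y(3) that by simp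
    ultimately have 1: "noncrossing (ys ! i) (ys ! Suc i) (ys ! j) (ys ! Suc j)"
      using nc[of i j] nc[of j i] i(1) j(1) noncrossing_sym by blast
    note 2 = noncrossing_swap(1)[THEN iffD1, OF 1]
    note 3 = noncrossing_swap(2)[THEN iffD1, OF 1] noncrossing_swap(2)[THEN iffD1, OF 2]
    then show "noncrossing (ys ! u) (ys ! v) (ys ! x) (ys ! y)"
      using i(2) j(2) 1 2 3 unfolding doubleton_eq_iff by auto
  qed
qed

text \<open>The empty input is treated apart because the main program presupposes two nonempty
  chains; under the hypotheses, one chain is empty only if both are.\<close>

definition solverc :: com where
  "solverc = Cond (ILess (IConst 0) (V ''n1'')) mainc Skip"

lemma solverc_correct:
  assumes dc: "double_chain C1 C2"
    and c: "real (card C1) \<ge> 1 / 5 * real (card C1 + card C2)" "real (card C2) \<ge> 1 / 5 * real (card C1 + card C2)"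
    and ps: "set ps = C1" "left_to_right ps" and qs: "set qs = C2" "left_to_right qs"
    and eq: "equitable (C1 \<union> C2) col"
  shows "\<exists>t s xs. exec solverc (input_store ps qs col) t s \<and> t \<le> 3000 * (card C1 + card C2 + 5) + 2 \<and>
    outputs_path s (ps @ qs) xs \<and> nhap (C1 \<union> C2) col xs"
proof -
  interpret drawn "\<lambda>s. if s then C1 else C2" "\<lambda>s. if s then ps else qs"
    using assms by unfold_locales auto
  have N: "N True = int (card C1)" "N False = int (card C2)" using N_card by simp_all
  \<comment> \<open>A fifth of the total on either side means a factor of at most four between the
    chains.\<close>
  have "real (card C1) \<le> real (4 * card C2)" "real (card C2) \<le> real (4 * card C1)"
    using c unfolding of_nat_add of_nat_mult by simp_all
  then have card: "card C1 \<le> 4 * card C2" "card C2 \<le> 4 * card C1" unfolding of_nat_le_iff .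
  have n1: "ints (input_store ps qs col) ''n1'' 0 = int (card C1)"
    using N by (simp add: input_store_def Let_def N_def)
  show ?thesis
  proof (cases "card C1 = 0")
    case True
    then have "C1 = {}" "C2 = {}" using card finite_C[of True] finite_C[of False] by auto
    then have e: "ps = []" "qs = []" using ps(1) qs(1) by auto
    have "exec solverc (input_store ps qs col) (Suc 1) (input_store ps qs col)"
      unfolding solverc_def by (rule exec.Cond_False) (use n1 True exec.Skip in simp_all)
    then show ?thesis
      using e \<open>C1 = {}\<close> \<open>C2 = {}\<close>
      by (intro exI[of _ "Suc 1"] exI[of _ "input_store ps qs col"] exI[of _ "[]"]) (simp add: outputs_path_def nhap_def)
  next
    case False
    then have "0 < card C2" using card by auto
    then obtain t s xs where r: "exec mainc (input_store ps qs col) t s" "t \<le> 50 * cost (int (card C1) + int (card C2) + 4)"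
      "outputs_path s (ps @ qs) xs" "nhap (C1 \<union> C2) col xs"
      using program_correct[of col] False card eq by (auto simp: N)
    have "exec solverc (input_store ps qs col) (Suc t) s"
      unfolding solverc_def by (rule exec.Cond_True) (use n1 False r(1) in simp_all)
    \<comment> \<open>50 stems from \<open>wp_main\<close> and 60 from \<open>cost\<close>; the 5
      consists of the four positions reserved for padding and the one in
      \<open>nat N + 1\<close>.\<close>
    moreover have "50 * cost (int (card C1) + int (card C2) + 4) = 3000 * (card C1 + card C2 + 5)"
      by (simp add: cost_def nat_add_distrib)
    ultimately show ?thesis using r(2-4) by (intro exI[of _ "Suc t"] exI[of _ s] exI[of _ xs]) simp
  qed
qed

text \<open>Existence is read off the correctness of the program, run on the sorted chains.\<close>

lemma nhap_exists:
  assumes "double_chain C1 C2"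
    and "real (card C1) \<ge> 1 / 5 * real (card C1 + card C2)" "real (card C2) \<ge> 1 / 5 * real (card C1 + card C2)"
    and "equitable (C1 \<union> C2) col"
  shows "\<exists>xs. nhap (C1 \<union> C2) col xs"
proof -
  have "finite C1" "inj_on fst C1" "finite C2" "inj_on fst C2"
    using assms(1) convex_chain_inj concave_chain_inj
    by (auto simp: double_chain_def convex_chain_def concave_chain_def)
  then obtain ps qs where "set ps = C1" "left_to_right ps" "set qs = C2" "left_to_right qs"
    using sorted_chain by metis
  then show ?thesis using solverc_correct[OF assms(1-3)] assms(4) by blast
qed

text \<open>At \<open>n = 1\<close> the left side is 18002, and it grows by 3000 per point, so 20000
  is sufficient from there on.\<close>

lemma linear_bound: "(\<lambda>n. real (3000 * (n + 5) + 2)) \<in> O(\<lambda>n. real n)"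
proof (rule bigoI[where c = 20000])
  show "\<forall>\<^sub>F n in at_top. norm (real (3000 * (n + 5) + 2)) \<le> 20000 * norm (real n)"
    by (rule eventually_at_top_linorderI[of 1]) simp
qed

theorem theorem1:
  shows "(\<forall>(C1 :: point set) (C2 :: point set) (n :: nat).
            double_chain C1 C2 \<longrightarrow> n = card C1 + card C2 \<longrightarrow>
            real (card C1) \<ge> 1 / 5 * real (card C1 + card C2) \<longrightarrow>
            real (card C2) \<ge> 1 / 5 * real (card C1 + card C2) \<longrightarrow>
              two_color_universal (C1 \<union> C2) (path_vertices n) (path_edges n) \<and>
              (\<forall>col :: point \<Rightarrow> bool. equitable (C1 \<union> C2) col \<longrightarrow>
                 (\<exists>xs. nhap (C1 \<union> C2) col xs))) \<and>
         (\<exists>(prog :: com) (T :: nat \<Rightarrow> nat).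
            (\<lambda>n. real (T n)) \<in> O(\<lambda>n. real n) \<and>
            (\<forall>(C1 :: point set) (C2 :: point set) (n :: nat) (ps :: point list) (qs :: point list)
              (col :: point \<Rightarrow> bool).
               double_chain C1 C2 \<longrightarrow> n = card C1 + card C2 \<longrightarrow>
               real (card C1) \<ge> 1 / 5 * real (card C1 + card C2) \<longrightarrow>
               real (card C2) \<ge> 1 / 5 * real (card C1 + card C2) \<longrightarrow>
               set ps = C1 \<longrightarrow> left_to_right ps \<longrightarrow> set qs = C2 \<longrightarrow> left_to_right qs \<longrightarrow>
               equitable (C1 \<union> C2) col \<longrightarrow>
                 (\<exists>t s xs. exec prog (input_store ps qs col) t s \<and> t \<le> T n \<and>
                    outputs_path s (ps @ qs) xs \<and> nhap (C1 \<union> C2) col xs)))"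
proof (rule conjI, intro allI impI)
  fix C1 C2 :: "point set" and n
  assume dc: "double_chain C1 C2" and n: "n = card C1 + card C2"
    and c: "real (card C1) \<ge> 1 / 5 * real (card C1 + card C2)" "real (card C2) \<ge> 1 / 5 * real (card C1 + card C2)"
  have "finite C1" "finite C2" "C1 \<inter> C2 = {}"
    using dc by (auto simp: double_chain_def convex_chain_def concave_chain_def)
  then have "finite (C1 \<union> C2)" "card (C1 \<union> C2) = n" using n by (auto simp: card_Un_disjoint)
  then show "two_color_universal (C1 \<union> C2) (path_vertices n) (path_edges n) \<and>
      (\<forall>col. equitable (C1 \<union> C2) col \<longrightarrow> (\<exists>xs. nhap (C1 \<union> C2) col xs))"
    using universal_path nhap_exists[OF dc c] by blast
next
  show "\<exists>prog T. (\<lambda>n. real (T n)) \<in> O(\<lambda>n. real n) \<and> (\<forall>C1 C2 n ps qs col.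
      double_chain C1 C2 \<longrightarrow> n = card C1 + card C2 \<longrightarrow>
      real (card C1) \<ge> 1 / 5 * real (card C1 + card C2) \<longrightarrow> real (card C2) \<ge> 1 / 5 * real (card C1 + card C2) \<longrightarrow>
      set ps = C1 \<longrightarrow> left_to_right ps \<longrightarrow> set qs = C2 \<longrightarrow> left_to_right qs \<longrightarrow> equitable (C1 \<union> C2) col \<longrightarrow>
      (\<exists>t s xs. exec prog (input_store ps qs col) t s \<and> t \<le> T n \<and> outputs_path s (ps @ qs) xs \<and> nhap (C1 \<union> C2) col xs))"
    using linear_bound solverc_correct
    by (intro exI[of _ solverc] exI[of _ "\<lambda>n. 3000 * (n + 5) + 2"] conjI allI impI) simp_all
qed

end
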